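(* Let $\mathbf f=(f_1,\ldots,f_L):[0,1]^2\to\mathbb R^L$ be linearly independent with $\mathbf f\in\mathcal C$, let $\boldsymbol\theta_0\in\mathbb R^L$, and for each $n$ let $\pi$ be a random permutation in $S_n$ with law $\mathbb P_{n,\boldsymbol\theta_0}$. Then, as $n\to\infty$: (a) $n^{-3/2}\,\mathbf L_n(\pi,\boldsymbol\theta_0)\xrightarrow{D}N(\mathbf 0,\Sigma(\boldsymbol\theta_0))$, where for $p,q\in[L]$ $$\Sigma_{pq}(\boldsymbol\theta):=\int_{[0,1]^6}\frac{g_p(\mathbf z_1,\mathbf z_2)\,g_q(\mathbf z_1,\mathbf z_3)}{\big(1+e^{\boldsymbol\theta^\top\mathbf g(\mathbf z_1,\mathbf z_2)}\big)\big(1+e^{\boldsymbol\theta^\top\mathbf g(\mathbf z_1,\mathbf z_3)}\big)}\prod_{a=1}^3d\mu_{\boldsymbol\theta}(\mathbf z_a).$$ (b) With probability tending to $1$, the vector equation $\mathbf L_n(\pi,\boldsymbol\theta)=\mathbf 0$ (in $\boldsymbol\theta\in\mathbb R^L$) has a unique root $\hat{\boldsymbol\theta}_{PL}$, which satisfies $$\sqrt n\,(\hat{\boldsymbol\theta}_{PL}-\boldsymbol\theta_0)\xrightarrow{D}N\Big(\mathbf 0,[A(\boldsymbol\theta_0)]^{-1}\Sigma(\boldsymbol\theta_0)[A(\boldsymbol\theta_0)]^{-1}\Big),$$ where $A(\boldsymbol\theta)$ is a positive definite $L\times L$ matrix defined by $$A_{pq}(\boldsymbol\theta):=\frac12\int_{[0,1]^4}\frac{g_p(\mathbf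 z_1,\mathbf z_2)\,g_q(\mathbf z_1,\mathbf z_2)\,e^{\boldsymbol\theta^\top\mathbf g(\mathbf z_1,\mathbf z_2)}}{\big(1+e^{\boldsymbol\theta^\top\mathbf g(\mathbf z_1,\mathbf z_2)}\big)^2}\prod_{a=1}^2d\mu_{\boldsymbol\theta}(\mathbf z_a).$$
   Context: $[n]=\{1,\ldots,n\}$ and $S_n$ is the set of permutations of $[n]$. Class $\mathcal C$: the set of continuous $F:[0,1]^2\to\mathbb R$, not almost everywhere $0$, such that $\int_0^1F(x,z)\,dz=0$ for all $x$ and $\int_0^1F(z,y)\,dz=0$ for all $y$. For a vector function, $\mathbf f\in\mathcal C$ means $f_r\in\mathcal C$ for every $r\in[L]$. $\mathbf f$ is linearly independent if there is no nonzero $\mathbf d\in\mathbb R^L$ with $\mathbf d^\top\mathbf f=0$ Lebesgue-a.e. on $[0,1]^2$. Model: for $\boldsymbol\theta\in\mathbb R^L$, $\mathbb P_{n,\boldsymbol\theta}$ is the probability on $S_n$ with mass function $\mathbb P_{n,\boldsymbol\theta}(\pi)=\exp(\boldsymbol\theta^\top\mathbf T(\pi)-Z_n(\boldsymbol\theta))$, where $\mathbf T(\pi)=\sum_{i=1}^n\mathbf f(i/n,\pi(i)/n)$ and $Z_n(\boldsymbol\theta)=\log\sum_{\pi\in S_n}\exp(\boldsymbol\theta^\top\mathbf T(\pi))$. Pseudo-likelihood score: for $\pi\in S_n$ and $1\le i<j\le n$, $$\mathbf y_\pi(i,j)=\mathbf f\big(\tfrac in,\tfrac{\pi(i)}n\big)+\mathbf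 f\big(\tfrac jn,\tfrac{\pi(j)}n\big)-\mathbf f\big(\tfrac in,\tfrac{\pi(j)}n\big)-\mathbf f\big(\tfrac jn,\tfrac{\pi(i)}n\big),$$ $$\mathbf L_n(\pi,\boldsymbol\theta)=\sum_{1\le i<j\le n}\frac{1}{1+e^{\boldsymbol\theta^\top\mathbf y_\pi(i,j)}}\,\mathbf y_\pi(i,j).$$ This is the gradient in $\boldsymbol\theta$ of the log pseudo-likelihood $\sum_{i<j}\log\frac{e^{\boldsymbol\theta^\top\mathbf y_\pi(i,j)}}{1+e^{\boldsymbol\theta^\top\mathbf y_\pi(i,j)}}$. Limit objects: $\mathbf g=(g_1,\dots,g_L):[0,1]^4\to\mathbb R^L$ is $\mathbf g((x_1,y_1),(x_2,y_2))=\mathbf f(x_1,y_1)+\mathbf f(x_2,y_2)-\mathbf f(x_1,y_2)-\mathbf f(x_2,y_1)$, and each $\mathbf z_a$ ranges over $[0,1]^2$. $\mathcal M$ is the set of probability measures on $[0,1]^2$ with both marginals uniform on $[0,1]$, $u$ is the uniform distribution on $[0,1]^2$, $\mu(\mathbf f)=\int\mathbf f\,d\mu$, and $D(\cdot\|\cdot)$ is Kullback–Leibler divergence ($+\infty$ without absolute continuity). $\mu_{\boldsymbol\theta}$ is the unique maximizer over $\mu\in\mathcal M$ of $\boldsymbol\theta^\top\mu(\mathbf f)-D(\mu\|u)$. *)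

theory Defs
  imports "HOL-Probability.Probability" "HOL-Combinatorics.Permutations"
begin

section \<open>Functions on the unit square\<close>

definition unit_square :: "(real \<times> real) set" where
  "unit_square = {0..1} \<times> {0..1}"

text \<open>Measures on the unit square live on the space \<open>unit_square\<close> itself (and not on the plane),
  so that functions which are only known to be continuous on the square are measurable.\<close>

definition unif_square :: "(real \<times> real) measure" where
  "unif_square = restrict_space lborel unit_square"

definition class_C :: "(real \<times> real \<Rightarrow> real) set" where
  "class_C = {F. continuous_on unit_square F \<and>
     \<not> (AE z in unif_square. F z = 0) \<and>
     (\<forall>x\<in>{0..1}. (LBINT z:{0..1}. F (x, z)) = 0) \<and>
     (\<forall>y\<in>{0..1}. (LBINT z:{0..1}. F (z, y)) = 0)}"

definition lin_indep :: "(real \<times> real \<Rightarrow> real ^ 'l) \<Rightarrow> bool" where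
  "lin_indep f \<longleftrightarrow> \<not> (\<exists>d. d \<noteq> 0 \<and> (AE z in unif_square. d \<bullet> f z = 0))"


section \<open>The permutation model\<close>

definition perms :: "nat \<Rightarrow> (nat \<Rightarrow> nat) set" where
  "perms n = {\<pi>. \<pi> permutes {1..n}}"

definition suff_stat :: "(real \<times> real \<Rightarrow> real ^ 'l) \<Rightarrow> nat \<Rightarrow> (nat \<Rightarrow> nat) \<Rightarrow> real ^ 'l" where
  "suff_stat f n \<pi> = (\<Sum>i=1..n. f (real i / real n, real (\<pi> i) / real n))"

definition log_partition :: "(real \<times> real \<Rightarrow> real ^ 'l) \<Rightarrow> nat \<Rightarrow> real ^ 'l \<Rightarrow> real" where
  "log_partition f n \<theta> = ln (\<Sum>\<pi>\<in>perms n. exp (\<theta> \<bullet> suff_stat f n \<pi>))"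

definition perm_law :: "(real \<times> real \<Rightarrow> real ^ 'l) \<Rightarrow> nat \<Rightarrow> real ^ 'l \<Rightarrow> (nat \<Rightarrow> nat) measure" where
  "perm_law f n \<theta> =
     point_measure (perms n) (\<lambda>\<pi>. ennreal (exp (\<theta> \<bullet> suff_stat f n \<pi> - log_partition f n \<theta>)))"


section \<open>The pseudo-likelihood score\<close>

definition y_diff ::
  "(real \<times> real \<Rightarrow> real ^ 'l) \<Rightarrow> nat \<Rightarrow> (nat \<Rightarrow> nat) \<Rightarrow> nat \<Rightarrow> nat \<Rightarrow> real ^ 'l" where
  "y_diff f n \<pi> i j =
     f (real i / real n, real (\<pi> i) / real n) + f (real j / real n, real (\<pi> j) / real n)
   - f (real i / real n, real (\<pi> j) / real n) - f (real j / real n, real (\<pi> i) / real n)"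

definition pl_score ::
  "(real \<times> real \<Rightarrow> real ^ 'l) \<Rightarrow> nat \<Rightarrow> (nat \<Rightarrow> nat) \<Rightarrow> real ^ 'l \<Rightarrow> real ^ 'l" where
  "pl_score f n \<pi> \<theta> =
     (\<Sum>(i, j)\<in>{(i, j). 1 \<le> i \<and> i < j \<and> j \<le> n}.
        (1 / (1 + exp (\<theta> \<bullet> y_diff f n \<pi> i j))) *\<^sub>R y_diff f n \<pi> i j)"


section \<open>Limit objects\<close>

definition g_fun ::
  "(real \<times> real \<Rightarrow> real ^ 'l) \<Rightarrow> real \<times> real \<Rightarrow> real \<times> real \<Rightarrow> real ^ 'l" where
  "g_fun f z1 z2 = f z1 + f z2 - f (fst z1, snd z2) - f (fst z2, snd z1)"

definition permutons :: "(real \<times> real) measure set" where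
  "permutons = {\<mu>. prob_space \<mu> \<and> sets \<mu> = sets (restrict_space borel unit_square) \<and>
     distr \<mu> borel fst = uniform_measure lborel {0..1} \<and>
     distr \<mu> borel snd = uniform_measure lborel {0..1}}"

text \<open>The library's real-valued \<open>KL_divergence b u \<mu>\<close> is the integral of \<open>log b (d\<mu>/du)\<close> with respect
  to \<open>\<mu>\<close>. For probability measures with \<open>\<mu>\<close> absolutely continuous with respect to \<open>u\<close>, the negative
  part of that integrand is always integrable, so the integral fails to exist as a real number
  exactly when the divergence is infinite.\<close>

definition KL :: "'a measure \<Rightarrow> 'a measure \<Rightarrow> ereal" where
  "KL \<mu> u =
     (if absolutely_continuous u \<mu> \<and> integrable \<mu> (entropy_density (exp 1) u \<mu>)
      then ereal (KL_divergence (exp 1) u \<mu>) else \<infinity>)"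

definition objective :: "(real \<times> real \<Rightarrow> real ^ 'l) \<Rightarrow> real ^ 'l \<Rightarrow> (real \<times> real) measure \<Rightarrow> ereal" where
  "objective f \<theta> \<mu> = ereal (\<theta> \<bullet> (\<integral>z. f z \<partial>\<mu>)) - KL \<mu> unif_square"

definition mu_opt :: "(real \<times> real \<Rightarrow> real ^ 'l) \<Rightarrow> real ^ 'l \<Rightarrow> (real \<times> real) measure" where
  "mu_opt f \<theta> = (THE \<mu>. \<mu> \<in> permutons \<and> (\<forall>\<nu>\<in>permutons. objective f \<theta> \<nu> \<le> objective f \<theta> \<mu>))"

definition Sigma_mat :: "(real \<times> real \<Rightarrow> real ^ 'l) \<Rightarrow> real ^ 'l \<Rightarrow> real ^ 'l ^ 'l" where
  "Sigma_mat f \<theta> = (\<chi> p q.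
     \<integral>(z1, z2, z3).
        (g_fun f z1 z2 $ p * g_fun f z1 z3 $ q)
        / ((1 + exp (\<theta> \<bullet> g_fun f z1 z2)) * (1 + exp (\<theta> \<bullet> g_fun f z1 z3)))
     \<partial>(mu_opt f \<theta> \<Otimes>\<^sub>M (mu_opt f \<theta> \<Otimes>\<^sub>M mu_opt f \<theta>)))"

definition A_mat :: "(real \<times> real \<Rightarrow> real ^ 'l) \<Rightarrow> real ^ 'l \<Rightarrow> real ^ 'l ^ 'l" where
  "A_mat f \<theta> = (\<chi> p q.
     1 / 2 * (\<integral>(z1, z2).
        (g_fun f z1 z2 $ p * g_fun f z1 z2 $ q * exp (\<theta> \<bullet> g_fun f z1 z2))
        / (1 + exp (\<theta> \<bullet> g_fun f z1 z2))\<^sup>2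
     \<partial>(mu_opt f \<theta> \<Otimes>\<^sub>M mu_opt f \<theta>)))"


section \<open>Normal laws and convergence in distribution\<close>

definition pos_def :: "real ^ 'n ^ 'n \<Rightarrow> bool" where
  "pos_def A \<longleftrightarrow> transpose A = A \<and> (\<forall>x. x \<noteq> 0 \<longrightarrow> 0 < x \<bullet> (A *v x))"

definition std_gaussian :: "(real ^ 'n) measure" where
  "std_gaussian = density lborel (\<lambda>x. ennreal (\<Prod>i\<in>UNIV. std_normal_density (x $ i)))"

text \<open>\<open>N\<close> is the normal law with mean \<open>m\<close> and covariance matrix \<open>S\<close>: the law of \<open>m + B Z\<close> with \<open>Z\<close>
  standard normal and \<open>B B\<^sup>T = S\<close>. This does not depend on \<open>B\<close>, and covers singular \<open>S\<close>.\<close>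

definition is_mv_normal :: "real ^ 'n \<Rightarrow> real ^ 'n ^ 'n \<Rightarrow> (real ^ 'n) measure \<Rightarrow> bool" where
  "is_mv_normal m S N \<longleftrightarrow>
     (\<exists>B :: real ^ 'n ^ 'n. B ** transpose B = S \<and> N = distr std_gaussian borel (\<lambda>x. m + B *v x))"

definition conv_weakly :: "(nat \<Rightarrow> 'a::topological_space measure) \<Rightarrow> 'a measure \<Rightarrow> bool" where
  "conv_weakly P N \<longleftrightarrow>
     (\<forall>h :: 'a \<Rightarrow> real. continuous_on UNIV h \<and> bounded (range h) \<longrightarrow>
        (\<lambda>n. \<integral>x. h x \<partial>P n) \<longlonglongrightarrow> (\<integral>x. h x \<partial>N))"

definition conv_in_distr_normal ::
  "(nat \<Rightarrow> 'a measure) \<Rightarrow> (nat \<Rightarrow> 'a \<Rightarrow> real ^ 'n) \<Rightarrow> real ^ 'n \<Rightarrow> real ^ 'n ^ 'n \<Rightarrow> bool" where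
  "conv_in_distr_normal P X m S \<longleftrightarrow>
     (\<exists>N. is_mv_normal m S N \<and> conv_weakly (\<lambda>n. distr (P n) borel (X n)) N)"

end

theory Submission
  imports Defs
begin

text \<open>Everything rests on one discrete symmetry. Let \<open>z\<^sub>i = (i/n, \<pi>(i)/n)\<close>, let \<open>\<pi>\<^sup>i\<^sup>j\<close> be \<open>\<pi>\<close> with
  the values at \<open>i\<close> and \<open>j\<close> exchanged, and suppose that the law gives \<open>\<pi>\<close> a weight proportional to \<open>\<Prod> M(z\<^sub>i)\<close>
  for a positive function \<open>M\<close>. The weight of \<open>\<pi>\<close> divided by \<open>M(z\<^sub>i) M(z\<^sub>j)\<close> does not change when \<open>\<pi>\<close> is
  replaced by \<open>\<pi>\<^sup>i\<^sup>j\<close>, so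
  \<open>E[X(\<pi>) / (M(z\<^sub>i) M(z\<^sub>j))] = E[X(\<pi>\<^sup>i\<^sup>j) / (M(z\<^sub>i) M(z\<^sub>j))]\<close> for every \<open>X\<close> (\<open>E_swap\<close>).

  The density \<open>M\<close>. With \<open>h = \<theta> \<bullet> f\<close>, the kernel \<open>exp h\<close> can be rescaled to a doubly stochastic density
  \<open>M(x,y) = exp(h(x,y)) / (B(x) A(y))\<close>; the scaling map contracts ratios of functions
  (\<open>schroedinger_system\<close>). The measure \<open>\<mu>\<close> with density \<open>M\<close> is the maximiser \<open>mu_opt\<close>, because the
  objective of a permuton \<open>\<nu>\<close> is a constant minus the divergence of \<open>\<nu>\<close> from \<open>\<mu>\<close> (\<open>mu_opt_eq\<close>). Along a
  permutation, \<open>\<Prod> M(z\<^sub>i)\<close> and \<open>\<Prod> exp(h(z\<^sub>i))\<close> differ by a factor that does not depend on \<open>\<pi>\<close>, so the model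
  is of the form above.

  Law of large numbers. The symmetry, applied to a statistic times itself, shows that the empirical
  measure reweighted by \<open>1/M\<close> is a product measure up to \<open>O(1/n)\<close> in mean square, even against test functions
  that depend on \<open>\<pi>\<close>, provided that a swap moves them only by \<open>O(1/n)\<close> (\<open>factor_defect_second_moment\<close>).
  Hence the empirical measure is close to \<open>M(x,y) s(x,y)\<close> with \<open>s\<close> a product function. Both \<open>M s\<close> and \<open>M\<close>
  have uniform marginals, and this forces \<open>s\<close> to be close to 1 (\<open>LLN_estimate\<close>). So the empirical measure
  converges to \<open>\<mu>\<close>, and its powers converge to those of \<open>\<mu>\<close> (\<open>LLN2\<close>, \<open>LLN3\<close>).

  Part (a). Write \<open>p\<^sub>i\<^sub>j = 1 / (1 + exp(\<theta> \<bullet> y\<^sub>i\<^sub>j))\<close>. The score is the sum of \<open>p\<^sub>i\<^sub>j y\<^sub>i\<^sub>j\<close>, and \<open>y\<^sub>i\<^sub>j\<close> changes sign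
  under the swap, so the symmetry becomes Stein's identity: \<open>E[p\<^sub>i\<^sub>j y\<^sub>i\<^sub>j F(\<pi>)]\<close> is half of
  \<open>E[p\<^sub>i\<^sub>j y\<^sub>i\<^sub>j (F(\<pi>) - F(\<pi>\<^sup>i\<^sup>j))]\<close>. Take \<open>F\<close> to be the sine of \<open>s\<close> times a linear functional \<open>X\<close> of the scaled
  score. Expanding \<open>F(\<pi>) - F(\<pi>\<^sup>i\<^sup>j)\<close> to first order leaves a three-point average, which converges by the
  law of large numbers, and gives \<open>E[X sin(s X + \<phi>)] = s V E[cos(s X + \<phi>)] + o(1)\<close> (\<open>stein_estimate\<close>).
  This differential equation in \<open>s\<close> yields the Gaussian characteristic function. The swap invariance of
  \<open>\<mu> \<Otimes> \<mu>\<close> identifies \<open>V\<close> with the quadratic form of \<open>Sigma_mat\<close> (\<open>Sigma_quadratic\<close>). A second moment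
  bound gives tightness, and \<open>levy_euclidean\<close> gives convergence in law.

  Part (b). The score is the gradient of a concave function, with Hessian close to \<open>- n\<^sup>2 A\<close> at \<open>\<theta>\<^sub>0\<close>. If a
  linear combination \<open>x \<bullet> g\<close> of the swap differences vanishes on the square, then integrating out one
  variable at a time makes \<open>x \<bullet> f\<close> vanish; so \<open>A\<close> is positive definite. With high probability the
  score therefore points inwards on a small sphere around \<open>\<theta>\<^sub>0\<close>, and Brouwer's theorem yields a root inside;
  strict monotonicity makes it unique. A Taylor expansion shows that the rescaled error of the root is the
  inverse of \<open>A\<close> applied to the scaled score, up to a term that tends to 0 in probability.\<close>

section \<open>Convergence in law from trigonometric moments\<close>

text \<open>Phase-shifted cosines are used in place of complex exponentials: their span is closed under products,
  and a single family of real moments carries the whole characteristic function.\<close>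

inductive trig :: "('a::euclidean_space \<Rightarrow> real) \<Rightarrow> bool" where
  cos: "trig (\<lambda>w. c * cos (t \<bullet> w + \<phi>))"
| add: "trig F \<Longrightarrow> trig G \<Longrightarrow> trig (\<lambda>w. F w + G w)"

lemma trig_const: "trig (\<lambda>w. c)"
  using trig.cos[of c 0 0] by simp

lemma trig_cos_mult: "trig G \<Longrightarrow> trig (\<lambda>w. (c * cos (t \<bullet> w + \<phi>)) * G w)"
proof (induction rule: trig.induct)
  case (cos d s \<psi>)
  have "trig (\<lambda>w. (c * d / 2) * cos ((t + s) \<bullet> w + (\<phi> + \<psi>)) + (c * d / 2) * cos ((t - s) \<bullet> w + (\<phi> - \<psi>)))"
    by (intro trig.intros)
  moreover have "(c * cos (t \<bullet> w + \<phi>)) * (d * cos (s \<bullet> w + \<psi>)) =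
      (c * d / 2) * cos ((t + s) \<bullet> w + (\<phi> + \<psi>)) + (c * d / 2) * cos ((t - s) \<bullet> w + (\<phi> - \<psi>))" for w
  proof -
    have 1: "(t + s) \<bullet> w + (\<phi> + \<psi>) = (t \<bullet> w + \<phi>) + (s \<bullet> w + \<psi>)"
      "(t - s) \<bullet> w + (\<phi> - \<psi>) = (t \<bullet> w + \<phi>) - (s \<bullet> w + \<psi>)"
      by (auto simp: inner_add_left inner_diff_left)
    show ?thesis unfolding 1 cos_add cos_diff by (simp add: algebra_simps)
  qed
  ultimately show ?case by simp
next
  case (add F G)
  then show ?case using trig.add[OF add.IH] by (simp add: algebra_simps)
qed

lemma trig_mult: "trig F \<Longrightarrow> trig G \<Longrightarrow> trig (\<lambda>w. F w * G w)"
proof (induction rule: trig.induct)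
  case (cos c t \<phi>)
  then show ?case by (rule trig_cos_mult)
next
  case (add F H)
  then have "trig (\<lambda>w. F w * G w + H w * G w)" by (intro trig.add) auto
  then show ?case by (simp add: algebra_simps)
qed

lemma trig_sum: "finite I \<Longrightarrow> (\<And>i. i \<in> I \<Longrightarrow> trig (F i)) \<Longrightarrow> trig (\<lambda>w. \<Sum>i\<in>I. F i w)"
  by (induction I rule: finite_induct) (auto intro: trig_const trig.add)

text \<open>On the box where all \<open>c * (w \<bullet> b)\<close> lie between \<open>- pi / 2\<close> and \<open>pi / 2\<close> this map is injective with inverse
  built from \<open>arcsin\<close>; everywhere else it folds the space back into the cube.\<close>

definition sines :: "real \<Rightarrow> 'a::euclidean_space \<Rightarrow> 'a" where
  "sines c w = (\<Sum>b\<in>Basis. sin (c * (w \<bullet> b)) *\<^sub>R b)"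

lemma trig_polynomial_sines:
  "real_polynomial_function p \<Longrightarrow> trig (\<lambda>w. p (sines c w))"
proof (induction rule: real_polynomial_function.induct)
  case (linear f)
  then interpret bounded_linear f .
  have "f (sines c w) = (\<Sum>b\<in>Basis. f b * cos ((c *\<^sub>R b) \<bullet> w + (- (pi / 2))))" for w
    unfolding sines_def sum scale
    by (intro sum.cong refl) (simp add: inner_commute[of w] cos_diff mult.commute)
  moreover have "trig (\<lambda>w. \<Sum>b\<in>Basis. f b * cos ((c *\<^sub>R b) \<bullet> w + (- (pi / 2))))"
    by (intro trig_sum trig.cos) auto
  ultimately show ?case by simp
qed (auto intro: trig_const trig.add trig_mult)

lemma trig_bounded_measurable:
  assumes "trig F"
  shows "continuous_on UNIV F \<and> (\<exists>C. \<forall>w. \<bar>F w\<bar> \<le> C)"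
  using assms
proof induction
  case (cos c t \<phi>)
  have "\<bar>c * cos (t \<bullet> w + \<phi>)\<bar> \<le> \<bar>c\<bar>" for w
    by (simp add: abs_mult mult_left_le)
  then show ?case by (auto intro!: continuous_on_mult continuous_on_cos continuous_on_add continuous_on_inner continuous_on_const continuous_on_id)
next
  case (add F G)
  then obtain C D where "\<And>w. \<bar>F w\<bar> \<le> C" "\<And>w. \<bar>G w\<bar> \<le> D" by auto
  then have "\<bar>F w + G w\<bar> \<le> C + D" for w
    using abs_triangle_ineq[of "F w" "G w"] add_mono order_trans by blast
  with add show ?case by (auto intro!: continuous_on_add)
qed

text \<open>A polynomial approximation of \<open>h\<close> composed with \<open>arcsin\<close> on the cube becomes, after substituting
  \<open>sines\<close>, a trigonometric polynomial that is close to \<open>h\<close> on the ball. Because \<open>sines\<close> folds all of space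
  into the cube, the bound on \<open>h\<close> persists far away from the ball, where the approximation fails.\<close>

lemma trig_approximation:
  fixes h :: "'a::euclidean_space \<Rightarrow> real"
  assumes h: "continuous_on UNIV h" and C: "\<And>x. \<bar>h x\<bar> \<le> C" and "e > 0" "R > 0"
  obtains F where "trig F" "\<And>w. norm w \<le> R \<Longrightarrow> \<bar>h w - F w\<bar> \<le> e" "\<And>w. \<bar>F w\<bar> \<le> C + e"
proof -
  (* With this frequency the ball of radius R is mapped injectively by the sines. *)
  define c where "c = pi / (2 * R)"
  have c: "c > 0" "c * R = pi / 2" using \<open>R > 0\<close> by (auto simp: c_def)
  define k where "k s = h (\<Sum>b\<in>Basis. (arcsin (s \<bullet> b) / c) *\<^sub>R b)" for s :: 'a
  have "continuous_on (cbox (- One) One) k"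
    unfolding k_def
    by (intro continuous_on_compose2[OF h] continuous_intros continuous_on_arcsin)
       (use c in \<open>auto simp: mem_box\<close>)
  from Stone_Weierstrass_real_polynomial_function[OF compact_cbox this \<open>e > 0\<close>]
  obtain p where p: "real_polynomial_function p"
    "\<And>x. x \<in> cbox (- One) One \<Longrightarrow> \<bar>k x - p x\<bar> < e" by auto
  have sb: "sines c w \<bullet> b = sin (c * (w \<bullet> b))" if "b \<in> Basis" for w b :: 'a
    using that by (simp add: sines_def)
  have box: "sines c w \<in> cbox (- One) One" for w :: 'a
    by (auto simp: mem_box sb)
  have inbox: "k (sines c w) = h w" if "norm w \<le> R" for w
  proof -
    have "arcsin (sines c w \<bullet> b) / c = w \<bullet> b" if b: "b \<in> Basis" for b
    proof -
      have "\<bar>c * (w \<bullet> b)\<bar> \<le> c * R"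
        using Basis_le_norm[OF b, of w] \<open>norm w \<le> R\<close> c by (auto simp: abs_mult)
      then have "arcsin (sin (c * (w \<bullet> b))) = c * (w \<bullet> b)"
        by (intro arcsin_sin) (auto simp: c)
      then show ?thesis using b c by (simp add: sb)
    qed
    then have "(\<Sum>b\<in>Basis. (arcsin (sines c w \<bullet> b) / c) *\<^sub>R b) = (\<Sum>b\<in>Basis. (w \<bullet> b) *\<^sub>R b)"
      by (intro sum.cong) auto
    then show ?thesis by (simp add: k_def euclidean_representation)
  qed
  show ?thesis
  proof (rule that[OF trig_polynomial_sines[OF p(1), of c]])
    show "\<bar>h w - p (sines c w)\<bar> \<le> e" if "norm w \<le> R" for w
      using p(2)[OF box, of w] inbox[OF that] by simp
    show "\<bar>p (sines c w)\<bar> \<le> C + e" for w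
      using p(2)[OF box, of w] C[of "\<Sum>b\<in>Basis. (arcsin (sines c w \<bullet> b) / c) *\<^sub>R b"]
      by (simp add: k_def)
  qed
qed

lemma norm_tail_borel [measurable]: "{x::'a::euclidean_space. R < norm x} \<in> sets borel"
  by measurable

text \<open>Tightness confines the mass to a ball, on which a bounded continuous function is a trigonometric
  polynomial up to a small error; off the ball both functions are bounded.\<close>

lemma levy_euclidean:
  fixes Q :: "nat \<Rightarrow> 'a::euclidean_space measure"
  assumes Q: "\<And>n. prob_space (Q n)" "\<And>n. sets (Q n) = sets borel"
    and N: "prob_space N" "sets N = sets borel"
    and char: "\<And>t \<phi>. (\<lambda>n. \<integral>x. cos (t \<bullet> x + \<phi>) \<partial>Q n) \<longlonglongrightarrow> (\<integral>x. cos (t \<bullet> x + \<phi>) \<partial>N)"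
    and tight: "\<And>e. e > 0 \<Longrightarrow> \<exists>R. \<forall>\<^sub>F n in sequentially. measure (Q n) {x. R < norm x} \<le> e"
  shows "conv_weakly Q N"
  unfolding conv_weakly_def
proof (intro allI impI)
  fix h :: "'a \<Rightarrow> real"
  assume h: "continuous_on UNIV h \<and> bounded (range h)"
  then obtain C where C: "\<And>x. \<bar>h x\<bar> \<le> C" by (auto simp: bounded_iff)
  have C0: "C \<ge> 0" using C[of 0] by linarith
  have int: "integrable P F" if "prob_space P" "sets P = sets borel" "continuous_on UNIV F" "\<And>w. \<bar>F w\<bar> \<le> D"
    for P and F :: "'a \<Rightarrow> real" and D
  proof -
    interpret prob_space P by fact
    show ?thesis
      by (rule integrable_const_bound[where B=D])
         (use that borel_measurable_continuous_onI[OF that(3)] in \<open>auto simp: measurable_cong_sets[OF that(2) refl]\<close>)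
  qed
  have tr: "(\<lambda>n. \<integral>x. F x \<partial>Q n) \<longlonglongrightarrow> (\<integral>x. F x \<partial>N)" if "trig F" for F
    using that
  proof induction
    case (cos c t \<phi>)
    show ?case using tendsto_mult_left[OF char[of t \<phi>], of c] by simp
  next
    case (add F G)
    from trig_bounded_measurable[OF add.hyps(1)] trig_bounded_measurable[OF add.hyps(2)]
    have "integrable P F \<and> integrable P G" if "prob_space P" "sets P = sets borel" for P
      using that by (auto intro: int)
    then have "(\<integral>x. F x + G x \<partial>P) = (\<integral>x. F x \<partial>P) + (\<integral>x. G x \<partial>P)" if "prob_space P" "sets P = sets borel" for P
      using that by (intro Bochner_Integration.integral_add) auto
    then show ?case using tendsto_add[OF add.IH] Q N by simp
  qed
  have key: "\<bar>(\<integral>x. h x \<partial>P) - (\<integral>x. F x \<partial>P)\<bar> \<le> e + (2 * C + e) * measure P {x. R < norm x}"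
    if P: "prob_space P" "sets P = sets borel" and F: "trig F"
      "\<And>w. norm w \<le> R \<Longrightarrow> \<bar>h w - F w\<bar> \<le> e" "\<And>w. \<bar>F w\<bar> \<le> C + e" and "e > 0" for P F R e
  proof -
    interpret prob_space P by fact
    have [measurable]: "{x. R < norm x} \<in> sets P"
      using P(2) by (simp add: norm_tail_borel)
    have i: "integrable P h" "integrable P F"
      using int[OF P, of h C] int[OF P, of F "C + e"] h C F trig_bounded_measurable by auto
    have "\<bar>(\<integral>x. h x \<partial>P) - (\<integral>x. F x \<partial>P)\<bar> = \<bar>\<integral>x. h x - F x \<partial>P\<bar>"
      using i by simp
    also have "\<dots> \<le> (\<integral>x. \<bar>h x - F x\<bar> \<partial>P)" by (rule integral_abs_bound)
    also have "\<dots> \<le> (\<integral>x. e + (2 * C + e) * indicator {x. R < norm x} x \<partial>P)"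
    proof (rule integral_mono)
      show "integrable P (\<lambda>x. \<bar>h x - F x\<bar>)" using i by auto
      show "integrable P (\<lambda>x. e + (2 * C + e) * indicat_real {x. R < norm x} x)"
        by (intro Bochner_Integration.integrable_add integrable_mult_right integrable_const integrable_real_indicator) (auto simp: emeasure_eq_measure)
      fix x
      show "\<bar>h x - F x\<bar> \<le> e + (2 * C + e) * indicat_real {x. R < norm x} x"
      proof (cases "R < norm x")
        case True
        then show ?thesis using C[of x] F(3)[of x] \<open>e > 0\<close> by (simp add: indicator_def)
      next
        case False
        then show ?thesis using F(2)[of x] by simp
      qed
    qed
    also have "\<dots> = e + (2 * C + e) * measure P {x. R < norm x}"
      by (subst Bochner_Integration.integral_add) (auto simp: emeasure_eq_measure prob_space)
    finally show ?thesis .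
  qed
  have "\<exists>R. measure N {x. R < norm x} \<le> e" if "e > 0" for e
  proof -
    interpret prob_space N by fact
    have "(\<lambda>k. measure N {x. real k < norm x}) \<longlonglongrightarrow> measure N (\<Inter>k. {x. real k < norm x})"
    proof (rule finite_Lim_measure_decseq)
      show "range (\<lambda>k. {x::'a. real k < norm x}) \<subseteq> sets N"
        unfolding N(2) by (intro image_subsetI norm_tail_borel)
      show "decseq (\<lambda>k. {x::'a. real k < norm x})"
      proof (rule decseq_SucI)
        fix k show "{x. real (Suc k) < norm (x::'a)} \<subseteq> {x. real k < norm x}"
          by (intro Collect_mono) simp
      qed
    qed
    moreover have "(\<Inter>k. {x::'a. real k < norm x}) = {}"
    proof -
      have "\<exists>k. \<not> real k < norm x" for x :: 'a using real_arch_simple[of "norm x"] by (auto simp: not_less)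
      then show ?thesis by auto
    qed
    ultimately have "(\<lambda>k. measure N {x. real k < norm x}) \<longlonglongrightarrow> 0" by simp
    then have "\<forall>\<^sub>F k in sequentially. measure N {x. real k < norm x} < e"
      using that by (auto dest: order_tendstoD)
    then obtain k where "measure N {x. real k < norm x} < e"
      using eventually_happens'[OF sequentially_bot] by blast
    then show ?thesis by (intro exI[of _ "real k"]) simp
  qed note tightN = this
  show "(\<lambda>n. \<integral>x. h x \<partial>Q n) \<longlonglongrightarrow> (\<integral>x. h x \<partial>N)"
  proof (rule LIMSEQ_I)
    fix r :: real assume "r > 0"
    (* Both integrals of h are compared with those of F at a cost of (2 + 2 * C) * e, and the integrals of F with
       each other at a cost of e. *)
    define e where "e = min 1 (r / (6 + 4 * C))"
    have e: "e > 0" "e \<le> 1" using \<open>r > 0\<close> C0 by (auto simp: e_def)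
    have er: "(6 + 4 * C) * e \<le> r"
    proof -
      have "e \<le> r / (6 + 4 * C)" by (simp add: e_def)
      then show ?thesis using C0 by (simp add: field_simps)
    qed
    obtain R1 where R1: "\<forall>\<^sub>F n in sequentially. measure (Q n) {x. R1 < norm x} \<le> e" using tight[OF e(1)] by auto
    obtain R2 where R2: "measure N {x. R2 < norm x} \<le> e" using tightN[OF e(1)] by auto
    define R where "R = max 1 (max R1 R2)"
    have "R > 0" by (simp add: R_def)
    have mono: "measure P {x. R < norm x} \<le> measure P {x. R' < norm x}"
      if "prob_space P" "sets P = sets borel" "R' \<le> R" for P R'
    proof -
      interpret prob_space P by fact
      show ?thesis using that by (intro finite_measure_mono) (auto simp: norm_tail_borel)
    qed
    obtain F where F: "trig F" "\<And>w. norm w \<le> R \<Longrightarrow> \<bar>h w - F w\<bar> \<le> e" "\<And>w. \<bar>F w\<bar> \<le> C + e"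
      using trig_approximation[of h C e R] h C e \<open>R > 0\<close> by blast
    have bound: "\<bar>(\<integral>x. h x \<partial>P) - (\<integral>x. F x \<partial>P)\<bar> \<le> e + (2 * C + 1) * e"
      if "prob_space P" "sets P = sets borel" "measure P {x. R' < norm x} \<le> e" "R' \<le> R" for P R'
    proof -
      have "(2 * C + e) * measure P {x. R < norm x} \<le> (2 * C + 1) * e"
        using mono[of P R'] that C0 e by (intro mult_mono) auto
      moreover have "\<bar>(\<integral>x. h x \<partial>P) - (\<integral>x. F x \<partial>P)\<bar> \<le> e + (2 * C + e) * measure P {x. R < norm x}"
        by (rule key) (use that F e in auto)
      ultimately show ?thesis by linarith
    qed
    have "\<forall>\<^sub>F n in sequentially. \<bar>(\<integral>x. F x \<partial>Q n) - (\<integral>x. F x \<partial>N)\<bar> < e"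
      using tendstoD[OF tr[OF F(1)] e(1)] by (simp add: dist_real_def)
    with R1 have "\<forall>\<^sub>F n in sequentially. norm ((\<integral>x. h x \<partial>Q n) - (\<integral>x. h x \<partial>N)) < r"
    proof eventually_elim
      case (elim n)
      have "\<bar>(\<integral>x. h x \<partial>Q n) - (\<integral>x. F x \<partial>Q n)\<bar> \<le> e + (2 * C + 1) * e"
        by (rule bound[of _ R1]) (use Q elim in \<open>auto simp: R_def\<close>)
      moreover have "\<bar>(\<integral>x. h x \<partial>N) - (\<integral>x. F x \<partial>N)\<bar> \<le> e + (2 * C + 1) * e"
        by (rule bound[of _ R2]) (use N R2 in \<open>auto simp: R_def\<close>)
      ultimately show ?case using elim er e(1) by (simp add: algebra_simps)
    qed
    then show "\<exists>no. \<forall>n\<ge>no. norm ((\<integral>x. h x \<partial>Q n) - (\<integral>x. h x \<partial>N)) < r"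
      by (simp add: eventually_sequentially)
  qed
qed

section \<open>Multivariate normal laws\<close>

lemma prod_vec_eq_prod_Basis:
  fixes x :: "real ^ 'n"
  shows "(\<Prod>i\<in>UNIV. F (x $ i)) = (\<Prod>b\<in>Basis. F (x \<bullet> b))"
proof -
  have B: "(Basis :: (real ^ 'n) set) = range (\<lambda>i. axis i 1)"
    by (auto simp: Basis_vec_def)
  have "inj (\<lambda>i. axis i (1::real) :: real ^ 'n)"
    by (auto simp: inj_on_def axis_eq_axis)
  then show ?thesis unfolding B by (subst prod.reindex) (auto simp: inner_axis)
qed

lemma integral_std_normal_iexp:
  "integrable lborel (\<lambda>y. std_normal_density y *\<^sub>R iexp (s * y))"
  "(\<integral>y. std_normal_density y *\<^sub>R iexp (s * y) \<partial>lborel) = complex_of_real (exp (- (s\<^sup>2) / 2))"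
proof -
  show "integrable lborel (\<lambda>y. std_normal_density y *\<^sub>R iexp (s * y))"
    by (rule Bochner_Integration.integrable_bound[where f = std_normal_density])
       (auto intro!: integrable_normal_density simp: norm_mult)
  have "(\<integral>y. std_normal_density y *\<^sub>R iexp (s * y) \<partial>lborel) = char std_normal_distribution s"
    unfolding char_def by (subst integral_density) auto
  then show "(\<integral>y. std_normal_density y *\<^sub>R iexp (s * y) \<partial>lborel) = complex_of_real (exp (- (s\<^sup>2) / 2))"
    by (simp add: char_std_normal_distribution)
qed

text \<open>The density and the exponential are both products over coordinates, so Fubini reduces the claim to
  the one-dimensional characteristic function.\<close>

lemma std_gaussian_iexp:
  fixes u :: "real ^ 'n"
  shows "(\<integral>x. iexp (u \<bullet> x) \<partial>std_gaussian) = complex_of_real (exp (- (norm u)\<^sup>2 / 2))"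
proof -
  have *: "std_gaussian = density lborel (\<lambda>x. ennreal (\<Prod>b\<in>Basis. std_normal_density (x \<bullet> b)) :: ennreal)"
    unfolding std_gaussian_def prod_vec_eq_prod_Basis ..
  have sums: "(\<Sum>b\<in>Basis. a b *\<^sub>R b) \<bullet> c = a c" if "c \<in> Basis" for a and c :: "real ^ 'n"
    using that by simp
  have "(\<integral>x. iexp (u \<bullet> x) \<partial>std_gaussian)
      = (\<integral>x. (\<Prod>b\<in>Basis. std_normal_density (x \<bullet> b)) *\<^sub>R iexp (u \<bullet> x) \<partial>lborel)"
    unfolding * by (subst integral_density) (auto intro!: prod_nonneg)
  also have "\<dots> = (\<integral>x. (\<Prod>b\<in>Basis. std_normal_density (x \<bullet> b) *\<^sub>R iexp ((u \<bullet> b) * (x \<bullet> b))) \<partial>lborel)"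
  proof (intro Bochner_Integration.integral_cong refl)
    fix x :: "real ^ 'n"
    have "iexp (u \<bullet> x) = (\<Prod>b\<in>Basis. iexp ((u \<bullet> b) * (x \<bullet> b)))"
      by (subst euclidean_inner) (simp add: exp_sum[symmetric] sum_distrib_left)
    then show "(\<Prod>b\<in>Basis. std_normal_density (x \<bullet> b)) *\<^sub>R iexp (u \<bullet> x) =
        (\<Prod>b\<in>Basis. std_normal_density (x \<bullet> b) *\<^sub>R iexp ((u \<bullet> b) * (x \<bullet> b)))"
      by (simp add: scaleR_conv_of_real prod.distrib)
  qed
  also have "\<dots> = (\<integral>y. (\<Prod>b\<in>Basis. std_normal_density (y b) *\<^sub>R iexp ((u \<bullet> b) * y b))
      \<partial>(\<Pi>\<^sub>M b\<in>(Basis :: (real ^ 'n) set). lborel))"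
    by (subst lborel_eq, subst integral_distr) (auto simp: sums intro!: Bochner_Integration.integral_cong prod.cong)
  also have "\<dots> = (\<Prod>b\<in>Basis. complex_of_real (exp (- ((u \<bullet> b)\<^sup>2) / 2)))"
  proof -
    interpret product_sigma_finite "\<lambda>b :: real ^ 'n. lborel :: real measure" ..
    show ?thesis
      by (subst product_integral_prod[OF finite_Basis integral_std_normal_iexp(1)])
         (intro prod.cong refl integral_std_normal_iexp(2))
  qed
  also have "\<dots> = complex_of_real (exp (- (norm u)\<^sup>2 / 2))"
  proof -
    have "(norm u)\<^sup>2 = (\<Sum>b\<in>Basis. (u \<bullet> b)\<^sup>2)"
      unfolding power2_norm_eq_inner by (subst euclidean_inner) (simp add: power2_eq_square)
    then show ?thesis
      by (simp add: exp_sum[symmetric] sum_negf sum_divide_distrib del: of_real_exp flip: of_real_prod)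
  qed
  finally show ?thesis .
qed

lemma sets_std_gaussian [measurable_cong, simp]: "sets std_gaussian = sets borel"
  by (simp add: std_gaussian_def)

lemma prob_space_std_gaussian: "prob_space (std_gaussian :: (real ^ 'n) measure)"
proof
  have "emeasure (std_gaussian :: (real ^ 'n) measure) (space std_gaussian)
     = (\<integral>\<^sup>+x. (\<Prod>b\<in>Basis. ennreal (std_normal_density (x \<bullet> b))) \<partial>(lborel :: (real ^ 'n) measure))"
    unfolding std_gaussian_def prod_vec_eq_prod_Basis
    by (subst emeasure_density) (auto simp: prod_ennreal)
  also have "\<dots> = (\<Prod>b\<in>(Basis :: (real ^ 'n) set). \<integral>\<^sup>+x. ennreal (std_normal_density x) \<partial>lborel)"
    by (subst nn_integral_lborel_prod) auto
  also have "(\<integral>\<^sup>+x. ennreal (std_normal_density x) \<partial>lborel) = 1"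
    by (subst nn_integral_eq_integral) (auto intro!: integrable_normal_density simp: integral_normal_density)
  finally show "emeasure (std_gaussian :: (real ^ 'n) measure) (space std_gaussian) = 1" by simp
qed

lemma mv_normal_cos:
  fixes B :: "real ^ 'n ^ 'n"
  assumes S: "B ** transpose B = S"
  defines "N \<equiv> distr std_gaussian borel (\<lambda>x. 0 + B *v x)"
  shows "(\<integral>x. cos (t \<bullet> x + \<phi>) \<partial>N) = cos \<phi> * exp (- (t \<bullet> (S *v t)) / 2)"
    and "prob_space N" "sets N = sets borel"
proof -
  interpret G: prob_space "std_gaussian :: (real ^ 'n) measure" by (rule prob_space_std_gaussian)
  have [measurable]: "((*v) B) \<in> borel_measurable borel"
    by (intro borel_measurable_continuous_onI matrix_vector_mult_linear_continuous_on)
  show "prob_space N" unfolding N_def by (intro G.prob_space_distr) simp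
  show "sets N = sets borel" by (simp add: N_def)
  define u where "u = t v* B"
  have u: "t \<bullet> (B *v x) = u \<bullet> x" for x by (simp add: u_def dot_lmul_matrix)
  have nu: "(norm u)\<^sup>2 = t \<bullet> (S *v t)"
  proof -
    have "S *v t = B *v (transpose B *v t)" by (simp add: S[symmetric] matrix_vector_mul_assoc del: transpose_matrix_vector)
    then have "t \<bullet> (S *v t) = u \<bullet> (transpose B *v t)" by (simp add: u)
    also have "transpose B *v t = u" by (simp add: u_def)
    finally show ?thesis by (simp add: power2_norm_eq_inner)
  qed
  have I: "integrable std_gaussian (\<lambda>x. iexp (u \<bullet> x))"
    by (rule G.integrable_const_bound[where B=1]) auto
  have c: "(\<integral>x. cos (u \<bullet> x) \<partial>std_gaussian) = exp (- (norm u)\<^sup>2 / 2)"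
    using arg_cong[OF std_gaussian_iexp[of u], of Re] integral_Re[OF I] by (simp add: Re_exp)
  have s: "(\<integral>x. sin (u \<bullet> x) \<partial>std_gaussian) = 0"
    using arg_cong[OF std_gaussian_iexp[of u], of Im] integral_Im[OF I] by (simp add: Im_exp)
  have Ic: "integrable std_gaussian (\<lambda>x. cos (u \<bullet> x))"
    by (rule G.integrable_const_bound[where B=1]) auto
  have Is: "integrable std_gaussian (\<lambda>x. sin (u \<bullet> x))"
    by (rule G.integrable_const_bound[where B=1]) auto
  have "(\<integral>x. cos (t \<bullet> x + \<phi>) \<partial>N) = (\<integral>x. cos (u \<bullet> x + \<phi>) \<partial>std_gaussian)"
    unfolding N_def by (subst integral_distr) (auto simp: u)
  also have "\<dots> = (\<integral>x. cos (u \<bullet> x) * cos \<phi> - sin (u \<bullet> x) * sin \<phi> \<partial>std_gaussian)"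
    by (simp add: cos_add)
  also have "\<dots> = cos \<phi> * exp (- (norm u)\<^sup>2 / 2)"
    using Ic Is by (subst Bochner_Integration.integral_diff) (auto simp: c s)
  finally show "(\<integral>x. cos (t \<bullet> x + \<phi>) \<partial>N) = cos \<phi> * exp (- (t \<bullet> (S *v t)) / 2)"
    unfolding nu .
qed

section \<open>Square roots of positive semidefinite matrices\<close>

lemma psd_diag_zero:
  fixes S :: "real ^ 'n ^ 'n"
  assumes sym: "transpose S = S" and psd: "\<And>x. 0 \<le> x \<bullet> (S *v x)" and "S $ p $ p = 0"
  shows "S $ p $ q = 0"
proof (rule ccontr)
  assume n: "S $ p $ q \<noteq> 0"
  have sy: "S $ q $ p = S $ p $ q" using sym by (metis transpose_def vec_lambda_beta)
  have b: "axis i 1 \<bullet> (S *v axis j 1) = S $ i $ j" for i j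
    by (simp add: inner_axis' matrix_vector_mul_component matrix_vector_mult_basis column_def)
  (* The quadratic form is affine in s here; this s makes its value -1. *)
  define s where "s = - (S $ q $ q + 1) / (2 * S $ p $ q)"
  define x where "x = s *\<^sub>R axis p 1 + axis q (1::real)"
  have "x \<bullet> (S *v x) = s * s * (S $ p $ p) + 2 * s * (S $ p $ q) + S $ q $ q"
    by (simp add: x_def matrix_vector_right_distrib inner_add_left inner_add_right b sy
        matrix_vector_mult_scaleR algebra_simps)
  also have "\<dots> = -1" using n assms(3) by (simp add: s_def field_simps)
  finally show False using psd[of x] by simp
qed

text \<open>Cholesky elimination: subtracting the outer product of a normalised row from the matrix keeps it
  positive semidefinite and clears one more diagonal entry, and a zero diagonal entry clears its row.\<close>

lemma psd_outer_decomposition: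
  fixes S :: "real ^ 'n ^ 'n"
  assumes "transpose S = S" and "\<And>x. 0 \<le> x \<bullet> (S *v x)"
  shows "\<exists>c :: 'n \<Rightarrow> real ^ 'n. \<forall>i j. S $ i $ j = (\<Sum>k\<in>UNIV. c k $ i * c k $ j)"
proof -
  have "\<forall>S :: real ^ 'n ^ 'n. transpose S = S \<longrightarrow> (\<forall>x. 0 \<le> x \<bullet> (S *v x)) \<longrightarrow> (\<forall>p. p \<notin> I \<longrightarrow> S $ p $ p = 0) \<longrightarrow>
     (\<exists>c :: 'n \<Rightarrow> real ^ 'n. (\<forall>k. k \<notin> I \<longrightarrow> c k = 0) \<and> (\<forall>i j. S $ i $ j = (\<Sum>k\<in>UNIV. c k $ i * c k $ j)))"
    if "finite I" for I
    using that
  proof (induction I rule: finite_induct)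
    case empty
    show ?case
    proof (intro allI impI exI[of _ "\<lambda>k. 0"] conjI)
      fix S :: "real ^ 'n ^ 'n" and i j
      assume "transpose S = S" "\<forall>x. 0 \<le> x \<bullet> (S *v x)" "\<forall>p. p \<notin> {} \<longrightarrow> S $ p $ p = 0"
      then have "S $ i $ j = 0" using psd_diag_zero[of S i j] by blast
      then show "S $ i $ j = (\<Sum>k\<in>UNIV. (0 :: real ^ 'n) $ i * (0 :: real ^ 'n) $ j)" by simp
    qed auto
  next
    case (insert p I)
    show ?case
    proof (intro allI impI)
      fix S :: "real ^ 'n ^ 'n"
      assume S: "transpose S = S" "\<forall>x. 0 \<le> x \<bullet> (S *v x)" "\<forall>q. q \<notin> insert p I \<longrightarrow> S $ q $ q = 0"
      show "\<exists>c :: 'n \<Rightarrow> real ^ 'n. (\<forall>k. k \<notin> insert p I \<longrightarrow> c k = 0) \<and> (\<forall>i j. S $ i $ j = (\<Sum>k\<in>UNIV. c k $ i * c k $ j))"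
      proof (cases "S $ p $ p = 0")
        case True
        then have "\<forall>q. q \<notin> I \<longrightarrow> S $ q $ q = 0" using S(3) by auto
        with insert.IH[rule_format, OF S(1), OF S(2)[rule_format]] show ?thesis by blast
      next
        case False
        have b: "axis i 1 \<bullet> (S *v axis j 1) = S $ i $ j" for i j
          by (simp add: inner_axis' matrix_vector_mult_basis column_def)
        have pos: "S $ p $ p > 0" using S(2)[rule_format, of "axis p 1"] False by (simp add: b)
        have sy: "S $ i $ j = S $ j $ i" for i j using S(1) by (metis transpose_def vec_lambda_beta)
        define v where "v = (1 / sqrt (S $ p $ p)) *\<^sub>R (\<chi> i. S $ p $ i)"
        define T where "T = (\<chi> i j. S $ i $ j - v $ i * v $ j)"
        have vv: "v $ i * v $ j = S $ p $ i * S $ p $ j / S $ p $ p" for i j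
          using pos by (simp add: v_def field_simps)
        have T1: "transpose T = T" by (auto simp: T_def transpose_def vec_eq_iff sy mult.commute)
        have Tx: "x \<bullet> (T *v x) = x \<bullet> (S *v x) - (v \<bullet> x)\<^sup>2" for x
        proof -
          have "T *v x = S *v x - (v \<bullet> x) *\<^sub>R v"
            by (simp add: vec_eq_iff T_def matrix_vector_mult_def inner_vec_def sum_subtractf
                sum_distrib_left sum_distrib_right algebra_simps)
          then show ?thesis by (simp add: inner_diff_right power2_eq_square inner_commute)
        qed
        have T2: "0 \<le> x \<bullet> (T *v x)" for x
        proof -
          define a where "a = (\<chi> i. S $ p $ i) \<bullet> x"
          have Sp: "axis p 1 \<bullet> (S *v x) = a"
            by (simp add: inner_axis' a_def) (simp add: matrix_vector_mult_def inner_vec_def)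
          have Sp2: "x \<bullet> (S *v axis p 1) = a"
            by (simp add: matrix_vector_mult_basis column_def a_def inner_vec_def sy[of _ p] mult.commute)
          (* The minimiser of the quadratic form along the direction of axis p. *)
          define y where "y = x - (a / S $ p $ p) *\<^sub>R axis p 1"
          have "y \<bullet> (S *v y) = x \<bullet> (S *v x) - a\<^sup>2 / S $ p $ p"
            using pos
            by (simp add: y_def matrix_vector_mult_diff_distrib matrix_vector_mult_scaleR inner_diff_left inner_diff_right
               Sp Sp2 b power2_eq_square field_simps)
          moreover have "(v \<bullet> x)\<^sup>2 = a\<^sup>2 / S $ p $ p"
            using pos by (simp add: v_def a_def power_mult_distrib power_divide)
          ultimately show ?thesis using S(2)[rule_format, of y] Tx[of x] by simp
        qed
        have "T $ q $ q = 0" if "q \<notin> I" for q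
        proof (cases "q = p")
          case True
          then show ?thesis using pos by (simp add: T_def vv)
        next
          case False
          then have "S $ q $ q = 0" using S(3) that by auto
          then have "S $ q $ p = 0" using psd_diag_zero[OF S(1)] S(2) by blast
          then show ?thesis using \<open>S $ q $ q = 0\<close> by (simp add: T_def vv sy[of p q])
        qed
        then obtain c :: "'n \<Rightarrow> real ^ 'n" where c: "\<forall>k. k \<notin> I \<longrightarrow> c k = 0" "\<forall>i j. T $ i $ j = (\<Sum>k\<in>UNIV. c k $ i * c k $ j)"
          using insert.IH T1 T2 by blast
        have "(\<Sum>k\<in>UNIV. (c(p := v)) k $ i * (c(p := v)) k $ j) = S $ i $ j" for i j
        proof -
          have "(\<Sum>k\<in>UNIV. (c(p := v)) k $ i * (c(p := v)) k $ j) = v $ i * v $ j + (\<Sum>k\<in>UNIV - {p}. c k $ i * c k $ j)"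
            by (subst sum.remove[of _ p]) auto
          also have "(\<Sum>k\<in>UNIV - {p}. c k $ i * c k $ j) = (\<Sum>k\<in>UNIV. c k $ i * c k $ j)"
            using c(1) insert.hyps(2) by (subst (2) sum.remove[of _ p]) auto
          also have "\<dots> = T $ i $ j" using c(2) by simp
          finally show ?thesis by (simp add: T_def)
        qed
        then show ?thesis using c(1) by (intro exI[of _ "c(p := v)"]) auto
      qed
    qed
  qed
  from this[of UNIV] assms show ?thesis by auto
qed

lemma psd_sqrt:
  fixes S :: "real ^ 'n ^ 'n"
  assumes "transpose S = S" and "\<And>x. 0 \<le> x \<bullet> (S *v x)"
  obtains B :: "real ^ 'n ^ 'n" where "B ** transpose B = S"
proof -
  obtain c :: "'n \<Rightarrow> real ^ 'n" where "\<And>i j. S $ i $ j = (\<Sum>k\<in>UNIV. c k $ i * c k $ j)"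
    using psd_outer_decomposition[OF assms] by blast
  then have "(\<chi> i k. c k $ i) ** transpose (\<chi> i k. c k $ i) = S"
    by (simp add: vec_eq_iff matrix_matrix_mult_def transpose_def)
  then show ?thesis by (rule that)
qed

section \<open>The Schroedinger system of a positive kernel\<close>

definition scaling :: "(real \<Rightarrow> real \<Rightarrow> real) \<Rightarrow> (real \<Rightarrow> real) \<Rightarrow> real \<Rightarrow> real" where
  "scaling K B y = integral {0..1} (\<lambda>x. K x y / B x)"

text \<open>A bound on the oscillation of the ratio of two functions, blind to constant factors. The scaling
  map contracts this quantity although it contracts no norm.\<close>

definition proportional :: "real \<Rightarrow> (real \<Rightarrow> real) \<Rightarrow> (real \<Rightarrow> real) \<Rightarrow> bool" where
  "proportional q B B' \<longleftrightarrow> (\<exists>l>0. \<forall>x\<in>{0..1}. l * B' x \<le> B x \<and> B x \<le> l * (1 + q) * B' x)"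

lemma proportional_mono: "proportional q B B' \<Longrightarrow> q \<le> r \<Longrightarrow> (\<And>x. x \<in> {0..1} \<Longrightarrow> 0 < B' x) \<Longrightarrow> proportional r B B'"
  unfolding proportional_def
proof (elim exE conjE)
  fix l assume *: "q \<le> r" "\<And>x. x \<in> {0..1} \<Longrightarrow> 0 < B' x" "0 < l" "\<forall>x\<in>{0..1}. l * B' x \<le> B x \<and> B x \<le> l * (1 + q) * B' x"
  have "l * (1 + q) * B' x \<le> l * (1 + r) * B' x" if "x \<in> {0..1}" for x
    using *(1) *(2)[OF that] *(3) by (intro mult_right_mono mult_left_mono) auto
  with * show "\<exists>l>0. \<forall>x\<in>{0..1}. l * B' x \<le> B x \<and> B x \<le> l * (1 + r) * B' x"
    by (intro exI[of _ l]) (auto intro: order_trans)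
qed

lemma proportional_trans:
  assumes "proportional q a b" "proportional r b c" "q \<ge> 0" "r \<ge> 0"
  shows "proportional ((1 + q) * (1 + r) - 1) a c"
proof -
  obtain l where l: "l > 0" "\<forall>x\<in>{0..1}. l * b x \<le> a x \<and> a x \<le> l * (1 + q) * b x" using assms(1) by (auto simp: proportional_def)
  obtain m where m: "m > 0" "\<forall>x\<in>{0..1}. m * c x \<le> b x \<and> b x \<le> m * (1 + r) * c x" using assms(2) by (auto simp: proportional_def)
  show ?thesis unfolding proportional_def
  proof (intro exI[of _ "l * m"] conjI ballI)
    fix x :: real assume x: "x \<in> {0..1}"
    have "l * (m * c x) \<le> l * b x" using l m x by (intro mult_left_mono) auto
    then show "l * m * c x \<le> a x" using l(2)[rule_format, OF x] by (simp add: mult.assoc)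
    have "l * (1 + q) * b x \<le> l * (1 + q) * (m * (1 + r) * c x)" using l m x assms by (intro mult_left_mono) auto
    then show "a x \<le> l * m * (1 + ((1 + q) * (1 + r) - 1)) * c x"
      using l(2)[rule_format, OF x] by (simp add: mult_ac)
  qed (use l m in auto)
qed

lemma proportional_sym:
  assumes "proportional q a b" "q \<ge> 0"
  shows "proportional q b a"
proof -
  obtain l where l: "l > 0" "\<forall>x\<in>{0..1}. l * b x \<le> a x \<and> a x \<le> l * (1 + q) * b x" using assms(1) by (auto simp: proportional_def)
  define s where "s = l * (1 + q)"
  have s: "s > 0" "1 / s * (1 + q) = 1 / l" using l assms(2) by (auto simp: s_def)
  show ?thesis unfolding proportional_def
  proof (intro exI[of _ "1 / s"] conjI ballI)
    fix x :: real assume "x \<in> {0..1}"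
    with l have *: "l * b x \<le> a x" "a x \<le> s * b x" by (auto simp: s_def)
    show "1 / s * a x \<le> b x" using * s(1) by (simp add: pos_divide_le_eq mult.commute)
    show "b x \<le> 1 / s * (1 + q) * a x" unfolding s(2) using * l(1) by (simp add: pos_le_divide_eq mult.commute)
  qed (use s in auto)
qed

lemma proportional_scale_left:
  assumes "proportional q a b" "s > 0" shows "proportional q (\<lambda>x. a x / s) b"
proof -
  obtain l where l: "l > 0" "\<forall>x\<in>{0..1}. l * b x \<le> a x \<and> a x \<le> l * (1 + q) * b x" using assms(1) by (auto simp: proportional_def)
  show ?thesis unfolding proportional_def
    by (intro exI[of _ "l / s"]) (use l assms in \<open>auto simp: field_simps\<close>)
qed

text \<open>The global bounds \<open>c\<close> and \<open>C\<close> give the contraction constant \<open>1 - (c / C)\<^sup>2\<close>.\<close>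

locale positive_kernel =
  fixes K :: "real \<Rightarrow> real \<Rightarrow> real" and c C :: real
  assumes K_cont: "continuous_on UNIV (\<lambda>z. K (fst z) (snd z))"
    and K_lower: "\<And>x y. c \<le> K x y" and K_upper: "\<And>x y. K x y \<le> C" and c_pos: "0 < c"
begin

lemma K_pos: "0 < K x y" using K_lower[of x y] c_pos by linarith
lemma c_le_C: "c \<le> C" using K_lower[of 0 0] K_upper[of 0 0] by linarith
lemma C_pos: "0 < C" using c_pos c_le_C by linarith

lemma K_comp: "continuous_on S f \<Longrightarrow> continuous_on S g \<Longrightarrow> continuous_on S (\<lambda>x. K (f x) (g x))"
  using continuous_on_compose2[OF K_cont continuous_on_Pair, of S f g] by simp

lemma transposed: "positive_kernel (\<lambda>x y. K y x) c C"
proof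
  show "continuous_on UNIV (\<lambda>z. K (snd z) (fst z))"
    by (intro K_comp continuous_intros)
qed (auto simp: K_lower K_upper c_pos)

lemma K_cont1: "continuous_on S (\<lambda>x. K x y)"
  by (intro K_comp continuous_intros)

definition admissible :: "(real \<Rightarrow> real) \<Rightarrow> bool" where
  "admissible B \<longleftrightarrow> continuous_on {0..1} B \<and> (\<forall>x\<in>{0..1}. 0 < B x)"

lemma admissible_cont1: "admissible B \<Longrightarrow> continuous_on {0..1} (\<lambda>x. K x y / B x)"
  unfolding admissible_def by (intro continuous_on_divide K_cont1) force+

lemma admissible_inv: "admissible B \<Longrightarrow> continuous_on {0..1} (\<lambda>x. 1 / B x)"
  unfolding admissible_def by (intro continuous_on_divide continuous_on_const) force+

lemma integral_inv_pos:
  assumes "admissible B" shows "0 < integral {0..1} (\<lambda>x. 1 / B x)"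
proof -
  have "continuous_on {0..1} B" "{0..1::real} \<noteq> {}" using assms by (auto simp: admissible_def)
  then obtain x0 where x0: "x0 \<in> {0..1}" "\<And>x. x \<in> {0..1} \<Longrightarrow> B x \<le> B x0"
    using continuous_attains_sup[of "{0..1::real}" B] by auto
  have "integral {0..1} (\<lambda>x::real. 1 / B x0) \<le> integral {0..1} (\<lambda>x. 1 / B x)"
    using assms x0 by (intro integral_le integrable_continuous_interval admissible_inv continuous_on_const)
      (auto simp: admissible_def intro!: divide_left_mono mult_pos_pos)
  then have "1 / B x0 \<le> integral {0..1} (\<lambda>x. 1 / B x)" by simp
  moreover have "0 < 1 / B x0" using assms x0(1) by (auto simp: admissible_def)
  ultimately show ?thesis by linarith
qed

lemma scaling_bounds:
  assumes "admissible B"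
  shows "c * integral {0..1} (\<lambda>x. 1 / B x) \<le> scaling K B y" "scaling K B y \<le> C * integral {0..1} (\<lambda>x. 1 / B x)"
proof -
  have m: "c * (1 / B x) \<le> K x y / B x" "K x y / B x \<le> C * (1 / B x)" if "x \<in> {0..1}" for x
  proof -
    have "B x > 0" using assms that by (auto simp: admissible_def)
    then show "c * (1 / B x) \<le> K x y / B x" "K x y / B x \<le> C * (1 / B x)"
      using K_lower[of x y] K_upper[of x y] by (auto simp: divide_right_mono)
  qed
  have "integral {0..1} (\<lambda>x. c * (1 / B x)) \<le> scaling K B y"
    unfolding scaling_def
    by (intro integral_le integrable_continuous_interval admissible_cont1 assms continuous_on_mult continuous_on_const admissible_inv) (use m in auto)
  then show "c * integral {0..1} (\<lambda>x. 1 / B x) \<le> scaling K B y" by (simp only: integral_mult_right)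
  have "scaling K B y \<le> integral {0..1} (\<lambda>x. C * (1 / B x))"
    unfolding scaling_def
    by (intro integral_le integrable_continuous_interval admissible_cont1 assms continuous_on_mult continuous_on_const admissible_inv) (use m in auto)
  then show "scaling K B y \<le> C * integral {0..1} (\<lambda>x. 1 / B x)" by (simp only: integral_mult_right)
qed

lemma scaling_pos: "admissible B \<Longrightarrow> 0 < scaling K B y"
  using scaling_bounds(1)[of B y] integral_inv_pos[of B] c_pos by (smt (verit) mult_pos_pos)

lemma scaling_cont:
  assumes "admissible B" shows "continuous_on UNIV (scaling K B)"
proof -
  have "continuous_on (UNIV \<times> cbox 0 1) (\<lambda>(y, x). K x y / B x)"
    unfolding case_prod_beta
  proof (intro continuous_on_divide)
    show "continuous_on (UNIV \<times> cbox 0 1) (\<lambda>z. K (snd z) (fst z))"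
      by (intro K_comp continuous_intros)
    show "continuous_on (UNIV \<times> cbox 0 1) (\<lambda>z::real \<times> real. B (snd z))"
    proof (rule continuous_on_compose2[OF _ continuous_on_snd[OF continuous_on_id]])
      show "continuous_on {0..1} B" using assms by (simp add: admissible_def)
    qed auto
    show "\<forall>z\<in>UNIV \<times> cbox 0 1. B (snd (z::real \<times> real)) \<noteq> 0" using assms by (force simp: admissible_def)
  qed
  from integral_continuous_on_param[OF this] show ?thesis by (simp add: scaling_def[abs_def])
qed

lemma scaling_admissible: "admissible B \<Longrightarrow> admissible (scaling K B)"
  using scaling_cont scaling_pos by (auto simp: admissible_def intro: continuous_on_subset)

lemma scaling_ratio: "admissible B \<Longrightarrow> c * scaling K B y \<le> C * scaling K B y'"
proof -
  assume B: "admissible B"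
  have "c * scaling K B y \<le> c * (C * integral {0..1} (\<lambda>x. 1 / B x))"
    using scaling_bounds(2)[OF B] c_pos by (intro mult_left_mono) auto
  also have "\<dots> = C * (c * integral {0..1} (\<lambda>x. 1 / B x))" by simp
  also have "\<dots> \<le> C * scaling K B y'" using scaling_bounds(1)[OF B] C_pos by (intro mult_left_mono) auto
  finally show ?thesis .
qed

text \<open>The ratio of the two images at \<open>y\<close> is an average of \<open>B' / B\<close> against a probability density that depends on
  \<open>y\<close>. Any two of these densities are comparable up to the factor \<open>(c / C)\<^sup>2\<close>. Hence so are the averages of the
  excess of \<open>B' / B\<close> over its lower bound, and the spread between them loses that fraction.\<close>

lemma scaling_contraction:
  assumes B: "admissible B" and B': "admissible B'" and proportional: "proportional q B B'" and q: "q \<ge> 0"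
  shows "proportional ((1 - (c / C)\<^sup>2) * q) (scaling K B) (scaling K B')"
proof -
  obtain lo where lo: "lo > 0" "\<And>x. x \<in> {0..1} \<Longrightarrow> lo * B' x \<le> B x" "\<And>x. x \<in> {0..1} \<Longrightarrow> B x \<le> lo * (1 + q) * B' x"
    using proportional by (auto simp: proportional_def)
  define l where "l = 1 / (lo * (1 + q))"
  have l: "l > 0" using lo q by (auto simp: l_def)
  let ?A = "scaling K B" and ?A' = "scaling K B'"
  have pos: "B x > 0" "B' x > 0" if "x \<in> {0..1}" for x using B B' that by (auto simp: admissible_def)
  have u: "l / B' x \<le> 1 / B x" "1 / B x \<le> l * (1 + q) / B' x" if "x \<in> {0..1}" for x
  proof -
    have "lo * (1 + q) > 0" using lo(1) q by simp
    then show "l / B' x \<le> 1 / B x"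
      using lo(3)[OF that] pos[OF that] unfolding l_def by (simp add: frac_le_eq divide_simps)
    have *: "l * (1 + q) = 1 / lo" using lo(1) q by (simp add: l_def)
    show "1 / B x \<le> l * (1 + q) / B' x"
      unfolding * using lo(2)[OF that] pos[OF that] lo(1) by (simp add: field_simps)
  qed
  note int = integrable_continuous_interval[OF admissible_cont1[OF B]] integrable_continuous_interval[OF admissible_cont1[OF B']]
  have diff: "?A y - l * ?A' y = integral {0..1} (\<lambda>x. K x y * (1 / B x - l / B' x))" for y
  proof -
    have "integral {0..1} (\<lambda>x. K x y / B x - l * (K x y / B' x))
        = integral {0..1} (\<lambda>x. K x y / B x) - integral {0..1} (\<lambda>x. l * (K x y / B' x))"
      by (intro integral_diff int integrable_on_mult_right)
    also have "\<dots> = ?A y - l * ?A' y" unfolding integral_mult_right scaling_def ..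
    finally have "integral {0..1} (\<lambda>x. K x y / B x - l * (K x y / B' x)) = ?A y - l * ?A' y" .
    then show ?thesis by (simp add: algebra_simps)
  qed
  have "continuous_on {0..1} (\<lambda>x. K x y * (1 / B x - l / B' x))" for y
    using B B' unfolding admissible_def by (intro continuous_on_mult continuous_on_diff continuous_on_divide K_cont1 continuous_on_const) force+
  then have intd: "(\<lambda>x. K x y * (1 / B x - l / B' x)) integrable_on {0..1}" for y by (rule integrable_continuous_interval)
  have le: "c / C * (?A y' - l * ?A' y') \<le> ?A y - l * ?A' y" for y y'
  proof -
    have "c / C * (?A y' - l * ?A' y') = integral {0..1} (\<lambda>x. c / C * (K x y' * (1 / B x - l / B' x)))"
      by (simp add: diff)
    also have "\<dots> \<le> integral {0..1} (\<lambda>x. K x y * (1 / B x - l / B' x))"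
    proof (intro integral_le intd integrable_on_mult_right)
      fix x :: real assume x: "x \<in> {0..1}"
      have "c * K x y' \<le> C * K x y" using K_lower[of x y] K_upper[of x y'] c_pos C_pos
        by (metis K_pos less_eq_real_def mult.commute mult_mono)
      then have "c / C * K x y' \<le> K x y" using C_pos by (simp add: field_simps)
      then show "c / C * (K x y' * (1 / B x - l / B' x)) \<le> K x y * (1 / B x - l / B' x)"
        using u(1)[OF x] unfolding mult.assoc[symmetric] by (intro mult_right_mono) auto
    qed
    finally show ?thesis by (simp add: diff)
  qed
  define f where "f y = ?A y / ?A' y" for y
  have A': "?A' y > 0" for y by (rule scaling_pos[OF B'])
  have fA: "?A y = f y * ?A' y" for y using A'[of y] by (simp add: f_def)
  have lf: "l \<le> f y" for y
  proof -
    have "0 \<le> integral {0..1} (\<lambda>x. K x y * (1 / B x - l / B' x))"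
      using u(1) K_pos by (intro integral_nonneg intd) (auto intro!: mult_nonneg_nonneg less_imp_le[OF K_pos])
    then show ?thesis using A'[of y] unfolding diff[symmetric] f_def by (simp add: field_simps)
  qed
  have fu: "f y \<le> l * (1 + q)" for y
  proof -
    have "?A y \<le> integral {0..1} (\<lambda>x. l * (1 + q) * (K x y / B' x))"
      unfolding scaling_def
    proof (intro integral_le int integrable_on_mult_right)
      fix x :: real assume x: "x \<in> {0..1}"
      show "K x y / B x \<le> l * (1 + q) * (K x y / B' x)"
        using mult_left_mono[OF u(2)[OF x], of "K x y"] K_pos[of x y] by (simp add: algebra_simps)
    qed
    then have "?A y \<le> l * (1 + q) * ?A' y" unfolding scaling_def integral_mult_right .
    then show ?thesis using A'[of y] by (simp add: f_def field_simps)
  qed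
  have con: "(c / C)\<^sup>2 * (f y' - l) \<le> f y - l" for y y'
  proof -
    have "(c / C)\<^sup>2 * (f y' - l) * ?A' y = (c / C) * ((f y' - l) * (c / C * ?A' y))"
      by (simp add: power2_eq_square)
    also have "c / C * ?A' y \<le> ?A' y'" using scaling_ratio[OF B', of y y'] C_pos by (simp add: field_simps)
    then have "(c / C) * ((f y' - l) * (c / C * ?A' y)) \<le> (c / C) * ((f y' - l) * ?A' y')"
      using lf[of y'] c_pos C_pos by (intro mult_left_mono) auto
    also have "\<dots> \<le> (f y - l) * ?A' y" using le[of y' y] by (simp add: fA algebra_simps)
    finally show ?thesis using A'[of y] by (simp add: mult_le_cancel_right)
  qed
  have "continuous_on {0..1} f"
    unfolding f_def using scaling_admissible[OF B] scaling_admissible[OF B'] A'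
    by (intro continuous_on_divide) (auto simp: admissible_def less_imp_neq[symmetric])
  then obtain y0 where y0: "y0 \<in> {0..1}" "\<And>y. y \<in> {0..1} \<Longrightarrow> f y0 \<le> f y"
    using continuous_attains_inf[of "{0..1::real}" f] by auto
  define k where "k = (c / C)\<^sup>2"
  have k: "0 \<le> k" "k \<le> 1" using c_pos C_pos c_le_C by (auto simp: k_def power_le_one)
  show ?thesis unfolding proportional_def k_def[symmetric]
  proof (intro exI[of _ "f y0"] conjI ballI)
    show "0 < f y0" using lf[of y0] l by linarith
    fix y :: real assume y: "y \<in> {0..1}"
    show "f y0 * ?A' y \<le> ?A y" using y0(2)[OF y] A'[of y] unfolding fA by (intro mult_right_mono) auto
    have "f y - f y0 \<le> (1 - k) * (f y - l)" using con[of y y0] unfolding k_def[symmetric] by (simp add: algebra_simps)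
    also have "\<dots> \<le> (1 - k) * (l * q)" using fu[of y] k by (intro mult_left_mono) (auto simp: algebra_simps)
    also have "\<dots> \<le> (1 - k) * (f y0 * q)" using lf[of y0] k q by (intro mult_left_mono mult_right_mono) auto
    finally have "f y \<le> f y0 * (1 + (1 - k) * q)" by (simp add: algebra_simps)
    then show "?A y \<le> f y0 * (1 + (1 - k) * q) * ?A' y"
      using A'[of y] unfolding fA by (intro mult_right_mono) auto
  qed
qed

definition round_trip :: "(real \<Rightarrow> real) \<Rightarrow> real \<Rightarrow> real" where
  "round_trip B = scaling (\<lambda>x y. K y x) (scaling K B)"

lemma round_trip_admissible: "admissible B \<Longrightarrow> admissible (round_trip B)"
  unfolding round_trip_def
  using positive_kernel.scaling_admissible[OF transposed] scaling_admissible
  by (simp add: positive_kernel.admissible_def[OF transposed] admissible_def)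

lemma round_trip_ratio: "admissible B \<Longrightarrow> c * round_trip B y \<le> C * round_trip B y'"
  unfolding round_trip_def
  using positive_kernel.scaling_ratio[OF transposed] scaling_admissible
  by (simp add: positive_kernel.admissible_def[OF transposed] admissible_def)

lemma round_trip_contraction:
  assumes "admissible B" "admissible B'" "proportional q B B'" "q \<ge> 0"
  shows "proportional ((1 - (c / C)\<^sup>2) * q) (round_trip B) (round_trip B')"
proof -
  define k where "k = 1 - (c / C)\<^sup>2"
  have k: "0 \<le> k" "k \<le> 1" using c_pos C_pos c_le_C by (auto simp: k_def power_le_one)
  have 1: "proportional (k * q) (scaling K B) (scaling K B')"
    unfolding k_def by (rule scaling_contraction[OF assms])
  have "proportional (k * (k * q)) (round_trip B) (round_trip B')"
    unfolding round_trip_def k_def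
    by (rule positive_kernel.scaling_contraction[OF transposed])
      (use scaling_admissible assms 1 k in \<open>auto simp: positive_kernel.admissible_def[OF transposed] admissible_def k_def\<close>)
  then show ?thesis unfolding k_def[symmetric]
    using k assms round_trip_admissible[OF assms(2)]
    by (elim proportional_mono) (auto simp: admissible_def mult_left_le_one_le)
qed

primrec sinkhorn :: "nat \<Rightarrow> real \<Rightarrow> real" where
  "sinkhorn 0 = (\<lambda>x. 1)"
| "sinkhorn (Suc n) = (\<lambda>x. round_trip (sinkhorn n) x / round_trip (sinkhorn n) 0)"

lemma admissible_scale: "admissible B \<Longrightarrow> s > 0 \<Longrightarrow> admissible (\<lambda>x. B x / s)"
  unfolding admissible_def by (intro conjI continuous_on_divide continuous_on_const) auto

lemma admissible_0: "admissible B \<Longrightarrow> 0 < B 0" by (auto simp: admissible_def)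

lemma sinkhorn_admissible: "admissible (sinkhorn n)"
proof (induction n)
  case 0
  show ?case by (simp add: admissible_def)
next
  case (Suc n)
  note R = round_trip_admissible[OF Suc]
  show ?case using admissible_scale[OF R admissible_0[OF R]] by simp
qed

lemma sinkhorn_0: "sinkhorn n 0 = 1"
  by (cases n) (use admissible_0[OF round_trip_admissible[OF sinkhorn_admissible]] in \<open>auto simp: less_imp_neq[symmetric]\<close>)

lemma sinkhorn_bounds: "c / C \<le> sinkhorn n x" "sinkhorn n x \<le> C / c"
proof -
  show "c / C \<le> sinkhorn n x"
  proof (cases n)
    case 0 then show ?thesis using c_le_C c_pos C_pos by simp
  next
    case (Suc m)
    then show ?thesis using round_trip_ratio[OF sinkhorn_admissible, of m 0 x] admissible_0[OF round_trip_admissible[OF sinkhorn_admissible], of m] C_pos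
      by (simp add: field_simps)
  qed
  show "sinkhorn n x \<le> C / c"
  proof (cases n)
    case 0 then show ?thesis using c_le_C c_pos C_pos by simp
  next
    case (Suc m)
    then show ?thesis using round_trip_ratio[OF sinkhorn_admissible, of m x 0] admissible_0[OF round_trip_admissible[OF sinkhorn_admissible], of m] c_pos
      by (simp add: field_simps)
  qed
qed

lemma sinkhorn_proportional: "proportional ((1 - (c / C)\<^sup>2) ^ n * ((C / c)\<^sup>2 - 1)) (sinkhorn (Suc n)) (sinkhorn n)"
proof (induction n)
  case 0
  have "proportional ((C / c)\<^sup>2 - 1) (sinkhorn 1) (sinkhorn 0)"
    unfolding proportional_def
    by (intro exI[of _ "c / C"]) (use sinkhorn_bounds[of 1] c_pos C_pos in \<open>auto simp: power2_eq_square\<close>)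
  then show ?case by simp
next
  case (Suc n)
  define k where "k = 1 - (c / C)\<^sup>2"
  have k: "0 \<le> k" "k \<le> 1" using c_pos C_pos c_le_C by (auto simp: k_def power_le_one)
  have q: "0 \<le> (C / c)\<^sup>2 - 1" using c_pos C_pos c_le_C by (simp add: one_le_power)
  have "proportional (k * (k ^ n * ((C / c)\<^sup>2 - 1))) (round_trip (sinkhorn (Suc n))) (round_trip (sinkhorn n))"
    using Suc.IH k q unfolding k_def[symmetric] by (subst k_def) (rule round_trip_contraction[OF sinkhorn_admissible sinkhorn_admissible], auto simp: k_def)
  then have 1: "proportional (k ^ Suc n * ((C / c)\<^sup>2 - 1)) (sinkhorn (Suc (Suc n))) (round_trip (sinkhorn n))"
    using proportional_scale_left admissible_0[OF round_trip_admissible[OF sinkhorn_admissible], of "Suc n"] by (simp add: mult.assoc)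
  have "proportional (k ^ Suc n * ((C / c)\<^sup>2 - 1)) (sinkhorn (Suc n)) (sinkhorn (Suc (Suc n)))"
    using proportional_scale_left[OF proportional_sym[OF 1] admissible_0[OF round_trip_admissible[OF sinkhorn_admissible], of n]] k q by simp
  from proportional_sym[OF this] show ?case unfolding k_def[symmetric] using k q by simp
qed

lemma sinkhorn_diff:
  assumes x: "x \<in> {0..1}"
  shows "\<bar>sinkhorn (Suc n) x - sinkhorn n x\<bar> \<le> (1 - (c / C)\<^sup>2) ^ n * ((C / c)\<^sup>2 - 1) * (C / c)"
proof -
  define q where "q = (1 - (c / C)\<^sup>2) ^ n * ((C / c)\<^sup>2 - 1)"
  have "0 \<le> 1 - (c / C)\<^sup>2" "0 \<le> (C / c)\<^sup>2 - 1" using c_pos C_pos c_le_C by (auto simp: power_le_one one_le_power)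
  then have q: "q \<ge> 0" by (auto simp: q_def)
  obtain l where l: "l > 0" "\<And>x. x \<in> {0..1} \<Longrightarrow> l * sinkhorn n x \<le> sinkhorn (Suc n) x"
     "\<And>x. x \<in> {0..1} \<Longrightarrow> sinkhorn (Suc n) x \<le> l * (1 + q) * sinkhorn n x"
    using sinkhorn_proportional[of n] unfolding proportional_def q_def[symmetric] by blast
  have l1: "l \<le> 1" "1 \<le> l * (1 + q)" using l(2)[of 0] l(3)[of 0] unfolding sinkhorn_0 by auto
  have p: "sinkhorn n x > 0" using sinkhorn_admissible[of n] x by (auto simp: admissible_def)
  have "sinkhorn (Suc n) x \<le> (1 + q) * sinkhorn n x"
    using l(3)[OF x] l1(1) q p by (smt (verit) mult_left_le_one_le mult_right_mono l(1))
  moreover have "(1 - q) * sinkhorn n x \<le> l * sinkhorn n x"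
  proof (intro mult_right_mono)
    have "l * q \<le> q" using l1 q l(1) by (simp add: mult_left_le_one_le)
    then show "1 - q \<le> l" using l1(2) by (simp add: algebra_simps)
  qed (use p in auto)
  ultimately have "\<bar>sinkhorn (Suc n) x - sinkhorn n x\<bar> \<le> q * sinkhorn n x" using l(2)[OF x] by (simp add: abs_le_iff algebra_simps)
  also have "\<dots> \<le> q * (C / c)" using q sinkhorn_bounds by (intro mult_left_mono) auto
  finally show ?thesis by (simp add: q_def)
qed

lemma sinkhorn_uniform_limit:
  obtains b where "uniform_limit {0..1} sinkhorn b sequentially"
proof -
  define k where "k = 1 - (c / C)\<^sup>2"
  have k: "0 \<le> k" "k < 1" using c_pos C_pos c_le_C by (auto simp: k_def power_le_one)
  have "uniform_limit {0..1} (\<lambda>n x. \<Sum>i<n. sinkhorn (Suc i) x - sinkhorn i x) (\<lambda>x. \<Sum>i. sinkhorn (Suc i) x - sinkhorn i x) sequentially"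
  proof (rule Weierstrass_m_test)
    show "norm (sinkhorn (Suc n) x - sinkhorn n x) \<le> k ^ n * ((C / c)\<^sup>2 - 1) * (C / c)" if "x \<in> {0..1}" for n x
      using sinkhorn_diff[OF that, of n] by (simp add: k_def)
    show "summable (\<lambda>n. k ^ n * ((C / c)\<^sup>2 - 1) * (C / c))"
      using k by (intro summable_mult2 summable_geometric) auto
  qed
  then have "uniform_limit {0..1} (\<lambda>n x. (\<Sum>i<n. sinkhorn (Suc i) x - sinkhorn i x) + 1) (\<lambda>x. (\<Sum>i. sinkhorn (Suc i) x - sinkhorn i x) + 1) sequentially"
    by (intro uniform_limit_add uniform_limit_const)
  moreover have "(\<Sum>i<n. sinkhorn (Suc i) x - sinkhorn i x) = sinkhorn n x - sinkhorn 0 x" for n x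
    by (rule sum_lessThan_telescope)
  then have "(\<lambda>n x. (\<Sum>i<n. sinkhorn (Suc i) x - sinkhorn i x) + 1) = sinkhorn"
    by (simp add: fun_eq_iff del: sinkhorn.simps(2))
  ultimately show ?thesis using that by metis
qed

text \<open>The limit \<open>b\<close> of the normalised iterates is proportional to its image up to an arbitrarily small
  oscillation, hence proportional to it. The factor is 1, since integrating the ratio of image and
  argument and exchanging the integrals gives 1.\<close>

lemma round_trip_fixed_point:
  obtains b where "admissible b" "\<And>x. x \<in> {0..1} \<Longrightarrow> round_trip b x = b x"
proof -
  obtain b where b: "uniform_limit {0..1} sinkhorn b sequentially" by (rule sinkhorn_uniform_limit)
  have bc: "continuous_on {0..1} b"
    by (rule uniform_limit_theorem[OF _ b]) (use sinkhorn_admissible in \<open>auto simp: admissible_def\<close>)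
  have bl: "c / C \<le> b x" if "x \<in> {0..1}" for x
    using tendsto_uniform_limitI[OF b that] by (rule tendsto_lowerbound) (auto simp: sinkhorn_bounds)
  have cC: "0 < c / C" using c_pos C_pos by simp
  have bg: "admissible b" using bc bl cC by (force simp: admissible_def)
  have close: "\<forall>\<^sub>F n in sequentially. proportional (4 * d) (sinkhorn n) b" if "d > 0" "d \<le> 1/2" for d
  proof -
    have "\<forall>\<^sub>F n in sequentially. \<forall>x\<in>{0..1}. dist (sinkhorn n x) (b x) < d * (c / C)"
      by (rule uniform_limitD[OF b mult_pos_pos[OF that(1) cC]])
    then show ?thesis
    proof eventually_elim
      case (elim n)
      have "\<bar>sinkhorn n x - b x\<bar> \<le> d * b x" if "x \<in> {0..1}" for x
        using elim[rule_format, OF that] mult_left_mono[OF bl[OF that], of d] \<open>d > 0\<close> by (simp add: dist_real_def)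
      then have *: "(1 - d) * b x \<le> sinkhorn n x" "sinkhorn n x \<le> (1 + d) * b x" if "x \<in> {0..1}" for x
        using that by (auto simp: abs_le_iff algebra_simps)
      have "1 + d \<le> (1 - d) * (1 + 4 * d)"
      proof -
        have "4 * d * d \<le> 4 * d * (1/2)" using that by (intro mult_left_mono) auto
        then show ?thesis by (simp add: algebra_simps)
      qed
      then have "(1 + d) * b x \<le> (1 - d) * (1 + 4 * d) * b x" if "x \<in> {0..1}" for x
        using bg that by (intro mult_right_mono) (auto simp: admissible_def less_imp_le)
      then have "sinkhorn n x \<le> (1 - d) * (1 + 4 * d) * b x" if "x \<in> {0..1}" for x
        using *(2)[OF that] that order_trans by blast
      with * show ?case unfolding proportional_def
        by (intro exI[of _ "1 - d"]) (use that in auto)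
    qed
  qed
  have nearb: "proportional e (round_trip b) b" if "e > 0" for e
  proof -
    (* Two errors 4d combine to 8d + 16d^2, which is at most 16d for d at most 1/2. *)
    define d where "d = min (1/2) (e / 24)"
    have d: "d > 0" "d \<le> 1/2" "24 * d \<le> e" using that by (auto simp: d_def)
    have "\<forall>\<^sub>F n in sequentially. proportional (4 * d) (sinkhorn n) b \<and> proportional (4 * d) (sinkhorn (Suc n)) b"
      using close[OF d(1,2)] eventually_sequentially_Suc[of "\<lambda>n. proportional (4 * d) (sinkhorn n) b"]
      by (intro eventually_conj) (simp_all del: sinkhorn.simps)
    then obtain n where n: "proportional (4 * d) (sinkhorn n) b" "proportional (4 * d) (sinkhorn (Suc n)) b"
      using eventually_happens'[OF sequentially_bot] by blast
    have "proportional ((1 - (c / C)\<^sup>2) * (4 * d)) (round_trip (sinkhorn n)) (round_trip b)"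
      using d by (intro round_trip_contraction sinkhorn_admissible bg n) auto
    moreover have "(1 - (c / C)\<^sup>2) * (4 * d) \<le> 4 * d" using d by (simp add: mult_left_le_one_le algebra_simps)
    ultimately have "proportional (4 * d) (round_trip (sinkhorn n)) (round_trip b)"
      using round_trip_admissible[OF bg] by (elim proportional_mono) (auto simp: admissible_def)
    then have "proportional (4 * d) (sinkhorn (Suc n)) (round_trip b)"
      using proportional_scale_left[OF _ admissible_0[OF round_trip_admissible[OF sinkhorn_admissible]]] by simp
    then have "proportional (4 * d) (round_trip b) (sinkhorn (Suc n))"
      by (rule proportional_sym) (use d in simp)
    from proportional_trans[OF this n(2)] d have "proportional ((1 + 4 * d) * (1 + 4 * d) - 1) (round_trip b) b" by simp
    moreover have "(1 + 4 * d) * (1 + 4 * d) - 1 \<le> e"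
    proof -
      have "d * d \<le> d * (1/2)" using d by (intro mult_left_mono) auto
      moreover have "(1 + 4 * d) * (1 + 4 * d) - 1 = 8 * d + 16 * (d * d)" by (simp add: algebra_simps)
      ultimately show ?thesis using d by linarith
    qed
    ultimately show ?thesis using bg by (elim proportional_mono) (auto simp: admissible_def)
  qed
  define r where "r x = round_trip b x / b x" for x
  have bp: "b x > 0" if "x \<in> {0..1}" for x using bg that by (auto simp: admissible_def)
  have rp: "round_trip b x > 0" if "x \<in> {0..1}" for x using round_trip_admissible[OF bg] that by (auto simp: admissible_def)
  have r_le: "r x \<le> r y" if xy: "x \<in> {0..1}" "y \<in> {0..1}" for x y
  proof (rule field_le_epsilon)
    fix e :: real assume "e > 0"
    have ry: "r y > 0" using bp rp xy by (auto simp: r_def)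
    obtain l where l: "l > 0" "\<forall>x\<in>{0..1}. l * b x \<le> round_trip b x \<and> round_trip b x \<le> l * (1 + e / r y) * b x"
      using nearb[of "e / r y"] \<open>e > 0\<close> ry unfolding proportional_def by auto
    have "r x \<le> l * (1 + e / r y)" "l \<le> r y"
      using l xy bp by (auto simp: r_def field_simps)
    then have "r x \<le> r y * (1 + e / r y)" using \<open>e > 0\<close> ry by (smt (verit) divide_pos_pos mult_right_mono)
    also have "\<dots> = r y + e" using ry by (simp add: field_simps)
    finally show "r x \<le> r y + e" .
  qed
  have r0: "r x = r 0" if "x \<in> {0..1}" for x using r_le[of x 0] r_le[of 0 x] that by auto
  have "r 0 = 1"
  proof -
    let ?A = "scaling K b"
    have Ag: "admissible ?A" by (rule scaling_admissible[OF bg])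
    have A: "?A y > 0" for y by (rule scaling_pos[OF bg])
    have cont: "continuous_on (cbox (0, 0) (1, 1)) (\<lambda>(x, y). K x y / (?A y * b x))"
      unfolding case_prod_beta
    proof (intro continuous_on_divide continuous_on_mult)
      show "continuous_on (cbox (0, 0) (1, 1)) (\<lambda>z. K (fst z) (snd z))" using K_cont continuous_on_subset by blast
      show "continuous_on (cbox (0, 0) (1, 1)) (\<lambda>z::real\<times>real. ?A (snd z))"
        by (rule continuous_on_compose2[OF scaling_cont[OF bg] continuous_on_snd[OF continuous_on_id]]) auto
      show "continuous_on (cbox (0, 0) (1, 1)) (\<lambda>z::real\<times>real. b (fst z))"
        by (rule continuous_on_compose2[OF bc continuous_on_fst[OF continuous_on_id]]) auto
      show "\<forall>z\<in>cbox (0, 0) (1, 1). ?A (snd z) * b (fst z) \<noteq> 0"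
      proof
        fix z :: "real \<times> real" assume "z \<in> cbox (0, 0) (1, 1)"
        then have "fst z \<in> {0..1}" by (cases z) (auto simp: cbox_Pair_eq)
        then show "?A (snd z) * b (fst z) \<noteq> 0" using A[of "snd z"] bp[of "fst z"] by simp
      qed
    qed
    have "r 0 = integral {0..1} (\<lambda>x::real. r 0)" by simp
    also have "\<dots> = integral {0..1} (\<lambda>x. integral {0..1} (\<lambda>y. K x y / (?A y * b x)))"
    proof (intro integral_cong)
      fix x :: real assume "x \<in> {0..1}"
      then have "r 0 = round_trip b x / b x" using r0[of x] by (simp add: r_def)
      also have "\<dots> = integral {0..1} (\<lambda>y. K x y / ?A y / b x)"
        by (simp only: round_trip_def scaling_def[of "\<lambda>x y. K y x"] integral_divide)
      finally show "r 0 = integral {0..1} (\<lambda>y. K x y / (?A y * b x))" by (simp add: divide_divide_eq_left)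
    qed
    also have "\<dots> = integral {0..1} (\<lambda>y. integral {0..1} (\<lambda>x. K x y / (?A y * b x)))"
      using integral_swap_continuous[OF cont] by simp
    also have "\<dots> = integral {0..1} (\<lambda>y::real. 1)"
    proof (intro integral_cong)
      fix y :: real
      have "integral {0..1} (\<lambda>x. K x y / (?A y * b x)) = integral {0..1} (\<lambda>x. K x y / b x / ?A y)"
        by (simp add: field_simps)
      also have "\<dots> = scaling K b y / ?A y" unfolding integral_divide by (simp add: scaling_def)
      finally show "integral {0..1} (\<lambda>x. K x y / (?A y * b x)) = 1" using A[of y] by simp
    qed
    finally show ?thesis by simp
  qed
  then have "round_trip b x = b x" if "x \<in> {0..1}" for x
    using r0[OF that] bp[OF that] by (simp add: r_def field_simps)
  with bg show ?thesis by (rule that)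
qed

text \<open>The fixed point solves the equations on the unit interval only; the two scaling integrals extend
  the solution to the whole line.\<close>

lemma schroedinger_system:
  obtains A B where "continuous_on UNIV A" "continuous_on UNIV B" "\<And>y. 0 < A y" "\<And>x. 0 < B x"
    "\<And>x. integral {0..1} (\<lambda>y. K x y / (B x * A y)) = 1"
    "\<And>y. integral {0..1} (\<lambda>x. K x y / (B x * A y)) = 1"
proof -
  obtain b where b: "admissible b" "\<And>x. x \<in> {0..1} \<Longrightarrow> round_trip b x = b x" by (rule round_trip_fixed_point) auto
  let ?A = "scaling K b" and ?B = "round_trip b"
  interpret T: positive_kernel "\<lambda>x y. K y x" c C by (rule transposed)
  have gA: "T.admissible ?A" using scaling_admissible[OF b(1)] by (simp add: admissible_def T.admissible_def)
  have A: "?A y > 0" for y by (rule scaling_pos[OF b(1)])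
  have B: "?B y > 0" for y unfolding round_trip_def by (rule T.scaling_pos[OF gA])
  show ?thesis
  proof (rule that[of ?A ?B])
    show "continuous_on UNIV ?A" by (rule scaling_cont[OF b(1)])
    show "continuous_on UNIV ?B" unfolding round_trip_def by (rule T.scaling_cont[OF gA])
    fix x
    have "integral {0..1} (\<lambda>y. K x y / (?B x * ?A y)) = integral {0..1} (\<lambda>y. K x y / ?A y / ?B x)"
      by (simp add: field_simps)
    also have "\<dots> = 1" unfolding integral_divide using B[of x] by (simp add: round_trip_def scaling_def[of "\<lambda>x y. K y x"])
    finally show "integral {0..1} (\<lambda>y. K x y / (?B x * ?A y)) = 1" .
    have "integral {0..1} (\<lambda>y. K y x / (?B y * ?A x)) = integral {0..1} (\<lambda>y. K y x / b y / ?A x)"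
      by (intro integral_cong) (simp add: b(2))
    also have "\<dots> = 1" unfolding integral_divide using A[of x] by (simp add: scaling_def)
    finally show "integral {0..1} (\<lambda>y. K y x / (?B y * ?A x)) = 1" .
  qed (use A B in auto)
qed

end

section \<open>The optimal permuton\<close>

text \<open>Gibbs' variational principle: \<open>k\<close> is the divergence of \<open>\<nu>\<close> from the measure with density \<open>M\<close>, which
  vanishes only when the two coincide.\<close>

lemma KL_Gibbs:
  fixes u \<nu> :: "'a measure" and M :: "'a \<Rightarrow> real"
  assumes u: "prob_space u" and \<nu>: "prob_space \<nu>" "sets \<nu> = sets u"
    and M: "M \<in> borel_measurable u" "\<And>x. 0 < M x" "prob_space (density u M)"
    and int: "integrable \<nu> (\<lambda>x. ln (M x))" and fin: "KL \<nu> u \<noteq> \<infinity>"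
  obtains k where "KL \<nu> u = ereal ((\<integral>x. ln (M x) \<partial>\<nu>) + k)" "0 \<le> k" "k = 0 \<Longrightarrow> \<nu> = density u M"
proof -
  interpret u: prob_space u by fact
  interpret \<nu>: prob_space \<nu> by fact
  interpret \<mu>: prob_space "density u M" by fact
  interpret I: information_space "density u M" "exp 1" by standard auto
  have lg: "log (exp 1) = ln" by (auto simp: log_def fun_eq_iff)
  have ac: "absolutely_continuous u \<nu>" and ed: "integrable \<nu> (entropy_density (exp 1) u \<nu>)"
    using fin by (auto simp: KL_def split: if_splits)
  obtain D where D: "D \<in> borel_measurable u" "AE x in u. RN_deriv u \<nu> x = ennreal (D x)"
    "AE x in \<nu>. 0 < D x" "\<And>x. 0 \<le> D x"
    using u.real_RN_deriv[OF \<nu>.finite_measure_axioms ac \<nu>(2)] by metis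
  note [measurable] = D(1) M(1)
  have \<nu>D: "\<nu> = density u D"
  proof -
    have "density u D = density u (RN_deriv u \<nu>)"
      using D(2) by (intro density_cong) (auto elim: eventually_mono)
    then show ?thesis using u.density_RN_deriv[OF ac \<nu>(2)] by simp
  qed
  define G where "G x = D x / M x" for x
  have [measurable]: "G \<in> borel_measurable u" by (auto simp: G_def[abs_def])
  have "density (density u M) G = density u (\<lambda>x. ennreal (M x) * ennreal (G x))"
    by (rule density_density_eq) auto
  also have "(\<lambda>x. ennreal (M x) * ennreal (G x)) = (\<lambda>x. ennreal (D x))"
    using M(2) D(4) by (auto simp: fun_eq_iff G_def ennreal_mult[symmetric] less_imp_le less_imp_neq[symmetric])
  finally have \<nu>G: "density (density u M) G = \<nu>" by (simp add: \<nu>D)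
  have G0: "0 \<le> G x" for x using M(2)[of x] D(4)[of x] by (simp add: G_def)
  have AEln: "AE x in \<nu>. entropy_density (exp 1) u \<nu> x = ln (D x)"
    using absolutely_continuous_AE[OF \<nu>(2) ac D(2)] D(4)
    by (auto simp: entropy_density_def lg)
  have meas\<nu>: "f \<in> borel_measurable \<nu>" if "f \<in> borel_measurable u" for f :: "'a \<Rightarrow> real"
    using that measurable_cong_sets[OF \<nu>(2) refl] by auto
  have intD: "integrable \<nu> (\<lambda>x. ln (D x))"
    by (rule integrable_cong_AE[THEN iffD1, OF _ _ AEln ed]; intro meas\<nu>; measurable)
  have "KL_divergence (exp 1) u \<nu> = (\<integral>x. ln (D x) \<partial>\<nu>)"
    unfolding KL_divergence_def by (rule integral_cong_AE[OF _ _ AEln]; intro meas\<nu>; measurable)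
  then have KL: "KL \<nu> u = ereal (\<integral>x. ln (D x) \<partial>\<nu>)" using ac ed by (simp add: KL_def)
  define k where "k = KL_divergence (exp 1) (density u M) \<nu>"
  have GAE: "AE x in \<nu>. ln (G x) = ln (D x) - ln (M x)"
    using D(3) by eventually_elim (simp add: G_def ln_div M(2) less_imp_neq[OF M(2), symmetric])
  have intG\<nu>: "integrable \<nu> (\<lambda>x. ln (G x))"
    by (rule integrable_cong_AE[THEN iffD2, OF _ _ GAE Bochner_Integration.integrable_diff[OF intD int]]; intro meas\<nu>; measurable)
  have intG: "integrable (density u M) (\<lambda>x. G x * log (exp 1) (G x))"
    using intG\<nu> unfolding \<nu>G[symmetric] lg by (subst (asm) integrable_density) (auto simp: G0)
  have "k = (\<integral>x. G x * log (exp 1) (G x) \<partial>(density u M))"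
    unfolding k_def \<nu>G[symmetric] by (rule \<mu>.KL_density) (auto simp: G0)
  also have "\<dots> = (\<integral>x. ln (G x) \<partial>\<nu>)"
    unfolding \<nu>G[symmetric] lg by (subst (2) integral_density) (auto simp: G0)
  also have "\<dots> = (\<integral>x. ln (D x) - ln (M x) \<partial>\<nu>)"
    by (rule integral_cong_AE[OF _ _ GAE]; intro meas\<nu>; measurable)
  also have "\<dots> = (\<integral>x. ln (D x) \<partial>\<nu>) - (\<integral>x. ln (M x) \<partial>\<nu>)" using intD int by simp
  finally have k: "(\<integral>x. ln (D x) \<partial>\<nu>) = (\<integral>x. ln (M x) \<partial>\<nu>) + k" by simp
  have kpos: "k > 0" if "\<nu> \<noteq> density u M"
    unfolding k_def \<nu>G[symmetric]
    by (rule I.KL_gt_0) (use that \<nu>(1) intG in \<open>auto simp: \<nu>G G0\<close>)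
  have "k = 0" if "\<nu> = density u M" unfolding k_def that by (rule \<mu>.KL_same_eq_0)
  with kpos have "0 \<le> k" by fastforce
  with KL k kpos show ?thesis by (intro that[of k]) auto
qed

lemma KL_density_self:
  fixes u :: "'a measure" and M :: "'a \<Rightarrow> real"
  assumes u: "prob_space u" and M: "M \<in> borel_measurable u" "\<And>x. 0 < M x"
    and int: "integrable (density u M) (\<lambda>x. ln (M x))"
  shows "KL (density u M) u = ereal (\<integral>x. ln (M x) \<partial>(density u M))"
proof -
  interpret u: prob_space u by fact
  have lg: "log (exp 1) = ln" by (auto simp: log_def fun_eq_iff)
  note [measurable] = M(1)
  have ac: "absolutely_continuous u (density u M)" by (rule absolutely_continuousI_density) auto
  have "AE x in u. ennreal (M x) = RN_deriv u (density u M) x"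
    by (rule u.RN_deriv_unique) auto
  from absolutely_continuous_AE[OF sets_density ac this]
  have 1: "AE x in density u M. ennreal (M x) = RN_deriv u (density u M) x" .
  have AE: "AE x in density u M. entropy_density (exp 1) u (density u M) x = ln (M x)"
    using 1
  proof eventually_elim
    case (elim x)
    show ?case unfolding entropy_density_def comp_def elim[symmetric] lg using M(2)[of x] by simp
  qed
  have "integrable (density u M) (entropy_density (exp 1) u (density u M))"
    by (rule integrable_cong_AE[THEN iffD2, OF _ _ AE]) (auto intro: int)
  moreover have "KL_divergence (exp 1) u (density u M) = (\<integral>x. ln (M x) \<partial>(density u M))"
    unfolding KL_divergence_def by (intro integral_cong_AE AE) auto
  ultimately show ?thesis using ac by (simp add: KL_def)
qed

lemma unit_square_cbox: "unit_square = cbox (0, 0) (1, 1)"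
  by (auto simp: unit_square_def cbox_Pair_eq)

lemma space_unif_square [simp]: "space unif_square = unit_square"
  by (simp add: unif_square_def space_restrict_space)

lemma sets_unif_square: "sets unif_square = sets (restrict_space borel unit_square)"
  by (simp add: unif_square_def sets_restrict_space)

lemma unit_square_borel [measurable]: "unit_square \<in> sets borel"
  by (simp add: unit_square_cbox)

lemma unit_square_sets [measurable]: "unit_square \<in> sets unif_square"
  using sets.top[of unif_square] by simp

lemma continuous_measurable_square:
  assumes "continuous_on UNIV F" and "sets \<mu> = sets (restrict_space borel unit_square)"
  shows "F \<in> borel_measurable \<mu>"
  using measurable_restrict_space1[OF borel_measurable_continuous_onI[OF assms(1)], of unit_square]
  by (simp add: measurable_cong_sets[OF assms(2) refl])

lemma prob_space_unif_square: "prob_space unif_square"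
proof
  have "emeasure unif_square (space unif_square) = emeasure lborel (unit_square \<inter> space lborel)"
    unfolding unif_square_def by (subst emeasure_restrict_space) (auto simp: space_restrict_space)
  also have "\<dots> = 1" by (simp add: unit_square_cbox emeasure_lborel_cbox_eq Basis_prod_def)
  finally show "emeasure unif_square (space unif_square) = 1" .
qed

lemma integral_unif_square:
  fixes F :: "real \<times> real \<Rightarrow> real"
  assumes F: "continuous_on UNIV F"
  shows "(\<integral>z. F z \<partial>unif_square) = integral {0..1} (\<lambda>x. integral {0..1} (\<lambda>y. F (x, y)))"
    and "integrable unif_square F"
proof -
  have F': "continuous_on unit_square F" using F continuous_on_subset by blast
  then have i: "set_integrable lborel unit_square F"
    unfolding set_integrable_def unit_square_cbox by (intro borel_integrable_compact) auto
  then show "integrable unif_square F"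
    unfolding unif_square_def by (subst integrable_restrict_space) (auto simp: set_integrable_def)
  have "(\<integral>z. F z \<partial>unif_square) = set_lebesgue_integral lborel unit_square F"
    unfolding unif_square_def by (subst integral_restrict_space) (auto simp: set_lebesgue_integral_def)
  also have "\<dots> = integral unit_square F" using i by (rule set_borel_integral_eq_integral(2))
  also have "\<dots> = integral {0..1} (\<lambda>x. integral {0..1} (\<lambda>y. F (x, y)))"
    using integral_prod_continuous[of 0 0 1 1 F] F' by (simp add: unit_square_cbox)
  finally show "(\<integral>z. F z \<partial>unif_square) = integral {0..1} (\<lambda>x. integral {0..1} (\<lambda>y. F (x, y)))" .
qed

lemma integrable_square:
  fixes F :: "real \<times> real \<Rightarrow> 'b::euclidean_space"
  assumes F: "continuous_on UNIV F" and \<nu>: "prob_space \<nu>" "sets \<nu> = sets (restrict_space borel unit_square)"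
  shows "integrable \<nu> F"
proof -
  interpret prob_space \<nu> by fact
  have sp: "space \<nu> = unit_square" using sets_eq_imp_space_eq[OF \<nu>(2)] by (simp add: space_restrict_space)
  have "compact (F ` unit_square)" unfolding unit_square_cbox
    by (intro compact_continuous_image continuous_on_subset[OF F]) auto
  then obtain C where C: "\<And>z. z \<in> unit_square \<Longrightarrow> norm (F z) \<le> C"
    using compact_imp_bounded bounded_iff by (metis image_eqI)
  show ?thesis
    by (rule integrable_const_bound[where B=C])
       (auto simp: sp C intro: continuous_measurable_square[OF F \<nu>(2)])
qed

text \<open>The density \<open>M\<close> is taken on the whole plane, so that continuity arguments need no boundary; only its
  values on the unit square enter the measure.\<close>

locale doubly_stochastic =
  fixes M :: "real \<times> real \<Rightarrow> real"
  assumes M_cont: "continuous_on UNIV M" and M_pos: "\<And>z. 0 < M z"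
    and M_row: "\<And>x. x \<in> {0..1} \<Longrightarrow> integral {0..1} (\<lambda>y. M (x, y)) = 1"
    and M_col: "\<And>y. y \<in> {0..1} \<Longrightarrow> integral {0..1} (\<lambda>x. M (x, y)) = 1"
begin

definition \<mu> :: "(real \<times> real) measure" where
  "\<mu> = density unif_square (\<lambda>z. ennreal (M z))"

lemma sets_\<mu>: "sets \<mu> = sets (restrict_space borel unit_square)"
  by (simp add: \<mu>_def sets_unif_square)

lemma space_\<mu> [simp]: "space \<mu> = unit_square"
  by (simp add: \<mu>_def)

lemma M_measurable [measurable]: "M \<in> borel_measurable unif_square"
  by (rule continuous_measurable_square[OF M_cont sets_unif_square])

lemma prob_space_\<mu>: "prob_space \<mu>"
proof
  have "emeasure \<mu> (space \<mu>) = (\<integral>\<^sup>+z. ennreal (M z) \<partial>unif_square)"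
    unfolding \<mu>_def by (subst emeasure_density) (auto intro!: nn_integral_cong)
  also have "\<dots> = ennreal (\<integral>z. M z \<partial>unif_square)"
    by (rule nn_integral_eq_integral) (auto intro: integral_unif_square M_cont less_imp_le M_pos)
  also have "(\<integral>z. M z \<partial>unif_square) = integral {0..1} (\<lambda>x::real. 1)"
    unfolding integral_unif_square(1)[OF M_cont] by (intro integral_cong M_row)
  finally show "emeasure \<mu> (space \<mu>) = 1" by simp
qed

lemma integral_\<mu>:
  assumes F: "continuous_on UNIV F"
  shows "(\<integral>z. F z \<partial>\<mu>) = integral {0..1} (\<lambda>x. integral {0..1} (\<lambda>y. M (x, y) * F (x, y)))"
proof -
  have [measurable]: "F \<in> borel_measurable unif_square"
    by (rule continuous_measurable_square[OF F sets_unif_square])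
  have "(\<integral>z. F z \<partial>\<mu>) = (\<integral>z. M z * F z \<partial>unif_square)"
    unfolding \<mu>_def by (subst integral_density) (auto simp: less_imp_le M_pos)
  also have "\<dots> = integral {0..1} (\<lambda>x. integral {0..1} (\<lambda>y. M (x, y) * F (x, y)))"
    by (subst integral_unif_square(1)) (auto intro: continuous_on_mult F M_cont)
  finally show ?thesis .
qed

lemma nn_integral_unit_density:
  fixes g :: "real \<Rightarrow> real"
  assumes "continuous_on UNIV g" "\<And>x. 0 < g x" "integral {0..1} g = 1"
  shows "(\<integral>\<^sup>+x. indicator {0..1} x * ennreal (g x) \<partial>lborel) = 1"
proof -
  have "(g has_integral 1) {0..1}" using assms
    by (metis continuous_on_subset has_integral_integral integrable_continuous_interval subset_UNIV)
  then have "((\<lambda>x. if x \<in> {0..1} then g x else 0) has_integral 1) UNIV"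
    by (simp only: has_integral_restrict_UNIV)
  also have "(\<lambda>x. if x \<in> {0..1} then g x else 0) = (\<lambda>x. indicator {0..1} x * g x)"
    by (auto simp: fun_eq_iff)
  finally have "((\<lambda>x. indicator {0..1} x * g x) has_integral 1) UNIV" .
  then have "(\<integral>\<^sup>+x. ennreal (indicator {0..1} x * g x) \<partial>lborel) = ennreal 1"
    by (intro nn_integral_has_integral_lborel)
       (auto intro!: borel_measurable_times borel_measurable_continuous_onI[OF assms(1)] simp: indicator_def less_imp_le assms(2))
  moreover have "(\<lambda>x. ennreal (indicator {0..1} x * g x)) = (\<lambda>x. indicator {0..1} x * ennreal (g x))"
    by (auto simp: indicator_def fun_eq_iff)
  ultimately show ?thesis by simp
qed

lemma nn_integral_\<mu>:
  assumes [measurable]: "f \<in> borel_measurable borel"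
  shows "(\<integral>\<^sup>+z. f z \<partial>\<mu>) = (\<integral>\<^sup>+z. indicator {0..1} (fst z) * indicator {0..1} (snd z) * ennreal (M z) * f z \<partial>(lborel \<Otimes>\<^sub>M lborel))"
proof -
  have [measurable]: "f \<in> borel_measurable unif_square"
    using measurable_restrict_space1[OF assms, of unit_square] by (simp add: measurable_cong_sets[OF sets_unif_square refl])
  have [measurable]: "M \<in> borel_measurable borel" by (rule borel_measurable_continuous_onI[OF M_cont])
  have "(\<integral>\<^sup>+z. f z \<partial>\<mu>) = (\<integral>\<^sup>+z. ennreal (M z) * f z \<partial>unif_square)"
    unfolding \<mu>_def by (subst nn_integral_density) auto
  also have "\<dots> = (\<integral>\<^sup>+z. ennreal (M z) * f z * indicator unit_square z \<partial>lborel)"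
    unfolding unif_square_def by (subst nn_integral_restrict_space) auto
  also have "\<dots> = (\<integral>\<^sup>+z. indicator {0..1} (fst z) * indicator {0..1} (snd z) * ennreal (M z) * f z \<partial>lborel)"
    by (intro nn_integral_cong) (auto simp: indicator_def unit_square_def)
  finally show ?thesis by (simp add: lborel_prod)
qed

lemma \<mu>_permuton: "\<mu> \<in> permutons"
proof -
  have [measurable]: "M \<in> borel_measurable borel" by (rule borel_measurable_continuous_onI[OF M_cont])
  then have [measurable]: "M \<in> borel_measurable (lborel \<Otimes>\<^sub>M lborel)" by (simp add: lborel_prod)
  have u: "emeasure (uniform_measure lborel {0..1}) X = (\<integral>\<^sup>+x. indicator {0..1} x * indicator X x \<partial>lborel)"
    if [measurable]: "X \<in> sets borel" for X :: "real set"
  proof -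
    have "(\<integral>\<^sup>+x. indicator {0..1} x * indicator X x \<partial>lborel) = (\<integral>\<^sup>+x. indicator ({0..1} \<inter> X) x \<partial>(lborel :: real measure))"
      by (simp add: indicator_inter_arith)
    also have "\<dots> = emeasure lborel ({0..1} \<inter> X)" by (rule nn_integral_indicator) simp
    finally show ?thesis by (subst emeasure_uniform_measure) (auto simp: divide_ennreal_def)
  qed
  have mf: "fst \<in> measurable \<mu> borel" "snd \<in> measurable \<mu> borel"
    by (auto intro!: continuous_measurable_square[OF _ sets_\<mu>] continuous_on_fst continuous_on_snd continuous_on_id)
  have c1: "continuous_on UNIV (\<lambda>y. M (x, y))" "continuous_on UNIV (\<lambda>y. M (y, x))" for x
    by (rule continuous_on_compose2[OF M_cont], auto intro!: continuous_on_Pair continuous_on_id continuous_on_const)+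
  have "distr \<mu> borel fst = uniform_measure lborel {0..1}"
  proof (rule measure_eqI)
    fix X assume "X \<in> sets (distr \<mu> borel fst)"
    then have [measurable]: "X \<in> sets borel" by simp
    have "emeasure (distr \<mu> borel fst) X = (\<integral>\<^sup>+z. indicator X (fst z) \<partial>\<mu>)"
      using mf by (subst nn_integral_distr[symmetric, where T = fst and M' = borel]) auto
    also have "\<dots> = (\<integral>\<^sup>+z. indicator {0..1} (fst z) * indicator {0..1} (snd z) * ennreal (M z) * indicator X (fst z) \<partial>(lborel \<Otimes>\<^sub>M lborel))"
      by (rule nn_integral_\<mu>) (auto simp: borel_prod[symmetric])
    also have "\<dots> = (\<integral>\<^sup>+x. \<integral>\<^sup>+y. indicator {0..1} x * indicator {0..1} y * ennreal (M (x, y)) * indicator X x \<partial>lborel \<partial>lborel)"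
      by (subst lborel.nn_integral_fst[symmetric]) auto
    also have "\<dots> = (\<integral>\<^sup>+x. indicator {0..1} x * indicator X x \<partial>lborel)"
    proof (intro nn_integral_cong)
      fix x :: real
      have "(\<integral>\<^sup>+y. indicator {0..1} x * indicator {0..1} y * ennreal (M (x, y)) * indicator X x \<partial>lborel)
         = (\<integral>\<^sup>+y. (indicator {0..1} x * indicator X x) * (indicator {0..1} y * ennreal (M (x, y))) \<partial>lborel)"
        by (simp add: mult_ac)
      also have "\<dots> = (indicator {0..1} x * indicator X x) * (\<integral>\<^sup>+y. indicator {0..1} y * ennreal (M (x, y)) \<partial>lborel)"
        by (rule nn_integral_cmult) (auto intro!: borel_measurable_times_ennreal borel_measurable_continuous_onI[OF c1(1)] measurable_compose[OF borel_measurable_continuous_onI[OF c1(1)] measurable_ennreal])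
      also have "\<dots> = indicator {0..1} x * indicator X x"
        using nn_integral_unit_density[OF c1(1) M_pos M_row, of x] by (cases "x \<in> {0..1}") auto
      finally show "(\<integral>\<^sup>+y. indicator {0..1} x * indicator {0..1} y * ennreal (M (x, y)) * indicator X x \<partial>lborel) = \<dots>" .
    qed
    finally show "emeasure (distr \<mu> borel fst) X = emeasure (uniform_measure lborel {0..1}) X"
      unfolding u[OF \<open>X \<in> sets borel\<close>] .
  qed simp
  moreover have "distr \<mu> borel snd = uniform_measure lborel {0..1}"
  proof (rule measure_eqI)
    fix X assume "X \<in> sets (distr \<mu> borel snd)"
    then have [measurable]: "X \<in> sets borel" by simp
    have "emeasure (distr \<mu> borel snd) X = (\<integral>\<^sup>+z. indicator X (snd z) \<partial>\<mu>)"
      using mf by (subst nn_integral_distr[symmetric, where T = snd and M' = borel]) auto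
    also have "\<dots> = (\<integral>\<^sup>+z. indicator {0..1} (fst z) * indicator {0..1} (snd z) * ennreal (M z) * indicator X (snd z) \<partial>(lborel \<Otimes>\<^sub>M lborel))"
      by (rule nn_integral_\<mu>) (auto simp: borel_prod[symmetric])
    also have "\<dots> = (\<integral>\<^sup>+y. \<integral>\<^sup>+x. indicator {0..1} x * indicator {0..1} y * ennreal (M (x, y)) * indicator X y \<partial>lborel \<partial>lborel)"
      by (subst lborel_pair.nn_integral_snd[symmetric]) auto
    also have "\<dots> = (\<integral>\<^sup>+x. indicator {0..1} x * indicator X x \<partial>lborel)"
    proof (intro nn_integral_cong)
      fix y :: real
      have "(\<integral>\<^sup>+x. indicator {0..1} x * indicator {0..1} y * ennreal (M (x, y)) * indicator X y \<partial>lborel)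
         = (\<integral>\<^sup>+x. (indicator {0..1} y * indicator X y) * (indicator {0..1} x * ennreal (M (x, y))) \<partial>lborel)"
        by (simp add: mult_ac)
      also have "\<dots> = (indicator {0..1} y * indicator X y) * (\<integral>\<^sup>+x. indicator {0..1} x * ennreal (M (x, y)) \<partial>lborel)"
        by (rule nn_integral_cmult) (auto intro!: borel_measurable_times_ennreal borel_measurable_continuous_onI[OF c1(2)] measurable_compose[OF borel_measurable_continuous_onI[OF c1(2)] measurable_ennreal])
      also have "\<dots> = indicator {0..1} y * indicator X y"
        using nn_integral_unit_density[OF c1(2) M_pos M_col, of y] by (cases "y \<in> {0..1}") auto
      finally show "(\<integral>\<^sup>+x. indicator {0..1} x * indicator {0..1} y * ennreal (M (x, y)) * indicator X y \<partial>lborel) = \<dots>" .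
    qed
    finally show "emeasure (distr \<mu> borel snd) X = emeasure (uniform_measure lborel {0..1}) X"
      unfolding u[OF \<open>X \<in> sets borel\<close>] .
  qed simp
  ultimately show ?thesis by (simp add: permutons_def prob_space_\<mu> sets_\<mu>)
qed

lemma permuton_integral_marginals:
  fixes a b :: "real \<Rightarrow> real"
  assumes \<nu>: "\<nu> \<in> permutons" and a: "continuous_on UNIV a" "continuous_on UNIV b"
  shows "(\<integral>z. a (fst z) + b (snd z) \<partial>\<nu>) = (\<integral>x. a x \<partial>(uniform_measure lborel {0..1})) + (\<integral>x. b x \<partial>(uniform_measure lborel {0..1}))"
proof -
  have p: "prob_space \<nu>" and s: "sets \<nu> = sets (restrict_space borel unit_square)"
    and d: "distr \<nu> borel fst = uniform_measure lborel {0..1}" "distr \<nu> borel snd = uniform_measure lborel {0..1}"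
    using \<nu> by (auto simp: permutons_def)
  have c: "continuous_on UNIV (\<lambda>z::real\<times>real. a (fst z))" "continuous_on UNIV (\<lambda>z::real\<times>real. b (snd z))"
    by (auto intro!: continuous_on_compose2[OF a(1)] continuous_on_compose2[OF a(2)] continuous_on_fst continuous_on_snd continuous_on_id)
  have mf: "fst \<in> measurable \<nu> borel" "snd \<in> measurable \<nu> borel"
    by (auto intro!: continuous_measurable_square[OF _ s] continuous_on_fst continuous_on_snd continuous_on_id)
  have "(\<integral>z. a (fst z) + b (snd z) \<partial>\<nu>) = (\<integral>z. a (fst z) \<partial>\<nu>) + (\<integral>z. b (snd z) \<partial>\<nu>)"
    by (intro Bochner_Integration.integral_add integrable_square[OF c(1) p s] integrable_square[OF c(2) p s])
  moreover have "(\<integral>x. a x \<partial>distr \<nu> borel fst) = (\<integral>z. a (fst z) \<partial>\<nu>)"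
    by (rule integral_distr[OF mf(1) borel_measurable_continuous_onI[OF a(1)]])
  moreover have "(\<integral>x. b x \<partial>distr \<nu> borel snd) = (\<integral>z. b (snd z) \<partial>\<nu>)"
    by (rule integral_distr[OF mf(2) borel_measurable_continuous_onI[OF a(2)]])
  ultimately show ?thesis unfolding d by simp
qed

text \<open>Up to functions of one coordinate, \<open>\<theta> \<bullet> f\<close> is the logarithm of \<open>M\<close>. Functions of one coordinate have the
  same integral under every permuton, so by \<open>KL_Gibbs\<close> the objective is a constant minus a divergence that
  vanishes at \<open>\<mu>\<close> alone.\<close>

lemma mu_opt_eq:
  fixes f :: "real \<times> real \<Rightarrow> real ^ 'l"
  assumes f: "continuous_on UNIV f" and a: "continuous_on UNIV a" "continuous_on UNIV b"
    and M: "\<And>z. \<theta> \<bullet> f z = ln (M z) + (a (fst z) + b (snd z))"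
  shows "mu_opt f \<theta> = \<mu>"
proof -
  define c where "c = (\<integral>x. a x \<partial>(uniform_measure lborel {0..1})) + (\<integral>x. b x \<partial>(uniform_measure lborel {0..1}))"
  have lnM: "continuous_on UNIV (\<lambda>z. ln (M z))" using M_pos M_cont by (intro continuous_on_ln) (auto simp: less_imp_neq[symmetric])
  have ab: "continuous_on UNIV (\<lambda>z::real\<times>real. a (fst z) + b (snd z))"
    by (auto intro!: continuous_on_add continuous_on_compose2[OF a(1)] continuous_on_compose2[OF a(2)] continuous_on_fst continuous_on_snd continuous_on_id)
  have split: "\<theta> \<bullet> (\<integral>z. f z \<partial>\<nu>) = (\<integral>z. ln (M z) \<partial>\<nu>) + c" if \<nu>: "\<nu> \<in> permutons" for \<nu>
  proof -
    have p: "prob_space \<nu>" and s: "sets \<nu> = sets (restrict_space borel unit_square)" using \<nu> by (auto simp: permutons_def)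
    have "\<theta> \<bullet> (\<integral>z. f z \<partial>\<nu>) = (\<integral>z. \<theta> \<bullet> f z \<partial>\<nu>)"
      by (rule integral_inner_right[symmetric]) (rule integrable_square[OF f p s])
    also have "\<dots> = (\<integral>z. ln (M z) \<partial>\<nu>) + (\<integral>z. a (fst z) + b (snd z) \<partial>\<nu>)"
      unfolding M by (intro Bochner_Integration.integral_add integrable_square lnM ab p s)
    finally show ?thesis unfolding permuton_integral_marginals[OF \<nu> a] by (simp add: c_def)
  qed
  have obj\<mu>: "objective f \<theta> \<mu> = ereal c"
  proof -
    have "KL \<mu> unif_square = ereal (\<integral>x. ln (M x) \<partial>\<mu>)"
      unfolding \<mu>_def
      by (rule KL_density_self[OF prob_space_unif_square M_measurable M_pos])
        (use integrable_square[OF lnM prob_space_\<mu> sets_\<mu>] in \<open>simp add: \<mu>_def\<close>)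
    then show ?thesis unfolding objective_def split[OF \<mu>_permuton] by simp
  qed
  have obj: "objective f \<theta> \<nu> \<le> ereal c \<and> (objective f \<theta> \<nu> = ereal c \<longrightarrow> \<nu> = \<mu>)" if \<nu>: "\<nu> \<in> permutons" for \<nu>
  proof (cases "KL \<nu> unif_square = \<infinity>")
    case True
    then show ?thesis by (simp add: objective_def)
  next
    case False
    have p: "prob_space \<nu>" and s: "sets \<nu> = sets (restrict_space borel unit_square)" using \<nu> by (auto simp: permutons_def)
    obtain k where k: "KL \<nu> unif_square = ereal ((\<integral>x. ln (M x) \<partial>\<nu>) + k)" "0 \<le> k" "k = 0 \<Longrightarrow> \<nu> = \<mu>"
      using KL_Gibbs[OF prob_space_unif_square p _ M_measurable M_pos _ _ False]
        s sets_unif_square prob_space_\<mu> integrable_square[OF lnM p s] unfolding \<mu>_def by metis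
    then show ?thesis unfolding objective_def split[OF \<nu>] by auto
  qed
  show ?thesis unfolding mu_opt_def
  proof (rule the_equality)
    show "\<mu> \<in> permutons \<and> (\<forall>\<nu>\<in>permutons. objective f \<theta> \<nu> \<le> objective f \<theta> \<mu>)"
      unfolding obj\<mu> using \<mu>_permuton obj by blast
    fix \<nu> assume "\<nu> \<in> permutons \<and> (\<forall>\<nu>'\<in>permutons. objective f \<theta> \<nu>' \<le> objective f \<theta> \<nu>)"
    then have \<nu>: "\<nu> \<in> permutons" and le: "ereal c \<le> objective f \<theta> \<nu>"
      unfolding obj\<mu>[symmetric] using \<mu>_permuton by blast+
    from obj[OF \<nu>] order_antisym[OF _ le] show "\<nu> = \<mu>" by blast
  qed
qed

end

section \<open>Averages and Riemann sums\<close>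

definition avg :: "nat \<Rightarrow> (nat \<Rightarrow> real) \<Rightarrow> real" where
  "avg n \<phi> = (\<Sum>i=1..n. \<phi> i) / real n"

lemma avg_add: "avg n (\<lambda>i. \<phi> i + \<psi> i) = avg n \<phi> + avg n \<psi>"
  by (simp add: avg_def sum.distrib add_divide_distrib)

lemma avg_diff: "avg n (\<lambda>i. \<phi> i - \<psi> i) = avg n \<phi> - avg n \<psi>"
  by (simp add: avg_def sum_subtractf diff_divide_distrib)

lemma avg_cmult: "avg n (\<lambda>i. c * \<phi> i) = c * avg n \<phi>"
  by (simp add: avg_def sum_distrib_left)

lemma avg_cmult_right: "avg n (\<lambda>i. \<phi> i * c) = avg n \<phi> * c"
  using avg_cmult[of n c \<phi>] by (simp add: mult.commute)

lemma avg_const: "n > 0 \<Longrightarrow> avg n (\<lambda>i. c) = c"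
  by (simp add: avg_def)

lemma avg_cong: "(\<And>i. i \<in> {1..n} \<Longrightarrow> \<phi> i = \<psi> i) \<Longrightarrow> avg n \<phi> = avg n \<psi>"
  unfolding avg_def by (rule arg_cong[where f="\<lambda>x. x / real n"], rule sum.cong) auto

lemma avg_mono: "(\<And>i. i \<in> {1..n} \<Longrightarrow> \<phi> i \<le> \<psi> i) \<Longrightarrow> avg n \<phi> \<le> avg n \<psi>"
  unfolding avg_def by (intro divide_right_mono sum_mono) auto

lemma avg_abs: "\<bar>avg n \<phi>\<bar> \<le> avg n (\<lambda>i. \<bar>\<phi> i\<bar>)"
  by (simp add: avg_def divide_right_mono)

lemma avg_le: "n > 0 \<Longrightarrow> (\<And>i. i \<in> {1..n} \<Longrightarrow> \<phi> i \<le> c) \<Longrightarrow> avg n \<phi> \<le> c"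
  using avg_mono[of n \<phi> "\<lambda>i. c"] by (simp add: avg_const)

lemma avg_ge: "n > 0 \<Longrightarrow> (\<And>i. i \<in> {1..n} \<Longrightarrow> c \<le> \<phi> i) \<Longrightarrow> c \<le> avg n \<phi>"
  using avg_mono[of n "\<lambda>i. c" \<phi>] by (simp add: avg_const)

lemma avg_abs_le: "n > 0 \<Longrightarrow> (\<And>i. i \<in> {1..n} \<Longrightarrow> \<bar>\<phi> i\<bar> \<le> c) \<Longrightarrow> \<bar>avg n \<phi>\<bar> \<le> c"
  by (rule order_trans[OF avg_abs avg_le])

lemma avg_swap: "avg n (\<lambda>i. avg n (\<lambda>j. \<phi> i j)) = avg n (\<lambda>j. avg n (\<lambda>i. \<phi> i j))"
  unfolding avg_def by (subst sum_divide_distrib[symmetric])+ (subst sum.swap, simp)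

text \<open>Changing a bounded function at two of the \<open>n\<close> indices moves its average by \<open>O(1/n)\<close> only; this is how
  swaps are controlled throughout.\<close>

lemma avg_stable:
  assumes n: "n > 0" and c: "0 \<le> c" "0 \<le> d"
    and "\<And>k. k \<in> {1..n} \<Longrightarrow> k \<noteq> i \<Longrightarrow> k \<noteq> j \<Longrightarrow> \<bar>\<phi> k - \<psi> k\<bar> \<le> c / n"
    and "\<And>k. k \<in> {1..n} \<Longrightarrow> \<bar>\<phi> k - \<psi> k\<bar> \<le> d"
  shows "\<bar>avg n \<phi> - avg n \<psi>\<bar> \<le> (c + 2 * d) / n"
proof -
  have "\<bar>avg n \<phi> - avg n \<psi>\<bar> \<le> avg n (\<lambda>k. \<bar>\<phi> k - \<psi> k\<bar>)"
    using avg_abs[of n "\<lambda>k. \<phi> k - \<psi> k"] by (simp add: avg_diff)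
  also have "\<dots> \<le> avg n (\<lambda>k. c / n + d * (if k = i then 1 else 0) + d * (if k = j then 1 else 0))"
  proof (rule avg_mono)
    fix k assume k: "k \<in> {1..n}"
    define a where "a = c / n"
    have "0 \<le> a" using c by (simp add: a_def)
    then show "\<bar>\<phi> k - \<psi> k\<bar> \<le> c / n + d * (if k = i then 1 else 0) + d * (if k = j then 1 else 0)"
      using assms(4)[OF k] assms(5)[OF k] c unfolding a_def[symmetric] by auto
  qed
  also have "\<dots> = c / n + d * avg n (\<lambda>k. if k = i then 1 else 0) + d * avg n (\<lambda>k. if k = j then 1 else 0)"
    using n by (simp add: avg_add avg_cmult avg_const)
  also have "\<dots> \<le> c / n + d * (1 / n) + d * (1 / n)"
  proof -
    have "avg n (\<lambda>k. if k = l then 1 else 0) \<le> 1 / n" for l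
      unfolding avg_def by (intro divide_right_mono) (auto simp: sum.delta)
    then show ?thesis using c by (intro add_mono mult_left_mono) auto
  qed
  also have "\<dots> = (c + 2 * d) / n" by (simp add: add_divide_distrib)
  finally show ?thesis .
qed

lemma riemann_sum_error:
  fixes u :: "real \<Rightarrow> real"
  assumes n: "n > 0" and u: "continuous_on {0..1} u"
    and mod: "\<And>y y'. y \<in> {0..1} \<Longrightarrow> y' \<in> {0..1} \<Longrightarrow> \<bar>y - y'\<bar> \<le> 1 / n \<Longrightarrow> \<bar>u y - u y'\<bar> \<le> e"
  shows "\<bar>avg n (\<lambda>j. u (real j / real n)) - integral {0..1} u\<bar> \<le> e"
proof -
  have int: "u integrable_on {a..b}" if "0 \<le> a" "b \<le> 1" for a b
    using that by (intro integrable_continuous_interval continuous_on_subset[OF u]) auto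
  have "\<bar>(\<Sum>j=1..k. u (real j / real n)) / real n - integral {0..real k / real n} u\<bar> \<le> e * (real k / real n)" if "k \<le> n" for k
    using that
  proof (induction k)
    case 0
    then show ?case by simp
  next
    case (Suc k)
    let ?a = "real k / real n" and ?b = "real (Suc k) / real n"
    have ab: "0 \<le> ?a" "?a \<le> ?b" "?b \<le> 1" "?b - ?a = 1 / n" using Suc.prems n by (auto simp: field_simps)
    have split: "integral {0..?a} u + integral {?a..?b} u = integral {0..?b} u"
      using ab by (intro Henstock_Kurzweil_Integration.integral_combine int) auto
    have "\<bar>u ?b / real n - integral {?a..?b} u\<bar> \<le> e * (1 / n)"
    proof -
      have "integral {?a..?b} (\<lambda>y. u ?b - u y) = integral {?a..?b} (\<lambda>y. u ?b) - integral {?a..?b} u"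
        using ab by (intro integral_diff int integrable_const_ivl) auto
      moreover have "integral {?a..?b} (\<lambda>y. u ?b) = u ?b / real n" using ab by (simp add: integral_const_real)
      moreover have "norm (integral {?a..?b} (\<lambda>y. u ?b - u y)) \<le> e * (?b - ?a)"
      proof (rule integral_bound[OF ab(2)])
        show "continuous_on {?a..?b} (\<lambda>y. u ?b - u y)"
          using ab by (intro continuous_on_diff continuous_on_const continuous_on_subset[OF u]) auto
        fix t assume t: "t \<in> {?a..?b}"
        have "t \<in> {0..1}" "?b \<in> {0..1}" "\<bar>?b - t\<bar> \<le> 1 / n"
          using t ab(1-3) order_trans[OF ab(1), of t] unfolding ab(4)[symmetric] by auto
        then show "norm (u ?b - u t) \<le> e" using mod by simp
      qed
      ultimately show ?thesis unfolding ab(4) by simp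
    qed
    moreover have "(\<Sum>j=1..Suc k. u (real j / real n)) / real n = (\<Sum>j=1..k. u (real j / real n)) / real n + u ?b / real n"
      by (simp add: add_divide_distrib)
    moreover have "e * ?b = e * ?a + e * (1 / n)" using ab(4) by (simp add: algebra_simps)
    ultimately show ?case using Suc split by simp
  qed
  from this[of n] n show ?thesis by (simp add: avg_def)
qed

lemma riemann_sum_uniform:
  fixes g :: "real \<times> real \<Rightarrow> real"
  assumes g: "continuous_on UNIV g" and e: "e > 0"
  shows "\<forall>\<^sub>F n in sequentially. \<forall>x\<in>{0..1}. \<bar>avg n (\<lambda>j. g (x, real j / real n)) - integral {0..1} (\<lambda>y. g (x, y))\<bar> \<le> e"
proof -
  have "uniformly_continuous_on unit_square g"
    unfolding unit_square_cbox by (intro compact_uniformly_continuous continuous_on_subset[OF g]) auto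
  then obtain d where d: "d > 0" "\<And>z z'. z \<in> unit_square \<Longrightarrow> z' \<in> unit_square \<Longrightarrow> dist z' z < d \<Longrightarrow> dist (g z') (g z) < e"
    using e unfolding uniformly_continuous_on_def by metis
  have "\<forall>\<^sub>F n in sequentially. 1 / real n < d"
    using order_tendstoD(2)[OF lim_1_over_n d(1)] by simp
  then show ?thesis using eventually_gt_at_top[of 0]
  proof eventually_elim
    case (elim n)
    show ?case
    proof
      fix x :: real assume x: "x \<in> {0..1}"
      show "\<bar>avg n (\<lambda>j. g (x, real j / real n)) - integral {0..1} (\<lambda>y. g (x, y))\<bar> \<le> e"
      proof (rule riemann_sum_error[OF elim(2)])
        show "continuous_on {0..1} (\<lambda>y. g (x, y))"
          by (rule continuous_on_compose2[OF g]) (auto intro!: continuous_on_Pair continuous_on_id continuous_on_const)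
        fix y y' :: real assume "y \<in> {0..1}" "y' \<in> {0..1}" "\<bar>y - y'\<bar> \<le> 1 / real n"
        then have "dist (g (x, y)) (g (x, y')) < e"
          using x elim(1) by (intro d(2)) (auto simp: unit_square_def dist_Pair_Pair dist_real_def)
        then show "\<bar>g (x, y) - g (x, y')\<bar> \<le> e" by (simp add: dist_real_def)
      qed
    qed
  qed
qed

lemma integral_param_continuous:
  fixes g :: "real \<times> real \<Rightarrow> real"
  assumes g: "continuous_on UNIV g"
  shows "continuous_on UNIV (\<lambda>x. integral {0..1} (\<lambda>y. g (x, y)))"
proof -
  have "continuous_on (UNIV \<times> cbox 0 1) (\<lambda>(x, y). g (x, y))"
    using continuous_on_subset[OF g, of "UNIV \<times> cbox 0 1"] by simp
  from integral_continuous_on_param[OF this] show ?thesis by simp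
qed

lemma riemann_sum_2:
  fixes g :: "real \<times> real \<Rightarrow> real"
  assumes g: "continuous_on UNIV g"
  shows "(\<lambda>n. avg n (\<lambda>i. avg n (\<lambda>j. g (real i / real n, real j / real n))))
    \<longlonglongrightarrow> integral {0..1} (\<lambda>x. integral {0..1} (\<lambda>y. g (x, y)))"
proof (rule tendstoI)
  fix e :: real assume e: "e > 0"
  define G where "G x = integral {0..1} (\<lambda>y. g (x, y))" for x
  have G: "continuous_on UNIV (\<lambda>z::real \<times> real. G (snd z))"
    using integral_param_continuous[OF g] unfolding G_def
    by (rule continuous_on_compose2) (auto intro!: continuous_on_snd continuous_on_id)
  have "e / 3 > 0" using e by simp
  from riemann_sum_uniform[OF g this] riemann_sum_uniform[OF G this] eventually_gt_at_top[of 0]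
  show "\<forall>\<^sub>F n in sequentially. dist (avg n (\<lambda>i. avg n (\<lambda>j. g (real i / real n, real j / real n)))) (integral {0..1} (\<lambda>x. integral {0..1} (\<lambda>y. g (x, y)))) < e"
  proof eventually_elim
    case (elim n)
    have "\<bar>avg n (\<lambda>i. avg n (\<lambda>j. g (real i / real n, real j / real n)) - G (real i / real n))\<bar> \<le> e / 3"
      by (rule avg_abs_le[OF elim(3)]) (use elim(1) in \<open>auto simp: G_def divide_le_eq\<close>)
    moreover have "\<bar>avg n (\<lambda>i. G (real i / real n)) - integral {0..1} G\<bar> \<le> e / 3"
      using elim(2) by force
    ultimately have "\<bar>avg n (\<lambda>i. avg n (\<lambda>j. g (real i / real n, real j / real n))) - integral {0..1} G\<bar> \<le> 2 * e / 3"
      unfolding avg_diff by linarith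
    then show ?case using e by (simp add: dist_real_def G_def[abs_def])
  qed
qed

section \<open>Swapping two values of a permutation\<close>

definition pt :: "nat \<Rightarrow> (nat \<Rightarrow> nat) \<Rightarrow> nat \<Rightarrow> real \<times> real" where
  "pt n \<pi> i = (real i / real n, real (\<pi> i) / real n)"

definition emp :: "nat \<Rightarrow> (nat \<Rightarrow> nat) \<Rightarrow> (real \<times> real \<Rightarrow> real) \<Rightarrow> real" where
  "emp n \<pi> F = avg n (\<lambda>i. F (pt n \<pi> i))"

abbreviation swp :: "(nat \<Rightarrow> nat) \<Rightarrow> nat \<Rightarrow> nat \<Rightarrow> nat \<Rightarrow> nat" where
  "swp \<pi> i j \<equiv> \<pi> \<circ> Transposition.transpose i j"

text \<open>The point with the abscissa of the first and the ordinate of the second argument: exchanging the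
  values at \<open>i\<close> and \<open>j\<close> replaces \<open>z\<^sub>i\<close> and \<open>z\<^sub>j\<close> by their two crossings (\<open>pt_swp\<close>).\<close>

definition cross :: "real \<times> real \<Rightarrow> real \<times> real \<Rightarrow> real \<times> real" where
  "cross z w = (fst z, snd w)"

lemma finite_perms [simp]: "finite (perms n)"
  by (simp add: perms_def finite_permutations)

lemma perms_nonempty: "perms n \<noteq> {}"
  using permutes_id[of "{1..n}"] unfolding perms_def by blast

lemma pt_square: "\<pi> \<in> perms n \<Longrightarrow> i \<in> {1..n} \<Longrightarrow> pt n \<pi> i \<in> unit_square"
  using permutes_in_image[of \<pi> "{1..n}" i] by (auto simp: perms_def pt_def unit_square_def divide_le_eq)

lemma cross_square: "z \<in> unit_square \<Longrightarrow> w \<in> unit_square \<Longrightarrow> cross z w \<in> unit_square"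
  by (auto simp: cross_def unit_square_def)

lemma swp_perms: "\<pi> \<in> perms n \<Longrightarrow> i \<in> {1..n} \<Longrightarrow> j \<in> {1..n} \<Longrightarrow> swp \<pi> i j \<in> perms n"
  by (auto simp: perms_def intro!: permutes_compose permutes_swap_id)

lemma swp_swp: "swp (swp \<pi> i j) i j = \<pi>"
  by (simp add: comp_assoc)

lemma pt_swp:
  "pt n (swp \<pi> i j) i = cross (pt n \<pi> i) (pt n \<pi> j)"
  "pt n (swp \<pi> i j) j = cross (pt n \<pi> j) (pt n \<pi> i)"
  "k \<noteq> i \<Longrightarrow> k \<noteq> j \<Longrightarrow> pt n (swp \<pi> i j) k = pt n \<pi> k"
  by (auto simp: pt_def cross_def)

lemma avg_perm: "\<pi> \<in> perms n \<Longrightarrow> avg n (\<lambda>j. \<phi> (\<pi> j)) = avg n \<phi>"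
  unfolding avg_def perms_def using sum.permute[of \<pi> "{1..n}" \<phi>] by (simp add: comp_def)

lemma sum_swp:
  assumes "i \<in> {1..n}" "j \<in> {1..n}"
  shows "(\<Sum>\<pi>\<in>perms n. X (swp \<pi> i j)) = (\<Sum>\<pi>\<in>perms n. X \<pi>)"
  by (rule sum.reindex_bij_witness[where i="\<lambda>\<pi>. swp \<pi> i j" and j="\<lambda>\<pi>. swp \<pi> i j"])
     (auto simp: swp_perms[OF _ assms] swp_swp)

context doubly_stochastic
begin

definition weight :: "nat \<Rightarrow> (nat \<Rightarrow> nat) \<Rightarrow> real" where
  "weight n \<pi> = (\<Prod>i=1..n. M (pt n \<pi> i)) / (\<Sum>\<pi>\<in>perms n. \<Prod>i=1..n. M (pt n \<pi> i))"

definition E :: "nat \<Rightarrow> ((nat \<Rightarrow> nat) \<Rightarrow> real) \<Rightarrow> real" where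
  "E n X = (\<Sum>\<pi>\<in>perms n. weight n \<pi> * X \<pi>)"

lemma Z_pos: "0 < (\<Sum>\<pi>\<in>perms n. \<Prod>i=1..n. M (pt n \<pi> i))"
  by (intro sum_pos prod_pos) (auto simp: M_pos perms_nonempty)

lemma weight_pos: "0 < weight n \<pi>"
  unfolding weight_def by (intro divide_pos_pos Z_pos prod_pos) (auto simp: M_pos)

lemma sum_weight: "(\<Sum>\<pi>\<in>perms n. weight n \<pi>) = 1"
  unfolding weight_def by (subst sum_divide_distrib[symmetric]) (use Z_pos[of n] in simp)

lemma E_add: "E n (\<lambda>\<pi>. X \<pi> + Y \<pi>) = E n X + E n Y"
  by (simp add: E_def sum.distrib algebra_simps)

lemma E_diff: "E n (\<lambda>\<pi>. X \<pi> - Y \<pi>) = E n X - E n Y"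
  by (simp add: E_def sum_subtractf algebra_simps)

lemma E_cmult: "E n (\<lambda>\<pi>. c * X \<pi>) = c * E n X"
  by (simp add: E_def sum_distrib_left mult_ac)

lemma E_const: "E n (\<lambda>\<pi>. c) = c"
  by (simp add: E_def sum_distrib_right[symmetric] sum_weight)

lemma E_cong: "(\<And>\<pi>. \<pi> \<in> perms n \<Longrightarrow> X \<pi> = Y \<pi>) \<Longrightarrow> E n X = E n Y"
  by (simp add: E_def)

lemma E_mono: "(\<And>\<pi>. \<pi> \<in> perms n \<Longrightarrow> X \<pi> \<le> Y \<pi>) \<Longrightarrow> E n X \<le> E n Y"
  unfolding E_def by (intro sum_mono mult_left_mono) (auto intro: less_imp_le[OF weight_pos])

lemma E_le: "(\<And>\<pi>. \<pi> \<in> perms n \<Longrightarrow> X \<pi> \<le> c) \<Longrightarrow> E n X \<le> c"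
  using E_mono[of n X "\<lambda>\<pi>. c"] by (simp add: E_const)

lemma E_nonneg: "(\<And>\<pi>. \<pi> \<in> perms n \<Longrightarrow> 0 \<le> X \<pi>) \<Longrightarrow> 0 \<le> E n X"
  using E_mono[of n "\<lambda>\<pi>. 0" X] by (simp add: E_const)

lemma E_abs: "\<bar>E n X\<bar> \<le> E n (\<lambda>\<pi>. \<bar>X \<pi>\<bar>)"
  unfolding E_def using sum_abs[of "\<lambda>\<pi>. weight n \<pi> * X \<pi>" "perms n"] by (simp add: abs_mult less_imp_le[OF weight_pos])

lemma E_avg: "E n (\<lambda>\<pi>. avg n (\<lambda>i. X i \<pi>)) = avg n (\<lambda>i. E n (X i))"
  unfolding E_def avg_def
  by (simp add: sum_divide_distrib sum_distrib_left) (subst sum.swap, simp)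

lemma E_abs_le_L2:
  assumes "a > 0" shows "E n (\<lambda>\<pi>. \<bar>X \<pi>\<bar>) \<le> a + E n (\<lambda>\<pi>. (X \<pi>)\<^sup>2) / a"
proof -
  have "\<bar>t\<bar> \<le> a + (1 / a) * t\<^sup>2" for t :: real
  proof (cases "\<bar>t\<bar> \<le> a")
    case True
    then show ?thesis using assms by (smt (verit) mult_nonneg_nonneg zero_le_power2 divide_nonneg_pos)
  next
    case False
    then have "a * \<bar>t\<bar> \<le> \<bar>t\<bar> * \<bar>t\<bar>" by (intro mult_right_mono) auto
    then have "\<bar>t\<bar> \<le> (1 / a) * t\<^sup>2" using assms by (simp add: field_simps power2_eq_square)
    then show ?thesis using assms by linarith
  qed
  then have "E n (\<lambda>\<pi>. \<bar>X \<pi>\<bar>) \<le> E n (\<lambda>\<pi>. a + (1 / a) * (X \<pi>)\<^sup>2)" by (intro E_mono) auto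
  then show ?thesis by (simp only: E_add E_cmult E_const) simp
qed

text \<open>Dividing by the two factors that a swap touches leaves a weight that the swap preserves.\<close>

definition swap_weight :: "real \<times> real \<Rightarrow> real \<times> real \<Rightarrow> real" where
  "swap_weight z z' = 1 / (M z * M z')"

text \<open>The remaining factors of the weight do not see the swap, and the swap is a bijection of the
  permutations.\<close>

lemma E_swap:
  assumes ij: "i \<in> {1..n}" "j \<in> {1..n}"
  shows "E n (\<lambda>\<pi>. swap_weight (pt n \<pi> i) (pt n \<pi> j) * X \<pi>) = E n (\<lambda>\<pi>. swap_weight (pt n \<pi> i) (pt n \<pi> j) * X (swp \<pi> i j))"
proof (cases "i = j")
  case True
  then show ?thesis by simp
next
  case False
  define Z where "Z = (\<Sum>\<pi>\<in>perms n. \<Prod>i=1..n. M (pt n \<pi> i))"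
  define R where "R \<pi> = (\<Prod>k\<in>{1..n} - {i, j}. M (pt n \<pi> k)) / Z" for \<pi>
  have R: "weight n \<pi> * swap_weight (pt n \<pi> i) (pt n \<pi> j) = R \<pi>" for \<pi>
  proof -
    have "(\<Prod>k=1..n. M (pt n \<pi> k)) = (\<Prod>k\<in>{i, j}. M (pt n \<pi> k)) * (\<Prod>k\<in>{1..n} - {i, j}. M (pt n \<pi> k))"
      using ij by (subst prod.subset_diff[of "{i, j}"]) (auto simp: mult.commute)
    then show ?thesis using False M_pos[of "pt n \<pi> i"] M_pos[of "pt n \<pi> j"]
      by (simp add: weight_def swap_weight_def R_def Z_def field_simps)
  qed
  have R2: "R (swp \<pi> i j) = R \<pi>" for \<pi>
    unfolding R_def by (rule arg_cong[where f="\<lambda>x. x / Z"], rule prod.cong) (auto simp: pt_swp)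
  have "E n (\<lambda>\<pi>. swap_weight (pt n \<pi> i) (pt n \<pi> j) * X \<pi>) = (\<Sum>\<pi>\<in>perms n. R \<pi> * X \<pi>)"
    unfolding E_def R[symmetric] by (simp add: mult.assoc)
  also have "\<dots> = (\<Sum>\<pi>\<in>perms n. R (swp \<pi> i j) * X (swp \<pi> i j))" by (rule sum_swp[OF ij, symmetric])
  also have "\<dots> = E n (\<lambda>\<pi>. swap_weight (pt n \<pi> i) (pt n \<pi> j) * X (swp \<pi> i j))"
    by (simp only: R2) (simp only: E_def R[symmetric] mult.assoc)
  finally show ?thesis .
qed

end

section \<open>Factorisation of the reweighted empirical measure\<close>

text \<open>Statistics bounded by \<open>b\<close> that a swap moves by at most \<open>c / n\<close>. Random test functions built from
  empirical averages are of this kind.\<close>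

definition stable :: "nat \<Rightarrow> ((nat \<Rightarrow> nat) \<Rightarrow> real) \<Rightarrow> real \<Rightarrow> real \<Rightarrow> bool" where
  "stable n X b c \<longleftrightarrow> 0 \<le> b \<and> 0 \<le> c \<and> (\<forall>\<pi>\<in>perms n. \<bar>X \<pi>\<bar> \<le> b) \<and>
     (\<forall>\<pi>\<in>perms n. \<forall>i\<in>{1..n}. \<forall>j\<in>{1..n}. \<bar>X \<pi> - X (swp \<pi> i j)\<bar> \<le> c / n)"

lemma stable_const: "\<bar>a\<bar> \<le> b \<Longrightarrow> stable n (\<lambda>\<pi>. a) b 0"
  by (auto simp: stable_def)

lemma stable_mult:
  assumes X: "stable n X b c" and Y: "stable n Y b' c'"
  shows "stable n (\<lambda>\<pi>. X \<pi> * Y \<pi>) (b * b') (b * c' + b' * c)"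
  unfolding stable_def
proof (intro conjI ballI)
  fix \<pi> assume p: "\<pi> \<in> perms n"
  show "\<bar>X \<pi> * Y \<pi>\<bar> \<le> b * b'" using X Y p unfolding abs_mult stable_def by (intro mult_mono) auto
  fix i j assume ij: "i \<in> {1..n}" "j \<in> {1..n}"
  let ?p = "swp \<pi> i j"
  have p': "?p \<in> perms n" using p ij by (rule swp_perms)
  have "X \<pi> * Y \<pi> - X ?p * Y ?p = X \<pi> * (Y \<pi> - Y ?p) + Y ?p * (X \<pi> - X ?p)" by (simp add: algebra_simps)
  then have "\<bar>X \<pi> * Y \<pi> - X ?p * Y ?p\<bar> \<le> \<bar>X \<pi>\<bar> * \<bar>Y \<pi> - Y ?p\<bar> + \<bar>Y ?p\<bar> * \<bar>X \<pi> - X ?p\<bar>"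
    using abs_triangle_ineq by (metis abs_mult)
  also have "\<dots> \<le> b * (c' / n) + b' * (c / n)"
    using X Y p p' ij unfolding stable_def by (intro add_mono mult_mono) auto
  finally show "\<bar>X \<pi> * Y \<pi> - X ?p * Y ?p\<bar> \<le> (b * c' + b' * c) / n" by (simp add: add_divide_distrib)
qed (use X Y in \<open>auto simp: stable_def\<close>)

lemma stable_inverse:
  assumes X: "stable n X b c" and a: "a > 0" "\<And>\<pi>. \<pi> \<in> perms n \<Longrightarrow> a \<le> X \<pi>"
  shows "stable n (\<lambda>\<pi>. 1 / X \<pi>) (1 / a) (c / a\<^sup>2)"
  unfolding stable_def
proof (intro conjI ballI)
  fix \<pi> assume p: "\<pi> \<in> perms n"
  show "\<bar>1 / X \<pi>\<bar> \<le> 1 / a" using a(1) a(2)[OF p] by (simp add: frac_le)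
  fix i j assume ij: "i \<in> {1..n}" "j \<in> {1..n}"
  let ?p = "swp \<pi> i j"
  have p': "?p \<in> perms n" using p ij by (rule swp_perms)
  have a1: "a \<le> X \<pi>" "a \<le> X ?p" using a(2) p p' by auto
  have "\<bar>1 / X \<pi> - 1 / X ?p\<bar> = \<bar>X \<pi> - X ?p\<bar> / (X \<pi> * X ?p)"
    using a1 a(1) by (simp add: diff_frac_eq abs_minus_commute abs_mult)
  also have "\<dots> \<le> (c / n) / (a * a)"
    using X p ij a1 a(1) unfolding stable_def by (intro frac_le mult_mono) auto
  finally show "\<bar>1 / X \<pi> - 1 / X ?p\<bar> \<le> c / a\<^sup>2 / n" by (simp add: power2_eq_square mult_ac)
qed (use X a in \<open>auto simp: stable_def\<close>)

lemma stable_emp: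
  assumes n: "n > 0" and G: "\<And>z. z \<in> unit_square \<Longrightarrow> \<bar>G z\<bar> \<le> b" and "0 \<le> b"
  shows "stable n (\<lambda>\<pi>. emp n \<pi> G) b (4 * b)"
  unfolding stable_def
proof (intro conjI ballI)
  fix \<pi> assume p: "\<pi> \<in> perms n"
  show "\<bar>emp n \<pi> G\<bar> \<le> b" unfolding emp_def by (rule avg_abs_le[OF n G]) (rule pt_square[OF p])
  fix i j assume ij: "i \<in> {1..n}" "j \<in> {1..n}"
  let ?p = "swp \<pi> i j"
  have p': "?p \<in> perms n" using p ij by (rule swp_perms)
  have "\<bar>emp n \<pi> G - emp n ?p G\<bar> \<le> (0 + 2 * (2 * b)) / n"
    unfolding emp_def
  proof (rule avg_stable[OF n, where i=i and j=j])
    fix k assume k: "k \<in> {1..n}"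
    show "\<bar>G (pt n \<pi> k) - G (pt n ?p k)\<bar> \<le> 2 * b"
      using G[OF pt_square[OF p k]] G[OF pt_square[OF p' k]] by linarith
    show "\<bar>G (pt n \<pi> k) - G (pt n ?p k)\<bar> \<le> 0 / n" if "k \<noteq> i" "k \<noteq> j"
      using pt_swp(3)[OF that] by simp
  qed (use assms in auto)
  then show "\<bar>emp n \<pi> G - emp n ?p G\<bar> \<le> 4 * b / n" by simp
qed (use assms in auto)

context doubly_stochastic
begin

text \<open>With \<open>\<rho>\<close> the empirical measure reweighted by \<open>1/M\<close>, this is \<open>\<rho>(1) \<rho>(\<Phi>) - (\<rho>\<^sub>1 \<Otimes> \<rho>\<^sub>2)(\<Phi>)\<close>, where \<open>\<rho>\<^sub>1\<close> and \<open>\<rho>\<^sub>2\<close>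
  are the marginals of \<open>\<rho>\<close> (\<open>factor_defect_alt\<close>): the failure of \<open>\<rho>\<close> to be a product measure.\<close>

definition factor_defect :: "nat \<Rightarrow> ((nat \<Rightarrow> nat) \<Rightarrow> real \<times> real \<Rightarrow> real) \<Rightarrow> (nat \<Rightarrow> nat) \<Rightarrow> real" where
  "factor_defect n \<Phi> \<pi> = avg n (\<lambda>i. avg n (\<lambda>j. swap_weight (pt n \<pi> i) (pt n \<pi> j) * (\<Phi> \<pi> (pt n \<pi> i) - \<Phi> \<pi> (cross (pt n \<pi> i) (pt n \<pi> j)))))"

text \<open>Under the swap of \<open>i\<close> and \<open>j\<close> the \<open>(i,j)\<close> summand \<open>D i j\<close> changes sign up to \<open>O(1/n)\<close>, while the whole
  statistic moves by \<open>O(1/n)\<close>. Hence \<open>E_swap\<close> pairs each summand of \<open>E[Y\<^sup>2]\<close> with its own negative, and only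
  \<open>O(1/n)\<close> remains.\<close>

lemma factor_defect_second_moment:
  assumes n: "n > 0" and \<kappa>: "\<And>z z'. z \<in> unit_square \<Longrightarrow> z' \<in> unit_square \<Longrightarrow> swap_weight z z' \<le> \<kappa>"
    and \<Phi>: "\<And>z. z \<in> unit_square \<Longrightarrow> stable n (\<lambda>\<pi>. \<Phi> \<pi> z) b c"
  shows "E n (\<lambda>\<pi>. (factor_defect n \<Phi> \<pi>)\<^sup>2) \<le> \<kappa>\<^sup>2 * (4 * b * c + 16 * b\<^sup>2) / n"
proof -
  define D where "D i j \<pi> = \<Phi> \<pi> (pt n \<pi> i) - \<Phi> \<pi> (cross (pt n \<pi> i) (pt n \<pi> j))" for i j \<pi>
  define Y where "Y = factor_defect n \<Phi>"
  have q0: "0 \<le> swap_weight z z'" for z z' using M_pos by (simp add: swap_weight_def less_imp_le)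
  have "(0, 0) \<in> unit_square" by (simp add: unit_square_def)
  from \<Phi>[OF this] order_trans[OF q0 \<kappa>[OF this this]] have b: "0 \<le> b" and c: "0 \<le> c" and \<kappa>0: "0 \<le> \<kappa>"
    by (auto simp: stable_def)
  have \<Phi>b: "\<bar>\<Phi> \<pi> z\<bar> \<le> b" if "\<pi> \<in> perms n" "z \<in> unit_square" for \<pi> z
    using \<Phi>[OF that(2)] that(1) by (simp add: stable_def)
  have \<Phi>c: "\<bar>\<Phi> \<pi> z - \<Phi> (swp \<pi> i j) z\<bar> \<le> c / n" if "\<pi> \<in> perms n" "z \<in> unit_square" "i \<in> {1..n}" "j \<in> {1..n}" for \<pi> z i j
    using \<Phi>[OF that(2)] that unfolding stable_def by blast
  note sq = pt_square cross_square
  have Db: "\<bar>D i j \<pi>\<bar> \<le> 2 * b" if "\<pi> \<in> perms n" "i \<in> {1..n}" "j \<in> {1..n}" for i j \<pi>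
    using \<Phi>b[OF that(1), of "pt n \<pi> i"] \<Phi>b[OF that(1), of "cross (pt n \<pi> i) (pt n \<pi> j)"] that sq
    unfolding D_def by (smt (verit))
  have qD: "\<bar>swap_weight (pt n \<pi> i) (pt n \<pi> j) * D i j \<pi>\<bar> \<le> \<kappa> * (2 * b)" if "\<pi> \<in> perms n" "i \<in> {1..n}" "j \<in> {1..n}" for i j \<pi>
    unfolding abs_mult abs_of_nonneg[OF q0] using that by (intro mult_mono Db \<kappa> sq) (auto simp: \<kappa>0)
  have YD: "Y \<pi> = avg n (\<lambda>i. avg n (\<lambda>j. swap_weight (pt n \<pi> i) (pt n \<pi> j) * D i j \<pi>))" for \<pi>
    by (simp add: Y_def factor_defect_def D_def)
  have Yb: "\<bar>Y \<pi>\<bar> \<le> \<kappa> * (2 * b)" if "\<pi> \<in> perms n" for \<pi>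
    unfolding YD using that by (intro avg_abs_le n qD)
  have Yc: "\<bar>Y \<pi> - Y (swp \<pi> i j)\<bar> \<le> \<kappa> * (2 * c + 16 * b) / n"
    if p: "\<pi> \<in> perms n" and ij: "i \<in> {1..n}" "j \<in> {1..n}" for i j \<pi>
  proof -
    let ?p = "swp \<pi> i j"
    have p': "?p \<in> perms n" by (rule swp_perms[OF p ij])
    let ?g = "\<lambda>\<pi> k l. swap_weight (pt n \<pi> k) (pt n \<pi> l) * D k l \<pi>"
    have d: "\<bar>?g \<pi> k l - ?g ?p k l\<bar> \<le> \<kappa> * (4 * b)" if "k \<in> {1..n}" "l \<in> {1..n}" for k l
      using qD[OF p that] qD[OF p' that] by linarith
    have "\<bar>Y \<pi> - Y ?p\<bar> \<le> (\<kappa> * (2 * c + 8 * b) + 2 * (\<kappa> * (4 * b))) / n"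
      unfolding YD
    proof (rule avg_stable[OF n, where i=i and j=j])
      fix k assume k: "k \<in> {1..n}"
      show "\<bar>avg n (?g \<pi> k) - avg n (?g ?p k)\<bar> \<le> \<kappa> * (4 * b)"
        unfolding avg_diff[symmetric] by (intro avg_abs_le n d k)
      assume kij: "k \<noteq> i" "k \<noteq> j"
      have "\<bar>avg n (?g \<pi> k) - avg n (?g ?p k)\<bar> \<le> (\<kappa> * (2 * c) + 2 * (\<kappa> * (4 * b))) / n"
      proof (rule avg_stable[OF n, where i=i and j=j])
        fix l assume l: "l \<in> {1..n}"
        show "\<bar>?g \<pi> k l - ?g ?p k l\<bar> \<le> \<kappa> * (4 * b)" by (rule d[OF k l])
        assume lij: "l \<noteq> i" "l \<noteq> j"
        have eq: "?g \<pi> k l - ?g ?p k l = swap_weight (pt n \<pi> k) (pt n \<pi> l) * (D k l \<pi> - D k l ?p)"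
          by (simp add: pt_swp(3)[OF kij] pt_swp(3)[OF lij] algebra_simps)
        have le: "\<bar>D k l \<pi> - D k l ?p\<bar> \<le> 2 * c / n"
        proof -
          have "D k l \<pi> - D k l ?p = (\<Phi> \<pi> (pt n \<pi> k) - \<Phi> ?p (pt n \<pi> k))
             - (\<Phi> \<pi> (cross (pt n \<pi> k) (pt n \<pi> l)) - \<Phi> ?p (cross (pt n \<pi> k) (pt n \<pi> l)))"
            by (simp add: D_def pt_swp(3)[OF kij] pt_swp(3)[OF lij])
          moreover have "\<bar>\<Phi> \<pi> (pt n \<pi> k) - \<Phi> ?p (pt n \<pi> k)\<bar> \<le> c / n"
            by (intro \<Phi>c p ij sq k)
          moreover have "\<bar>\<Phi> \<pi> (cross (pt n \<pi> k) (pt n \<pi> l)) - \<Phi> ?p (cross (pt n \<pi> k) (pt n \<pi> l))\<bar> \<le> c / n"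
            by (intro \<Phi>c p ij sq k l)
          ultimately show ?thesis by (simp add: abs_le_iff)
        qed
        have "\<bar>?g \<pi> k l - ?g ?p k l\<bar> = swap_weight (pt n \<pi> k) (pt n \<pi> l) * \<bar>D k l \<pi> - D k l ?p\<bar>"
          by (simp only: eq abs_mult abs_of_nonneg[OF q0])
        also have "\<dots> \<le> \<kappa> * (2 * c / n)"
          by (intro mult_mono \<kappa> sq p k l le \<kappa>0) simp
        finally show "\<bar>?g \<pi> k l - ?g ?p k l\<bar> \<le> \<kappa> * (2 * c) / n" by simp
      qed (use \<kappa>0 b c in auto)
      also have "\<dots> = \<kappa> * (2 * c + 8 * b) / n" by (simp add: algebra_simps)
      finally show "\<bar>avg n (?g \<pi> k) - avg n (?g ?p k)\<bar> \<le> \<kappa> * (2 * c + 8 * b) / n" .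
    qed (use \<kappa>0 b c in auto)
    also have "\<dots> = \<kappa> * (2 * c + 16 * b) / n" by (simp add: algebra_simps)
    finally show ?thesis .
  qed
  have pair: "2 * E n (\<lambda>\<pi>. swap_weight (pt n \<pi> i) (pt n \<pi> j) * (D i j \<pi> * Y \<pi>)) \<le> \<kappa> * (\<kappa> * (8 * b * c + 32 * b\<^sup>2) / n)"
    if ij: "i \<in> {1..n}" "j \<in> {1..n}" for i j
  proof -
    have "2 * E n (\<lambda>\<pi>. swap_weight (pt n \<pi> i) (pt n \<pi> j) * (D i j \<pi> * Y \<pi>)) =
       E n (\<lambda>\<pi>. swap_weight (pt n \<pi> i) (pt n \<pi> j) * (D i j \<pi> * Y \<pi>)) +
       E n (\<lambda>\<pi>. swap_weight (pt n \<pi> i) (pt n \<pi> j) * (D i j (swp \<pi> i j) * Y (swp \<pi> i j)))"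
      using E_swap[OF ij, of "\<lambda>\<pi>. D i j \<pi> * Y \<pi>"] by simp
    also have "\<dots> = E n (\<lambda>\<pi>. swap_weight (pt n \<pi> i) (pt n \<pi> j) * (D i j \<pi> * Y \<pi> + D i j (swp \<pi> i j) * Y (swp \<pi> i j)))"
      by (simp add: E_add[symmetric] distrib_left)
    also have "\<dots> \<le> \<kappa> * (\<kappa> * (8 * b * c + 32 * b\<^sup>2) / n)"
    proof (rule E_le)
      fix \<pi> assume p: "\<pi> \<in> perms n"
      let ?p = "swp \<pi> i j"
      have p': "?p \<in> perms n" by (rule swp_perms[OF p ij])
      have cc: "cross (cross (pt n \<pi> i) (pt n \<pi> j)) (cross (pt n \<pi> j) (pt n \<pi> i)) = pt n \<pi> i" by (simp add: cross_def)
      (* The swap exchanges z_i with its crossing, so the sum only sees the dependence of \<Phi> on the permutation. *)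
      have "D i j \<pi> + D i j ?p = (\<Phi> \<pi> (pt n \<pi> i) - \<Phi> ?p (pt n \<pi> i))
          - (\<Phi> \<pi> (cross (pt n \<pi> i) (pt n \<pi> j)) - \<Phi> ?p (cross (pt n \<pi> i) (pt n \<pi> j)))"
        by (simp add: D_def pt_swp cc)
      moreover have "\<bar>\<Phi> \<pi> (pt n \<pi> i) - \<Phi> ?p (pt n \<pi> i)\<bar> \<le> c / n" by (intro \<Phi>c p ij sq)
      moreover have "\<bar>\<Phi> \<pi> (cross (pt n \<pi> i) (pt n \<pi> j)) - \<Phi> ?p (cross (pt n \<pi> i) (pt n \<pi> j))\<bar> \<le> c / n"
        by (intro \<Phi>c p ij sq)
      ultimately have D_sum: "\<bar>D i j \<pi> + D i j ?p\<bar> \<le> 2 * c / n" by (simp add: abs_le_iff)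
      have "\<bar>D i j \<pi> * Y \<pi> + D i j ?p * Y ?p\<bar> = \<bar>(D i j \<pi> + D i j ?p) * Y \<pi> - D i j ?p * (Y \<pi> - Y ?p)\<bar>"
        by (simp add: algebra_simps)
      also have "\<dots> \<le> \<bar>D i j \<pi> + D i j ?p\<bar> * \<bar>Y \<pi>\<bar> + \<bar>D i j ?p\<bar> * \<bar>Y \<pi> - Y ?p\<bar>"
        using abs_triangle_ineq4 by (metis abs_mult)
      also have "\<dots> \<le> (2 * c / n) * (\<kappa> * (2 * b)) + (2 * b) * (\<kappa> * (2 * c + 16 * b) / n)"
        using c b n by (intro add_mono mult_mono D_sum Yb Db Yc p p' ij) auto
      also have "\<dots> = \<kappa> * (8 * b * c + 32 * b\<^sup>2) / n"
        using n by (simp add: field_simps power2_eq_square)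
      finally have *: "\<bar>D i j \<pi> * Y \<pi> + D i j ?p * Y ?p\<bar> \<le> \<kappa> * (8 * b * c + 32 * b\<^sup>2) / n" .
      have "swap_weight (pt n \<pi> i) (pt n \<pi> j) * (D i j \<pi> * Y \<pi> + D i j ?p * Y ?p)
          \<le> swap_weight (pt n \<pi> i) (pt n \<pi> j) * (\<kappa> * (8 * b * c + 32 * b\<^sup>2) / n)"
        using * q0 by (intro mult_left_mono) auto
      also have "\<dots> \<le> \<kappa> * (\<kappa> * (8 * b * c + 32 * b\<^sup>2) / n)"
        using b c \<kappa>0 by (intro mult_right_mono \<kappa> sq p ij) auto
      finally show "swap_weight (pt n \<pi> i) (pt n \<pi> j) * (D i j \<pi> * Y \<pi> + D i j ?p * Y ?p) \<le> \<kappa> * (\<kappa> * (8 * b * c + 32 * b\<^sup>2) / n)" .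
    qed
    finally show ?thesis .
  qed
  have "2 * E n (\<lambda>\<pi>. (Y \<pi>)\<^sup>2) = 2 * E n (\<lambda>\<pi>. avg n (\<lambda>i. avg n (\<lambda>j. swap_weight (pt n \<pi> i) (pt n \<pi> j) * (D i j \<pi> * Y \<pi>))))"
  proof -
    have "(Y \<pi>)\<^sup>2 = avg n (\<lambda>i. avg n (\<lambda>j. swap_weight (pt n \<pi> i) (pt n \<pi> j) * (D i j \<pi> * Y \<pi>)))" for \<pi>
    proof -
      have "(Y \<pi>)\<^sup>2 = avg n (\<lambda>i. avg n (\<lambda>j. swap_weight (pt n \<pi> i) (pt n \<pi> j) * D i j \<pi>)) * Y \<pi>"
        by (simp add: power2_eq_square YD[symmetric])
      then show ?thesis unfolding avg_cmult_right[symmetric] by (simp add: mult.assoc)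
    qed
    then show ?thesis by simp
  qed
  also have "\<dots> = avg n (\<lambda>i. avg n (\<lambda>j. 2 * E n (\<lambda>\<pi>. swap_weight (pt n \<pi> i) (pt n \<pi> j) * (D i j \<pi> * Y \<pi>))))"
    by (simp add: E_avg avg_cmult)
  also have "\<dots> \<le> \<kappa> * (\<kappa> * (8 * b * c + 32 * b\<^sup>2) / n)"
    by (intro avg_le n pair)
  also have "\<dots> = 2 * (\<kappa>\<^sup>2 * (4 * b * c + 16 * b\<^sup>2) / n)"
    by (simp add: power2_eq_square algebra_simps)
  finally show ?thesis by (simp add: Y_def[symmetric])
qed

lemma factor_defect_first_moment:
  assumes n: "n > 0" and \<kappa>: "\<And>z z'. z \<in> unit_square \<Longrightarrow> z' \<in> unit_square \<Longrightarrow> swap_weight z z' \<le> \<kappa>"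
    and \<Phi>: "\<And>z. z \<in> unit_square \<Longrightarrow> stable n (\<lambda>\<pi>. \<Phi> \<pi> z) b c"
  shows "E n (\<lambda>\<pi>. \<bar>factor_defect n \<Phi> \<pi>\<bar>) \<le> (1 + \<kappa>\<^sup>2 * (4 * b * c + 16 * b\<^sup>2)) / sqrt n"
proof -
  define K where "K = \<kappa>\<^sup>2 * (4 * b * c + 16 * b\<^sup>2)"
  have "E n (\<lambda>\<pi>. \<bar>factor_defect n \<Phi> \<pi>\<bar>) \<le> 1 / sqrt n + E n (\<lambda>\<pi>. (factor_defect n \<Phi> \<pi>)\<^sup>2) / (1 / sqrt n)"
    by (rule E_abs_le_L2) (use n in auto)
  also have "\<dots> \<le> 1 / sqrt n + (K / n) / (1 / sqrt n)"
    using factor_defect_second_moment[OF assms] unfolding K_def by (intro add_left_mono divide_right_mono) auto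
  also have "(K / n) / (1 / sqrt n) = K / sqrt n"
    using n real_sqrt_mult_self[of "real n"] by (simp add: field_simps)
  finally show ?thesis by (simp add: K_def add_divide_distrib)
qed

end

section \<open>The law of large numbers\<close>

context doubly_stochastic
begin

lemma M_bounds:
  obtains m C where "0 < m" "\<And>z. z \<in> unit_square \<Longrightarrow> m \<le> M z" "\<And>z. z \<in> unit_square \<Longrightarrow> M z \<le> C"
proof -
  have "(0, 0) \<in> unit_square" by (simp add: unit_square_def)
  then have c: "compact unit_square" "continuous_on unit_square M" "unit_square \<noteq> {}"
    using continuous_on_subset[OF M_cont] compact_cbox unfolding unit_square_cbox by blast+
  obtain z0 where z0: "z0 \<in> unit_square" "\<And>z. z \<in> unit_square \<Longrightarrow> M z0 \<le> M z"
    using continuous_attains_inf[OF c(1,3,2)] by blast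
  obtain z1 where z1: "z1 \<in> unit_square" "\<And>z. z \<in> unit_square \<Longrightarrow> M z \<le> M z1"
    using continuous_attains_sup[OF c(1,3,2)] by blast
  show ?thesis by (rule that[of "M z0" "M z1"]) (use z0 z1 M_pos in auto)
qed

text \<open>The total mass of the reweighted empirical measure \<open>\<rho>\<close>; \<open>col_field\<close> and \<open>row_field\<close> below integrate \<open>M\<close>
  against its two marginals.\<close>

definition inv_mass :: "nat \<Rightarrow> (nat \<Rightarrow> nat) \<Rightarrow> real" where
  "inv_mass n \<pi> = emp n \<pi> (\<lambda>z. 1 / M z)"

definition col_field :: "nat \<Rightarrow> (nat \<Rightarrow> nat) \<Rightarrow> real \<Rightarrow> real" where
  "col_field n \<pi> y = emp n \<pi> (\<lambda>z. M (fst z, y) / M z)"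

definition row_field :: "nat \<Rightarrow> (nat \<Rightarrow> nat) \<Rightarrow> real \<Rightarrow> real" where
  "row_field n \<pi> x = emp n \<pi> (\<lambda>z. M (x, snd z) / M z)"

lemma factor_defect_alt: "factor_defect n \<Phi> \<pi> = inv_mass n \<pi> * avg n (\<lambda>i. \<Phi> \<pi> (pt n \<pi> i) / M (pt n \<pi> i))
   - avg n (\<lambda>i. avg n (\<lambda>j. \<Phi> \<pi> (cross (pt n \<pi> i) (pt n \<pi> j)) / (M (pt n \<pi> i) * M (pt n \<pi> j))))"
proof -
  have "factor_defect n \<Phi> \<pi> = avg n (\<lambda>i. avg n (\<lambda>j. \<Phi> \<pi> (pt n \<pi> i) / M (pt n \<pi> i) * (1 / M (pt n \<pi> j))
     - \<Phi> \<pi> (cross (pt n \<pi> i) (pt n \<pi> j)) / (M (pt n \<pi> i) * M (pt n \<pi> j))))"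
    by (simp add: factor_defect_def swap_weight_def diff_divide_distrib)
  also have "\<dots> = avg n (\<lambda>i. \<Phi> \<pi> (pt n \<pi> i) / M (pt n \<pi> i) * inv_mass n \<pi>
     - avg n (\<lambda>j. \<Phi> \<pi> (cross (pt n \<pi> i) (pt n \<pi> j)) / (M (pt n \<pi> i) * M (pt n \<pi> j))))"
    by (simp only: avg_diff avg_cmult inv_mass_def emp_def)
  also have "\<dots> = avg n (\<lambda>i. \<Phi> \<pi> (pt n \<pi> i) / M (pt n \<pi> i)) * inv_mass n \<pi>
     - avg n (\<lambda>i. avg n (\<lambda>j. \<Phi> \<pi> (cross (pt n \<pi> i) (pt n \<pi> j)) / (M (pt n \<pi> i) * M (pt n \<pi> j))))"
    by (simp only: avg_diff avg_cmult_right)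
  finally show ?thesis by (simp add: mult.commute)
qed

lemma M_ne: "M z \<noteq> 0" using M_pos[of z] by simp

context
  fixes m C :: real
  assumes m_pos: "0 < m" and m_le: "\<And>z. z \<in> unit_square \<Longrightarrow> m \<le> M z"
    and M_le: "\<And>z. z \<in> unit_square \<Longrightarrow> M z \<le> C"
begin

lemma C_pos: "0 < C"
  using m_pos m_le[of "(0,0)"] M_le[of "(0,0)"] by (auto simp: unit_square_def)

lemma ratio_bounds:
  assumes "z \<in> unit_square" "z' \<in> unit_square"
  shows "m / C \<le> M z / M z'" "M z / M z' \<le> C / m"
  using m_le[OF assms(1)] m_le[OF assms(2)] M_le[OF assms(1)] M_le[OF assms(2)] m_pos C_pos M_pos[of z] M_pos[of z']
  by (auto intro!: frac_le)

lemma swap_weight_le: "z \<in> unit_square \<Longrightarrow> z' \<in> unit_square \<Longrightarrow> swap_weight z z' \<le> 1 / (m * m)"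
  unfolding swap_weight_def using m_le[of z] m_le[of z'] m_pos by (intro divide_left_mono mult_mono mult_pos_pos) (auto intro: M_pos)

lemma col_field_bounds:
  assumes "n > 0" "\<pi> \<in> perms n" "y \<in> {0..1}"
  shows "m / C \<le> col_field n \<pi> y" "col_field n \<pi> y \<le> C / m"
proof -
  have "pt n \<pi> i \<in> unit_square" "(fst (pt n \<pi> i), y) \<in> unit_square" if "i \<in> {1..n}" for i
    using pt_square[OF assms(2) that] assms(3) by (auto simp: unit_square_def)
  then show "m / C \<le> col_field n \<pi> y" "col_field n \<pi> y \<le> C / m"
    unfolding col_field_def emp_def using assms(1) by (auto intro!: avg_le avg_ge ratio_bounds simp del: atLeastAtMost_iff)
qed

lemma row_field_bounds:
  assumes "n > 0" "\<pi> \<in> perms n" "x \<in> {0..1}"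
  shows "m / C \<le> row_field n \<pi> x" "row_field n \<pi> x \<le> C / m"
proof -
  have "pt n \<pi> i \<in> unit_square" "(x, snd (pt n \<pi> i)) \<in> unit_square" if "i \<in> {1..n}" for i
    using pt_square[OF assms(2) that] assms(3) by (auto simp: unit_square_def)
  then show "m / C \<le> row_field n \<pi> x" "row_field n \<pi> x \<le> C / m"
    unfolding row_field_def emp_def using assms(1) by (auto intro!: avg_le avg_ge ratio_bounds simp del: atLeastAtMost_iff)
qed

lemma inv_mass_bounds:
  assumes "n > 0" "\<pi> \<in> perms n"
  shows "1 / C \<le> inv_mass n \<pi>" "inv_mass n \<pi> \<le> 1 / m"
proof -
  have "1 / C \<le> 1 / M (pt n \<pi> i)" "1 / M (pt n \<pi> i) \<le> 1 / m" if "i \<in> {1..n}" for i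
    using m_le[OF pt_square[OF assms(2) that]] M_le[OF pt_square[OF assms(2) that]] m_pos C_pos M_pos[of "pt n \<pi> i"]
    by (auto intro!: frac_le)
  then show "1 / C \<le> inv_mass n \<pi>" "inv_mass n \<pi> \<le> 1 / m"
    unfolding inv_mass_def emp_def using assms(1) by (auto intro!: avg_le avg_ge simp del: atLeastAtMost_iff)
qed

lemma col_field_stable: "n > 0 \<Longrightarrow> y \<in> {0..1} \<Longrightarrow> stable n (\<lambda>\<pi>. col_field n \<pi> y) (C / m) (4 * (C / m))"
  unfolding col_field_def
proof (rule stable_emp)
  fix z :: "real \<times> real" assume "y \<in> {0..1}" "z \<in> unit_square"
  then have "(fst z, y) \<in> unit_square" "z \<in> unit_square" by (auto simp: unit_square_def)
  from ratio_bounds(2)[OF this] show "\<bar>M (fst z, y) / M z\<bar> \<le> C / m" using M_pos by (simp add: less_imp_le)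
qed (use C_pos m_pos in auto)

lemma row_field_stable: "n > 0 \<Longrightarrow> x \<in> {0..1} \<Longrightarrow> stable n (\<lambda>\<pi>. row_field n \<pi> x) (C / m) (4 * (C / m))"
  unfolding row_field_def
proof (rule stable_emp)
  fix z :: "real \<times> real" assume "x \<in> {0..1}" "z \<in> unit_square"
  then have "(x, snd z) \<in> unit_square" "z \<in> unit_square" by (auto simp: unit_square_def)
  from ratio_bounds(2)[OF this] show "\<bar>M (x, snd z) / M z\<bar> \<le> C / m" using M_pos by (simp add: less_imp_le)
qed (use C_pos m_pos in auto)

lemma factor_defect_bound:
  obtains K where "0 \<le> K" "\<And>n \<Phi>. n > 0 \<Longrightarrow> (\<And>z. z \<in> unit_square \<Longrightarrow> stable n (\<lambda>\<pi>. \<Phi> \<pi> z) b c)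
     \<Longrightarrow> E n (\<lambda>\<pi>. \<bar>factor_defect n \<Phi> \<pi>\<bar>) \<le> K / sqrt n"
proof -
  let ?K = "1 + (1 / (m * m))\<^sup>2 * (4 * b * c + 16 * b\<^sup>2)"
  have b: "E n (\<lambda>\<pi>. \<bar>factor_defect n \<Phi> \<pi>\<bar>) \<le> ?K / sqrt n"
    if "n > 0" "\<And>z. z \<in> unit_square \<Longrightarrow> stable n (\<lambda>\<pi>. \<Phi> \<pi> z) b c" for n \<Phi>
    using that by (intro factor_defect_first_moment swap_weight_le)
  show ?thesis
  proof (rule that[of "max 0 ?K"])
    fix n \<Phi> assume n: "n > 0" "\<And>z. z \<in> unit_square \<Longrightarrow> stable n (\<lambda>\<pi>. \<Phi> \<pi> z) b c"
    have "?K / sqrt n \<le> max 0 ?K / sqrt n" by (intro divide_right_mono) auto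
    moreover have "E n (\<lambda>\<pi>. \<bar>factor_defect n \<Phi> \<pi>\<bar>) \<le> ?K / sqrt n" by (rule b[OF n])
    ultimately show "E n (\<lambda>\<pi>. \<bar>factor_defect n \<Phi> \<pi>\<bar>) \<le> max 0 ?K / sqrt n" by linarith
  qed simp
qed

text \<open>The factor defect of \<open>\<Phi>(x,y) = M(x,y) u(x) / row_field(x)\<close>: dividing by the row field makes the inner
  average collapse. The column version is \<open>col_test\<close>.\<close>

definition row_test :: "nat \<Rightarrow> ((nat \<Rightarrow> nat) \<Rightarrow> real \<Rightarrow> real) \<Rightarrow> (nat \<Rightarrow> nat) \<Rightarrow> real" where
  "row_test n u \<pi> = inv_mass n \<pi> * avg n (\<lambda>i. u \<pi> (i / n) / row_field n \<pi> (i / n)) - emp n \<pi> (\<lambda>z. u \<pi> (fst z) / M z)"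

definition col_test :: "nat \<Rightarrow> ((nat \<Rightarrow> nat) \<Rightarrow> real \<Rightarrow> real) \<Rightarrow> (nat \<Rightarrow> nat) \<Rightarrow> real" where
  "col_test n v \<pi> = inv_mass n \<pi> * avg n (\<lambda>j. v \<pi> (j / n) / col_field n \<pi> (j / n)) - emp n \<pi> (\<lambda>z. v \<pi> (snd z) / M z)"

lemma node: "i \<in> {1..n} \<Longrightarrow> real i / real n \<in> {0..1}"
  by (auto simp: divide_le_eq)

lemma row_test_bound:
  obtains K where "0 \<le> K" "\<And>n u. n > 0 \<Longrightarrow> (\<And>x. x \<in> {0..1} \<Longrightarrow> stable n (\<lambda>\<pi>. u \<pi> x) b c)
     \<Longrightarrow> E n (\<lambda>\<pi>. \<bar>row_test n u \<pi>\<bar>) \<le> K / sqrt n"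
proof -
  have mC: "m / C > 0" using m_pos C_pos by simp
  let ?b = "(C * b) * (1 / (m / C))"
  let ?c = "(C * b) * (4 * (C / m) / (m / C)\<^sup>2) + (1 / (m / C)) * (C * c + b * 0)"
  obtain K where K: "0 \<le> K" "\<And>n \<Phi>. n > 0 \<Longrightarrow> (\<And>z. z \<in> unit_square \<Longrightarrow> stable n (\<lambda>\<pi>. \<Phi> \<pi> z) ?b ?c)
     \<Longrightarrow> E n (\<lambda>\<pi>. \<bar>factor_defect n \<Phi> \<pi>\<bar>) \<le> K / sqrt n" using factor_defect_bound by blast
  show ?thesis
  proof (rule that[OF K(1)])
    fix n :: nat and u :: "(nat \<Rightarrow> nat) \<Rightarrow> real \<Rightarrow> real" assume n: "n > 0" and u: "\<And>x. x \<in> {0..1} \<Longrightarrow> stable n (\<lambda>\<pi>. u \<pi> x) b c"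
    let ?\<Phi> = "\<lambda>\<pi> z. M z * u \<pi> (fst z) * (1 / row_field n \<pi> (fst z))"
    have "E n (\<lambda>\<pi>. \<bar>factor_defect n ?\<Phi> \<pi>\<bar>) \<le> K / sqrt n"
    proof (rule K(2)[OF n])
      fix z assume z: "z \<in> unit_square"
      then have x: "fst z \<in> {0..1}" by (auto simp: unit_square_def)
      show "stable n (\<lambda>\<pi>. ?\<Phi> \<pi> z) ?b ?c"
        by (intro stable_mult stable_inverse[OF row_field_stable[OF n x] mC] row_field_bounds n x u stable_const)
           (use M_le[OF z] M_pos[of z] in simp)
    qed
    moreover have "factor_defect n ?\<Phi> \<pi> = row_test n u \<pi>" if p: "\<pi> \<in> perms n" for \<pi>
    proof -
      have "avg n (\<lambda>j. ?\<Phi> \<pi> (cross (pt n \<pi> i) (pt n \<pi> j)) / (M (pt n \<pi> i) * M (pt n \<pi> j))) = u \<pi> (fst (pt n \<pi> i)) / M (pt n \<pi> i)"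
        if i: "i \<in> {1..n}" for i
      proof -
        let ?x = "fst (pt n \<pi> i)"
        have "?x \<in> {0..1}" using pt_square[OF p i] by (auto simp: unit_square_def)
        then have B: "row_field n \<pi> ?x > 0" using row_field_bounds(1)[OF n p, of ?x] mC by linarith
        have "avg n (\<lambda>j. ?\<Phi> \<pi> (cross (pt n \<pi> i) (pt n \<pi> j)) / (M (pt n \<pi> i) * M (pt n \<pi> j)))
          = avg n (\<lambda>j. u \<pi> ?x / (row_field n \<pi> ?x * M (pt n \<pi> i)) * (M (?x, snd (pt n \<pi> j)) / M (pt n \<pi> j)))"
          by (intro avg_cong) (simp add: cross_def mult_ac)
        also have "\<dots> = u \<pi> ?x / (row_field n \<pi> ?x * M (pt n \<pi> i)) * row_field n \<pi> ?x"
          by (simp only: avg_cmult) (simp only: row_field_def emp_def)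
        finally show ?thesis using B by simp
      qed
      then have "avg n (\<lambda>i. avg n (\<lambda>j. ?\<Phi> \<pi> (cross (pt n \<pi> i) (pt n \<pi> j)) / (M (pt n \<pi> i) * M (pt n \<pi> j))))
         = emp n \<pi> (\<lambda>z. u \<pi> (fst z) / M z)"
        unfolding emp_def by (intro avg_cong)
      moreover have "avg n (\<lambda>i. ?\<Phi> \<pi> (pt n \<pi> i) / M (pt n \<pi> i)) = avg n (\<lambda>i. u \<pi> (i / n) / row_field n \<pi> (i / n))"
        by (intro avg_cong) (simp add: M_ne pt_def)
      ultimately show ?thesis unfolding factor_defect_alt row_test_def by simp
    qed
    then have "E n (\<lambda>\<pi>. \<bar>factor_defect n ?\<Phi> \<pi>\<bar>) = E n (\<lambda>\<pi>. \<bar>row_test n u \<pi>\<bar>)" by (intro E_cong) simp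
    ultimately show "E n (\<lambda>\<pi>. \<bar>row_test n u \<pi>\<bar>) \<le> K / sqrt n" by simp
  qed
qed

lemma col_test_bound:
  obtains K where "0 \<le> K" "\<And>n v. n > 0 \<Longrightarrow> (\<And>y. y \<in> {0..1} \<Longrightarrow> stable n (\<lambda>\<pi>. v \<pi> y) b c)
     \<Longrightarrow> E n (\<lambda>\<pi>. \<bar>col_test n v \<pi>\<bar>) \<le> K / sqrt n"
proof -
  have mC: "m / C > 0" using m_pos C_pos by simp
  let ?b = "(C * b) * (1 / (m / C))"
  let ?c = "(C * b) * (4 * (C / m) / (m / C)\<^sup>2) + (1 / (m / C)) * (C * c + b * 0)"
  obtain K where K: "0 \<le> K" "\<And>n \<Phi>. n > 0 \<Longrightarrow> (\<And>z. z \<in> unit_square \<Longrightarrow> stable n (\<lambda>\<pi>. \<Phi> \<pi> z) ?b ?c)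
     \<Longrightarrow> E n (\<lambda>\<pi>. \<bar>factor_defect n \<Phi> \<pi>\<bar>) \<le> K / sqrt n" using factor_defect_bound by blast
  show ?thesis
  proof (rule that[OF K(1)])
    fix n :: nat and v :: "(nat \<Rightarrow> nat) \<Rightarrow> real \<Rightarrow> real" assume n: "n > 0" and v: "\<And>x. x \<in> {0..1} \<Longrightarrow> stable n (\<lambda>\<pi>. v \<pi> x) b c"
    let ?\<Phi> = "\<lambda>\<pi> z. M z * v \<pi> (snd z) * (1 / col_field n \<pi> (snd z))"
    have "E n (\<lambda>\<pi>. \<bar>factor_defect n ?\<Phi> \<pi>\<bar>) \<le> K / sqrt n"
    proof (rule K(2)[OF n])
      fix z assume z: "z \<in> unit_square"
      then have x: "snd z \<in> {0..1}" by (auto simp: unit_square_def)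
      show "stable n (\<lambda>\<pi>. ?\<Phi> \<pi> z) ?b ?c"
        by (intro stable_mult stable_inverse[OF col_field_stable[OF n x] mC] col_field_bounds n x v stable_const)
           (use M_le[OF z] M_pos[of z] in simp)
    qed
    moreover have "factor_defect n ?\<Phi> \<pi> = col_test n v \<pi>" if p: "\<pi> \<in> perms n" for \<pi>
    proof -
      have "avg n (\<lambda>i. ?\<Phi> \<pi> (cross (pt n \<pi> i) (pt n \<pi> j)) / (M (pt n \<pi> i) * M (pt n \<pi> j))) = v \<pi> (snd (pt n \<pi> j)) / M (pt n \<pi> j)"
        if j: "j \<in> {1..n}" for j
      proof -
        let ?y = "snd (pt n \<pi> j)"
        have "?y \<in> {0..1}" using pt_square[OF p j] by (auto simp: unit_square_def)
        then have A: "col_field n \<pi> ?y > 0" using col_field_bounds(1)[OF n p, of ?y] mC by linarith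
        have "avg n (\<lambda>i. ?\<Phi> \<pi> (cross (pt n \<pi> i) (pt n \<pi> j)) / (M (pt n \<pi> i) * M (pt n \<pi> j)))
          = avg n (\<lambda>i. v \<pi> ?y / (col_field n \<pi> ?y * M (pt n \<pi> j)) * (M (fst (pt n \<pi> i), ?y) / M (pt n \<pi> i)))"
          by (intro avg_cong) (simp add: cross_def mult_ac)
        also have "\<dots> = v \<pi> ?y / (col_field n \<pi> ?y * M (pt n \<pi> j)) * col_field n \<pi> ?y"
          by (simp only: avg_cmult) (simp only: col_field_def emp_def)
        finally show ?thesis using A by simp
      qed
      then have "avg n (\<lambda>j. avg n (\<lambda>i. ?\<Phi> \<pi> (cross (pt n \<pi> i) (pt n \<pi> j)) / (M (pt n \<pi> i) * M (pt n \<pi> j))))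
         = emp n \<pi> (\<lambda>z. v \<pi> (snd z) / M z)"
        unfolding emp_def by (intro avg_cong)
      moreover have "avg n (\<lambda>i. ?\<Phi> \<pi> (pt n \<pi> i) / M (pt n \<pi> i)) = avg n (\<lambda>i. v \<pi> (\<pi> i / n) / col_field n \<pi> (\<pi> i / n))"
        by (intro avg_cong) (simp add: M_ne pt_def)
      moreover have "\<dots> = avg n (\<lambda>j. v \<pi> (j / n) / col_field n \<pi> (j / n))"
        using avg_perm[OF p, of "\<lambda>j. v \<pi> (j / n) / col_field n \<pi> (j / n)"] .
      ultimately show ?thesis unfolding factor_defect_alt col_test_def by (subst avg_swap) simp
    qed
    then have "E n (\<lambda>\<pi>. \<bar>factor_defect n ?\<Phi> \<pi>\<bar>) = E n (\<lambda>\<pi>. \<bar>col_test n v \<pi>\<bar>)" by (intro E_cong) simp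
    ultimately show "E n (\<lambda>\<pi>. \<bar>col_test n v \<pi>\<bar>) \<le> K / sqrt n" by simp
  qed
qed

lemma plain_test_bound:
  assumes F: "\<And>z. z \<in> unit_square \<Longrightarrow> \<bar>F z\<bar> \<le> b"
  obtains K where "0 \<le> K" "\<And>n. n > 0 \<Longrightarrow>
     E n (\<lambda>\<pi>. \<bar>inv_mass n \<pi> * emp n \<pi> F - emp n \<pi> (\<lambda>z. emp n \<pi> (\<lambda>z'. F (fst z, snd z') * M (fst z, snd z') / M z') / M z)\<bar>) \<le> K / sqrt n"
proof -
  have b: "0 \<le> b" using F[of "(0,0)"] by (simp add: unit_square_def)
  obtain K where K: "0 \<le> K" "\<And>n \<Phi>. n > 0 \<Longrightarrow> (\<And>z. z \<in> unit_square \<Longrightarrow> stable n (\<lambda>\<pi>. \<Phi> \<pi> z) (C * b) 0)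
     \<Longrightarrow> E n (\<lambda>\<pi>. \<bar>factor_defect n \<Phi> \<pi>\<bar>) \<le> K / sqrt n" using factor_defect_bound by blast
  show ?thesis
  proof (rule that[OF K(1)])
    fix n :: nat assume n: "n > 0"
    have 1: "E n (\<lambda>\<pi>. \<bar>factor_defect n (\<lambda>\<pi> z. M z * F z) \<pi>\<bar>) \<le> K / sqrt n"
    proof (rule K(2)[OF n], rule stable_const)
      fix z assume z: "z \<in> unit_square"
      show "\<bar>M z * F z\<bar> \<le> C * b" unfolding abs_mult
        using M_le[OF z] M_pos[of z] F[OF z] by (intro mult_mono) auto
    qed
    have "factor_defect n (\<lambda>\<pi> z. M z * F z) \<pi> = inv_mass n \<pi> * emp n \<pi> F - emp n \<pi> (\<lambda>z. emp n \<pi> (\<lambda>z'. F (fst z, snd z') * M (fst z, snd z') / M z') / M z)" for \<pi>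
    proof -
      have "avg n (\<lambda>i. M (pt n \<pi> i) * F (pt n \<pi> i) / M (pt n \<pi> i)) = emp n \<pi> F"
        unfolding emp_def by (intro avg_cong) (simp add: M_ne)
      moreover have "avg n (\<lambda>j. M (cross (pt n \<pi> i) (pt n \<pi> j)) * F (cross (pt n \<pi> i) (pt n \<pi> j)) / (M (pt n \<pi> i) * M (pt n \<pi> j)))
         = emp n \<pi> (\<lambda>z'. F (fst (pt n \<pi> i), snd z') * M (fst (pt n \<pi> i), snd z') / M z') / M (pt n \<pi> i)" for i
        unfolding emp_def using avg_cmult_right[of n _ "1 / M (pt n \<pi> i)", symmetric]
        by (simp add: cross_def mult_ac)
      ultimately show ?thesis unfolding factor_defect_alt by (simp add: emp_def)
    qed
    with 1 show "E n (\<lambda>\<pi>. \<bar>inv_mass n \<pi> * emp n \<pi> F - emp n \<pi> (\<lambda>z. emp n \<pi> (\<lambda>z'. F (fst z, snd z') * M (fst z, snd z') / M z') / M z)\<bar>) \<le> K / sqrt n"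
      by simp
  qed
qed

lemma avg_mono_abs: "(\<And>i. i \<in> {1..n} \<Longrightarrow> \<bar>\<phi> i\<bar> \<le> \<psi> i) \<Longrightarrow> \<bar>avg n \<phi>\<bar> \<le> avg n \<psi>"
  by (rule order_trans[OF avg_abs avg_mono])

text \<open>The tests show that the empirical measure is close to \<open>M s\<close> with \<open>s = inv_mass / (row_field col_field)\<close>
  on the grid, and that \<open>M s\<close> has nearly uniform marginals. Since \<open>col_field (s - 1)\<close> is a function of \<open>x\<close>
  minus a function of \<open>y\<close>, the average of \<open>M col_field (s - 1)\<^sup>2\<close> is the difference of the marginals of \<open>M s\<close>
  and \<open>M\<close> tested against these functions, and is therefore small.\<close>

lemma LLN_estimate:
  assumes F: "\<And>z. z \<in> unit_square \<Longrightarrow> \<bar>F z\<bar> \<le> b"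
  obtains K where "0 \<le> K" "\<And>n \<rho> a. n > 0 \<Longrightarrow> 0 \<le> \<rho> \<Longrightarrow> 0 < a \<Longrightarrow>
     (\<And>x. x \<in> {0..1} \<Longrightarrow> \<bar>avg n (\<lambda>j. M (x, j / n)) - 1\<bar> \<le> \<rho>) \<Longrightarrow>
     (\<And>y. y \<in> {0..1} \<Longrightarrow> \<bar>avg n (\<lambda>i. M (i / n, y)) - 1\<bar> \<le> \<rho>) \<Longrightarrow>
     E n (\<lambda>\<pi>. \<bar>emp n \<pi> F - avg n (\<lambda>i. avg n (\<lambda>j. F (i / n, j / n) * M (i / n, j / n)))\<bar>)
       \<le> K * (1 / sqrt n + a + (1 / sqrt n + \<rho>) / a)"
proof -
  have b: "0 \<le> b" using F[of "(0,0)"] by (simp add: unit_square_def)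
  have mC: "m / C > 0" "C / m > 0" using m_pos C_pos by auto
  obtain K1 where K1: "0 \<le> K1" "\<And>n u. n > 0 \<Longrightarrow> (\<And>x. x \<in> {0..1} \<Longrightarrow> stable n (\<lambda>\<pi>. u \<pi> x) C 0)
     \<Longrightarrow> E n (\<lambda>\<pi>. \<bar>row_test n u \<pi>\<bar>) \<le> K1 / sqrt n" using row_test_bound by blast
  obtain K2 where K2: "0 \<le> K2" "\<And>n u. n > 0 \<Longrightarrow> (\<And>x. x \<in> {0..1} \<Longrightarrow> stable n (\<lambda>\<pi>. u \<pi> x) C 0)
     \<Longrightarrow> E n (\<lambda>\<pi>. \<bar>col_test n u \<pi>\<bar>) \<le> K2 / sqrt n" using col_test_bound by blast
  (* The test functions: U is random, and links the joint test T3 to the row test T4. *)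
  define U where "U n \<pi> x = emp n \<pi> (\<lambda>z'. F (x, snd z') * M (x, snd z') / M z')" for n \<pi> x
  define T3 where "T3 n \<pi> = inv_mass n \<pi> * emp n \<pi> F - emp n \<pi> (\<lambda>z. U n \<pi> (fst z) / M z)" for n \<pi>
  obtain K3 where K3: "0 \<le> K3" "\<And>n. n > 0 \<Longrightarrow> E n (\<lambda>\<pi>. \<bar>T3 n \<pi>\<bar>) \<le> K3 / sqrt n"
    unfolding T3_def U_def by (rule plain_test_bound[of F b, OF F]) blast+
  obtain K4 where K4: "0 \<le> K4" "\<And>n u. n > 0 \<Longrightarrow> (\<And>x. x \<in> {0..1} \<Longrightarrow> stable n (\<lambda>\<pi>. u \<pi> x) (b * (C / m)) (4 * (b * (C / m))))
     \<Longrightarrow> E n (\<lambda>\<pi>. \<bar>row_test n u \<pi>\<bar>) \<le> K4 / sqrt n" using row_test_bound by blast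
  obtain K5 where K5: "0 \<le> K5" "\<And>n u. n > 0 \<Longrightarrow> (\<And>x. x \<in> {0..1} \<Longrightarrow> stable n (\<lambda>\<pi>. u \<pi> x) (b * C) 0)
     \<Longrightarrow> E n (\<lambda>\<pi>. \<bar>col_test n u \<pi>\<bar>) \<le> K5 / sqrt n" using col_test_bound by blast
  define e1 where "e1 n \<pi> y = row_test n (\<lambda>\<pi> x. M (x, y)) \<pi>" for n \<pi> y
  define e2 where "e2 n \<pi> x = col_test n (\<lambda>\<pi> y. M (x, y)) \<pi>" for n \<pi> x
  define T4 where "T4 n \<pi> = row_test n (U n) \<pi>" for n \<pi>
  define e5 where "e5 n \<pi> x = col_test n (\<lambda>\<pi> y. F (x, y) * M (x, y)) \<pi>" for n \<pi> x
  have sq: "(x, y) \<in> unit_square" if "x \<in> {0..1}" "y \<in> {0..1}" for x y :: real using that by (simp add: unit_square_def)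
  have Mabs: "\<bar>M z\<bar> \<le> C" if "z \<in> unit_square" for z using M_le[OF that] M_pos[of z] by simp
  have FMabs: "\<bar>F z * M z\<bar> \<le> b * C" if "z \<in> unit_square" for z
    unfolding abs_mult using F[OF that] Mabs[OF that] b by (intro mult_mono) auto
  have Ee1: "E n (\<lambda>\<pi>. \<bar>e1 n \<pi> y\<bar>) \<le> K1 / sqrt n" if "n > 0" "y \<in> {0..1}" for n y
    unfolding e1_def using that by (intro K1(2) stable_const Mabs sq) auto
  have Ee2: "E n (\<lambda>\<pi>. \<bar>e2 n \<pi> x\<bar>) \<le> K2 / sqrt n" if "n > 0" "x \<in> {0..1}" for n x
    unfolding e2_def using that by (intro K2(2) stable_const Mabs sq) auto
  have Ee5: "E n (\<lambda>\<pi>. \<bar>e5 n \<pi> x\<bar>) \<le> K5 / sqrt n" if "n > 0" "x \<in> {0..1}" for n x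
    unfolding e5_def using that by (intro K5(2) stable_const FMabs sq) auto
  have ET4: "E n (\<lambda>\<pi>. \<bar>T4 n \<pi>\<bar>) \<le> K4 / sqrt n" if "n > 0" for n
    unfolding T4_def
  proof (rule K4(2)[OF that])
    fix x :: real assume x: "x \<in> {0..1}"
    show "stable n (\<lambda>\<pi>. U n \<pi> x) (b * (C / m)) (4 * (b * (C / m)))"
      unfolding U_def
    proof (rule stable_emp[OF that])
      fix z assume z: "z \<in> unit_square"
      then have z': "(x, snd z) \<in> unit_square" using x by (auto simp: unit_square_def)
      have "\<bar>F (x, snd z) * M (x, snd z) / M z\<bar> = \<bar>F (x, snd z)\<bar> * (M (x, snd z) / M z)"
        using M_pos by (simp add: abs_mult less_imp_le)
      also have "\<dots> \<le> b * (C / m)" using F[OF z'] ratio_bounds(2)[OF z' z] b M_pos by (intro mult_mono) (auto simp: less_imp_le)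
      finally show "\<bar>F (x, snd z) * M (x, snd z) / M z\<bar> \<le> b * (C / m)" .
    qed (use b m_pos C_pos in auto)
  qed
  define k where "k = C / (m * m)"
  have k: "k > 0" using m_pos C_pos by (simp add: k_def)
  define l where "l = (1 / m) * (C / m)"
  have l: "l > 0" using m_pos C_pos by (simp add: l_def)
  define h where "h = C / m"
  have h: "h > 0" using mC by (simp add: h_def)
  have pointwise: "\<bar>emp n \<pi> F - avg n (\<lambda>i. avg n (\<lambda>j. F (i / n, j / n) * M (i / n, j / n)))\<bar> \<le>
      C * \<bar>T3 n \<pi>\<bar> + C * \<bar>T4 n \<pi>\<bar> + h * avg n (\<lambda>i. \<bar>e5 n \<pi> (i / n)\<bar>) + b * C * a
      + (b * C * k / a) * (l * h * avg n (\<lambda>i. \<bar>e2 n \<pi> (i / n)\<bar>) + h * h * avg n (\<lambda>j. \<bar>e1 n \<pi> (j / n)\<bar>) + (l + h) * \<rho>)"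
    if n: "n > 0" and p: "\<pi> \<in> perms n" and a: "0 < a" and rho: "0 \<le> \<rho>"
      and row: "\<And>x. x \<in> {0..1} \<Longrightarrow> \<bar>avg n (\<lambda>j. M (x, j / n)) - 1\<bar> \<le> \<rho>"
      and col: "\<And>y. y \<in> {0..1} \<Longrightarrow> \<bar>avg n (\<lambda>i. M (i / n, y)) - 1\<bar> \<le> \<rho>" for n \<pi> a \<rho>
  proof -
    define R where "R = inv_mass n \<pi>"
    define A where "A j = col_field n \<pi> (real j / real n)" for j :: nat
    define B where "B i = row_field n \<pi> (real i / real n)" for i :: nat
    define N where "N i j = M (real i / real n, real j / real n)" for i j :: nat
    define G where "G i j = F (real i / real n, real j / real n)" for i j :: nat
    define s where "s i j = R / (B i * A j)" for i j
    have R: "1 / C \<le> R" "R \<le> 1 / m" using inv_mass_bounds[OF n p] by (auto simp: R_def)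
    have Rp: "R > 0" using R(1) C_pos by (smt (verit) divide_pos_pos)
    have A: "m / C \<le> A j" "A j \<le> h" "A j > 0" if "j \<in> {1..n}" for j
      using col_field_bounds[OF n p node[OF that]] mC by (auto simp: A_def h_def)
    have B: "m / C \<le> B j" "B j \<le> h" "B j > 0" if "j \<in> {1..n}" for j
      using row_field_bounds[OF n p node[OF that]] mC by (auto simp: B_def h_def)
    have N: "m \<le> N i j" "N i j \<le> C" if "i \<in> {1..n}" "j \<in> {1..n}" for i j
      using m_le[OF sq[OF node node]] M_le[OF sq[OF node node]] that by (auto simp: N_def)
    have invB: "1 / B i \<le> h" if "i \<in> {1..n}" for i
      using B[OF that] mC m_pos C_pos unfolding h_def by (metis frac_le divide_divide_eq_right mult_1 zero_le_one order_refl)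
    have invA: "1 / A i \<le> h" if "i \<in> {1..n}" for i
      using A[OF that] mC m_pos C_pos unfolding h_def by (metis frac_le divide_divide_eq_right mult_1 zero_le_one order_refl)
    (* By the tests e1 and e2 the density M s has marginals close to 1 along both axes. *)
    have E1: "avg n (\<lambda>i. N i j * s i j) = 1 + e1 n \<pi> (j / n) / A j" if j: "j \<in> {1..n}" for j
    proof -
      have "avg n (\<lambda>i. N i j * s i j) = avg n (\<lambda>i. (R / A j) * (N i j / B i))"
        by (intro avg_cong) (simp add: s_def mult_ac)
      also have "\<dots> = (R * avg n (\<lambda>i. N i j / B i)) / A j" by (simp only: avg_cmult) simp
      also have "R * avg n (\<lambda>i. N i j / B i) = e1 n \<pi> (j / n) + A j"
        by (simp add: e1_def row_test_def R_def N_def B_def A_def col_field_def)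
      finally show ?thesis using A(3)[OF j] by (simp add: add_divide_distrib)
    qed
    have E2: "avg n (\<lambda>j. N i j * s i j) = 1 + e2 n \<pi> (i / n) / B i" if i: "i \<in> {1..n}" for i
    proof -
      have "avg n (\<lambda>j. N i j * s i j) = avg n (\<lambda>j. (R / B i) * (N i j / A j))"
        by (intro avg_cong) (simp add: s_def mult_ac)
      also have "\<dots> = (R * avg n (\<lambda>j. N i j / A j)) / B i" by (simp only: avg_cmult) simp
      also have "R * avg n (\<lambda>j. N i j / A j) = e2 n \<pi> (i / n) + B i"
        by (simp add: e2_def col_test_def R_def N_def B_def A_def row_field_def)
      finally show ?thesis using B(3)[OF i] by (simp add: add_divide_distrib)
    qed
    have colb: "\<bar>avg n (\<lambda>i. N i j * (s i j - 1))\<bar> \<le> h * \<bar>e1 n \<pi> (j / n)\<bar> + \<rho>" if j: "j \<in> {1..n}" for j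
    proof -
      have "avg n (\<lambda>i. N i j * (s i j - 1)) = avg n (\<lambda>i. N i j * s i j) - avg n (\<lambda>i. N i j)"
        by (simp add: avg_diff[symmetric] right_diff_distrib)
      also have "\<dots> = (1 / A j) * e1 n \<pi> (j / n) - (avg n (\<lambda>i. N i j) - 1)" by (simp add: E1[OF j])
      also have "\<bar>\<dots>\<bar> \<le> \<bar>(1 / A j) * e1 n \<pi> (j / n)\<bar> + \<bar>avg n (\<lambda>i. N i j) - 1\<bar>" by (rule abs_triangle_ineq4)
      also have "\<dots> \<le> h * \<bar>e1 n \<pi> (j / n)\<bar> + \<rho>"
      proof (rule add_mono)
        show "\<bar>(1 / A j) * e1 n \<pi> (j / n)\<bar> \<le> h * \<bar>e1 n \<pi> (j / n)\<bar>"
          unfolding abs_mult using invA[OF j] A(3)[OF j] by (intro mult_right_mono) auto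
        show "\<bar>avg n (\<lambda>i. N i j) - 1\<bar> \<le> \<rho>" using col[OF node[OF j]] by (simp add: N_def)
      qed
      finally show ?thesis .
    qed
    have rowb: "\<bar>avg n (\<lambda>j. N i j * (s i j - 1))\<bar> \<le> h * \<bar>e2 n \<pi> (i / n)\<bar> + \<rho>" if i: "i \<in> {1..n}" for i
    proof -
      have "avg n (\<lambda>j. N i j * (s i j - 1)) = avg n (\<lambda>j. N i j * s i j) - avg n (\<lambda>j. N i j)"
        by (simp add: avg_diff[symmetric] right_diff_distrib)
      also have "\<dots> = (1 / B i) * e2 n \<pi> (i / n) - (avg n (\<lambda>j. N i j) - 1)" by (simp add: E2[OF i])
      also have "\<bar>\<dots>\<bar> \<le> \<bar>(1 / B i) * e2 n \<pi> (i / n)\<bar> + \<bar>avg n (\<lambda>j. N i j) - 1\<bar>" by (rule abs_triangle_ineq4)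
      also have "\<dots> \<le> h * \<bar>e2 n \<pi> (i / n)\<bar> + \<rho>"
      proof (rule add_mono)
        show "\<bar>(1 / B i) * e2 n \<pi> (i / n)\<bar> \<le> h * \<bar>e2 n \<pi> (i / n)\<bar>"
          unfolding abs_mult using invB[OF i] B(3)[OF i] by (intro mult_right_mono) auto
        show "\<bar>avg n (\<lambda>j. N i j) - 1\<bar> \<le> \<rho>" using row[OF node[OF i]] by (simp add: N_def)
      qed
      finally show ?thesis .
    qed
    let ?L1 = "avg n (\<lambda>j. \<bar>e1 n \<pi> (j / n)\<bar>)" and ?L2 = "avg n (\<lambda>i. \<bar>e2 n \<pi> (i / n)\<bar>)" and ?L5 = "avg n (\<lambda>i. \<bar>e5 n \<pi> (i / n)\<bar>)"
    have S: "avg n (\<lambda>i. avg n (\<lambda>j. (s i j - 1)\<^sup>2)) \<le> k * (l * h * ?L2 + h * h * ?L1 + (l + h) * \<rho>)"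
    proof -
      have "avg n (\<lambda>i. avg n (\<lambda>j. (s i j - 1)\<^sup>2)) \<le> avg n (\<lambda>i. avg n (\<lambda>j. k * (N i j * (s i j - 1) * (R / B i - A j))))"
      proof (intro avg_mono)
        fix i j assume i: "i \<in> {1..n}" and j: "j \<in> {1..n}"
        have "R / B i - A j = A j * (s i j - 1)" using A(3)[OF j] B(3)[OF i] by (simp add: s_def field_simps)
        then have eq: "k * (N i j * (s i j - 1) * (R / B i - A j)) = (k * (N i j * A j)) * (s i j - 1)\<^sup>2"
          by (simp add: power2_eq_square mult_ac)
        have "m * (m / C) \<le> N i j * A j" using N[OF i j] A[OF j] m_pos mC by (intro mult_mono) auto
        then have "k * (m * (m / C)) \<le> k * (N i j * A j)" using k by (intro mult_left_mono) auto
        then have "1 \<le> k * (N i j * A j)" using m_pos C_pos by (simp add: k_def)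
        then show "(s i j - 1)\<^sup>2 \<le> k * (N i j * (s i j - 1) * (R / B i - A j))"
          unfolding eq by (metis mult_1 mult_right_mono zero_le_power2)
      qed
      also have "\<dots> = k * avg n (\<lambda>i. avg n (\<lambda>j. N i j * (s i j - 1) * (R / B i - A j)))"
        by (simp only: avg_cmult)
      also have "avg n (\<lambda>i. avg n (\<lambda>j. N i j * (s i j - 1) * (R / B i - A j))) =
          avg n (\<lambda>i. (R / B i) * avg n (\<lambda>j. N i j * (s i j - 1))) - avg n (\<lambda>j. A j * avg n (\<lambda>i. N i j * (s i j - 1)))"
      proof -
        have "avg n (\<lambda>i. avg n (\<lambda>j. N i j * (s i j - 1) * (R / B i - A j)))
           = avg n (\<lambda>i. avg n (\<lambda>j. (R / B i) * (N i j * (s i j - 1)))) - avg n (\<lambda>i. avg n (\<lambda>j. A j * (N i j * (s i j - 1))))"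
        proof -
          have "N i j * (s i j - 1) * (R / B i - A j) = (R / B i) * (N i j * (s i j - 1)) - A j * (N i j * (s i j - 1))" for i j
            by (simp add: right_diff_distrib mult_ac)
          then show ?thesis by (simp only: avg_diff)
        qed
        then show ?thesis by (subst (asm) (2) avg_swap) (simp only: avg_cmult)
      qed
      also have "\<dots> \<le> avg n (\<lambda>i. l * (h * \<bar>e2 n \<pi> (i / n)\<bar> + \<rho>)) + avg n (\<lambda>j. h * (h * \<bar>e1 n \<pi> (j / n)\<bar> + \<rho>))"
      proof -
        have "\<bar>avg n (\<lambda>i. (R / B i) * avg n (\<lambda>j. N i j * (s i j - 1)))\<bar> \<le> avg n (\<lambda>i. l * (h * \<bar>e2 n \<pi> (i / n)\<bar> + \<rho>))"
        proof (rule avg_mono_abs)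
          fix i assume i: "i \<in> {1..n}"
          have "\<bar>R / B i\<bar> \<le> l"
          proof -
            have "R * (1 / B i) \<le> (1 / m) * h" using R Rp invB[OF i] B(3)[OF i] m_pos by (intro mult_mono) auto
            then show ?thesis using Rp B(3)[OF i] by (simp add: l_def h_def)
          qed
          then show "\<bar>(R / B i) * avg n (\<lambda>j. N i j * (s i j - 1))\<bar> \<le> l * (h * \<bar>e2 n \<pi> (i / n)\<bar> + \<rho>)"
            unfolding abs_mult[of "R / B i"] using l by (intro mult_mono rowb i) auto
        qed
        moreover have "\<bar>avg n (\<lambda>j. A j * avg n (\<lambda>i. N i j * (s i j - 1)))\<bar> \<le> avg n (\<lambda>j. h * (h * \<bar>e1 n \<pi> (j / n)\<bar> + \<rho>))"
        proof (rule avg_mono_abs)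
          fix j assume j: "j \<in> {1..n}"
          show "\<bar>A j * avg n (\<lambda>i. N i j * (s i j - 1))\<bar> \<le> h * (h * \<bar>e1 n \<pi> (j / n)\<bar> + \<rho>)"
            unfolding abs_mult[of "A j"] using h A[OF j] by (intro mult_mono colb j) auto
        qed
        ultimately show ?thesis by linarith
      qed
      also have "\<dots> = l * h * ?L2 + h * h * ?L1 + (l + h) * \<rho>"
        by (simp only: avg_cmult avg_add avg_const[OF n]) (simp add: algebra_simps)
      finally show ?thesis using k by (simp add: mult_left_mono)
    qed
    have G: "\<bar>G i j * N i j\<bar> \<le> b * C" if "i \<in> {1..n}" "j \<in> {1..n}" for i j
      using FMabs[OF sq[OF node node]] that by (simp add: G_def N_def)
    (* T3 replaces the empirical measure by the product of its reweighted marginals; then T4 replaces the first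
       marginal by its density 1 / B against the uniform grid, and e5 the second one by 1 / A. *)
    have sA: "emp n \<pi> F - avg n (\<lambda>i. avg n (\<lambda>j. G i j * N i j * s i j)) = (1 / R) * T3 n \<pi> - (1 / R) * T4 n \<pi> - avg n (\<lambda>i. (1 / B i) * e5 n \<pi> (i / n))"
    proof -
      define u where "u i = U n \<pi> (real i / real n)" for i :: nat
      define g where "g i = avg n (\<lambda>j. G i j * N i j / A j)" for i
      define Eu where "Eu = emp n \<pi> (\<lambda>z. U n \<pi> (fst z) / M z)"
      have 1: "R * emp n \<pi> F = T3 n \<pi> + Eu" by (simp add: T3_def Eu_def R_def)
      have 2: "R * avg n (\<lambda>i. (1 / B i) * u i) = T4 n \<pi> + Eu" by (simp add: T4_def row_test_def Eu_def R_def u_def B_def)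
      have 3: "u i = R * g i - e5 n \<pi> (i / n)" for i
        by (simp add: e5_def col_test_def u_def U_def R_def g_def G_def N_def A_def)
      have "avg n (\<lambda>i. avg n (\<lambda>j. G i j * N i j * s i j)) = avg n (\<lambda>i. (1 / B i) * (R * g i))"
      proof (intro avg_cong)
        fix i
        have "avg n (\<lambda>j. G i j * N i j * s i j) = avg n (\<lambda>j. (R / B i) * (G i j * N i j / A j))"
          by (intro avg_cong) (simp add: s_def mult_ac)
        also have "\<dots> = (R / B i) * g i" by (simp only: avg_cmult g_def)
        finally show "avg n (\<lambda>j. G i j * N i j * s i j) = (1 / B i) * (R * g i)" by simp
      qed
      also have "\<dots> = avg n (\<lambda>i. (1 / B i) * u i) + avg n (\<lambda>i. (1 / B i) * e5 n \<pi> (i / n))"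
        by (simp only: avg_add[symmetric] 3 distrib_left[symmetric]) simp
      finally have 4: "avg n (\<lambda>i. avg n (\<lambda>j. G i j * N i j * s i j)) = avg n (\<lambda>i. (1 / B i) * u i) + avg n (\<lambda>i. (1 / B i) * e5 n \<pi> (i / n))" .
      have "emp n \<pi> F = (T3 n \<pi> + Eu) / R" "avg n (\<lambda>i. (1 / B i) * u i) = (T4 n \<pi> + Eu) / R"
        using 1 2 Rp by (auto simp: eq_divide_eq mult.commute)
      then show ?thesis unfolding 4 by (simp add: add_divide_distrib)
    qed
    have "1 / R \<le> C" using R C_pos Rp by (simp add: field_simps)
    then have "(1 / R) * \<bar>x\<bar> \<le> C * \<bar>x\<bar>" for x by (rule mult_right_mono) simp
    then have "\<bar>(1 / R) * x\<bar> \<le> C * \<bar>x\<bar>" for x using Rp by (simp add: abs_mult)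
    from this[of "T3 n \<pi>"] this[of "T4 n \<pi>"]
    have "\<bar>(1 / R) * T3 n \<pi>\<bar> \<le> C * \<bar>T3 n \<pi>\<bar>" "\<bar>(1 / R) * T4 n \<pi>\<bar> \<le> C * \<bar>T4 n \<pi>\<bar>" .
    moreover have "\<bar>avg n (\<lambda>i. (1 / B i) * e5 n \<pi> (i / n))\<bar> \<le> h * ?L5"
      unfolding avg_cmult[symmetric]
    proof (rule avg_mono_abs)
      fix i assume i: "i \<in> {1..n}"
      show "\<bar>(1 / B i) * e5 n \<pi> (i / n)\<bar> \<le> h * \<bar>e5 n \<pi> (i / n)\<bar>"
        unfolding abs_mult using invB[OF i] B(3)[OF i] by (intro mult_right_mono) auto
    qed
    ultimately have 1: "\<bar>emp n \<pi> F - avg n (\<lambda>i. avg n (\<lambda>j. G i j * N i j * s i j))\<bar> \<le> C * \<bar>T3 n \<pi>\<bar> + C * \<bar>T4 n \<pi>\<bar> + h * ?L5"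
      unfolding sA by linarith
    have 2: "\<bar>avg n (\<lambda>i. avg n (\<lambda>j. G i j * N i j * s i j)) - avg n (\<lambda>i. avg n (\<lambda>j. G i j * N i j))\<bar>
       \<le> b * C * a + (b * C / a) * avg n (\<lambda>i. avg n (\<lambda>j. (s i j - 1)\<^sup>2))"
    proof -
      have "\<bar>avg n (\<lambda>i. avg n (\<lambda>j. G i j * N i j * s i j)) - avg n (\<lambda>i. avg n (\<lambda>j. G i j * N i j))\<bar>
        = \<bar>avg n (\<lambda>i. avg n (\<lambda>j. G i j * N i j * (s i j - 1)))\<bar>"
        by (simp only: avg_diff[symmetric]) (simp add: algebra_simps)
      also have "\<dots> \<le> avg n (\<lambda>i. avg n (\<lambda>j. b * C * a + (b * C / a) * (s i j - 1)\<^sup>2))"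
      proof (intro avg_mono_abs)
        fix i j assume i: "i \<in> {1..n}" and j: "j \<in> {1..n}"
        (* Passes from a mean square bound to a mean bound; a is chosen later. *)
        have t: "\<bar>t\<bar> \<le> a + t\<^sup>2 / a" for t :: real
        proof (cases "\<bar>t\<bar> \<le> a")
          case True
          have "0 \<le> t\<^sup>2 / a" using a by simp
          with True show ?thesis by linarith
        next
          case False
          then have "a * \<bar>t\<bar> \<le> \<bar>t\<bar> * \<bar>t\<bar>" by (intro mult_right_mono) auto
          then have "\<bar>t\<bar> \<le> t\<^sup>2 / a" using a by (simp add: field_simps power2_eq_square)
          then show ?thesis using a by linarith
        qed
        have "\<bar>G i j * N i j * (s i j - 1)\<bar> \<le> (b * C) * (a + (s i j - 1)\<^sup>2 / a)"
          unfolding abs_mult[of _ "s i j - 1"] using b C_pos by (intro mult_mono G[OF i j] t) auto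
        then show "\<bar>G i j * N i j * (s i j - 1)\<bar> \<le> b * C * a + (b * C / a) * (s i j - 1)\<^sup>2" by (simp add: algebra_simps)
      qed
      also have "\<dots> = b * C * a + (b * C / a) * avg n (\<lambda>i. avg n (\<lambda>j. (s i j - 1)\<^sup>2))"
        by (simp only: avg_add avg_cmult avg_const[OF n])
      finally show ?thesis .
    qed
    have "(b * C / a) * avg n (\<lambda>i. avg n (\<lambda>j. (s i j - 1)\<^sup>2)) \<le> (b * C / a) * (k * (l * h * ?L2 + h * h * ?L1 + (l + h) * \<rho>))"
      using b C_pos a by (intro mult_left_mono S) auto
    also have "\<dots> = (b * C * k / a) * (l * h * ?L2 + h * h * ?L1 + (l + h) * \<rho>)" by simp
    finally show ?thesis using 1 2 unfolding G_def N_def by linarith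
  qed
  define K where "K = C * K3 + C * K4 + h * K5 + b * C + b * C * k * (l * h * K2 + h * h * K1 + (l + h))"
  show ?thesis
  proof (rule that[of K])
    show "0 \<le> K" using K1(1) K2(1) K3(1) K4(1) K5(1) b C_pos h l k by (auto simp: K_def intro!: add_nonneg_nonneg mult_nonneg_nonneg)
    fix n :: nat and \<rho> a :: real
    assume n: "n > 0" and rho: "0 \<le> \<rho>" and a: "0 < a"
      and row: "\<And>x. x \<in> {0..1} \<Longrightarrow> \<bar>avg n (\<lambda>j. M (x, j / n)) - 1\<bar> \<le> \<rho>"
      and col: "\<And>y. y \<in> {0..1} \<Longrightarrow> \<bar>avg n (\<lambda>i. M (i / n, y)) - 1\<bar> \<le> \<rho>"
    define t where "t = 1 / sqrt n"
    have t: "0 \<le> t" by (simp add: t_def)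
    have x: "X \<le> K' / sqrt n \<Longrightarrow> X \<le> K' * t" for X K' by (simp add: t_def)
    have "E n (\<lambda>\<pi>. \<bar>emp n \<pi> F - avg n (\<lambda>i. avg n (\<lambda>j. F (i / n, j / n) * M (i / n, j / n)))\<bar>) \<le>
      E n (\<lambda>\<pi>. C * \<bar>T3 n \<pi>\<bar> + C * \<bar>T4 n \<pi>\<bar> + h * avg n (\<lambda>i. \<bar>e5 n \<pi> (i / n)\<bar>) + b * C * a
      + (b * C * k / a) * (l * h * avg n (\<lambda>i. \<bar>e2 n \<pi> (i / n)\<bar>) + h * h * avg n (\<lambda>j. \<bar>e1 n \<pi> (j / n)\<bar>) + (l + h) * \<rho>))"
      by (intro E_mono pointwise n a rho row col)
    also have "\<dots> = C * E n (\<lambda>\<pi>. \<bar>T3 n \<pi>\<bar>) + C * E n (\<lambda>\<pi>. \<bar>T4 n \<pi>\<bar>) + h * avg n (\<lambda>i. E n (\<lambda>\<pi>. \<bar>e5 n \<pi> (i / n)\<bar>)) + b * C * a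
      + (b * C * k / a) * (l * h * avg n (\<lambda>i. E n (\<lambda>\<pi>. \<bar>e2 n \<pi> (i / n)\<bar>)) + h * h * avg n (\<lambda>j. E n (\<lambda>\<pi>. \<bar>e1 n \<pi> (j / n)\<bar>)) + (l + h) * \<rho>)"
      by (simp only: E_add E_cmult E_const E_avg)
    also have "\<dots> \<le> C * (K3 * t) + C * (K4 * t) + h * (K5 * t) + b * C * a
      + (b * C * k / a) * (l * h * (K2 * t) + h * h * (K1 * t) + (l + h) * \<rho>)"
      using C_pos h l k b a K3(2)[OF n] ET4[OF n]
      by (intro add_mono mult_left_mono order_refl avg_le n x Ee5 Ee2 Ee1 node) auto
    also have "\<dots> \<le> K * (t + a + (t + \<rho>) / a)"
    proof -
      define P where "P = C * K3 + C * K4 + h * K5"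
      define Q where "Q = b * C"
      define V where "V = b * C * k * (l * h * K2 + h * h * K1)"
      define W where "W = b * C * k * (l + h)"
      have nn: "0 \<le> P" "0 \<le> Q" "0 \<le> V" "0 \<le> W"
        using K1(1) K2(1) K3(1) K4(1) K5(1) b C_pos h l k by (auto simp: P_def Q_def V_def W_def intro!: add_nonneg_nonneg mult_nonneg_nonneg)
      have Kd: "K = P + Q + (V + W)" by (simp add: K_def P_def Q_def V_def W_def algebra_simps)
      have "C * (K3 * t) + C * (K4 * t) + h * (K5 * t) + b * C * a
        + (b * C * k / a) * (l * h * (K2 * t) + h * h * (K1 * t) + (l + h) * \<rho>) = P * t + Q * a + V * (t / a) + W * (\<rho> / a)"
        using a by (simp add: P_def Q_def V_def W_def field_simps)
      also have "\<dots> \<le> K * t + K * a + (K * (t / a) + K * (\<rho> / a))"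
      proof -
        have le: "P \<le> K" "Q \<le> K" "V \<le> K" "W \<le> K" using nn by (auto simp: Kd)
        have "P * t \<le> K * t" "Q * a \<le> K * a" "V * (t / a) \<le> K * (t / a)" "W * (\<rho> / a) \<le> K * (\<rho> / a)"
          using a t rho by (intro mult_right_mono le divide_nonneg_pos; simp)+
        then show ?thesis by linarith
      qed
      also have "\<dots> = K * (t + a + (t + \<rho>) / a)" by (simp add: algebra_simps add_divide_distrib)
      finally show ?thesis .
    qed
    finally show "E n (\<lambda>\<pi>. \<bar>emp n \<pi> F - avg n (\<lambda>i. avg n (\<lambda>j. F (i / n, j / n) * M (i / n, j / n)))\<bar>)
       \<le> K * (1 / sqrt n + a + (1 / sqrt n + \<rho>) / a)" by (simp add: t_def)
  qed
qed

end

text \<open>The two parameters of the estimate are balanced: \<open>a\<close> is a small multiple of the target error, and the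
  Riemann sum error and \<open>1 / sqrt n\<close> are eventually below \<open>a\<^sup>2\<close>.\<close>

lemma LLN:
  assumes F: "continuous_on UNIV F"
  shows "(\<lambda>n. E n (\<lambda>\<pi>. \<bar>emp n \<pi> F - (\<integral>z. F z \<partial>\<mu>)\<bar>)) \<longlonglongrightarrow> 0"
proof -
  obtain m C where mC: "0 < m" "\<And>z. z \<in> unit_square \<Longrightarrow> m \<le> M z" "\<And>z. z \<in> unit_square \<Longrightarrow> M z \<le> C"
    using M_bounds by blast
  have "compact (F ` unit_square)" unfolding unit_square_cbox
    by (intro compact_continuous_image continuous_on_subset[OF F]) auto
  then obtain b where b: "\<And>z. z \<in> unit_square \<Longrightarrow> \<bar>F z\<bar> \<le> b"
    using compact_imp_bounded bounded_iff by (metis image_eqI real_norm_def)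
  obtain K where K: "0 \<le> K" "\<And>n \<rho> a. n > 0 \<Longrightarrow> 0 \<le> \<rho> \<Longrightarrow> 0 < a \<Longrightarrow>
     (\<And>x. x \<in> {0..1} \<Longrightarrow> \<bar>avg n (\<lambda>j. M (x, j / n)) - 1\<bar> \<le> \<rho>) \<Longrightarrow>
     (\<And>y. y \<in> {0..1} \<Longrightarrow> \<bar>avg n (\<lambda>i. M (i / n, y)) - 1\<bar> \<le> \<rho>) \<Longrightarrow>
     E n (\<lambda>\<pi>. \<bar>emp n \<pi> F - avg n (\<lambda>i. avg n (\<lambda>j. F (i / n, j / n) * M (i / n, j / n)))\<bar>)
       \<le> K * (1 / sqrt n + a + (1 / sqrt n + \<rho>) / a)"
    by (rule LLN_estimate[of m C F b, OF mC b]) blast+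
  have lim: "(\<lambda>n. avg n (\<lambda>i. avg n (\<lambda>j. F (i / n, j / n) * M (i / n, j / n)))) \<longlonglongrightarrow> (\<integral>z. F z \<partial>\<mu>)"
    using riemann_sum_2[of "\<lambda>z. F z * M z"] F M_cont by (simp add: integral_\<mu>[OF F] continuous_on_mult mult.commute)
  have Msw: "continuous_on UNIV (\<lambda>z. M (snd z, fst z))"
    by (rule continuous_on_compose2[OF M_cont]) (auto intro!: continuous_on_Pair continuous_on_fst continuous_on_snd continuous_on_id)
  show ?thesis
  proof (rule tendstoI)
    fix e :: real assume e: "e > 0"
    define a where "a = e / (8 * (K + 1))"
    have a: "a > 0" "8 * (K * a) \<le> e" using e K(1) by (auto simp: a_def field_simps)
    have aa: "a * a > 0" using a by simp
    have "(\<lambda>n. 1 / sqrt (real n)) \<longlonglongrightarrow> 0"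
      using tendsto_real_sqrt[OF lim_1_over_n[where 'a=real]] by (simp add: real_sqrt_divide)
    from order_tendstoD(2)[OF this, of "min a (a * a)"] a
    have "\<forall>\<^sub>F n in sequentially. 1 / sqrt (real n) < min a (a * a)" by simp
    then show "\<forall>\<^sub>F n in sequentially. dist (E n (\<lambda>\<pi>. \<bar>emp n \<pi> F - (\<integral>z. F z \<partial>\<mu>)\<bar>)) 0 < e"
      using riemann_sum_uniform[OF M_cont aa] riemann_sum_uniform[OF Msw aa] eventually_gt_at_top[of 0]
        tendstoD[OF lim half_gt_zero[OF e]]
    proof eventually_elim
      case (elim n)
      let ?L = "avg n (\<lambda>i. avg n (\<lambda>j. F (i / n, j / n) * M (i / n, j / n)))"
      have "E n (\<lambda>\<pi>. \<bar>emp n \<pi> F - (\<integral>z. F z \<partial>\<mu>)\<bar>) \<le> E n (\<lambda>\<pi>. \<bar>emp n \<pi> F - ?L\<bar> + \<bar>?L - (\<integral>z. F z \<partial>\<mu>)\<bar>)"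
        by (intro E_mono) linarith
      also have "\<dots> = E n (\<lambda>\<pi>. \<bar>emp n \<pi> F - ?L\<bar>) + \<bar>?L - (\<integral>z. F z \<partial>\<mu>)\<bar>" by (simp only: E_add E_const)
      also have "E n (\<lambda>\<pi>. \<bar>emp n \<pi> F - ?L\<bar>) \<le> K * (1 / sqrt n + a + (1 / sqrt n + a * a) / a)"
        using elim aa a M_row M_col by (intro K(2)) auto
      also have "K * (1 / sqrt n + a + (1 / sqrt n + a * a) / a) \<le> K * (a + a + (a * a + a * a) / a)"
        using elim(1) a K(1) by (intro mult_left_mono add_mono divide_right_mono) auto
      also have "\<dots> = 4 * (K * a)" using a by (simp add: field_simps)
      also have "\<bar>?L - (\<integral>z. F z \<partial>\<mu>)\<bar> < e / 2" using elim(5) by (simp add: dist_real_def)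
      finally have "E n (\<lambda>\<pi>. \<bar>emp n \<pi> F - (\<integral>z. F z \<partial>\<mu>)\<bar>) < e" using a by linarith
      moreover have "0 \<le> E n (\<lambda>\<pi>. \<bar>emp n \<pi> F - (\<integral>z. F z \<partial>\<mu>)\<bar>)" by (intro E_nonneg) simp
      ultimately show ?case by simp
    qed
  qed
qed

end

section \<open>Several points of the empirical measure\<close>

text \<open>Finite sums of products of functions of one variable: on these the empirical averages factorise, and
  by Stone--Weierstrass they are dense.\<close>

inductive tensor_sum :: "('a::metric_space \<times> 'b::metric_space \<Rightarrow> real) \<Rightarrow> bool" where
  prod: "continuous_on UNIV u \<Longrightarrow> continuous_on UNIV v \<Longrightarrow> tensor_sum (\<lambda>z. u (fst z) * v (snd z))"
| add: "tensor_sum F \<Longrightarrow> tensor_sum G \<Longrightarrow> tensor_sum (\<lambda>z. F z + G z)"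

lemma tensor_sum_mult_prod:
  assumes "continuous_on UNIV u" "continuous_on UNIV v"
  shows "tensor_sum G \<Longrightarrow> tensor_sum (\<lambda>z. (u (fst z) * v (snd z)) * G z)"
proof (induction rule: tensor_sum.induct)
  case (prod u' v')
  then have "tensor_sum (\<lambda>z. (\<lambda>x. u x * u' x) (fst z) * (\<lambda>y. v y * v' y) (snd z))"
    using assms by (intro tensor_sum.prod continuous_on_mult)
  then show ?case by (simp add: mult_ac)
next
  case (add F G)
  then show ?case using tensor_sum.add[OF add.IH] by (simp add: algebra_simps)
qed

lemma tensor_sum_mult: "tensor_sum F \<Longrightarrow> tensor_sum G \<Longrightarrow> tensor_sum (\<lambda>z. F z * G z)"
proof (induction rule: tensor_sum.induct)
  case (prod u v)
  then show ?case by (intro tensor_sum_mult_prod)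
next
  case (add F H)
  then have "tensor_sum (\<lambda>z. F z * G z + H z * G z)" by (intro tensor_sum.add) auto
  then show ?case by (simp add: algebra_simps)
qed

lemma tensor_sum_continuous: "tensor_sum F \<Longrightarrow> continuous_on S F"
proof (induction rule: tensor_sum.induct)
  case (prod u v)
  show ?case
    by (intro continuous_on_mult continuous_on_compose2[OF prod(1) continuous_on_fst[OF continuous_on_id]]
      continuous_on_compose2[OF prod(2) continuous_on_snd[OF continuous_on_id]]) auto
qed (intro continuous_on_add)

lemma tensor_sum_dense:
  fixes Q :: "'a::metric_space \<times> 'b::metric_space \<Rightarrow> real"
  assumes Q: "continuous_on (S \<times> T) Q" and S: "compact S" "compact T" and "e > 0"
  obtains P where "tensor_sum P" "\<And>z. z \<in> S \<times> T \<Longrightarrow> \<bar>Q z - P z\<bar> < e"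
proof -
  interpret function_ring_on "{P. tensor_sum P}" "S \<times> T"
  proof
    show "compact (S \<times> T)" using S by (rule compact_Times)
    show "(\<lambda>_. c) \<in> {P. tensor_sum P}" for c
      using tensor_sum.prod[of "\<lambda>_. c" "\<lambda>_. 1"] by simp
    fix x y :: "'a \<times> 'b" assume ne: "x \<noteq> y"
    show "\<exists>f\<in>{P. tensor_sum P}. f x \<noteq> f y"
    proof (cases "fst x = fst y")
      case True
      with ne have "snd x \<noteq> snd y" by (simp add: prod_eq_iff)
      then have "1 * dist (snd x) (snd x) \<noteq> 1 * dist (snd y) (snd x)" by simp
      moreover have "tensor_sum (\<lambda>z::'a\<times>'b. 1 * dist (snd z) (snd x))"
        by (rule tensor_sum.prod[of "\<lambda>_. 1" "\<lambda>b. dist b (snd x)"]) (intro continuous_on_const continuous_on_dist continuous_on_id)+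
      ultimately show ?thesis by (intro bexI[of _ "\<lambda>z. 1 * dist (snd z) (snd x)"]) (simp_all only: mem_Collect_eq not_False_eq_True)
    next
      case False
      then have "dist (fst x) (fst x) * 1 \<noteq> dist (fst y) (fst x) * 1" by simp
      moreover have "tensor_sum (\<lambda>z::'a\<times>'b. dist (fst z) (fst x) * 1)"
        by (rule tensor_sum.prod[of "\<lambda>b. dist b (fst x)" "\<lambda>_. 1"]) (intro continuous_on_const continuous_on_dist continuous_on_id)+
      ultimately show ?thesis by (intro bexI[of _ "\<lambda>z. dist (fst z) (fst x) * 1"]) (simp_all only: mem_Collect_eq not_False_eq_True)
    qed
  qed (auto intro: tensor_sum_continuous tensor_sum.add tensor_sum_mult)
  from Stone_Weierstrass_basic[OF Q \<open>e > 0\<close>] that show ?thesis by blast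
qed

lemma continuous_prob_integrable:
  fixes Q :: "'a::euclidean_space \<Rightarrow> real"
  assumes P: "prob_space P" "space P = T" "compact T" and m: "(\<lambda>w. w) \<in> measurable P borel"
    and Q: "continuous_on UNIV Q"
  shows "integrable P Q" "\<And>b. (\<And>z. z \<in> T \<Longrightarrow> \<bar>Q z\<bar> \<le> b) \<Longrightarrow> \<bar>\<integral>z. Q z \<partial>P\<bar> \<le> b"
proof -
  interpret prob_space P by fact
  have meas: "Q \<in> borel_measurable P"
    using measurable_compose[OF m borel_measurable_continuous_onI[OF Q]] by simp
  have "compact (Q ` T)" by (intro compact_continuous_image continuous_on_subset[OF Q] P) auto
  then obtain C where C: "\<And>z. z \<in> T \<Longrightarrow> norm (Q z) \<le> C"
    using compact_imp_bounded bounded_iff by (metis image_eqI)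
  show i: "integrable P Q"
    by (rule integrable_const_bound[where B=C]) (auto simp: P(2) C intro: meas simp del: real_norm_def)
  fix b assume b: "\<And>z. z \<in> T \<Longrightarrow> \<bar>Q z\<bar> \<le> b"
  have "\<bar>\<integral>z. Q z \<partial>P\<bar> \<le> (\<integral>z. \<bar>Q z\<bar> \<partial>P)" by (rule integral_abs_bound)
  also have "\<dots> \<le> (\<integral>z. b \<partial>P)" using i b by (intro integral_mono) (auto simp: P(2))
  finally show "\<bar>\<integral>z. Q z \<partial>P\<bar> \<le> b" by (simp add: prob_space)
qed

lemma compact_unit_square: "compact unit_square" by (simp add: unit_square_cbox)

context doubly_stochastic
begin

text \<open>Convergence in mean, rather than in probability, because all statistics are bounded and the estimates
  come in this form.\<close>

definition L1_lim :: "(nat \<Rightarrow> (nat \<Rightarrow> nat) \<Rightarrow> real) \<Rightarrow> real \<Rightarrow> bool" where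
  "L1_lim X c \<longleftrightarrow> (\<lambda>n. E n (\<lambda>\<pi>. \<bar>X n \<pi> - c\<bar>)) \<longlonglongrightarrow> 0"

lemma L1_lim_bound:
  assumes "L1_lim X c" "L1_lim Y d" "\<And>n \<pi>. n > 0 \<Longrightarrow> \<pi> \<in> perms n \<Longrightarrow> \<bar>W n \<pi> - e\<bar> \<le> a * \<bar>X n \<pi> - c\<bar> + b * \<bar>Y n \<pi> - d\<bar>"
  shows "L1_lim W e"
  unfolding L1_lim_def
proof (rule tendsto_sandwich[OF _ _ tendsto_const])
  show "\<forall>\<^sub>F n in sequentially. 0 \<le> E n (\<lambda>\<pi>. \<bar>W n \<pi> - e\<bar>)" by (intro always_eventually allI E_nonneg) simp
  show "\<forall>\<^sub>F n in sequentially. E n (\<lambda>\<pi>. \<bar>W n \<pi> - e\<bar>) \<le> a * E n (\<lambda>\<pi>. \<bar>X n \<pi> - c\<bar>) + b * E n (\<lambda>\<pi>. \<bar>Y n \<pi> - d\<bar>)"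
    using eventually_gt_at_top[of 0]
  proof eventually_elim
    case (elim n)
    then show ?case unfolding E_cmult[symmetric] E_add[symmetric] by (intro E_mono assms(3))
  qed
  show "(\<lambda>n. a * E n (\<lambda>\<pi>. \<bar>X n \<pi> - c\<bar>) + b * E n (\<lambda>\<pi>. \<bar>Y n \<pi> - d\<bar>)) \<longlonglongrightarrow> 0"
    using tendsto_add[OF tendsto_mult_left[of _ 0 _ a] tendsto_mult_left[of _ 0 _ b]] assms(1,2)
    by (fastforce simp: L1_lim_def)
qed

lemma L1_lim_add: "L1_lim X c \<Longrightarrow> L1_lim Y d \<Longrightarrow> L1_lim (\<lambda>n \<pi>. X n \<pi> + Y n \<pi>) (c + d)"
  by (rule L1_lim_bound[where X=X and Y=Y and a=1 and b=1 and c=c and d=d]) (auto simp: abs_if)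

lemma L1_lim_mult:
  assumes "L1_lim X c" "L1_lim Y d" and b: "\<And>n \<pi>. n > 0 \<Longrightarrow> \<pi> \<in> perms n \<Longrightarrow> \<bar>X n \<pi>\<bar> \<le> b"
  shows "L1_lim (\<lambda>n \<pi>. X n \<pi> * Y n \<pi>) (c * d)"
proof (rule L1_lim_bound[OF assms(1,2), where a = "\<bar>d\<bar>" and b = b])
  fix n :: nat and \<pi> assume n: "n > 0" "\<pi> \<in> perms n"
  have "X n \<pi> * Y n \<pi> - c * d = d * (X n \<pi> - c) + X n \<pi> * (Y n \<pi> - d)" by (simp add: algebra_simps)
  then have "\<bar>X n \<pi> * Y n \<pi> - c * d\<bar> \<le> \<bar>d\<bar> * \<bar>X n \<pi> - c\<bar> + \<bar>X n \<pi>\<bar> * \<bar>Y n \<pi> - d\<bar>"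
    by (metis abs_mult abs_triangle_ineq)
  also have "\<dots> \<le> \<bar>d\<bar> * \<bar>X n \<pi> - c\<bar> + b * \<bar>Y n \<pi> - d\<bar>" using b[OF n] by (intro add_left_mono mult_right_mono) auto
  finally show "\<bar>X n \<pi> * Y n \<pi> - c * d\<bar> \<le> \<bar>d\<bar> * \<bar>X n \<pi> - c\<bar> + b * \<bar>Y n \<pi> - d\<bar>" .
qed

lemma L1_lim_approx:
  assumes "\<And>e. e > 0 \<Longrightarrow> \<exists>Y d. L1_lim Y d \<and> \<bar>c - d\<bar> \<le> e \<and> (\<forall>n \<pi>. n > 0 \<longrightarrow> \<pi> \<in> perms n \<longrightarrow> \<bar>X n \<pi> - Y n \<pi>\<bar> \<le> e)"
  shows "L1_lim X c"
  unfolding L1_lim_def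
proof (rule tendstoI)
  fix e :: real assume e: "e > 0"
  obtain Y d where Y: "L1_lim Y d" "\<bar>c - d\<bar> \<le> e / 4" "\<And>n \<pi>. n > 0 \<Longrightarrow> \<pi> \<in> perms n \<Longrightarrow> \<bar>X n \<pi> - Y n \<pi>\<bar> \<le> e / 4"
    using assms[of "e / 4"] e by auto
  have "\<forall>\<^sub>F n in sequentially. E n (\<lambda>\<pi>. \<bar>Y n \<pi> - d\<bar>) < e / 4"
    using order_tendstoD(2)[OF Y(1)[unfolded L1_lim_def], of "e / 4"] e by simp
  then show "\<forall>\<^sub>F n in sequentially. dist (E n (\<lambda>\<pi>. \<bar>X n \<pi> - c\<bar>)) 0 < e"
    using eventually_gt_at_top[of 0]
  proof eventually_elim
    case (elim n)
    have "E n (\<lambda>\<pi>. \<bar>X n \<pi> - c\<bar>) \<le> E n (\<lambda>\<pi>. \<bar>Y n \<pi> - d\<bar> + e / 2)"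
    proof (rule E_mono)
      fix \<pi> assume "\<pi> \<in> perms n"
      from Y(3)[OF elim(2) this] Y(2) show "\<bar>X n \<pi> - c\<bar> \<le> \<bar>Y n \<pi> - d\<bar> + e / 2" by linarith
    qed
    also have "\<dots> = E n (\<lambda>\<pi>. \<bar>Y n \<pi> - d\<bar>) + e / 2" by (simp only: E_add E_const)
    finally have "E n (\<lambda>\<pi>. \<bar>X n \<pi> - c\<bar>) < e" using elim e by linarith
    moreover have "0 \<le> E n (\<lambda>\<pi>. \<bar>X n \<pi> - c\<bar>)" by (intro E_nonneg) simp
    ultimately show ?case by simp
  qed
qed

lemma L1_lim_E: "L1_lim X c \<Longrightarrow> (\<lambda>n. E n (X n)) \<longlonglongrightarrow> c"
proof -
  assume "L1_lim X c"
  then have l: "(\<lambda>n. E n (\<lambda>\<pi>. \<bar>X n \<pi> - c\<bar>)) \<longlonglongrightarrow> 0" by (simp add: L1_lim_def)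
  have "\<bar>E n (X n) - c\<bar> \<le> E n (\<lambda>\<pi>. \<bar>X n \<pi> - c\<bar>)" for n
    using E_abs[of n "\<lambda>\<pi>. X n \<pi> - c"] by (simp only: E_diff E_const)
  then have "(\<lambda>n. E n (X n) - c) \<longlonglongrightarrow> 0"
    by (intro Lim_null_comparison[OF _ l]) auto
  then show ?thesis by (simp only: LIM_zero_iff)
qed

lemma \<mu>_ident: "(\<lambda>w. w) \<in> measurable \<mu> borel"
  using measurable_restrict_space1[OF measurable_ident, of borel unit_square]
  by (simp add: measurable_cong_sets[OF sets_\<mu> refl] id_def)

text \<open>Adds one more point of the empirical measure to any functional that obeys a law of large numbers. It
  is applied once for pairs and once more for triples.\<close>

lemma LLN_tensor:
  fixes \<Lambda> :: "nat \<Rightarrow> (nat \<Rightarrow> nat) \<Rightarrow> ('b::euclidean_space \<Rightarrow> real) \<Rightarrow> real"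
  assumes \<nu>: "prob_space \<nu>" "space \<nu> = S" "compact S" "(\<lambda>w. w) \<in> measurable \<nu> borel"
    and add: "\<And>n \<pi> F G. \<Lambda> n \<pi> (\<lambda>w. F w + G w) = \<Lambda> n \<pi> F + \<Lambda> n \<pi> G"
    and scale: "\<And>n \<pi> c F. \<Lambda> n \<pi> (\<lambda>w. c * F w) = c * \<Lambda> n \<pi> F"
    and bound: "\<And>n \<pi> F b. n > 0 \<Longrightarrow> \<pi> \<in> perms n \<Longrightarrow> (\<And>w. w \<in> S \<Longrightarrow> \<bar>F w\<bar> \<le> b) \<Longrightarrow> \<bar>\<Lambda> n \<pi> F\<bar> \<le> b"
    and conv: "\<And>v. continuous_on UNIV v \<Longrightarrow> L1_lim (\<lambda>n \<pi>. \<Lambda> n \<pi> v) (\<integral>w. v w \<partial>\<nu>)"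
    and Q: "continuous_on UNIV Q"
  shows "L1_lim (\<lambda>n \<pi>. emp n \<pi> (\<lambda>z. \<Lambda> n \<pi> (\<lambda>w. Q (z, w)))) (\<integral>p. Q p \<partial>(\<mu> \<Otimes>\<^sub>M \<nu>))"
    and "prob_space (\<mu> \<Otimes>\<^sub>M \<nu>)" "space (\<mu> \<Otimes>\<^sub>M \<nu>) = unit_square \<times> S" "compact (unit_square \<times> S)"
      "(\<lambda>w. w) \<in> measurable (\<mu> \<Otimes>\<^sub>M \<nu>) borel"
proof -
  interpret \<mu>: prob_space \<mu> by (rule prob_space_\<mu>)
  interpret \<nu>: prob_space \<nu> by fact
  interpret pair_prob_space \<mu> \<nu> ..
  show pp: "prob_space (\<mu> \<Otimes>\<^sub>M \<nu>)" by (rule P.prob_space_axioms)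
  show sp: "space (\<mu> \<Otimes>\<^sub>M \<nu>) = unit_square \<times> S" by (simp add: space_pair_measure \<nu>)
  show cp: "compact (unit_square \<times> S)" by (intro compact_Times compact_unit_square \<nu>)
  have "(\<lambda>p. (fst p, snd p)) \<in> measurable (\<mu> \<Otimes>\<^sub>M \<nu>) (borel \<Otimes>\<^sub>M borel)"
    by (intro measurable_Pair measurable_compose[OF measurable_fst \<mu>_ident] measurable_compose[OF measurable_snd \<nu>(4)])
  then show id: "(\<lambda>w. w) \<in> measurable (\<mu> \<Otimes>\<^sub>M \<nu>) borel" by (simp add: borel_prod)
  note int = continuous_prob_integrable[OF pp sp cp id]
  note int\<mu> = continuous_prob_integrable[OF prob_space_\<mu> space_\<mu> compact_unit_square \<mu>_ident]
  note int\<nu> = continuous_prob_integrable[OF \<nu>]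
  have tensor: "L1_lim (\<lambda>n \<pi>. emp n \<pi> (\<lambda>z. \<Lambda> n \<pi> (\<lambda>w. P (z, w)))) (\<integral>p. P p \<partial>(\<mu> \<Otimes>\<^sub>M \<nu>))" if "tensor_sum P" for P
    using that
  proof induction
    case (prod u v)
    have uv: "continuous_on UNIV (\<lambda>z. u (fst z) * v (snd z))" by (rule tensor_sum_continuous[OF tensor_sum.prod[OF prod]])
    have "(\<integral>p. u (fst p) * v (snd p) \<partial>(\<mu> \<Otimes>\<^sub>M \<nu>)) = (\<integral>z. (\<integral>w. u z * v w \<partial>\<nu>) \<partial>\<mu>)"
      using integral_fst'[OF int(1)[OF uv]] by simp
    also have "\<dots> = (\<integral>z. u z \<partial>\<mu>) * (\<integral>w. v w \<partial>\<nu>)" by simp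
    finally have I: "(\<integral>p. u (fst p) * v (snd p) \<partial>(\<mu> \<Otimes>\<^sub>M \<nu>)) = (\<integral>z. u z \<partial>\<mu>) * (\<integral>w. v w \<partial>\<nu>)" .
    have "compact (u ` unit_square)" by (intro compact_continuous_image continuous_on_subset[OF prod(1)] compact_unit_square) auto
    then obtain C where C: "\<And>z. z \<in> unit_square \<Longrightarrow> \<bar>u z\<bar> \<le> C"
      using compact_imp_bounded bounded_iff by (metis image_eqI real_norm_def)
    have "emp n \<pi> (\<lambda>z. \<Lambda> n \<pi> (\<lambda>w. u z * v w)) = emp n \<pi> u * \<Lambda> n \<pi> v" for n \<pi>
      unfolding scale by (simp add: emp_def avg_cmult_right)
    moreover have "L1_lim (\<lambda>n \<pi>. emp n \<pi> u * \<Lambda> n \<pi> v) ((\<integral>z. u z \<partial>\<mu>) * (\<integral>w. v w \<partial>\<nu>))"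
    proof (rule L1_lim_mult)
      show "L1_lim (\<lambda>n \<pi>. emp n \<pi> u) (\<integral>z. u z \<partial>\<mu>)" unfolding L1_lim_def by (rule LLN[OF prod(1)])
      show "L1_lim (\<lambda>n \<pi>. \<Lambda> n \<pi> v) (\<integral>w. v w \<partial>\<nu>)" by (rule conv[OF prod(2)])
      show "\<bar>emp n \<pi> u\<bar> \<le> C" if "n > 0" "\<pi> \<in> perms n" for n \<pi>
        unfolding emp_def by (intro avg_abs_le that C pt_square)
    qed
    ultimately show ?case unfolding I by simp
  next
    case (add F G)
    have "(\<integral>p. F p + G p \<partial>(\<mu> \<Otimes>\<^sub>M \<nu>)) = (\<integral>p. F p \<partial>(\<mu> \<Otimes>\<^sub>M \<nu>)) + (\<integral>p. G p \<partial>(\<mu> \<Otimes>\<^sub>M \<nu>))"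
      by (intro Bochner_Integration.integral_add int(1) tensor_sum_continuous add)
    then show ?case unfolding \<open>\<And>n \<pi> F G. \<Lambda> n \<pi> (\<lambda>w. F w + G w) = \<Lambda> n \<pi> F + \<Lambda> n \<pi> G\<close>
      using L1_lim_add[OF add.IH] by (simp add: emp_def avg_add)
  qed
  show "L1_lim (\<lambda>n \<pi>. emp n \<pi> (\<lambda>z. \<Lambda> n \<pi> (\<lambda>w. Q (z, w)))) (\<integral>p. Q p \<partial>(\<mu> \<Otimes>\<^sub>M \<nu>))"
  proof (rule L1_lim_approx)
    fix e :: real assume e: "e > 0"
    obtain P where P: "tensor_sum P" "\<And>z. z \<in> unit_square \<times> S \<Longrightarrow> \<bar>Q z - P z\<bar> < e"
      using tensor_sum_dense[OF continuous_on_subset[OF Q subset_UNIV] compact_unit_square \<nu>(3) e] by blast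
    have PQ: "continuous_on UNIV (\<lambda>z. Q z - P z)" by (intro continuous_on_diff Q tensor_sum_continuous P)
    have "\<bar>(\<integral>p. Q p \<partial>(\<mu> \<Otimes>\<^sub>M \<nu>)) - (\<integral>p. P p \<partial>(\<mu> \<Otimes>\<^sub>M \<nu>))\<bar> = \<bar>\<integral>p. Q p - P p \<partial>(\<mu> \<Otimes>\<^sub>M \<nu>)\<bar>"
      using int(1)[OF Q] int(1)[OF tensor_sum_continuous[OF P(1)]] by simp
    also have "\<dots> \<le> e" using P(2) by (intro int(2) PQ) (auto intro: less_imp_le)
    finally have 1: "\<bar>(\<integral>p. Q p \<partial>(\<mu> \<Otimes>\<^sub>M \<nu>)) - (\<integral>p. P p \<partial>(\<mu> \<Otimes>\<^sub>M \<nu>))\<bar> \<le> e" .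
    have "\<bar>emp n \<pi> (\<lambda>z. \<Lambda> n \<pi> (\<lambda>w. Q (z, w))) - emp n \<pi> (\<lambda>z. \<Lambda> n \<pi> (\<lambda>w. P (z, w)))\<bar> \<le> e"
      if n: "n > 0" "\<pi> \<in> perms n" for n \<pi>
    proof -
      have d: "\<Lambda> n \<pi> (\<lambda>w. Q (z, w)) - \<Lambda> n \<pi> (\<lambda>w. P (z, w)) = \<Lambda> n \<pi> (\<lambda>w. Q (z, w) - P (z, w))" for z
        using add[of n \<pi> "\<lambda>w. Q (z, w)" "\<lambda>w. (-1) * P (z, w)"] scale[of n \<pi> "-1" "\<lambda>w. P (z, w)"] by simp
      show ?thesis unfolding emp_def avg_diff[symmetric] d
      proof (intro avg_abs_le n bound)
        fix i w assume "i \<in> {1..n}" "w \<in> S"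
        then have "(pt n \<pi> i, w) \<in> unit_square \<times> S" using pt_square[OF n(2)] by blast
        from P(2)[OF this] show "\<bar>Q (pt n \<pi> i, w) - P (pt n \<pi> i, w)\<bar> \<le> e" by simp
      qed
    qed
    with 1 tensor[OF P(1)] show "\<exists>Y d. L1_lim Y d \<and> \<bar>(\<integral>p. Q p \<partial>(\<mu> \<Otimes>\<^sub>M \<nu>)) - d\<bar> \<le> e \<and>
       (\<forall>n \<pi>. n > 0 \<longrightarrow> \<pi> \<in> perms n \<longrightarrow> \<bar>emp n \<pi> (\<lambda>z. \<Lambda> n \<pi> (\<lambda>w. Q (z, w))) - Y n \<pi>\<bar> \<le> e)" by blast
  qed
qed

definition emp2 :: "nat \<Rightarrow> (nat \<Rightarrow> nat) \<Rightarrow> ((real \<times> real) \<times> (real \<times> real) \<Rightarrow> real) \<Rightarrow> real" where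
  "emp2 n \<pi> Q = emp n \<pi> (\<lambda>z. emp n \<pi> (\<lambda>w. Q (z, w)))"

definition emp3 :: "nat \<Rightarrow> (nat \<Rightarrow> nat) \<Rightarrow> ((real \<times> real) \<times> (real \<times> real) \<times> (real \<times> real) \<Rightarrow> real) \<Rightarrow> real" where
  "emp3 n \<pi> Q = emp n \<pi> (\<lambda>z. emp2 n \<pi> (\<lambda>w. Q (z, w)))"

lemma emp_add: "emp n \<pi> (\<lambda>z. F z + G z) = emp n \<pi> F + emp n \<pi> G"
  by (simp add: emp_def avg_add)

lemma emp_cmult: "emp n \<pi> (\<lambda>z. c * F z) = c * emp n \<pi> F"
  by (simp add: emp_def avg_cmult)

lemma emp_bound: "n > 0 \<Longrightarrow> \<pi> \<in> perms n \<Longrightarrow> (\<And>z. z \<in> unit_square \<Longrightarrow> \<bar>F z\<bar> \<le> b) \<Longrightarrow> \<bar>emp n \<pi> F\<bar> \<le> b"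
  unfolding emp_def by (intro avg_abs_le) (auto simp: pt_square)

lemma emp2_bound: "n > 0 \<Longrightarrow> \<pi> \<in> perms n \<Longrightarrow> (\<And>p. p \<in> unit_square \<times> unit_square \<Longrightarrow> \<bar>F p\<bar> \<le> b) \<Longrightarrow> \<bar>emp2 n \<pi> F\<bar> \<le> b"
  unfolding emp2_def by (intro emp_bound) auto

lemma LLN2:
  assumes "continuous_on UNIV Q"
  shows "L1_lim (\<lambda>n \<pi>. emp2 n \<pi> Q) (\<integral>p. Q p \<partial>(\<mu> \<Otimes>\<^sub>M \<mu>))"
    and "prob_space (\<mu> \<Otimes>\<^sub>M \<mu>)" "space (\<mu> \<Otimes>\<^sub>M \<mu>) = unit_square \<times> unit_square"
      "(\<lambda>w. w) \<in> measurable (\<mu> \<Otimes>\<^sub>M \<mu>) borel"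
proof -
  note * = LLN_tensor[OF prob_space_\<mu> space_\<mu> compact_unit_square \<mu>_ident, of emp, OF emp_add emp_cmult emp_bound _ assms]
  have c: "L1_lim (\<lambda>n \<pi>. emp n \<pi> v) (\<integral>w. v w \<partial>\<mu>)" if "continuous_on UNIV v" for v
    unfolding L1_lim_def by (rule LLN[OF that])
  show "L1_lim (\<lambda>n \<pi>. emp2 n \<pi> Q) (\<integral>p. Q p \<partial>(\<mu> \<Otimes>\<^sub>M \<mu>))" unfolding emp2_def by (rule *(1)) (auto intro: c)
  show "prob_space (\<mu> \<Otimes>\<^sub>M \<mu>)" "space (\<mu> \<Otimes>\<^sub>M \<mu>) = unit_square \<times> unit_square" "(\<lambda>w. w) \<in> measurable (\<mu> \<Otimes>\<^sub>M \<mu>) borel"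
    by (rule *(2) *(3) *(5); auto intro: c)+
qed

lemma LLN3:
  assumes "continuous_on UNIV Q"
  shows "L1_lim (\<lambda>n \<pi>. emp3 n \<pi> Q) (\<integral>p. Q p \<partial>(\<mu> \<Otimes>\<^sub>M (\<mu> \<Otimes>\<^sub>M \<mu>)))"
    and "prob_space (\<mu> \<Otimes>\<^sub>M (\<mu> \<Otimes>\<^sub>M \<mu>))" "space (\<mu> \<Otimes>\<^sub>M (\<mu> \<Otimes>\<^sub>M \<mu>)) = unit_square \<times> unit_square \<times> unit_square"
      "(\<lambda>w. w) \<in> measurable (\<mu> \<Otimes>\<^sub>M (\<mu> \<Otimes>\<^sub>M \<mu>)) borel"
proof -
  have a: "emp2 n \<pi> (\<lambda>w. F w + G w) = emp2 n \<pi> F + emp2 n \<pi> G" "emp2 n \<pi> (\<lambda>w. c * F w) = c * emp2 n \<pi> F" for n \<pi> F G c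
    by (simp_all add: emp2_def emp_add emp_cmult)
  have z: "continuous_on UNIV (\<lambda>_. 0 :: real)" by simp
  note * = LLN_tensor[OF LLN2(2)[OF z] LLN2(3)[OF z] compact_Times[OF compact_unit_square compact_unit_square] LLN2(4)[OF z],
      of emp2, OF a emp2_bound LLN2(1) assms]
  show "L1_lim (\<lambda>n \<pi>. emp3 n \<pi> Q) (\<integral>p. Q p \<partial>(\<mu> \<Otimes>\<^sub>M (\<mu> \<Otimes>\<^sub>M \<mu>)))" unfolding emp3_def by (rule *(1)) auto
  show "prob_space (\<mu> \<Otimes>\<^sub>M (\<mu> \<Otimes>\<^sub>M \<mu>))" "space (\<mu> \<Otimes>\<^sub>M (\<mu> \<Otimes>\<^sub>M \<mu>)) = unit_square \<times> unit_square \<times> unit_square"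
      "(\<lambda>w. w) \<in> measurable (\<mu> \<Otimes>\<^sub>M (\<mu> \<Otimes>\<^sub>M \<mu>)) borel"
    by (rule *(2) *(3) *(5); auto)+
qed

definition swap_weight2 :: "(real \<times> real) \<times> (real \<times> real) \<Rightarrow> real" where "swap_weight2 p = swap_weight (fst p) (snd p)"
definition swap :: "(real \<times> real) \<times> (real \<times> real) \<Rightarrow> (real \<times> real) \<times> (real \<times> real)" where
  "swap p = (cross (fst p) (snd p), cross (snd p) (fst p))"

lemma continuous_swap: "continuous_on S swap"
  unfolding swap_def cross_def
  by (intro continuous_on_Pair continuous_on_fst continuous_on_snd continuous_on_id)

lemma continuous_M_comp: "continuous_on S f \<Longrightarrow> continuous_on S (\<lambda>x. M (f x))"
  by (rule continuous_on_compose2[OF M_cont]) auto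

lemma continuous_swap_weight2: "continuous_on S swap_weight2"
  unfolding swap_weight2_def[abs_def] swap_weight_def
  by (intro continuous_on_divide continuous_on_const continuous_on_mult continuous_M_comp continuous_on_fst continuous_on_snd continuous_on_id)
     (simp add: M_ne)

text \<open>Both sides are limits of expectations which \<open>E_swap\<close> makes equal for every \<open>n\<close>, so that no change of
  variables in four dimensions is needed.\<close>

lemma swap_invariance:
  assumes X: "continuous_on UNIV X"
  shows "(\<integral>p. swap_weight2 p * X p \<partial>(\<mu> \<Otimes>\<^sub>M \<mu>)) = (\<integral>p. swap_weight2 p * X (swap p) \<partial>(\<mu> \<Otimes>\<^sub>M \<mu>))"
proof -
  have Xs: "continuous_on UNIV (\<lambda>p. X (swap p))" by (rule continuous_on_compose2[OF X continuous_swap]) auto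
  have "E n (\<lambda>\<pi>. emp2 n \<pi> (\<lambda>p. swap_weight2 p * X p)) = E n (\<lambda>\<pi>. emp2 n \<pi> (\<lambda>p. swap_weight2 p * X (swap p)))" for n
  proof -
    have "E n (\<lambda>\<pi>. swap_weight2 (pt n \<pi> i, pt n \<pi> j) * X (pt n \<pi> i, pt n \<pi> j)) = E n (\<lambda>\<pi>. swap_weight2 (pt n \<pi> i, pt n \<pi> j) * X (swap (pt n \<pi> i, pt n \<pi> j)))"
      if "i \<in> {1..n}" "j \<in> {1..n}" for i j
      using E_swap[OF that, of "\<lambda>\<pi>. X (pt n \<pi> i, pt n \<pi> j)"] by (simp only: swap_weight2_def swap_def pt_swp fst_conv snd_conv)
    then show ?thesis unfolding emp2_def emp_def E_avg by (intro avg_cong)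
  qed
  moreover have "(\<lambda>n. E n (\<lambda>\<pi>. emp2 n \<pi> (\<lambda>p. swap_weight2 p * X p))) \<longlonglongrightarrow> (\<integral>p. swap_weight2 p * X p \<partial>(\<mu> \<Otimes>\<^sub>M \<mu>))"
    by (intro L1_lim_E LLN2(1) continuous_on_mult continuous_swap_weight2 X)
  moreover have "(\<lambda>n. E n (\<lambda>\<pi>. emp2 n \<pi> (\<lambda>p. swap_weight2 p * X (swap p)))) \<longlonglongrightarrow> (\<integral>p. swap_weight2 p * X (swap p) \<partial>(\<mu> \<Otimes>\<^sub>M \<mu>))"
    by (intro L1_lim_E LLN2(1) continuous_on_mult continuous_swap_weight2 Xs)
  ultimately show ?thesis by (simp add: LIMSEQ_unique)
qed

end

section \<open>Stein's identity and the central limit theorem\<close>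

lemma sin_first_order: "\<bar>sin (a + h) - sin a - h * cos a\<bar> \<le> (h::real)\<^sup>2"
proof -
  have "cmod (iexp h - (\<Sum>k\<le>1. (\<i> * complex_of_real h) ^ k / fact k)) \<le> \<bar>h\<bar> ^ Suc 1 / fact (Suc 1)"
    by (rule iexp_approx1)
  then have "cmod (iexp h - (1 + \<i> * h)) \<le> h\<^sup>2 / 2" by (simp add: numeral_2_eq_2)
  then have "cmod (iexp a * (iexp h - (1 + \<i> * h))) \<le> h\<^sup>2 / 2" by (simp add: norm_mult)
  moreover have "Im (iexp a * (iexp h - (1 + \<i> * h))) = sin (a + h) - sin a - h * cos a"
    by (simp add: Re_exp Im_exp sin_add algebra_simps)
  ultimately show ?thesis using abs_Im_le_cmod[of "iexp a * (iexp h - (1 + \<i> * h))"] zero_le_power2[of h] by linarith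
qed

text \<open>Comparison with the solution \<open>exp (- V s\<^sup>2 / 2)\<close> of \<open>c' = - V s c\<close>, by the integrating factor
  \<open>exp (V s\<^sup>2 / 2)\<close>.\<close>

lemma exp_square_ode_estimate:
  fixes c :: "real \<Rightarrow> real"
  assumes V: "0 \<le> V" and der: "\<And>s. (c has_real_derivative c' s) (at s)"
    and e: "\<And>s. 0 \<le> s \<Longrightarrow> s \<le> 1 \<Longrightarrow> \<bar>c' s + V * s * c s\<bar> \<le> e"
  shows "\<bar>c 1 - exp (- V / 2) * c 0\<bar> \<le> exp (V / 2) * e"
proof -
  define u where "u s = exp (V * s\<^sup>2 / 2) * c s" for s
  have "(u has_real_derivative exp (V * s\<^sup>2 / 2) * (c' s + V * s * c s)) (at s)" for s
    unfolding u_def by (auto intro!: derivative_eq_intros der simp: algebra_simps)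
  then obtain s where s: "0 < s" "s < 1" "u 1 - u 0 = (1 - 0) * (exp (V * s\<^sup>2 / 2) * (c' s + V * s * c s))"
    using MVT2[of 0 1 u "\<lambda>s. exp (V * s\<^sup>2 / 2) * (c' s + V * s * c s)"] by auto
  have "s\<^sup>2 \<le> 1" using s by (simp add: power_le_one)
  then have "V * s\<^sup>2 \<le> V" using V by (simp add: mult_left_le)
  then have "\<bar>u 1 - u 0\<bar> \<le> exp (V / 2) * e"
    unfolding s(3) using e[of s] s by (simp add: abs_mult) (intro mult_mono, auto)
  moreover have "c 1 - exp (- V / 2) * c 0 = exp (- V / 2) * (u 1 - u 0)"
    by (simp add: u_def right_diff_distrib exp_minus field_simps)
  moreover have "exp (- V / 2) * \<bar>u 1 - u 0\<bar> \<le> 1 * \<bar>u 1 - u 0\<bar>" using V by (intro mult_right_mono) auto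
  ultimately show ?thesis by (simp add: abs_mult)
qed

lemma emp_swp:
  assumes n: "n > 0" and ij: "i \<in> {1..n}" "j \<in> {1..n}"
  shows "emp n (swp \<pi> i j) u = emp n \<pi> u + (1 / n) * (u (cross (pt n \<pi> i) (pt n \<pi> j)) + u (cross (pt n \<pi> j) (pt n \<pi> i))
     - u (pt n \<pi> i) - u (pt n \<pi> j))"
proof (cases "i = j")
  case True
  then show ?thesis by (simp add: cross_def)
next
  case False
  let ?p = "swp \<pi> i j"
  have "(\<Sum>k=1..n. u (pt n ?p k)) - (\<Sum>k=1..n. u (pt n \<pi> k)) = (\<Sum>k=1..n. u (pt n ?p k) - u (pt n \<pi> k))"
    by (simp add: sum_subtractf)
  also have "\<dots> = (\<Sum>k\<in>{i, j}. u (pt n ?p k) - u (pt n \<pi> k))"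
    using ij by (intro sum.mono_neutral_right) (auto simp: pt_swp(3))
  also have "\<dots> = u (cross (pt n \<pi> i) (pt n \<pi> j)) + u (cross (pt n \<pi> j) (pt n \<pi> i)) - u (pt n \<pi> i) - u (pt n \<pi> j)"
    using False by (simp add: pt_swp(1,2))
  finally show ?thesis unfolding emp_def avg_def by (simp add: diff_divide_distrib[symmetric] add_divide_distrib[symmetric] algebra_simps)
qed

context doubly_stochastic
begin

lemma continuous_partial_integral:
  fixes Q :: "'a::heine_borel \<times> (real \<times> real) \<Rightarrow> real"
  assumes Q: "continuous_on UNIV Q"
  shows "continuous_on UNIV (\<lambda>z. \<integral>w. Q (z, w) \<partial>\<mu>)"
proof (rule continuous_on_sequentiallyI)
  fix x :: "nat \<Rightarrow> 'a" and a :: 'a assume x: "x \<longlonglongrightarrow> a"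
  interpret prob_space \<mu> by (rule prob_space_\<mu>)
  have "compact (insert a (range x) \<times> unit_square)"
    by (intro compact_Times compact_unit_square compact_sequence_with_limit x)
  then have "compact (Q ` (insert a (range x) \<times> unit_square))"
    by (intro compact_continuous_image continuous_on_subset[OF Q]) auto
  then obtain C where C: "\<And>z. z \<in> insert a (range x) \<times> unit_square \<Longrightarrow> norm (Q z) \<le> C"
    using compact_imp_bounded bounded_iff by (metis image_eqI)
  have Qz: "continuous_on UNIV (\<lambda>w. Q (z, w))" for z
    by (rule continuous_on_compose2[OF Q]) (auto intro!: continuous_on_Pair continuous_on_const continuous_on_id)
  have meas: "(\<lambda>w. Q (z, w)) \<in> borel_measurable \<mu>" for z
    by (rule continuous_measurable_square[OF Qz sets_\<mu>])
  show "(\<lambda>n. \<integral>w. Q (x n, w) \<partial>\<mu>) \<longlonglongrightarrow> (\<integral>w. Q (a, w) \<partial>\<mu>)"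
  proof (rule integral_dominated_convergence[where w="\<lambda>_. C"])
    show "AE w in \<mu>. (\<lambda>n. Q (x n, w)) \<longlonglongrightarrow> Q (a, w)"
    proof (rule AE_I2)
      fix w
      have "isCont Q (a, w)" using continuous_on_eq_continuous_at[OF open_UNIV, of Q] Q by blast
      then show "(\<lambda>n. Q (x n, w)) \<longlonglongrightarrow> Q (a, w)"
        by (rule isCont_tendsto_compose) (intro tendsto_Pair x tendsto_const)
    qed
    show "AE w in \<mu>. norm (Q (x n, w)) \<le> C" for n
      by (rule AE_I2) (use C in auto)
  qed (auto intro: meas)
qed

lemma integral_pair:
  fixes Q :: "(real \<times> real) \<times> (real \<times> real) \<Rightarrow> real"
  assumes Q: "continuous_on UNIV Q"
  shows "(\<integral>p. Q p \<partial>(\<mu> \<Otimes>\<^sub>M \<mu>)) = (\<integral>z. \<integral>w. Q (z, w) \<partial>\<mu> \<partial>\<mu>)"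
    and "(\<integral>p. Q p \<partial>(\<mu> \<Otimes>\<^sub>M \<mu>)) = (\<integral>w. \<integral>z. Q (z, w) \<partial>\<mu> \<partial>\<mu>)"
    and "integrable (\<mu> \<Otimes>\<^sub>M \<mu>) Q"
proof -
  interpret \<mu>: prob_space \<mu> by (rule prob_space_\<mu>)
  interpret pair_prob_space \<mu> \<mu> ..
  show i: "integrable (\<mu> \<Otimes>\<^sub>M \<mu>) Q"
    by (rule continuous_prob_integrable(1)[OF LLN2(2)[OF Q] LLN2(3)[OF Q] _ LLN2(4)[OF Q] Q])
       (intro compact_Times compact_unit_square)
  show "(\<integral>p. Q p \<partial>(\<mu> \<Otimes>\<^sub>M \<mu>)) = (\<integral>z. \<integral>w. Q (z, w) \<partial>\<mu> \<partial>\<mu>)"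
    using integral_fst'[OF i] by simp
  show "(\<integral>p. Q p \<partial>(\<mu> \<Otimes>\<^sub>M \<mu>)) = (\<integral>w. \<integral>z. Q (z, w) \<partial>\<mu> \<partial>\<mu>)"
    using integral_snd[of "\<lambda>x y. Q (x, y)"] i by simp
qed

lemma integral_triple:
  fixes Q :: "(real \<times> real) \<times> (real \<times> real) \<times> (real \<times> real) \<Rightarrow> real"
  assumes Q: "continuous_on UNIV Q"
  shows "(\<integral>p. Q p \<partial>(\<mu> \<Otimes>\<^sub>M (\<mu> \<Otimes>\<^sub>M \<mu>))) = (\<integral>z. \<integral>w. \<integral>v. Q (z, w, v) \<partial>\<mu> \<partial>\<mu> \<partial>\<mu>)"
proof -
  have z: "continuous_on UNIV (\<lambda>_. 0 :: real)" by simp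
  interpret \<mu>: prob_space \<mu> by (rule prob_space_\<mu>)
  interpret \<mu>2: prob_space "\<mu> \<Otimes>\<^sub>M \<mu>" by (rule LLN2(2)[OF z])
  interpret pair_prob_space \<mu> "\<mu> \<Otimes>\<^sub>M \<mu>" ..
  have i: "integrable (\<mu> \<Otimes>\<^sub>M (\<mu> \<Otimes>\<^sub>M \<mu>)) Q"
    by (rule continuous_prob_integrable(1)[OF LLN3(2)[OF Q] LLN3(3)[OF Q] _ LLN3(4)[OF Q] Q])
       (intro compact_Times compact_unit_square)
  have c: "continuous_on UNIV (\<lambda>p. Q (z, p))" for z
    by (rule continuous_on_compose2[OF Q]) (auto intro!: continuous_on_Pair continuous_on_const continuous_on_id)
  have "(\<integral>p. Q p \<partial>(\<mu> \<Otimes>\<^sub>M (\<mu> \<Otimes>\<^sub>M \<mu>))) = (\<integral>z. \<integral>p. Q (z, p) \<partial>(\<mu> \<Otimes>\<^sub>M \<mu>) \<partial>\<mu>)"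
    using integral_fst'[OF i] by simp
  then show ?thesis unfolding integral_pair(1)[OF c] .
qed

context
  fixes g :: "(real \<times> real) \<times> (real \<times> real) \<Rightarrow> real"
  assumes g_cont: "continuous_on UNIV g" and g_sym: "\<And>z w. g (z, w) = g (w, z)"
    and g_swap: "\<And>p. g (swap p) = - g p"
begin

text \<open>Half the harmonic mean of the weights before and after the swap. It is invariant under the swap, and
  in the permutation model \<open>swap_weight2 * swap_mean\<close> is the factor \<open>1 / (1 + exp (\<theta> \<bullet> y))\<close> of the score.\<close>

definition swap_mean :: "(real \<times> real) \<times> (real \<times> real) \<Rightarrow> real" where
  "swap_mean p = M (fst p) * M (snd p) * (M (fst (swap p)) * M (snd (swap p))) /
     (M (fst p) * M (snd p) + M (fst (swap p)) * M (snd (swap p)))"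

definition score_kernel :: "(real \<times> real) \<times> (real \<times> real) \<Rightarrow> real" where
  "score_kernel p = swap_weight2 p * (swap_mean p * g p)"

lemma swap_swap: "swap (swap p) = p" by (simp add: swap_def cross_def)

lemma swap_mean_swap: "swap_mean (swap p) = swap_mean p"
  unfolding swap_mean_def swap_swap by (simp add: mult_ac add.commute)

lemma continuous_swap_mean: "continuous_on UNIV swap_mean"
proof -
  have ne: "M a * M b + M c * M d \<noteq> 0" for a b c d using M_pos by (smt (verit) mult_pos_pos)
  show ?thesis unfolding swap_mean_def[abs_def]
    by (intro continuous_on_divide continuous_on_add continuous_on_mult continuous_M_comp continuous_on_fst continuous_on_snd continuous_on_id continuous_swap ballI ne)
qed

lemma continuous_sg: "continuous_on UNIV (\<lambda>p. swap_mean p * g p)"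
  by (intro continuous_on_mult continuous_swap_mean g_cont)

lemma continuous_score_kernel: "continuous_on UNIV score_kernel"
  unfolding score_kernel_def[abs_def] by (intro continuous_on_mult continuous_swap_weight2 continuous_sg)

lemma score_kernel_sym: "score_kernel (z, w) = score_kernel (w, z)"
  unfolding score_kernel_def swap_weight2_def swap_weight_def swap_mean_def swap_def using g_sym[of z w] by (simp add: mult_ac)

text \<open>The one-point projection of the two-point kernel; its second moment is the limiting variance.\<close>

definition \<Phi> :: "real \<times> real \<Rightarrow> real" where
  "\<Phi> z = (\<integral>w. score_kernel (z, w) \<partial>\<mu>)"

definition limit_variance :: real where "limit_variance = (\<integral>z. (\<Phi> z)\<^sup>2 \<partial>\<mu>)"

lemma limit_variance_nonneg: "0 \<le> limit_variance" unfolding limit_variance_def by simp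

lemma continuous_\<Phi>: "continuous_on UNIV \<Phi>"
  unfolding \<Phi>_def[abs_def] by (rule continuous_partial_integral[OF continuous_score_kernel])

lemma continuous_\<Phi>_comp: "continuous_on S f \<Longrightarrow> continuous_on S (\<lambda>x. \<Phi> (f x))"
  by (rule continuous_on_compose2[OF continuous_\<Phi>]) auto

lemma continuous_score_kernel_comp: "continuous_on S f \<Longrightarrow> continuous_on S (\<lambda>x. score_kernel (f x))"
  by (rule continuous_on_compose2[OF continuous_score_kernel]) auto

lemma score_kernel_Phi_integrals:
  "(\<integral>p. score_kernel p * \<Phi> (fst p) \<partial>(\<mu> \<Otimes>\<^sub>M \<mu>)) = limit_variance"
  "(\<integral>p. score_kernel p * \<Phi> (snd p) \<partial>(\<mu> \<Otimes>\<^sub>M \<mu>)) = limit_variance"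
  "(\<integral>p. score_kernel p * \<Phi> (fst (swap p)) \<partial>(\<mu> \<Otimes>\<^sub>M \<mu>)) = - limit_variance"
  "(\<integral>p. score_kernel p * \<Phi> (snd (swap p)) \<partial>(\<mu> \<Otimes>\<^sub>M \<mu>)) = - limit_variance"
proof -
  have c: "continuous_on UNIV (\<lambda>p::(real\<times>real)\<times>(real\<times>real). \<Phi> (fst p))" "continuous_on UNIV (\<lambda>p::(real\<times>real)\<times>(real\<times>real). \<Phi> (snd p))"
    by (intro continuous_\<Phi>_comp continuous_on_fst continuous_on_snd continuous_on_id)+
  show 1: "(\<integral>p. score_kernel p * \<Phi> (fst p) \<partial>(\<mu> \<Otimes>\<^sub>M \<mu>)) = limit_variance"
    by (subst integral_pair(1)) (auto intro!: continuous_on_mult continuous_score_kernel c simp: \<Phi>_def[symmetric] limit_variance_def power2_eq_square)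
  have "(\<integral>p. score_kernel p * \<Phi> (snd p) \<partial>(\<mu> \<Otimes>\<^sub>M \<mu>)) = (\<integral>w. \<integral>z. score_kernel (w, z) * \<Phi> w \<partial>\<mu> \<partial>\<mu>)"
    by (subst integral_pair(2)) (auto intro!: continuous_on_mult continuous_score_kernel c simp: score_kernel_sym[of _ w for w])
  then show 2: "(\<integral>p. score_kernel p * \<Phi> (snd p) \<partial>(\<mu> \<Otimes>\<^sub>M \<mu>)) = limit_variance"
    by (simp add: \<Phi>_def[symmetric] limit_variance_def power2_eq_square)
  have sw: "(\<integral>p. score_kernel p * F (swap p) \<partial>(\<mu> \<Otimes>\<^sub>M \<mu>)) = - (\<integral>p. score_kernel p * F p \<partial>(\<mu> \<Otimes>\<^sub>M \<mu>))" if F: "continuous_on UNIV F" for F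
  proof -
    have "(\<integral>p. swap_weight2 p * (swap_mean p * g p * F p) \<partial>(\<mu> \<Otimes>\<^sub>M \<mu>)) = (\<integral>p. swap_weight2 p * (swap_mean (swap p) * g (swap p) * F (swap p)) \<partial>(\<mu> \<Otimes>\<^sub>M \<mu>))"
      by (rule swap_invariance) (intro continuous_on_mult[OF continuous_sg F])
    then show ?thesis unfolding swap_mean_swap g_swap score_kernel_def by (simp add: mult_ac)
  qed
  show "(\<integral>p. score_kernel p * \<Phi> (fst (swap p)) \<partial>(\<mu> \<Otimes>\<^sub>M \<mu>)) = - limit_variance" using sw[OF c(1)] 1 by simp
  show "(\<integral>p. score_kernel p * \<Phi> (snd (swap p)) \<partial>(\<mu> \<Otimes>\<^sub>M \<mu>)) = - limit_variance" using sw[OF c(2)] 2 by simp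
qed

text \<open>The first-order effect of swapping the values at \<open>z\<close> and \<open>w\<close> on the two-point average of the kernel, seen
  from a third point \<open>v\<close>.\<close>

definition \<kappa> :: "(real \<times> real) \<Rightarrow> (real \<times> real) \<Rightarrow> real \<times> real \<Rightarrow> real" where
  "\<kappa> z w v = score_kernel (v, z) + score_kernel (v, w) - score_kernel (v, cross z w) - score_kernel (v, cross w z)"

definition \<Theta> :: "(real \<times> real) \<times> (real \<times> real) \<times> (real \<times> real) \<Rightarrow> real" where
  "\<Theta> p = score_kernel (fst p, fst (snd p)) * \<kappa> (fst p) (fst (snd p)) (snd (snd p))"

lemma continuous_cross: "continuous_on S f \<Longrightarrow> continuous_on S h \<Longrightarrow> continuous_on S (\<lambda>x. cross (f x) (h x))"
  unfolding cross_def by (intro continuous_on_Pair continuous_on_fst continuous_on_snd)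

lemma continuous_\<Theta>: "continuous_on UNIV \<Theta>"
  unfolding \<Theta>_def[abs_def] \<kappa>_def
  by (intro continuous_on_mult continuous_on_add continuous_on_diff continuous_score_kernel_comp continuous_on_Pair continuous_cross
    continuous_on_fst continuous_on_snd continuous_on_id)

text \<open>Of the four terms of \<open>\<kappa>\<close>, two give the variance directly; the crossed ones enter with a minus sign and
  give minus the variance by swap invariance. Hence the factor 4.\<close>

lemma integral_\<Theta>: "(\<integral>p. \<Theta> p \<partial>(\<mu> \<Otimes>\<^sub>M (\<mu> \<Otimes>\<^sub>M \<mu>))) = 4 * limit_variance"
proof -
  have Gv: "continuous_on UNIV (\<lambda>v. score_kernel (v, a))" for a
    by (intro continuous_score_kernel_comp continuous_on_Pair continuous_on_id continuous_on_const)
  have i: "integrable \<mu> (\<lambda>v. score_kernel (v, a))" for a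
    by (rule integrable_square[OF Gv prob_space_\<mu> sets_\<mu>])
  have P: "(\<integral>v. score_kernel (v, a) \<partial>\<mu>) = \<Phi> a" for a unfolding \<Phi>_def score_kernel_sym[of a] ..
  let ?K = "\<lambda>p. score_kernel p * (\<Phi> (fst p) + \<Phi> (snd p) - \<Phi> (fst (swap p)) - \<Phi> (snd (swap p)))"
  have ck: "continuous_on UNIV (\<lambda>p. score_kernel p * \<Phi> (fst p))" "continuous_on UNIV (\<lambda>p. score_kernel p * \<Phi> (snd p))"
     "continuous_on UNIV (\<lambda>p. score_kernel p * \<Phi> (fst (swap p)))" "continuous_on UNIV (\<lambda>p. score_kernel p * \<Phi> (snd (swap p)))"
    by (intro continuous_on_mult continuous_score_kernel continuous_\<Phi>_comp continuous_on_fst continuous_on_snd continuous_on_id continuous_swap)+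
  have eq: "?K p = score_kernel p * \<Phi> (fst p) + score_kernel p * \<Phi> (snd p) - score_kernel p * \<Phi> (fst (swap p)) - score_kernel p * \<Phi> (snd (swap p))" for p
    by (simp add: algebra_simps)
  have cK: "continuous_on UNIV ?K"
    unfolding eq by (intro continuous_on_add continuous_on_diff ck)
  have "(\<integral>p. \<Theta> p \<partial>(\<mu> \<Otimes>\<^sub>M (\<mu> \<Otimes>\<^sub>M \<mu>))) = (\<integral>z. \<integral>w. ?K (z, w) \<partial>\<mu> \<partial>\<mu>)"
    unfolding integral_triple[OF continuous_\<Theta>]
    by (intro Bochner_Integration.integral_cong refl) (simp add: \<Theta>_def \<kappa>_def i P swap_def)
  also have "\<dots> = (\<integral>p. ?K p \<partial>(\<mu> \<Otimes>\<^sub>M \<mu>))" by (rule integral_pair(1)[OF cK, symmetric])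
  also have "\<dots> = 4 * limit_variance"
    unfolding eq by (simp add: integral_pair(3) ck continuous_on_add continuous_on_diff score_kernel_Phi_integrals)
  finally show ?thesis .
qed

definition scaled_stat :: "nat \<Rightarrow> (nat \<Rightarrow> nat) \<Rightarrow> real" where
  "scaled_stat n \<pi> = sqrt n / 2 * emp2 n \<pi> score_kernel"

text \<open>The kernel changes sign under the swap, so \<open>E_swap\<close> equates the expectation with its swapped negative.\<close>

lemma stein_identity:
  assumes n: "n > 0"
  shows "E n (\<lambda>\<pi>. emp2 n \<pi> score_kernel * F \<pi>) = (1 / 2) * avg n (\<lambda>i. avg n (\<lambda>j. E n (\<lambda>\<pi>. score_kernel (pt n \<pi> i, pt n \<pi> j) * (F \<pi> - F (swp \<pi> i j)))))"
proof -
  have "emp2 n \<pi> score_kernel * F \<pi> = avg n (\<lambda>i. avg n (\<lambda>j. score_kernel (pt n \<pi> i, pt n \<pi> j) * F \<pi>))" for \<pi>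
    by (simp add: emp2_def emp_def avg_cmult_right)
  then have "E n (\<lambda>\<pi>. emp2 n \<pi> score_kernel * F \<pi>) = avg n (\<lambda>i. avg n (\<lambda>j. E n (\<lambda>\<pi>. score_kernel (pt n \<pi> i, pt n \<pi> j) * F \<pi>)))"
    by (simp add: E_avg)
  also have "\<dots> = avg n (\<lambda>i. avg n (\<lambda>j. (1 / 2) * E n (\<lambda>\<pi>. score_kernel (pt n \<pi> i, pt n \<pi> j) * (F \<pi> - F (swp \<pi> i j)))))"
  proof (intro avg_cong)
    fix i j assume ij: "i \<in> {1..n}" "j \<in> {1..n}"
    let ?z = "\<lambda>\<pi>. (pt n \<pi> i, pt n \<pi> j)"
    have "E n (\<lambda>\<pi>. score_kernel (?z \<pi>) * F \<pi>) = E n (\<lambda>\<pi>. swap_weight (pt n \<pi> i) (pt n \<pi> j) * (swap_mean (?z \<pi>) * g (?z \<pi>) * F \<pi>))"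
      by (simp add: score_kernel_def swap_weight2_def mult.assoc)
    also have "\<dots> = E n (\<lambda>\<pi>. swap_weight (pt n \<pi> i) (pt n \<pi> j) * (swap_mean (?z (swp \<pi> i j)) * g (?z (swp \<pi> i j)) * F (swp \<pi> i j)))"
      using E_swap[OF ij, of "\<lambda>\<pi>. swap_mean (?z \<pi>) * g (?z \<pi>) * F \<pi>"] .
    also have "?z (swp \<pi> i j) = swap (?z \<pi>)" for \<pi> by (simp only: pt_swp swap_def fst_conv snd_conv)
    then have "E n (\<lambda>\<pi>. swap_weight (pt n \<pi> i) (pt n \<pi> j) * (swap_mean (?z (swp \<pi> i j)) * g (?z (swp \<pi> i j)) * F (swp \<pi> i j)))
      = E n (\<lambda>\<pi>. (-1) * (score_kernel (?z \<pi>) * F (swp \<pi> i j)))"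
      by (simp only: swap_mean_swap g_swap score_kernel_def swap_weight2_def fst_conv snd_conv) (simp add: mult_ac)
    also have "\<dots> = - E n (\<lambda>\<pi>. score_kernel (?z \<pi>) * F (swp \<pi> i j))" by (simp only: E_cmult)
    finally have "E n (\<lambda>\<pi>. score_kernel (?z \<pi>) * F \<pi>) = - E n (\<lambda>\<pi>. score_kernel (?z \<pi>) * F (swp \<pi> i j))" .
    then show "E n (\<lambda>\<pi>. score_kernel (?z \<pi>) * F \<pi>) = (1 / 2) * E n (\<lambda>\<pi>. score_kernel (?z \<pi>) * (F \<pi> - F (swp \<pi> i j)))"
      by (simp add: right_diff_distrib E_diff)
  qed
  finally show ?thesis by (simp only: avg_cmult)
qed

text \<open>A swap adds a signed measure of mass \<open>O(1/n)\<close> to the empirical measure. In a symmetric bilinear average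
  the two linear terms agree, and the quadratic term is \<open>O(1/n\<^sup>2)\<close>.\<close>

lemma emp2_swp:
  assumes n: "n > 0" and p: "\<pi> \<in> perms n" and ij: "i \<in> {1..n}" "j \<in> {1..n}"
    and b: "\<And>p. p \<in> unit_square \<times> unit_square \<Longrightarrow> \<bar>score_kernel p\<bar> \<le> b"
  shows "\<bar>emp2 n \<pi> score_kernel - emp2 n (swp \<pi> i j) score_kernel - (2 / n) * emp n \<pi> (\<kappa> (pt n \<pi> i) (pt n \<pi> j))\<bar> \<le> 16 * b / n\<^sup>2"
proof -
  let ?z = "pt n \<pi> i" and ?w = "pt n \<pi> j"
  let ?c = "cross ?z ?w" and ?d = "cross ?w ?z"
  (* The change of the empirical measure under the swap, multiplied by n. *)
  define \<delta> where "\<delta> u = u ?c + u ?d - u ?z - u ?w" for u :: "real \<times> real \<Rightarrow> real"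
  have sq: "?z \<in> unit_square" "?w \<in> unit_square" "?c \<in> unit_square" "?d \<in> unit_square"
    using pt_square[OF p] ij cross_square by auto
  have es: "emp n (swp \<pi> i j) u = emp n \<pi> u + (1 / n) * \<delta> u" for u
    unfolding \<delta>_def by (rule emp_swp[OF n ij])
  have \<kappa>: "\<kappa> ?z ?w v = - \<delta> (\<lambda>w. score_kernel (v, w))" for v by (simp add: \<kappa>_def \<delta>_def)
  have sym: "emp n \<pi> (\<lambda>w. score_kernel (v, w)) = emp n \<pi> (\<lambda>w. score_kernel (w, v))" for v using score_kernel_sym by simp
  have \<delta>emp: "\<delta> (\<lambda>z. emp n \<pi> (\<lambda>w. score_kernel (z, w))) = emp n \<pi> (\<lambda>v. \<delta> (\<lambda>w. score_kernel (v, w)))"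
    unfolding \<delta>_def sym by (simp add: emp_def avg_add avg_diff)
  have "emp2 n (swp \<pi> i j) score_kernel = emp n \<pi> (\<lambda>z. emp n \<pi> (\<lambda>w. score_kernel (z, w)) + (1 / n) * \<delta> (\<lambda>w. score_kernel (z, w)))
     + (1 / n) * \<delta> (\<lambda>z. emp n \<pi> (\<lambda>w. score_kernel (z, w)) + (1 / n) * \<delta> (\<lambda>w. score_kernel (z, w)))"
    unfolding emp2_def es ..
  also have "\<dots> = emp2 n \<pi> score_kernel + (1 / n) * emp n \<pi> (\<lambda>v. \<delta> (\<lambda>w. score_kernel (v, w)))
     + (1 / n) * (\<delta> (\<lambda>z. emp n \<pi> (\<lambda>w. score_kernel (z, w))) + (1 / n) * \<delta> (\<lambda>z. \<delta> (\<lambda>w. score_kernel (z, w))))"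
    unfolding emp_add emp_cmult emp2_def by (simp add: \<delta>_def algebra_simps)
  finally have 1: "emp2 n (swp \<pi> i j) score_kernel = emp2 n \<pi> score_kernel + (2 / n) * emp n \<pi> (\<lambda>v. \<delta> (\<lambda>w. score_kernel (v, w))) + (1 / n) * (1 / n) * \<delta> (\<lambda>z. \<delta> (\<lambda>w. score_kernel (z, w)))"
    unfolding \<delta>emp by (simp add: algebra_simps)
  have 2: "emp n \<pi> (\<kappa> ?z ?w) = - emp n \<pi> (\<lambda>v. \<delta> (\<lambda>w. score_kernel (v, w)))"
    using emp_cmult[of n \<pi> "-1" "\<lambda>v. \<delta> (\<lambda>w. score_kernel (v, w))"] by (simp add: \<kappa>[abs_def])
  have \<delta>b: "\<bar>\<delta> u\<bar> \<le> 4 * a" if "\<And>z. z \<in> unit_square \<Longrightarrow> \<bar>u z\<bar> \<le> a" for u a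
    using that[OF sq(1)] that[OF sq(2)] that[OF sq(3)] that[OF sq(4)] unfolding \<delta>_def by linarith
  have "\<bar>\<delta> (\<lambda>z. \<delta> (\<lambda>w. score_kernel (z, w)))\<bar> \<le> 4 * (4 * b)" by (intro \<delta>b b) auto
  then have "\<bar>(1 / n) * (1 / n) * \<delta> (\<lambda>z. \<delta> (\<lambda>w. score_kernel (z, w)))\<bar> \<le> (1 / n) * (1 / n) * (16 * b)"
    unfolding abs_mult by (intro mult_mono) auto
  then show ?thesis unfolding 1 2 by (simp add: power2_eq_square)
qed

lemma score_kernel_bound: obtains b where "0 \<le> b" "\<And>p. p \<in> unit_square \<times> unit_square \<Longrightarrow> \<bar>score_kernel p\<bar> \<le> b"
proof -
  have "compact (score_kernel ` (unit_square \<times> unit_square))"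
    by (intro compact_continuous_image continuous_on_subset[OF continuous_score_kernel] compact_Times compact_unit_square) auto
  then obtain b where b: "\<And>z. z \<in> unit_square \<times> unit_square \<Longrightarrow> \<bar>score_kernel z\<bar> \<le> b"
    using compact_imp_bounded bounded_iff by (metis image_eqI real_norm_def)
  show ?thesis by (rule that[of "max 0 b"]) (use b in fastforce)+
qed

lemma \<kappa>_bound:
  assumes "\<And>p. p \<in> unit_square \<times> unit_square \<Longrightarrow> \<bar>score_kernel p\<bar> \<le> b" "z \<in> unit_square" "w \<in> unit_square" "v \<in> unit_square"
  shows "\<bar>\<kappa> z w v\<bar> \<le> 4 * b"
proof -
  have "\<bar>score_kernel (v, a)\<bar> \<le> b" if "a \<in> unit_square" for a using assms that by auto
  from this[OF assms(2)] this[OF assms(3)] this[OF cross_square[OF assms(2,3)]] this[OF cross_square[OF assms(3,2)]]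
  show ?thesis unfolding \<kappa>_def by linarith
qed

lemma scaled_stat_swp:
  assumes n: "n > 0" and p: "\<pi> \<in> perms n" and ij: "i \<in> {1..n}" "j \<in> {1..n}"
    and b: "0 \<le> b" "\<And>p. p \<in> unit_square \<times> unit_square \<Longrightarrow> \<bar>score_kernel p\<bar> \<le> b"
  shows "\<bar>sqrt n * (scaled_stat n \<pi> - scaled_stat n (swp \<pi> i j)) - emp n \<pi> (\<kappa> (pt n \<pi> i) (pt n \<pi> j))\<bar> \<le> 8 * b / sqrt n"
    and "\<bar>scaled_stat n \<pi> - scaled_stat n (swp \<pi> i j)\<bar> \<le> 12 * b / sqrt n"
proof -
  let ?D = "emp2 n \<pi> score_kernel - emp2 n (swp \<pi> i j) score_kernel" and ?k = "emp n \<pi> (\<kappa> (pt n \<pi> i) (pt n \<pi> j))"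
  have sn: "sqrt n * sqrt n = n" "sqrt n > 0" using n by auto
  have eq: "scaled_stat n \<pi> - scaled_stat n (swp \<pi> i j) = sqrt n / 2 * ?D" by (simp add: scaled_stat_def algebra_simps)
  have "sqrt n * (scaled_stat n \<pi> - scaled_stat n (swp \<pi> i j)) = sqrt n * sqrt n / 2 * ?D" unfolding eq by simp
  then have 0: "sqrt n * (scaled_stat n \<pi> - scaled_stat n (swp \<pi> i j)) - ?k = (real n / 2) * (?D - (2 / n) * ?k)"
    unfolding sn using n by (simp add: right_diff_distrib)
  have "\<bar>sqrt n * (scaled_stat n \<pi> - scaled_stat n (swp \<pi> i j)) - ?k\<bar> \<le> (real n / 2) * (16 * b / n\<^sup>2)"
    unfolding 0 abs_mult using emp2_swp[OF n p ij b(2)] by (intro mult_mono) auto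
  also have "\<dots> = 8 * b / n" using n by (simp add: power2_eq_square)
  also have "\<dots> \<le> 8 * b / sqrt n"
  proof (rule divide_left_mono)
    have "1 \<le> sqrt n" using n by simp
    then show "sqrt n \<le> n" using mult_left_mono[of 1 "sqrt n" "sqrt n"] sn by simp
  qed (use b n in auto)
  finally show 1: "\<bar>sqrt n * (scaled_stat n \<pi> - scaled_stat n (swp \<pi> i j)) - ?k\<bar> \<le> 8 * b / sqrt n" .
  have "\<bar>?k\<bar> \<le> 4 * b" by (intro emp_bound n p \<kappa>_bound b pt_square ij)
  moreover have "8 * b / sqrt n \<le> 8 * b" using b n by (simp add: divide_le_eq mult_le_cancel_left1)
  ultimately have "\<bar>sqrt n * (scaled_stat n \<pi> - scaled_stat n (swp \<pi> i j))\<bar> \<le> 12 * b" using 1 by linarith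
  then show "\<bar>scaled_stat n \<pi> - scaled_stat n (swp \<pi> i j)\<bar> \<le> 12 * b / sqrt n" using sn by (simp add: abs_mult pos_le_divide_eq mult.commute)
qed

lemma scaled_stat_second_moment:
  obtains K where "0 \<le> K" "\<And>n. n > 0 \<Longrightarrow> E n (\<lambda>\<pi>. (scaled_stat n \<pi>)\<^sup>2) \<le> K"
proof -
  obtain b where b: "0 \<le> b" "\<And>p. p \<in> unit_square \<times> unit_square \<Longrightarrow> \<bar>score_kernel p\<bar> \<le> b" using score_kernel_bound by blast
  show ?thesis
  proof (rule that[of "3 * b\<^sup>2"])
    fix n :: nat assume n: "n > 0"
    have "E n (\<lambda>\<pi>. (scaled_stat n \<pi>)\<^sup>2) = E n (\<lambda>\<pi>. sqrt n / 2 * (emp2 n \<pi> score_kernel * scaled_stat n \<pi>))"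
      by (rule E_cong) (simp add: scaled_stat_def power2_eq_square)
    also have "\<dots> = sqrt n / 4 * avg n (\<lambda>i. avg n (\<lambda>j. E n (\<lambda>\<pi>. score_kernel (pt n \<pi> i, pt n \<pi> j) * (scaled_stat n \<pi> - scaled_stat n (swp \<pi> i j)))))"
      by (simp only: E_cmult stein_identity[OF n])
    also have "\<dots> \<le> sqrt n / 4 * (b * (12 * b / sqrt n))"
    proof (intro mult_left_mono avg_le n E_le)
      fix i j \<pi> assume ij: "i \<in> {1..n}" "j \<in> {1..n}" and p: "\<pi> \<in> perms n"
      have "\<bar>score_kernel (pt n \<pi> i, pt n \<pi> j) * (scaled_stat n \<pi> - scaled_stat n (swp \<pi> i j))\<bar> \<le> b * (12 * b / sqrt n)"
        unfolding abs_mult using pt_square[OF p] ij b(1)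
        by (intro mult_mono b(2) scaled_stat_swp(2)[OF n p ij b]) auto
      then show "score_kernel (pt n \<pi> i, pt n \<pi> j) * (scaled_stat n \<pi> - scaled_stat n (swp \<pi> i j)) \<le> b * (12 * b / sqrt n)" by linarith
    qed simp
    also have "\<dots> = 3 * b\<^sup>2" using n by (simp add: power2_eq_square)
    finally show "E n (\<lambda>\<pi>. (scaled_stat n \<pi>)\<^sup>2) \<le> 3 * b\<^sup>2" .
  qed simp
qed

text \<open>Stein's identity with a sine as test function. The first-order term of the increment of the sine is the
  three-point average of \<open>\<Theta>\<close>, whose limit is \<open>4 * limit_variance\<close>.\<close>

lemma stein_estimate:
  assumes n: "n > 0" and s: "0 \<le> s" "s \<le> 1" and b: "0 \<le> b" "\<And>p. p \<in> unit_square \<times> unit_square \<Longrightarrow> \<bar>score_kernel p\<bar> \<le> b"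
  shows "\<bar>E n (\<lambda>\<pi>. scaled_stat n \<pi> * sin (s * scaled_stat n \<pi> + \<phi>)) - limit_variance * s * E n (\<lambda>\<pi>. cos (s * scaled_stat n \<pi> + \<phi>))\<bar>
    \<le> b * (144 * b\<^sup>2 + 8 * b) / sqrt n + E n (\<lambda>\<pi>. \<bar>emp3 n \<pi> \<Theta> - 4 * limit_variance\<bar>)"
proof -
  let ?S = "\<lambda>\<pi>. sin (s * scaled_stat n \<pi> + \<phi>)" and ?C = "\<lambda>\<pi>. cos (s * scaled_stat n \<pi> + \<phi>)"
  let ?G = "\<lambda>i j \<pi>. score_kernel (pt n \<pi> i, pt n \<pi> j)" and ?k = "\<lambda>i j \<pi>. emp n \<pi> (\<kappa> (pt n \<pi> i) (pt n \<pi> j))"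
  define r where "r = b * ((144 * b\<^sup>2 + 8 * b) / sqrt n)"
  have sn: "sqrt n * sqrt n = n" "sqrt n > 0" using n by auto
  have "E n (\<lambda>\<pi>. scaled_stat n \<pi> * ?S \<pi>) = E n (\<lambda>\<pi>. sqrt n / 2 * (emp2 n \<pi> score_kernel * ?S \<pi>))"
    by (rule E_cong) (simp add: scaled_stat_def)
  also have "\<dots> = sqrt n / 4 * avg n (\<lambda>i. avg n (\<lambda>j. E n (\<lambda>\<pi>. ?G i j \<pi> * (?S \<pi> - ?S (swp \<pi> i j)))))"
    by (simp only: E_cmult stein_identity[OF n])
  also have "\<dots> = (1 / 4) * avg n (\<lambda>i. avg n (\<lambda>j. E n (\<lambda>\<pi>. sqrt n * (?G i j \<pi> * (?S \<pi> - ?S (swp \<pi> i j))))))"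
    by (simp only: E_cmult avg_cmult)
  finally have 1: "E n (\<lambda>\<pi>. scaled_stat n \<pi> * ?S \<pi>) = (1 / 4) * avg n (\<lambda>i. avg n (\<lambda>j. E n (\<lambda>\<pi>. sqrt n * (?G i j \<pi> * (?S \<pi> - ?S (swp \<pi> i j))))))" .
  have "avg n (\<lambda>i. avg n (\<lambda>j. E n (\<lambda>\<pi>. s * (?C \<pi> * (?G i j \<pi> * ?k i j \<pi>))))) = E n (\<lambda>\<pi>. s * (?C \<pi> * emp3 n \<pi> \<Theta>))"
    unfolding E_avg[symmetric] avg_cmult
    by (intro E_cong) (simp add: emp3_def emp2_def \<Theta>_def emp_cmult, simp add: emp_def)
  then have 2: "E n (\<lambda>\<pi>. s * (?C \<pi> * emp3 n \<pi> \<Theta>)) = avg n (\<lambda>i. avg n (\<lambda>j. E n (\<lambda>\<pi>. s * (?C \<pi> * (?G i j \<pi> * ?k i j \<pi>)))))" ..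
  have "\<bar>avg n (\<lambda>i. avg n (\<lambda>j. E n (\<lambda>\<pi>. sqrt n * (?G i j \<pi> * (?S \<pi> - ?S (swp \<pi> i j)))))) - E n (\<lambda>\<pi>. s * (?C \<pi> * emp3 n \<pi> \<Theta>))\<bar> \<le> r"
    unfolding 2 avg_diff[symmetric] E_diff[symmetric]
  proof (intro avg_abs_le n order_trans[OF E_abs] E_le)
    fix i j \<pi> assume ij: "i \<in> {1..n}" "j \<in> {1..n}" and p: "\<pi> \<in> perms n"
    let ?p = "swp \<pi> i j"
    define d where "d = scaled_stat n \<pi> - scaled_stat n ?p"
    have d1: "\<bar>sqrt n * d - ?k i j \<pi>\<bar> \<le> 8 * b / sqrt n" and d2: "\<bar>d\<bar> \<le> 12 * b / sqrt n"
      using scaled_stat_swp[OF n p ij b] by (auto simp: d_def)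
    have "s * scaled_stat n ?p + \<phi> = (s * scaled_stat n \<pi> + \<phi>) + (- s * d)" by (simp add: d_def algebra_simps)
    then have 3: "\<bar>?S ?p - ?S \<pi> - (- s * d) * ?C \<pi>\<bar> \<le> (- s * d)\<^sup>2" using sin_first_order by metis
    have "(- s * d)\<^sup>2 = s\<^sup>2 * \<bar>d\<bar>\<^sup>2" by (simp add: power_mult_distrib)
    also have "\<dots> \<le> 1 * (12 * b / sqrt n)\<^sup>2" using s d2 by (intro mult_mono power_mono) (auto simp: power_le_one)
    also have "\<dots> = 144 * b\<^sup>2 / n" using n by (simp add: power_divide power_mult_distrib)
    finally have 4: "\<bar>?S \<pi> - ?S ?p - s * d * ?C \<pi>\<bar> \<le> 144 * b\<^sup>2 / n" using 3 by (simp add: abs_le_iff)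
    have 5: "sqrt n * (?S \<pi> - ?S ?p) - s * ?C \<pi> * ?k i j \<pi> = sqrt n * (?S \<pi> - ?S ?p - s * d * ?C \<pi>) + s * ?C \<pi> * (sqrt n * d - ?k i j \<pi>)"
      by (simp add: algebra_simps)
    have "\<bar>sqrt n * (?S \<pi> - ?S ?p - s * d * ?C \<pi>)\<bar> \<le> sqrt n * (144 * b\<^sup>2 / n)"
      unfolding abs_mult using 4 by (intro mult_mono) auto
    also have "\<dots> = 144 * b\<^sup>2 / sqrt n" using n by (simp add: real_div_sqrt field_simps)
    finally have 6: "\<bar>sqrt n * (?S \<pi> - ?S ?p - s * d * ?C \<pi>)\<bar> \<le> 144 * b\<^sup>2 / sqrt n" .
    have "\<bar>s * ?C \<pi>\<bar> \<le> 1" unfolding abs_mult using s by (intro mult_le_one) auto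
    then have "\<bar>s * ?C \<pi> * (sqrt n * d - ?k i j \<pi>)\<bar> \<le> 1 * (8 * b / sqrt n)"
      unfolding abs_mult[of "s * ?C \<pi>"] by (intro mult_mono d1) auto
    with 6 have 7: "\<bar>sqrt n * (?S \<pi> - ?S ?p) - s * ?C \<pi> * ?k i j \<pi>\<bar> \<le> (144 * b\<^sup>2 + 8 * b) / sqrt n"
      unfolding 5 by (simp add: add_divide_distrib)
    have "sqrt n * (?G i j \<pi> * (?S \<pi> - ?S ?p)) - s * (?C \<pi> * (?G i j \<pi> * ?k i j \<pi>)) = ?G i j \<pi> * (sqrt n * (?S \<pi> - ?S ?p) - s * ?C \<pi> * ?k i j \<pi>)"
      by (simp add: algebra_simps)
    then have "\<bar>sqrt n * (?G i j \<pi> * (?S \<pi> - ?S ?p)) - s * (?C \<pi> * (?G i j \<pi> * ?k i j \<pi>))\<bar> = \<bar>?G i j \<pi>\<bar> * \<bar>sqrt n * (?S \<pi> - ?S ?p) - s * ?C \<pi> * ?k i j \<pi>\<bar>"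
      by (simp only: abs_mult)
    also have "\<dots> \<le> r" unfolding r_def using pt_square[OF p] ij b by (intro mult_mono 7 b(2)) auto
    finally show "\<bar>sqrt n * (?G i j \<pi> * (?S \<pi> - ?S ?p)) - s * (?C \<pi> * (?G i j \<pi> * ?k i j \<pi>))\<bar> \<le> r" .
  qed
  then have 8: "\<bar>E n (\<lambda>\<pi>. scaled_stat n \<pi> * ?S \<pi>) - (1 / 4) * E n (\<lambda>\<pi>. s * (?C \<pi> * emp3 n \<pi> \<Theta>))\<bar> \<le> r / 4" unfolding 1 by linarith
  have "\<bar>E n (\<lambda>\<pi>. s * (?C \<pi> * emp3 n \<pi> \<Theta>)) - 4 * limit_variance * s * E n ?C\<bar> = \<bar>E n (\<lambda>\<pi>. s * ?C \<pi> * (emp3 n \<pi> \<Theta> - 4 * limit_variance))\<bar>"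
    unfolding E_cmult[symmetric] E_diff[symmetric] by (simp add: algebra_simps)
  also have "\<dots> \<le> E n (\<lambda>\<pi>. \<bar>emp3 n \<pi> \<Theta> - 4 * limit_variance\<bar>)"
  proof (rule order_trans[OF E_abs E_mono])
    fix \<pi>
    have "\<bar>s * ?C \<pi>\<bar> \<le> 1" unfolding abs_mult using s by (intro mult_le_one) auto
    then have "\<bar>s * ?C \<pi>\<bar> * \<bar>emp3 n \<pi> \<Theta> - 4 * limit_variance\<bar> \<le> 1 * \<bar>emp3 n \<pi> \<Theta> - 4 * limit_variance\<bar>" by (intro mult_right_mono) auto
    then show "\<bar>s * ?C \<pi> * (emp3 n \<pi> \<Theta> - 4 * limit_variance)\<bar> \<le> \<bar>emp3 n \<pi> \<Theta> - 4 * limit_variance\<bar>" by (simp add: abs_mult)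
  qed
  finally have 9: "\<bar>E n (\<lambda>\<pi>. s * (?C \<pi> * emp3 n \<pi> \<Theta>)) - 4 * limit_variance * s * E n ?C\<bar> \<le> E n (\<lambda>\<pi>. \<bar>emp3 n \<pi> \<Theta> - 4 * limit_variance\<bar>)" .
  have "0 \<le> r" using b by (simp add: r_def)
  moreover have "0 \<le> E n (\<lambda>\<pi>. \<bar>emp3 n \<pi> \<Theta> - 4 * limit_variance\<bar>)" by (intro E_nonneg) simp
  moreover have "r = b * (144 * b\<^sup>2 + 8 * b) / sqrt n" by (simp add: r_def)
  ultimately show ?thesis using 8 9 by linarith
qed

lemma clt_cos: "(\<lambda>n. E n (\<lambda>\<pi>. cos (scaled_stat n \<pi> + \<phi>))) \<longlonglongrightarrow> cos \<phi> * exp (- limit_variance / 2)"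
proof -
  obtain b where b: "0 \<le> b" "\<And>p. p \<in> unit_square \<times> unit_square \<Longrightarrow> \<bar>score_kernel p\<bar> \<le> b" using score_kernel_bound by blast
  define e where "e n = b * (144 * b\<^sup>2 + 8 * b) / sqrt n + E n (\<lambda>\<pi>. \<bar>emp3 n \<pi> \<Theta> - 4 * limit_variance\<bar>)" for n
  have "\<bar>E n (\<lambda>\<pi>. cos (scaled_stat n \<pi> + \<phi>)) - cos \<phi> * exp (- limit_variance / 2)\<bar> \<le> exp (limit_variance / 2) * e n" if n: "n > 0" for n
  proof -
    define c where "c s = E n (\<lambda>\<pi>. cos (s * scaled_stat n \<pi> + \<phi>))" for s
    have d: "(c has_real_derivative E n (\<lambda>\<pi>. - scaled_stat n \<pi> * sin (s * scaled_stat n \<pi> + \<phi>))) (at s)" for s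
      unfolding c_def E_def by (auto intro!: derivative_eq_intros sum.cong)
    have "\<bar>E n (\<lambda>\<pi>. - scaled_stat n \<pi> * sin (s * scaled_stat n \<pi> + \<phi>)) + limit_variance * s * c s\<bar> \<le> e n" if "0 \<le> s" "s \<le> 1" for s
    proof -
      have "E n (\<lambda>\<pi>. - scaled_stat n \<pi> * sin (s * scaled_stat n \<pi> + \<phi>)) = - E n (\<lambda>\<pi>. scaled_stat n \<pi> * sin (s * scaled_stat n \<pi> + \<phi>))"
        using E_cmult[of n "-1" "\<lambda>\<pi>. scaled_stat n \<pi> * sin (s * scaled_stat n \<pi> + \<phi>)"] by simp
      then show ?thesis using stein_estimate[OF n that b, of \<phi>] by (simp add: c_def e_def abs_minus_commute)
    qed
    from exp_square_ode_estimate[OF limit_variance_nonneg d this] show ?thesis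
      by (simp add: c_def E_const mult.commute)
  qed
  then have ev: "\<forall>\<^sub>F n in sequentially. norm (E n (\<lambda>\<pi>. cos (scaled_stat n \<pi> + \<phi>)) - cos \<phi> * exp (- limit_variance / 2)) \<le> exp (limit_variance / 2) * e n"
    by (intro eventually_mono[OF eventually_gt_at_top[of 0]]) simp
  have lim: "(\<lambda>n. exp (limit_variance / 2) * e n) \<longlonglongrightarrow> exp (limit_variance / 2) * (b * (144 * b\<^sup>2 + 8 * b) * 0 + 0)"
  proof -
    have "(\<lambda>n. 1 / sqrt (real n)) \<longlonglongrightarrow> 0"
      using tendsto_real_sqrt[OF lim_1_over_n[where 'a=real]] by (simp add: real_sqrt_divide)
    then have "(\<lambda>n. b * (144 * b\<^sup>2 + 8 * b) * (1 / sqrt (real n))) \<longlonglongrightarrow> b * (144 * b\<^sup>2 + 8 * b) * 0" by (rule tendsto_mult_left)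
    moreover have "(\<lambda>n. E n (\<lambda>\<pi>. \<bar>emp3 n \<pi> \<Theta> - 4 * limit_variance\<bar>)) \<longlonglongrightarrow> 0"
      using LLN3(1)[OF continuous_\<Theta>] unfolding L1_lim_def integral_\<Theta> .
    ultimately show ?thesis unfolding e_def by (intro tendsto_mult_left tendsto_add) auto
  qed
  then have "(\<lambda>n. exp (limit_variance / 2) * e n) \<longlonglongrightarrow> 0" by simp
  from Lim_null_comparison[OF ev this]
  have "(\<lambda>n. E n (\<lambda>\<pi>. cos (scaled_stat n \<pi> + \<phi>)) - cos \<phi> * exp (- limit_variance / 2)) \<longlonglongrightarrow> 0" .
  then show ?thesis by (simp only: LIM_zero_iff)
qed

end

end

section \<open>The logistic function, inward vector fields and matrices\<close>

definition logistic :: "real \<Rightarrow> real" where "logistic s = 1 / (1 + exp s)"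

lemma logistic_bounds: "0 < logistic s" "logistic s < 1"
  by (auto simp: logistic_def add_pos_pos)

lemma logistic_deriv: "(logistic has_real_derivative - (logistic s * (1 - logistic s))) (at s)"
proof -
  have ne: "1 + exp s \<noteq> 0" using exp_gt_zero[of s] by linarith
  have "((\<lambda>s. 1 / (1 + exp s)) has_real_derivative - exp s / (1 + exp s)\<^sup>2) (at s)"
    using ne by (auto intro!: derivative_eq_intros simp: power2_eq_square)
  moreover have "- exp s / (1 + exp s)\<^sup>2 = - (logistic s * (1 - logistic s))"
    using ne by (simp add: logistic_def power2_eq_square divide_simps)
  ultimately show ?thesis by (simp add: logistic_def[abs_def])
qed

lemma logistic_mvt:
  obtains \<xi> where "\<bar>\<xi> - s\<bar> \<le> \<bar>s' - s\<bar>" "logistic s' - logistic s = - (logistic \<xi> * (1 - logistic \<xi>)) * (s' - s)"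
proof (cases s s' rule: linorder_cases)
  case less
  from MVT2[OF this, of logistic "\<lambda>s. - (logistic s * (1 - logistic s))"] logistic_deriv
  obtain z where "z > s" "z < s'" "logistic s' - logistic s = (s' - s) * - (logistic z * (1 - logistic z))" by auto
  then show ?thesis by (intro that[of z]) (auto simp: mult.commute)
next
  case equal then show ?thesis by (intro that[of s]) auto
next
  case greater
  from MVT2[OF this, of logistic "\<lambda>s. - (logistic s * (1 - logistic s))"] logistic_deriv
  obtain z where "z > s'" "z < s" "logistic s - logistic s' = (s - s') * - (logistic z * (1 - logistic z))" by auto
  then show ?thesis by (intro that[of z]) (auto simp: algebra_simps)
qed

lemma logistic_lipschitz: "\<bar>logistic s' - logistic s\<bar> \<le> \<bar>s' - s\<bar>"
proof -
  obtain \<xi> where "logistic s' - logistic s = - (logistic \<xi> * (1 - logistic \<xi>)) * (s' - s)" by (rule logistic_mvt)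
  moreover have "\<bar>- (logistic \<xi> * (1 - logistic \<xi>))\<bar> \<le> 1" using logistic_bounds[of \<xi>] by (auto simp: abs_mult intro!: mult_le_one)
  ultimately show ?thesis unfolding abs_mult by (metis abs_ge_zero abs_mult mult_left_le_one_le)
qed

lemma logistic_taylor: "\<bar>logistic (s + d) - logistic s + logistic s * (1 - logistic s) * d\<bar> \<le> d\<^sup>2"
proof -
  obtain \<xi> where x: "\<bar>\<xi> - s\<bar> \<le> \<bar>s + d - s\<bar>" "logistic (s + d) - logistic s = - (logistic \<xi> * (1 - logistic \<xi>)) * (s + d - s)" by (rule logistic_mvt)
  have "logistic (s + d) - logistic s + logistic s * (1 - logistic s) * d = (logistic s - logistic \<xi>) * (1 - logistic s - logistic \<xi>) * d"
    unfolding x(2) by (simp add: algebra_simps)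
  also have "\<bar>\<dots>\<bar> = \<bar>logistic s - logistic \<xi>\<bar> * \<bar>1 - logistic s - logistic \<xi>\<bar> * \<bar>d\<bar>" by (simp add: abs_mult)
  also have "\<dots> \<le> \<bar>d\<bar> * 1 * \<bar>d\<bar>"
  proof (intro mult_mono)
    show "\<bar>logistic s - logistic \<xi>\<bar> \<le> \<bar>d\<bar>" using logistic_lipschitz[of s \<xi>] x(1) by (simp add: abs_minus_commute)
    show "\<bar>1 - logistic s - logistic \<xi>\<bar> \<le> 1" using logistic_bounds[of s] logistic_bounds[of \<xi>] by (auto simp: abs_le_iff)
  qed auto
  finally show ?thesis by (simp add: power2_eq_square)
qed

lemma logistic_monotone: "(logistic s' - logistic s) * (s' - s) \<le> 0" "(logistic s' - logistic s) * (s' - s) = 0 \<Longrightarrow> s' = s"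
proof -
  obtain \<xi> where x: "logistic s' - logistic s = - (logistic \<xi> * (1 - logistic \<xi>)) * (s' - s)" by (rule logistic_mvt)
  have "(logistic s' - logistic s) * (s' - s) = - (logistic \<xi> * (1 - logistic \<xi>)) * (s' - s)\<^sup>2" unfolding x by (simp add: power2_eq_square)
  moreover have "0 < logistic \<xi> * (1 - logistic \<xi>)" using logistic_bounds[of \<xi>] by simp
  ultimately show "(logistic s' - logistic s) * (s' - s) \<le> 0" "(logistic s' - logistic s) * (s' - s) = 0 \<Longrightarrow> s' = s"
    by (auto simp: mult_nonneg_nonneg)
qed

lemma symmetric_double_sum:
  fixes s :: "nat \<Rightarrow> nat \<Rightarrow> real"
  assumes sym: "\<And>i j. i \<in> {1..n} \<Longrightarrow> j \<in> {1..n} \<Longrightarrow> s i j = s j i" and diag: "\<And>i. i \<in> {1..n} \<Longrightarrow> s i i = 0"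
  shows "(\<Sum>i=1..n. \<Sum>j=1..n. s i j) = 2 * (\<Sum>(i, j)\<in>{(i, j). 1 \<le> i \<and> i < j \<and> j \<le> n}. s i j)"
proof -
  let ?U = "{(i, j). 1 \<le> i \<and> i < j \<and> j \<le> n}" and ?L = "{(i, j). 1 \<le> j \<and> j < i \<and> i \<le> n}" and ?D = "(\<lambda>i. (i, i)) ` {1..n}"
  have fin: "finite ?U" "finite ?L" "finite ?D"
    by (auto intro: finite_subset[of _ "{1..n} \<times> {1..n}"])
  have "(\<Sum>i=1..n. \<Sum>j=1..n. s i j) = (\<Sum>(i, j)\<in>{1..n} \<times> {1..n}. s i j)" by (rule sum.cartesian_product)
  also have "{1..n} \<times> {1..n} = (?U \<union> ?L) \<union> ?D" by auto
  also have "(\<Sum>(i, j)\<in>(?U \<union> ?L) \<union> ?D. s i j) = (\<Sum>(i, j)\<in>?U \<union> ?L. s i j) + (\<Sum>(i, j)\<in>?D. s i j)"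
    using fin by (intro sum.union_disjoint) auto
  also have "(\<Sum>(i, j)\<in>?U \<union> ?L. s i j) = (\<Sum>(i, j)\<in>?U. s i j) + (\<Sum>(i, j)\<in>?L. s i j)"
    using fin by (intro sum.union_disjoint) auto
  also have "(\<Sum>(i, j)\<in>?D. s i j) = 0" by (intro sum.neutral) (auto simp: diag)
  also have "(\<Sum>(i, j)\<in>?L. s i j) = (\<Sum>(i, j)\<in>?U. s i j)"
    by (rule sum.reindex_bij_witness[where i="\<lambda>(i, j). (j, i)" and j="\<lambda>(i, j). (j, i)"]) (auto simp: sym)
  finally show ?thesis by simp
qed

text \<open>Moving by the field and projecting back to the ball has a fixed point by Brouwer's theorem. At a
  fixed point with nonzero field the field would point outwards on the sphere.\<close>

lemma inward_field_root:
  fixes \<phi> :: "'a::euclidean_space \<Rightarrow> 'a"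
  assumes cont: "continuous_on UNIV \<phi>" and r: "r > 0" and inward: "\<And>v. norm v = r \<Longrightarrow> v \<bullet> \<phi> v < 0"
  obtains v where "norm v \<le> r" "\<phi> v = 0"
proof -
  let ?S = "cball (0::'a) r"
  have S: "closed ?S" "convex ?S" "?S \<noteq> {}" "compact ?S" using r by auto
  have c1: "continuous_on ?S (\<lambda>v. closest_point ?S (v + \<phi> v))"
    by (rule continuous_on_compose2[OF continuous_on_closest_point[OF S(2,1,3), of UNIV] continuous_on_add[OF continuous_on_id continuous_on_subset[OF cont]]]) auto
  have c2: "(\<lambda>v. closest_point ?S (v + \<phi> v)) \<in> ?S \<rightarrow> ?S" using closest_point_in_set[OF S(1,3)] by blast
  obtain v where v: "v \<in> ?S" "closest_point ?S (v + \<phi> v) = v"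
    by (rule brouwer[OF S(4,2,3) c1 c2]) blast
  have dot: "\<phi> v \<bullet> (x - v) \<le> 0" if "x \<in> ?S" for x
    using closest_point_dot[OF S(2,1) that, of "v + \<phi> v"] unfolding v(2) by simp
  have "\<phi> v = 0"
  proof (rule ccontr)
    assume ne: "\<phi> v \<noteq> 0"
    have nv: "norm v = r"
    proof (rule ccontr)
      assume "norm v \<noteq> r"
      then have lt: "norm v < r" using v(1) by simp
      define c where "c = (r - norm v) / norm (\<phi> v)"
      have c: "c > 0" using lt ne by (simp add: c_def)
      have "v + c *\<^sub>R \<phi> v \<in> ?S"
        using norm_triangle_ineq[of v "c *\<^sub>R \<phi> v"] c ne lt by (simp add: c_def)
      from dot[OF this] have "c * (\<phi> v \<bullet> \<phi> v) \<le> 0" by simp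
      moreover have "0 < c * (\<phi> v \<bullet> \<phi> v)" using c ne by (intro mult_pos_pos) auto
      ultimately show False by linarith
    qed
    have "0 \<in> ?S" using r by simp
    from dot[OF this] inward[OF nv] show False by (simp add: inner_commute)
  qed
  then show ?thesis using v(1) by (intro that[of v]) auto
qed

lemma pos_def_coercive:
  fixes A :: "real ^ 'n ^ 'n"
  assumes "pos_def A"
  obtains l where "l > 0" "\<And>x. l * (norm x)\<^sup>2 \<le> x \<bullet> (A *v x)"
proof -
  have c: "continuous_on (sphere 0 1) (\<lambda>x. x \<bullet> (A *v x))"
    by (intro continuous_on_inner continuous_on_id matrix_vector_mult_linear_continuous_on)
  have "axis undefined 1 \<in> sphere (0 :: real ^ 'n) 1" by simp
  then have "sphere (0 :: real ^ 'n) 1 \<noteq> {}" by blast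
  then obtain x0 where x0: "x0 \<in> sphere (0 :: real ^ 'n) 1" "\<And>x. x \<in> sphere 0 1 \<Longrightarrow> x0 \<bullet> (A *v x0) \<le> x \<bullet> (A *v x)"
    using continuous_attains_inf[OF compact_sphere _ c] by blast
  have "x0 \<noteq> 0" using x0(1) by auto
  show ?thesis
  proof (rule that[of "x0 \<bullet> (A *v x0)"])
    show "x0 \<bullet> (A *v x0) > 0" using assms \<open>x0 \<noteq> 0\<close> by (simp add: pos_def_def)
    fix x :: "real ^ 'n"
    show "x0 \<bullet> (A *v x0) * (norm x)\<^sup>2 \<le> x \<bullet> (A *v x)"
    proof (cases "x = 0")
      case False
      define y where "y = (1 / norm x) *\<^sub>R x"
      have y: "y \<in> sphere 0 1" "x = norm x *\<^sub>R y" using False by (auto simp: y_def)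
      have "x \<bullet> (A *v x) = (norm x)\<^sup>2 * (y \<bullet> (A *v y))"
        by (subst (1 2) y(2)) (simp add: matrix_vector_mult_scaleR power2_eq_square)
      then show ?thesis using mult_left_mono[OF x0(2)[OF y(1)], of "(norm x)\<^sup>2"] by (simp add: mult.commute)
    qed simp
  qed
qed

lemma pos_def_inverse:
  fixes A :: "real ^ 'n ^ 'n"
  assumes "pos_def A"
  shows "A ** matrix_inv A = mat 1" "matrix_inv A ** A = mat 1" "transpose (matrix_inv A) = matrix_inv A"
proof -
  have "\<And>x. A *v x = 0 \<Longrightarrow> x = 0"
    using assms by (metis inner_zero_right less_irrefl pos_def_def)
  then obtain B where "B ** A = mat 1"
    using matrix_left_invertible_ker[of A] by blast
  then have inv: "invertible A" using invertible_left_inverse by blast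
  then show 1: "A ** matrix_inv A = mat 1" "matrix_inv A ** A = mat 1"
    by (auto simp: matrix_inv_def invertible_def intro: someI2_ex)
  have t: "transpose A = A" using assms by (simp add: pos_def_def)
  have "transpose (matrix_inv A) ** A = mat 1"
    using arg_cong[OF 1(1), of transpose] by (simp add: matrix_transpose_mul t transpose_mat)
  then have "transpose (matrix_inv A) ** A ** matrix_inv A = matrix_inv A" by simp
  then show "transpose (matrix_inv A) = matrix_inv A"
    by (simp add: matrix_mul_assoc[symmetric] 1)
qed

lemma norm_matrix_vector_entries:
  fixes A :: "real ^ 'n ^ 'n"
  shows "norm (A *v x) \<le> (\<Sum>p\<in>UNIV. \<Sum>q\<in>UNIV. \<bar>A $ p $ q\<bar>) * norm x"
proof -
  have "norm (A *v x) \<le> (\<Sum>p\<in>UNIV. \<bar>(A *v x) $ p\<bar>)" by (rule norm_le_l1_cart)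
  also have "\<dots> \<le> (\<Sum>p\<in>UNIV. (\<Sum>q\<in>UNIV. \<bar>A $ p $ q\<bar>) * norm x)"
  proof (rule sum_mono)
    fix p
    have "\<bar>(A *v x) $ p\<bar> \<le> (\<Sum>q\<in>UNIV. \<bar>A $ p $ q * x $ q\<bar>)"
      unfolding matrix_vector_mult_def by (simp add: sum_abs)
    also have "\<dots> \<le> (\<Sum>q\<in>UNIV. \<bar>A $ p $ q\<bar> * norm x)"
      by (intro sum_mono) (auto simp: abs_mult intro!: mult_left_mono component_le_norm_cart)
    finally show "\<bar>(A *v x) $ p\<bar> \<le> (\<Sum>q\<in>UNIV. \<bar>A $ p $ q\<bar>) * norm x" by (simp add: sum_distrib_right)
  qed
  finally show ?thesis by (simp add: sum_distrib_right)
qed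

text \<open>Balances the two terms by a parameter that is free in every estimate.\<close>

lemma tendsto_zero_of_tradeoff:
  fixes x y :: "nat \<Rightarrow> real"
  assumes x: "\<And>n. n > 0 \<Longrightarrow> 0 \<le> x n" and y: "y \<longlonglongrightarrow> 0" and K: "0 \<le> K"
    and b: "\<And>n e. n > 0 \<Longrightarrow> e > 0 \<Longrightarrow> x n \<le> e * K + y n / e"
  shows "x \<longlonglongrightarrow> 0"
proof (rule tendstoI)
  fix r :: real assume r: "r > 0"
  define e where "e = r / (2 * (K + 1))"
  have e: "e > 0" "e * K \<le> r / 2" using r K by (auto simp: e_def field_simps)
  have "\<forall>\<^sub>F n in sequentially. y n < e * r / 2" using order_tendstoD(2)[OF y, of "e * r / 2"] e r by simp
  then show "\<forall>\<^sub>F n in sequentially. dist (x n) 0 < r" using eventually_gt_at_top[of 0]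
  proof eventually_elim
    case (elim n)
    then have "y n / e < r / 2" using e by (simp add: field_simps)
    with b[OF elim(2) e(1)] e(2) have "x n < r" by linarith
    then show ?case using x[OF elim(2)] by simp
  qed
qed

section \<open>Asymptotic normality of the score\<close>

text \<open>\<open>F\<close> is a continuous extension of \<open>f\<close> to the plane, and \<open>a\<close>, \<open>b\<close> are the logarithms of the two scaling
  functions that turn \<open>exp (\<theta> \<bullet> F)\<close> into the doubly stochastic density \<open>M\<close>.\<close>

locale tilted_model = doubly_stochastic M for M +
  fixes f F :: "real \<times> real \<Rightarrow> real ^ 'l" and \<theta> :: "real ^ 'l" and a b :: "real \<Rightarrow> real"
  assumes F_cont: "continuous_on UNIV F" and F_eq: "\<And>z. z \<in> unit_square \<Longrightarrow> F z = f z"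
    and a_cont: "continuous_on UNIV a" and b_cont: "continuous_on UNIV b"
    and M_rel: "\<And>z. \<theta> \<bullet> F z = ln (M z) + (a (fst z) + b (snd z))"
    and F_row: "\<And>t x. x \<in> {0..1} \<Longrightarrow> integral {0..1} (\<lambda>y. t \<bullet> F (x, y)) = 0"
    and F_col: "\<And>t y. y \<in> {0..1} \<Longrightarrow> integral {0..1} (\<lambda>x. t \<bullet> F (x, y)) = 0"
    and indep: "lin_indep f"
begin

text \<open>The functions of one coordinate sum to the same constant along every permutation, and this constant
  cancels in the normalisation.\<close>

lemma perm_law_weight:
  assumes "\<pi> \<in> perms n"
  shows "exp (\<theta> \<bullet> suff_stat f n \<pi> - log_partition f n \<theta>) = weight n \<pi>"
proof -
  define c where "c = exp ((\<Sum>i=1..n. a (i / n)) + (\<Sum>i=1..n. b (i / n)))"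
  have c: "c > 0" by (simp add: c_def)
  have e: "exp (\<theta> \<bullet> suff_stat f n \<pi>) = c * (\<Prod>i=1..n. M (pt n \<pi> i))" if p: "\<pi> \<in> perms n" for \<pi>
  proof -
    have "\<theta> \<bullet> suff_stat f n \<pi> = (\<Sum>i=1..n. \<theta> \<bullet> F (pt n \<pi> i))"
      unfolding suff_stat_def inner_sum_right using F_eq[OF pt_square[OF p]] by (intro sum.cong) (auto simp: pt_def)
    also have "\<dots> = (\<Sum>i=1..n. ln (M (pt n \<pi> i))) + ((\<Sum>i=1..n. a (i / n)) + (\<Sum>i=1..n. b (\<pi> i / n)))"
      unfolding M_rel by (simp add: sum.distrib pt_def)
    also have "(\<Sum>i=1..n. b (\<pi> i / n)) = (\<Sum>i=1..n. b (i / n))"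
      using sum.permute[of \<pi> "{1..n}" "\<lambda>i. b (i / n)"] p by (simp add: perms_def comp_def)
    finally show ?thesis by (simp add: c_def exp_add exp_sum M_pos mult_ac)
  qed
  have "(\<Sum>\<pi>\<in>perms n. exp (\<theta> \<bullet> suff_stat f n \<pi>)) = c * (\<Sum>\<pi>\<in>perms n. \<Prod>i=1..n. M (pt n \<pi> i))"
    unfolding sum_distrib_left by (intro sum.cong e refl)
  then have "exp (log_partition f n \<theta>) = c * (\<Sum>\<pi>\<in>perms n. \<Prod>i=1..n. M (pt n \<pi> i))"
    unfolding log_partition_def using c Z_pos[of n] by simp
  then show ?thesis unfolding exp_diff e[OF assms] weight_def using c by simp
qed

lemma perm_law_eq: "perm_law f n \<theta> = point_measure (perms n) (\<lambda>\<pi>. ennreal (weight n \<pi>))"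
  unfolding perm_law_def point_measure_def
  by (intro density_cong AE_I2) (auto simp: perm_law_weight)

lemma integral_perm_law: "(\<integral>\<pi>. h \<pi> \<partial>(perm_law f n \<theta>)) = E n h" for h :: "(nat \<Rightarrow> nat) \<Rightarrow> real"
  unfolding perm_law_eq E_def
  by (subst lebesgue_integral_point_measure_finite) (auto simp: less_imp_le[OF weight_pos])

lemma prob_space_perm_law: "prob_space (perm_law f n \<theta>)"
proof
  have "emeasure (perm_law f n \<theta>) (space (perm_law f n \<theta>)) = (\<Sum>\<pi>\<in>perms n. ennreal (weight n \<pi>))"
    unfolding perm_law_eq by (simp add: space_point_measure emeasure_point_measure_finite)
  also have "\<dots> = ennreal (\<Sum>\<pi>\<in>perms n. weight n \<pi>)" by (rule sum_ennreal) (simp add: less_imp_le[OF weight_pos])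
  finally show "emeasure (perm_law f n \<theta>) (space (perm_law f n \<theta>)) = 1" by (simp add: sum_weight)
qed

lemma space_perm_law [simp]: "space (perm_law f n \<theta>) = perms n" "sets (perm_law f n \<theta>) = Pow (perms n)"
  by (simp_all add: perm_law_eq space_point_measure sets_point_measure)

lemma measure_perm_law: "measure (perm_law f n \<theta>) {\<pi> \<in> perms n. P \<pi>} = E n (\<lambda>\<pi>. of_bool (P \<pi>))"
proof -
  interpret prob_space "perm_law f n \<theta>" by (rule prob_space_perm_law)
  have "measure (perm_law f n \<theta>) {\<pi> \<in> perms n. P \<pi>} = (\<integral>\<pi>. indicator {\<pi> \<in> perms n. P \<pi>} \<pi> \<partial>(perm_law f n \<theta>))"
    by (simp add: Int_absorb2)
  also have "\<dots> = E n (\<lambda>\<pi>. of_bool (P \<pi>))" unfolding integral_perm_law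
    by (rule E_cong) (auto simp: indicator_def)
  finally show ?thesis .
qed

lemma perm_law_measurable: "Y \<in> measurable (perm_law f n \<theta>) borel"
  by (auto simp: measurable_def)

text \<open>Convergence in law reduced to finite sums over permutations.\<close>

lemma normal_limit_criterion:
  fixes Y :: "nat \<Rightarrow> (nat \<Rightarrow> nat) \<Rightarrow> real ^ 'l"
  assumes S: "transpose S = S" "\<And>x. 0 \<le> x \<bullet> (S *v x)"
    and char: "\<And>t \<phi>. (\<lambda>n. E n (\<lambda>\<pi>. cos (t \<bullet> Y n \<pi> + \<phi>))) \<longlonglongrightarrow> cos \<phi> * exp (- (t \<bullet> (S *v t)) / 2)"
    and tight: "\<And>e. e > 0 \<Longrightarrow> \<exists>R. \<forall>\<^sub>F n in sequentially. E n (\<lambda>\<pi>. of_bool (R < norm (Y n \<pi>))) \<le> e"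
  shows "conv_in_distr_normal (\<lambda>n. perm_law f n \<theta>) Y 0 S"
proof -
  obtain B :: "real ^ 'l ^ 'l" where B: "B ** transpose B = S" using psd_sqrt[OF S] by blast
  define N where "N = distr std_gaussian borel (\<lambda>x. 0 + B *v x)"
  note N = mv_normal_cos[OF B, folded N_def]
  let ?Q = "\<lambda>n. distr (perm_law f n \<theta>) borel (Y n)"
  have "conv_weakly ?Q N"
  proof (rule levy_euclidean)
    fix n
    interpret prob_space "perm_law f n \<theta>" by (rule prob_space_perm_law)
    show "prob_space (?Q n)" by (rule prob_space_distr[OF perm_law_measurable])
    show "sets (?Q n) = sets borel" by simp
  next
    show "prob_space N" "sets N = sets borel" by (rule N)+
  next
    fix t :: "real ^ 'l" and \<phi> :: real
    have "(\<integral>x. cos (t \<bullet> x + \<phi>) \<partial>?Q n) = E n (\<lambda>\<pi>. cos (t \<bullet> Y n \<pi> + \<phi>))" for n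
      by (subst integral_distr[OF perm_law_measurable]) (auto simp: integral_perm_law)
    then show "(\<lambda>n. \<integral>x. cos (t \<bullet> x + \<phi>) \<partial>?Q n) \<longlonglongrightarrow> (\<integral>x. cos (t \<bullet> x + \<phi>) \<partial>N)"
      using char[of t \<phi>] by (simp add: N(1))
  next
    fix e :: real assume "e > 0"
    then obtain R where R: "\<forall>\<^sub>F n in sequentially. E n (\<lambda>\<pi>. of_bool (R < norm (Y n \<pi>))) \<le> e" using tight by blast
    have "measure (?Q n) {x. R < norm x} = E n (\<lambda>\<pi>. of_bool (R < norm (Y n \<pi>)))" for n
    proof -
      have "Y n -` {x. R < norm x} \<inter> perms n = {\<pi> \<in> perms n. R < norm (Y n \<pi>)}" by auto
      then show ?thesis
        by (subst measure_distr[OF perm_law_measurable norm_tail_borel]) (simp only: space_perm_law measure_perm_law)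
    qed
    with R show "\<exists>R. \<forall>\<^sub>F n in sequentially. measure (?Q n) {x. R < norm x} \<le> e"
      by (intro exI[of _ R]) (simp only:)
  qed
  moreover have "is_mv_normal 0 S N" unfolding is_mv_normal_def N_def using B by blast
  ultimately show ?thesis unfolding conv_in_distr_normal_def by blast
qed

text \<open>The limit object \<open>g\<close> formed from the extension \<open>F\<close>, as a function of a pair of points.\<close>

definition swap_diff :: "(real \<times> real) \<times> (real \<times> real) \<Rightarrow> real ^ 'l" where
  "swap_diff p = g_fun F (fst p) (snd p)"

lemma continuous_swap_diff: "continuous_on S swap_diff"
proof -
  have F: "continuous_on S h \<Longrightarrow> continuous_on S (\<lambda>x. F (h x))" for h :: "(real \<times> real) \<times> (real \<times> real) \<Rightarrow> real \<times> real"
    by (rule continuous_on_compose2[OF F_cont]) auto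
  show ?thesis unfolding swap_diff_def[abs_def] g_fun_def
    by (intro continuous_on_add continuous_on_diff F continuous_on_Pair continuous_on_fst continuous_on_snd continuous_on_id)
qed

lemma continuous_swap_diff_inner: "continuous_on S (\<lambda>p. t \<bullet> swap_diff p)"
  by (intro continuous_on_inner continuous_on_const continuous_swap_diff)

lemma swap_diff_sym: "swap_diff (z, w) = swap_diff (w, z)"
  by (simp add: swap_diff_def g_fun_def)

lemma swap_diff_swap: "swap_diff (swap p) = - swap_diff p"
  by (simp add: swap_diff_def g_fun_def swap_def cross_def)

lemma swap_diff_diag: "swap_diff (z, z) = 0"
  by (simp add: swap_diff_def g_fun_def)

lemma swap_diff_eq: "z \<in> unit_square \<Longrightarrow> w \<in> unit_square \<Longrightarrow> swap_diff (z, w) = g_fun f z w"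
  using cross_square[of z w] cross_square[of w z] unfolding swap_diff_def g_fun_def cross_def by (simp add: F_eq)

lemma y_diff_eq_swap_diff: "\<pi> \<in> perms n \<Longrightarrow> i \<in> {1..n} \<Longrightarrow> j \<in> {1..n} \<Longrightarrow> y_diff f n \<pi> i j = swap_diff (pt n \<pi> i, pt n \<pi> j)"
  using swap_diff_eq[OF pt_square pt_square, of \<pi> n i \<pi> n j] by (simp add: y_diff_def g_fun_def pt_def)

lemma swap_diff_inner: "continuous_on UNIV (\<lambda>p. t \<bullet> swap_diff p)" "\<And>z w. t \<bullet> swap_diff (z, w) = t \<bullet> swap_diff (w, z)" "\<And>p. t \<bullet> swap_diff (swap p) = - (t \<bullet> swap_diff p)"
  by (auto simp: continuous_swap_diff_inner swap_diff_swap swap_diff_sym)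

text \<open>The functions \<open>a\<close> and \<open>b\<close> cancel in a swap difference, so \<open>exp (\<theta> \<bullet> g)\<close> is the ratio of the weights before
  and after the swap.\<close>

lemma score_kernel_eq: "score_kernel (\<lambda>p. t \<bullet> swap_diff p) p = logistic (\<theta> \<bullet> swap_diff p) * (t \<bullet> swap_diff p)"
proof -
  define u where "u = M (fst p) * M (snd p)"
  define v where "v = M (fst (swap p)) * M (snd (swap p))"
  have uv: "u > 0" "v > 0" by (auto simp: u_def v_def M_pos)
  have "\<theta> \<bullet> swap_diff p = \<theta> \<bullet> F (fst p) + \<theta> \<bullet> F (snd p) - \<theta> \<bullet> F (fst (swap p)) - \<theta> \<bullet> F (snd (swap p))"
    by (simp add: swap_diff_def g_fun_def swap_def cross_def inner_add_right inner_diff_right)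
  also have "\<dots> = ln u - ln v"
    unfolding M_rel by (simp add: u_def v_def swap_def cross_def ln_mult M_pos M_ne)
  finally have "exp (\<theta> \<bullet> swap_diff p) = u / v" using uv by (simp add: exp_diff)
  then have "logistic (\<theta> \<bullet> swap_diff p) = 1 / (1 + u / v)" by (simp only: logistic_def)
  then have "logistic (\<theta> \<bullet> swap_diff p) = v / (u + v)" using uv by (simp add: field_simps)
  moreover have "swap_weight2 p * swap_mean p = v / (u + v)"
    using uv by (simp add: swap_weight2_def swap_weight_def swap_mean_def[OF swap_diff_inner] u_def[symmetric] v_def[symmetric])
  ultimately show ?thesis unfolding score_kernel_def[OF swap_diff_inner] by (simp add: mult.assoc[symmetric])
qed

text \<open>The summand is symmetric in \<open>i\<close> and \<open>j\<close> and vanishes on the diagonal, so the sum over \<open>i < j\<close> is half of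
  the full double sum.\<close>

lemma pl_score_emp2:
  assumes n: "n > 0" and p: "\<pi> \<in> perms n"
  shows "t \<bullet> pl_score f n \<pi> \<eta> = (real n)\<^sup>2 / 2 * emp2 n \<pi> (\<lambda>p. logistic (\<eta> \<bullet> swap_diff p) * (t \<bullet> swap_diff p))"
proof -
  define s where "s i j = logistic (\<eta> \<bullet> swap_diff (pt n \<pi> i, pt n \<pi> j)) * (t \<bullet> swap_diff (pt n \<pi> i, pt n \<pi> j))" for i j
  have "(\<Sum>i=1..n. \<Sum>j=1..n. s i j) = 2 * (\<Sum>(i, j)\<in>{(i, j). 1 \<le> i \<and> i < j \<and> j \<le> n}. s i j)"
    by (rule symmetric_double_sum) (auto simp: s_def swap_diff_diag swap_diff_sym[of "pt n \<pi> i" "pt n \<pi> j" for i j])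
  moreover have "(\<Sum>(i, j)\<in>{(i, j). 1 \<le> i \<and> i < j \<and> j \<le> n}. s i j) = t \<bullet> pl_score f n \<pi> \<eta>"
    unfolding pl_score_def inner_sum_right
    by (intro sum.cong refl) (auto simp: s_def logistic_def y_diff_eq_swap_diff[OF p])
  moreover have "emp2 n \<pi> (\<lambda>p. logistic (\<eta> \<bullet> swap_diff p) * (t \<bullet> swap_diff p)) = (\<Sum>i=1..n. \<Sum>j=1..n. s i j) / (real n)\<^sup>2"
    by (simp add: emp2_def emp_def avg_def s_def sum_divide_distrib[symmetric] power2_eq_square)
  ultimately show ?thesis using n by simp
qed

definition scaled_score :: "nat \<Rightarrow> (nat \<Rightarrow> nat) \<Rightarrow> real ^ 'l" where
  "scaled_score n \<pi> = (real n powr (- 3 / 2)) *\<^sub>R pl_score f n \<pi> \<theta>"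

lemma scaled_score_eq_scaled_stat:
  assumes n: "n > 0" and p: "\<pi> \<in> perms n"
  shows "t \<bullet> scaled_score n \<pi> = scaled_stat (\<lambda>p. t \<bullet> swap_diff p) n \<pi>"
proof -
  have "(real n)\<^sup>2 = real n powr 2" using n by simp
  then have "real n powr (- 3 / 2) * (real n)\<^sup>2 = real n powr (- 3 / 2) * real n powr 2" by (simp only:)
  also have "\<dots> = real n powr (- 3 / 2 + 2)" by (rule powr_add[symmetric])
  also have "\<dots> = sqrt n" by (simp add: powr_half_sqrt)
  finally have e: "real n powr (- 3 / 2) * (real n)\<^sup>2 = sqrt n" .
  have "t \<bullet> scaled_score n \<pi> = real n powr (- 3 / 2) * (real n)\<^sup>2 / 2 * emp2 n \<pi> (\<lambda>p. logistic (\<theta> \<bullet> swap_diff p) * (t \<bullet> swap_diff p))"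
    unfolding scaled_score_def inner_scaleR_right pl_score_emp2[OF n p] by simp
  moreover have "score_kernel (\<lambda>p. t \<bullet> swap_diff p) = (\<lambda>p. logistic (\<theta> \<bullet> swap_diff p) * (t \<bullet> swap_diff p))"
    by (rule ext) (rule score_kernel_eq)
  ultimately show ?thesis by (simp only: e scaled_stat_def[OF swap_diff_inner])
qed

lemma mu_opt_eq_\<mu>: "mu_opt f \<theta> = \<mu>"
proof -
  have "objective f \<theta> \<nu> = objective F \<theta> \<nu>" if "\<nu> \<in> permutons" for \<nu>
  proof -
    have s: "sets \<nu> = sets (restrict_space borel unit_square)" using that by (simp add: permutons_def)
    have "space \<nu> = unit_square" using sets_eq_imp_space_eq[OF s] by (simp add: space_restrict_space)
    then have "(\<integral>z. f z \<partial>\<nu>) = (\<integral>z. F z \<partial>\<nu>)" by (intro Bochner_Integration.integral_cong) (auto simp: F_eq)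
    then show ?thesis by (simp add: objective_def)
  qed
  then have "(\<lambda>\<mu>. \<mu> \<in> permutons \<and> (\<forall>\<nu>\<in>permutons. objective f \<theta> \<nu> \<le> objective f \<theta> \<mu>)) =
     (\<lambda>\<mu>. \<mu> \<in> permutons \<and> (\<forall>\<nu>\<in>permutons. objective F \<theta> \<nu> \<le> objective F \<theta> \<mu>))"
    by (auto simp: fun_eq_iff)
  then have "mu_opt f \<theta> = mu_opt F \<theta>" unfolding mu_opt_def by simp
  also have "\<dots> = \<mu>" by (rule mu_opt_eq[OF F_cont a_cont b_cont M_rel])
  finally show ?thesis .
qed

text \<open>Given the first point, the other two are independent, and the triple integral factorises.\<close>

lemma Sigma_entry: "Sigma_mat f \<theta> $ p $ r = (\<integral>z. \<Phi> (\<lambda>u. axis p 1 \<bullet> swap_diff u) z * \<Phi> (\<lambda>u. axis r 1 \<bullet> swap_diff u) z \<partial>\<mu>)"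
proof -
  let ?Gp = "score_kernel (\<lambda>u. axis p 1 \<bullet> swap_diff u)" and ?Gr = "score_kernel (\<lambda>u. axis r 1 \<bullet> swap_diff u)"
  have cont: "continuous_on UNIV (\<lambda>u :: (real \<times> real) \<times> (real \<times> real) \<times> (real \<times> real). ?Gp (fst u, fst (snd u)) * ?Gr (fst u, snd (snd u)))"
    by (intro continuous_on_mult continuous_score_kernel_comp[OF swap_diff_inner] continuous_on_Pair continuous_on_fst continuous_on_snd continuous_on_id)
  have "Sigma_mat f \<theta> $ p $ r = (\<integral>u. ?Gp (fst u, fst (snd u)) * ?Gr (fst u, snd (snd u)) \<partial>(\<mu> \<Otimes>\<^sub>M (\<mu> \<Otimes>\<^sub>M \<mu>)))"
    unfolding Sigma_mat_def mu_opt_eq_\<mu> vec_lambda_beta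
  proof (intro Bochner_Integration.integral_cong refl)
    fix u :: "(real \<times> real) \<times> (real \<times> real) \<times> (real \<times> real)" assume "u \<in> space (\<mu> \<Otimes>\<^sub>M (\<mu> \<Otimes>\<^sub>M \<mu>))"
    then obtain z1 z2 z3 where u: "u = (z1, z2, z3)" "z1 \<in> unit_square" "z2 \<in> unit_square" "z3 \<in> unit_square"
      by (cases u) (auto simp: space_pair_measure)
    show "(case u of (z1, z2, z3) \<Rightarrow> g_fun f z1 z2 $ p * g_fun f z1 z3 $ r
        / ((1 + exp (\<theta> \<bullet> g_fun f z1 z2)) * (1 + exp (\<theta> \<bullet> g_fun f z1 z3)))) = ?Gp (fst u, fst (snd u)) * ?Gr (fst u, snd (snd u))"
      unfolding u by (simp only: score_kernel_eq fst_conv snd_conv prod.case swap_diff_eq[OF u(2,3)] swap_diff_eq[OF u(2,4)]) (simp add: logistic_def inner_axis')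
  qed
  also have "\<dots> = (\<integral>z. \<Phi> (\<lambda>u. axis p 1 \<bullet> swap_diff u) z * \<Phi> (\<lambda>u. axis r 1 \<bullet> swap_diff u) z \<partial>\<mu>)"
    unfolding integral_triple[OF cont] by (simp add: \<Phi>_def[OF swap_diff_inner])
  finally show ?thesis .
qed

lemma \<Phi>_linear: "\<Phi> (\<lambda>u. t \<bullet> swap_diff u) z = (\<Sum>p\<in>UNIV. t $ p * \<Phi> (\<lambda>u. axis p 1 \<bullet> swap_diff u) z)"
proof -
  have lin: "score_kernel (\<lambda>u. t \<bullet> swap_diff u) v = (\<Sum>p\<in>UNIV. t $ p * score_kernel (\<lambda>u. axis p 1 \<bullet> swap_diff u) v)" for v
    by (simp only: score_kernel_eq) (simp add: inner_axis' inner_vec_def[of t] sum_distrib_left mult_ac)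
  have i: "integrable \<mu> (\<lambda>w. score_kernel (\<lambda>u. axis p 1 \<bullet> swap_diff u) (z, w))" for p
    by (intro integrable_square prob_space_\<mu> sets_\<mu> continuous_score_kernel_comp[OF swap_diff_inner] continuous_on_Pair continuous_on_const continuous_on_id)
  have "\<Phi> (\<lambda>u. t \<bullet> swap_diff u) z = (\<integral>w. (\<Sum>p\<in>UNIV. t $ p * score_kernel (\<lambda>u. axis p 1 \<bullet> swap_diff u) (z, w)) \<partial>\<mu>)"
    by (simp only: \<Phi>_def[OF swap_diff_inner] lin)
  also have "\<dots> = (\<Sum>p\<in>UNIV. \<integral>w. t $ p * score_kernel (\<lambda>u. axis p 1 \<bullet> swap_diff u) (z, w) \<partial>\<mu>)"
    by (intro Bochner_Integration.integral_sum integrable_mult_right i)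
  also have "\<dots> = (\<Sum>p\<in>UNIV. t $ p * \<Phi> (\<lambda>u. axis p 1 \<bullet> swap_diff u) z)"
    by (simp only: \<Phi>_def[OF swap_diff_inner] Bochner_Integration.integral_mult_right_zero)
  finally show ?thesis .
qed

lemma Sigma_quadratic: "t \<bullet> (Sigma_mat f \<theta> *v t) = limit_variance (\<lambda>u. t \<bullet> swap_diff u)"
proof -
  let ?P = "\<lambda>p. \<Phi> (\<lambda>u. axis p 1 \<bullet> swap_diff u)"
  have i: "integrable \<mu> (\<lambda>z. ?P p z * ?P r z)" for p r
    by (intro integrable_square prob_space_\<mu> sets_\<mu> continuous_on_mult continuous_\<Phi>[OF swap_diff_inner])
  have "limit_variance (\<lambda>u. t \<bullet> swap_diff u) = (\<integral>z. (\<Sum>p\<in>UNIV. \<Sum>r\<in>UNIV. t $ p * t $ r * (?P p z * ?P r z)) \<partial>\<mu>)"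
    unfolding limit_variance_def[OF swap_diff_inner] \<Phi>_linear[of t] power2_eq_square sum_product by (simp add: mult_ac)
  also have "\<dots> = (\<Sum>p\<in>UNIV. \<Sum>r\<in>UNIV. t $ p * t $ r * (\<integral>z. ?P p z * ?P r z \<partial>\<mu>))"
    by (simp only: Bochner_Integration.integral_sum integrable_mult_right i Bochner_Integration.integrable_sum Bochner_Integration.integral_mult_right_zero)
  also have "\<dots> = t \<bullet> (Sigma_mat f \<theta> *v t)"
    by (simp add: inner_vec_def matrix_vector_mult_def Sigma_entry sum_distrib_left mult_ac)
  finally show ?thesis by simp
qed

lemma Sigma_sym: "transpose (Sigma_mat f \<theta>) = Sigma_mat f \<theta>"
  by (simp add: vec_eq_iff transpose_def Sigma_entry mult.commute)

lemma Sigma_psd: "0 \<le> t \<bullet> (Sigma_mat f \<theta> *v t)"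
  unfolding Sigma_quadratic by (rule limit_variance_nonneg[OF swap_diff_inner])

lemma scaled_score_char: "(\<lambda>n. E n (\<lambda>\<pi>. cos (t \<bullet> scaled_score n \<pi> + \<phi>))) \<longlonglongrightarrow> cos \<phi> * exp (- (t \<bullet> (Sigma_mat f \<theta> *v t)) / 2)"
  unfolding Sigma_quadratic
proof (rule Lim_transform_eventually[OF clt_cos[OF swap_diff_inner]])
  show "\<forall>\<^sub>F n in sequentially. E n (\<lambda>\<pi>. cos (scaled_stat (\<lambda>p. t \<bullet> swap_diff p) n \<pi> + \<phi>)) = E n (\<lambda>\<pi>. cos (t \<bullet> scaled_score n \<pi> + \<phi>))"
    using eventually_gt_at_top[of 0] by eventually_elim (rule E_cong, simp add: scaled_score_eq_scaled_stat)
qed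

lemma E_sum: "E n (\<lambda>\<pi>. \<Sum>i\<in>I. Y i \<pi>) = (\<Sum>i\<in>I. E n (Y i))"
  unfolding E_def by (simp add: sum_distrib_left) (rule sum.swap)

lemma scaled_score_second_moment:
  obtains K where "0 \<le> K" "\<And>n. n > 0 \<Longrightarrow> E n (\<lambda>\<pi>. (norm (scaled_score n \<pi>))\<^sup>2) \<le> K"
proof -
  have "\<exists>K. 0 \<le> K \<and> (\<forall>n>0. E n (\<lambda>\<pi>. (axis r 1 \<bullet> scaled_score n \<pi>)\<^sup>2) \<le> K)" for r
  proof -
    obtain K where K: "0 \<le> K" "\<And>n. n > 0 \<Longrightarrow> E n (\<lambda>\<pi>. (scaled_stat (\<lambda>p. axis r 1 \<bullet> swap_diff p) n \<pi>)\<^sup>2) \<le> K"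
      by (rule scaled_stat_second_moment[OF swap_diff_inner]) blast+
    have "E n (\<lambda>\<pi>. (axis r 1 \<bullet> scaled_score n \<pi>)\<^sup>2) = E n (\<lambda>\<pi>. (scaled_stat (\<lambda>p. axis r 1 \<bullet> swap_diff p) n \<pi>)\<^sup>2)" if "n > 0" for n
      using that by (intro E_cong) (simp add: scaled_score_eq_scaled_stat)
    with K show ?thesis by auto
  qed
  then obtain K where K: "\<And>r. 0 \<le> K r" "\<And>r n. n > 0 \<Longrightarrow> E n (\<lambda>\<pi>. (axis r 1 \<bullet> scaled_score n \<pi>)\<^sup>2) \<le> K r"
    by metis
  have "(norm (scaled_score n \<pi>))\<^sup>2 = (\<Sum>r\<in>UNIV. (axis r 1 \<bullet> scaled_score n \<pi>)\<^sup>2)" for n \<pi>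
    unfolding power2_norm_eq_inner inner_axis' by (simp add: inner_vec_def power2_eq_square)
  then have "E n (\<lambda>\<pi>. (norm (scaled_score n \<pi>))\<^sup>2) \<le> (\<Sum>r\<in>UNIV. K r)" if "n > 0" for n
    using that by (simp add: E_sum) (intro sum_mono K(2))
  then show ?thesis using K(1) by (intro that[of "\<Sum>r\<in>UNIV. K r"]) (auto intro: sum_nonneg)
qed

lemma markov:
  assumes "R > 0" shows "E n (\<lambda>\<pi>. of_bool (R < Y \<pi>)) \<le> E n (\<lambda>\<pi>. (Y \<pi>)\<^sup>2) / R\<^sup>2"
proof -
  have "E n (\<lambda>\<pi>. of_bool (R < Y \<pi>)) \<le> E n (\<lambda>\<pi>. (1 / R\<^sup>2) * (Y \<pi>)\<^sup>2)"
  proof (rule E_mono)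
    fix \<pi>
    have "R\<^sup>2 \<le> (Y \<pi>)\<^sup>2" if "R < Y \<pi>" using that assms by (intro power_mono) auto
    then show "of_bool (R < Y \<pi>) \<le> (1 / R\<^sup>2) * (Y \<pi>)\<^sup>2" using assms by (auto simp: field_simps)
  qed
  then show ?thesis unfolding E_cmult by simp
qed

lemma scaled_score_tight:
  assumes e: "e > 0"
  obtains R where "R > 0" "\<And>n. n > 0 \<Longrightarrow> E n (\<lambda>\<pi>. of_bool (R < norm (scaled_score n \<pi>))) \<le> e"
proof -
  obtain K where K: "0 \<le> K" "\<And>n. n > 0 \<Longrightarrow> E n (\<lambda>\<pi>. (norm (scaled_score n \<pi>))\<^sup>2) \<le> K" using scaled_score_second_moment by blast
  define R where "R = sqrt ((K + 1) / e)"
  have R: "R > 0" "R\<^sup>2 = (K + 1) / e" using K e by (auto simp: R_def)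
  show ?thesis
  proof (rule that[OF R(1)])
    fix n :: nat assume n: "n > 0"
    have "E n (\<lambda>\<pi>. of_bool (R < norm (scaled_score n \<pi>))) \<le> E n (\<lambda>\<pi>. (norm (scaled_score n \<pi>))\<^sup>2) / R\<^sup>2" by (rule markov[OF R(1)])
    also have "\<dots> \<le> K / R\<^sup>2" by (intro divide_right_mono K n) simp
    also have "\<dots> \<le> e" using K e unfolding R(2) by (simp add: field_simps)
    finally show "E n (\<lambda>\<pi>. of_bool (R < norm (scaled_score n \<pi>))) \<le> e" .
  qed
qed

theorem score_clt: "conv_in_distr_normal (\<lambda>n. perm_law f n \<theta>) scaled_score 0 (Sigma_mat f \<theta>)"
proof (rule normal_limit_criterion[OF Sigma_sym Sigma_psd scaled_score_char])
  fix e :: real assume "e > 0"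
  then obtain R where R: "\<And>n. n > 0 \<Longrightarrow> E n (\<lambda>\<pi>. of_bool (R < norm (scaled_score n \<pi>))) \<le> e" using scaled_score_tight by blast
  then show "\<exists>R. \<forall>\<^sub>F n in sequentially. E n (\<lambda>\<pi>. of_bool (R < norm (scaled_score n \<pi>))) \<le> e"
    by (intro exI[of _ R] eventually_mono[OF eventually_gt_at_top[of 0]]) auto
qed

end

section \<open>Positive definiteness of the limiting information matrix\<close>

lemma continuous_logistic: "continuous_on A h \<Longrightarrow> continuous_on A (\<lambda>x. logistic (h x))"
  unfolding logistic_def
  by (intro continuous_on_divide continuous_on_add continuous_on_const continuous_on_exp ballI)
     (auto simp: add_pos_pos less_imp_neq[symmetric])

context doubly_stochastic
begin

text \<open>A continuous nonnegative function with vanishing integral is zero, and \<open>M\<close> has no zeros.\<close>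

lemma zero_integral_imp_zero:
  fixes h :: "real \<times> real \<Rightarrow> real"
  assumes h: "continuous_on UNIV h" "\<And>z. 0 \<le> h z" and I: "(\<integral>z. h z \<partial>\<mu>) = 0" and z: "z \<in> unit_square"
  shows "h z = 0"
proof -
  have c: "continuous_on (cbox (0, 0) (1, 1)) (\<lambda>z. M z * h z)"
    by (intro continuous_on_mult continuous_on_subset[OF M_cont] continuous_on_subset[OF h(1)]) auto
  have "integral (cbox (0, 0) (1, 1)) (\<lambda>z. M z * h z) = 0"
    using I integral_prod_continuous[OF c] unfolding integral_\<mu>[OF h(1)] by simp
  moreover have "box (0, 0) (1, 1 :: real) \<noteq> ({} :: (real \<times> real) set)"
    by (auto simp: box_ne_empty Basis_prod_def)
  ultimately have "M z * h z = 0"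
    using integral_cbox_eq_0_iff[OF c] h(2) M_pos z unfolding unit_square_cbox
    by (metis less_imp_le mult_nonneg_nonneg)
  then show ?thesis by (simp add: M_ne)
qed

end

context tilted_model
begin

definition logistic_weight :: "(real \<times> real) \<times> (real \<times> real) \<Rightarrow> real" where
  "logistic_weight u = logistic (\<theta> \<bullet> swap_diff u) * (1 - logistic (\<theta> \<bullet> swap_diff u))"

definition hessian_kernel :: "'l \<Rightarrow> 'l \<Rightarrow> (real \<times> real) \<times> (real \<times> real) \<Rightarrow> real" where
  "hessian_kernel p r u = swap_diff u $ p * swap_diff u $ r * logistic_weight u"

lemma logistic_weight_pos: "0 < logistic_weight u"
  using logistic_bounds[of "\<theta> \<bullet> swap_diff u"] by (simp add: logistic_weight_def)

lemma continuous_logistic_weight: "continuous_on A logistic_weight"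
  unfolding logistic_weight_def[abs_def] by (intro continuous_on_mult continuous_on_diff continuous_on_const continuous_logistic continuous_swap_diff_inner)

lemma continuous_hessian_kernel: "continuous_on A (hessian_kernel p r)"
  unfolding hessian_kernel_def[abs_def] by (intro continuous_on_mult continuous_logistic_weight continuous_on_component continuous_swap_diff)

lemma A_entry: "A_mat f \<theta> $ p $ r = 1 / 2 * (\<integral>u. hessian_kernel p r u \<partial>(\<mu> \<Otimes>\<^sub>M \<mu>))"
proof -
  have "(\<integral>(z1, z2). (g_fun f z1 z2 $ p * g_fun f z1 z2 $ r * exp (\<theta> \<bullet> g_fun f z1 z2)) / (1 + exp (\<theta> \<bullet> g_fun f z1 z2))\<^sup>2 \<partial>(\<mu> \<Otimes>\<^sub>M \<mu>))
    = (\<integral>u. hessian_kernel p r u \<partial>(\<mu> \<Otimes>\<^sub>M \<mu>))"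
  proof (intro Bochner_Integration.integral_cong refl)
    fix u assume "u \<in> space (\<mu> \<Otimes>\<^sub>M \<mu>)"
    then obtain z1 z2 where u: "u = (z1, z2)" "z1 \<in> unit_square" "z2 \<in> unit_square"
      by (cases u) (auto simp: space_pair_measure)
    have w: "exp s / (1 + exp s)\<^sup>2 = logistic s * (1 - logistic s)" for s
    proof -
      have "1 + exp s \<noteq> 0" using exp_gt_zero[of s] by linarith
      then show ?thesis by (simp add: logistic_def power2_eq_square divide_simps)
    qed
    show "(case u of (z1, z2) \<Rightarrow> g_fun f z1 z2 $ p * g_fun f z1 z2 $ r * exp (\<theta> \<bullet> g_fun f z1 z2) / (1 + exp (\<theta> \<bullet> g_fun f z1 z2))\<^sup>2) = hessian_kernel p r u"
      unfolding u hessian_kernel_def logistic_weight_def w[symmetric] swap_diff_eq[OF u(2,3)] by simp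
  qed
  then show ?thesis unfolding A_mat_def mu_opt_eq_\<mu> by simp
qed

lemma bilinear_hessian_kernel: "(t \<bullet> swap_diff u) * (v \<bullet> swap_diff u) * logistic_weight u = (\<Sum>p\<in>UNIV. \<Sum>r\<in>UNIV. t $ p * v $ r * hessian_kernel p r u)"
proof -
  have "(t \<bullet> swap_diff u) * (v \<bullet> swap_diff u) = (\<Sum>p\<in>UNIV. \<Sum>r\<in>UNIV. (t $ p * swap_diff u $ p) * (v $ r * swap_diff u $ r))"
    unfolding inner_vec_def inner_real_def by (rule sum_product)
  then show ?thesis by (simp add: hessian_kernel_def sum_distrib_left mult_ac)
qed

lemma integrable_pair: "continuous_on UNIV Q \<Longrightarrow> integrable (\<mu> \<Otimes>\<^sub>M \<mu>) Q" for Q :: "(real \<times> real) \<times> (real \<times> real) \<Rightarrow> real"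
  by (rule integral_pair(3))

lemma A_quadratic: "x \<bullet> (A_mat f \<theta> *v x) = 1 / 2 * (\<integral>u. (x \<bullet> swap_diff u) * (x \<bullet> swap_diff u) * logistic_weight u \<partial>(\<mu> \<Otimes>\<^sub>M \<mu>))"
proof -
  have "(\<integral>u. (x \<bullet> swap_diff u) * (x \<bullet> swap_diff u) * logistic_weight u \<partial>(\<mu> \<Otimes>\<^sub>M \<mu>)) = (\<Sum>p\<in>UNIV. \<Sum>r\<in>UNIV. x $ p * x $ r * (\<integral>u. hessian_kernel p r u \<partial>(\<mu> \<Otimes>\<^sub>M \<mu>)))"
    unfolding bilinear_hessian_kernel
    by (simp only: Bochner_Integration.integral_sum integrable_mult_right integrable_pair continuous_hessian_kernel Bochner_Integration.integrable_sum Bochner_Integration.integral_mult_right_zero)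
  then show ?thesis
    by (simp add: inner_vec_def matrix_vector_mult_def A_entry sum_distrib_left mult_ac)
qed

lemma A_sym: "transpose (A_mat f \<theta>) = A_mat f \<theta>"
  by (simp add: vec_eq_iff transpose_def A_entry hessian_kernel_def mult_ac)

text \<open>Integrating the four-term relation over one ordinate shows that \<open>x \<bullet> F\<close> does not depend on the abscissa;
  since its integral over the abscissa is zero, it vanishes. Linear independence then gives \<open>x = 0\<close>.\<close>

lemma swap_diff_orthogonal_imp_zero:
  assumes "\<And>z w. z \<in> unit_square \<Longrightarrow> w \<in> unit_square \<Longrightarrow> x \<bullet> swap_diff (z, w) = 0"
  shows "x = 0"
proof (rule ccontr)
  assume ne: "x \<noteq> 0"
  have sq: "(s, t) \<in> unit_square" if "s \<in> {0..1}" "t \<in> {0..1}" for s t :: real using that by (simp add: unit_square_def)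
  have xF: "continuous_on UNIV (\<lambda>z. x \<bullet> F z)" by (intro continuous_on_inner continuous_on_const F_cont)
  have i1: "(\<lambda>y. x \<bullet> F (s, y)) integrable_on {0..1}" for s
    by (intro integrable_continuous_interval continuous_on_compose2[OF xF]) (auto intro!: continuous_on_Pair continuous_on_const continuous_on_id)
  have const: "x \<bullet> F (s', y) = x \<bullet> F (s, y)" if s: "s \<in> {0..1}" "s' \<in> {0..1}" "y \<in> {0..1}" for s s' y
  proof -
    define c where "c = x \<bullet> F (s', y) - x \<bullet> F (s, y)"
    have e: "x \<bullet> F (s', y') - x \<bullet> F (s, y') = c" if "y' \<in> {0..1}" for y'
      using assms[OF sq[OF s(1,3)] sq[OF s(2) that]]
      by (simp add: swap_diff_def g_fun_def c_def inner_add_right inner_diff_right)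
    have "integral {0..1} (\<lambda>y'. x \<bullet> F (s', y') - x \<bullet> F (s, y')) = integral {0..1} (\<lambda>y'::real. c)"
      by (intro integral_cong e)
    moreover have "integral {0..1} (\<lambda>y'. x \<bullet> F (s', y') - x \<bullet> F (s, y')) = 0"
      by (subst integral_diff[OF i1 i1]) (simp add: F_row[OF s(1)] F_row[OF s(2)])
    ultimately show ?thesis by (simp add: c_def)
  qed
  have "x \<bullet> f z = 0" if z: "z \<in> unit_square" for z
  proof -
    obtain s y where zy: "z = (s, y)" "s \<in> {0..1}" "y \<in> {0..1}" using z by (auto simp: unit_square_def)
    have "integral {0..1} (\<lambda>s'. x \<bullet> F (s', y)) = integral {0..1} (\<lambda>s'::real. x \<bullet> F (s, y))"
      by (intro integral_cong const zy)
    then have "x \<bullet> F (s, y) = 0" by (simp add: F_col[OF zy(3)])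
    then show ?thesis using F_eq[OF z] zy by simp
  qed
  then have "AE z in unif_square. x \<bullet> f z = 0" by (intro AE_I2) simp
  with indep ne show False unfolding lin_indep_def by blast
qed

lemma A_pos_def: "pos_def (A_mat f \<theta>)"
  unfolding pos_def_def
proof (intro conjI A_sym allI impI)
  fix x :: "real ^ 'l" assume x: "x \<noteq> 0"
  define Q where "Q u = (x \<bullet> swap_diff u) * (x \<bullet> swap_diff u) * logistic_weight u" for u
  have Q: "continuous_on UNIV Q" unfolding Q_def[abs_def] by (intro continuous_on_mult continuous_swap_diff_inner continuous_logistic_weight)
  have Q0: "0 \<le> Q u" for u unfolding Q_def by (rule mult_nonneg_nonneg[OF zero_le_square less_imp_le[OF logistic_weight_pos]])
  have nn: "0 \<le> (\<integral>u. Q u \<partial>(\<mu> \<Otimes>\<^sub>M \<mu>))" using Q0 by simp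
  have "(\<integral>u. Q u \<partial>(\<mu> \<Otimes>\<^sub>M \<mu>)) \<noteq> 0"
  proof
    assume "(\<integral>u. Q u \<partial>(\<mu> \<Otimes>\<^sub>M \<mu>)) = 0"
    then have 1: "(\<integral>z. \<integral>w. Q (z, w) \<partial>\<mu> \<partial>\<mu>) = 0" by (simp only: integral_pair(1)[OF Q])
    have "Q (z, w) = 0" if z: "z \<in> unit_square" and w: "w \<in> unit_square" for z w
    proof (rule zero_integral_imp_zero[where h = "\<lambda>w. Q (z, w)", OF _ Q0 _ w])
      show "continuous_on UNIV (\<lambda>w. Q (z, w))"
        by (rule continuous_on_compose2[OF Q]) (auto intro!: continuous_on_Pair continuous_on_const continuous_on_id)
      show "(\<integral>w. Q (z, w) \<partial>\<mu>) = 0"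
        by (rule zero_integral_imp_zero[where h = "\<lambda>z. \<integral>w. Q (z, w) \<partial>\<mu>", OF continuous_partial_integral[OF Q] _ 1 z])
           (use Q0 in simp)
    qed
    then have "x \<bullet> swap_diff (z, w) = 0" if "z \<in> unit_square" "w \<in> unit_square" for z w
      using that logistic_weight_pos[of "(z, w)"] unfolding Q_def by (metis less_irrefl mult_eq_0_iff)
    with swap_diff_orthogonal_imp_zero x show False by blast
  qed
  with nn have "0 < (\<integral>u. Q u \<partial>(\<mu> \<Otimes>\<^sub>M \<mu>))" by linarith
  then show "0 < x \<bullet> (A_mat f \<theta> *v x)" unfolding A_quadratic Q_def by simp
qed

section \<open>Taylor expansion of the score\<close>

lemma emp2_add: "emp2 n \<pi> (\<lambda>w. h w + k w) = emp2 n \<pi> h + emp2 n \<pi> k"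
  by (simp add: emp2_def emp_add)

lemma emp2_cmult: "emp2 n \<pi> (\<lambda>w. c * h w) = c * emp2 n \<pi> h"
  by (simp add: emp2_def emp_cmult)

lemma emp2_diff: "emp2 n \<pi> (\<lambda>w. h w - k w) = emp2 n \<pi> h - emp2 n \<pi> k"
  using emp2_add[of n \<pi> h "\<lambda>w. (-1) * k w"] by (simp only: emp2_cmult) simp

lemma emp2_sum: "finite I \<Longrightarrow> emp2 n \<pi> (\<lambda>w. \<Sum>i\<in>I. h i w) = (\<Sum>i\<in>I. emp2 n \<pi> (h i))"
proof (induction I rule: finite_induct)
  case empty
  show ?case using emp2_cmult[of n \<pi> 0 "\<lambda>_. 0"] by simp
qed (simp add: emp2_add)

text \<open>Minus the derivative of the normalised score \<open>mean_score n \<pi>\<close> at 0, that is, at the parameter \<open>\<theta>\<close>.\<close>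

definition hessian :: "nat \<Rightarrow> (nat \<Rightarrow> nat) \<Rightarrow> real ^ 'l ^ 'l" where
  "hessian n \<pi> = (\<chi> p r. 1 / 2 * emp2 n \<pi> (hessian_kernel p r))"

definition hessian_error :: "nat \<Rightarrow> (nat \<Rightarrow> nat) \<Rightarrow> real" where
  "hessian_error n \<pi> = (\<Sum>p\<in>UNIV. \<Sum>r\<in>UNIV. \<bar>(hessian n \<pi> - A_mat f \<theta>) $ p $ r\<bar>)"

definition mean_score :: "nat \<Rightarrow> (nat \<Rightarrow> nat) \<Rightarrow> real ^ 'l \<Rightarrow> real ^ 'l" where
  "mean_score n \<pi> v = (1 / (real n)\<^sup>2) *\<^sub>R pl_score f n \<pi> (\<theta> + v)"

lemma mean_score_emp2: "n > 0 \<Longrightarrow> \<pi> \<in> perms n \<Longrightarrow> t \<bullet> mean_score n \<pi> v = 1 / 2 * emp2 n \<pi> (\<lambda>u. logistic (\<theta> \<bullet> swap_diff u + v \<bullet> swap_diff u) * (t \<bullet> swap_diff u))"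
  unfolding mean_score_def inner_scaleR_right pl_score_emp2 inner_add_left by simp

lemma hessian_emp2: "t \<bullet> (hessian n \<pi> *v v) = 1 / 2 * emp2 n \<pi> (\<lambda>u. (t \<bullet> swap_diff u) * (v \<bullet> swap_diff u) * logistic_weight u)"
  unfolding bilinear_hessian_kernel
  by (simp add: emp2_sum emp2_cmult) (simp add: hessian_def inner_vec_def matrix_vector_mult_def sum_distrib_left sum_divide_distrib mult_ac)

lemma hessian_error_nonneg: "0 \<le> hessian_error n \<pi>"
  unfolding hessian_error_def by (intro sum_nonneg) auto

lemma hessian_error_conv: "(\<lambda>n. E n (hessian_error n)) \<longlonglongrightarrow> 0"
proof -
  have "E n (hessian_error n) = (\<Sum>p\<in>UNIV. \<Sum>r\<in>UNIV. 1 / 2 * E n (\<lambda>\<pi>. \<bar>emp2 n \<pi> (hessian_kernel p r) - (\<integral>u. hessian_kernel p r u \<partial>(\<mu> \<Otimes>\<^sub>M \<mu>))\<bar>))" for n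
  proof -
    have "E n (hessian_error n) = E n (\<lambda>\<pi>. \<Sum>p\<in>UNIV. \<Sum>r\<in>UNIV. 1 / 2 * \<bar>emp2 n \<pi> (hessian_kernel p r) - (\<integral>u. hessian_kernel p r u \<partial>(\<mu> \<Otimes>\<^sub>M \<mu>))\<bar>)"
    proof (rule E_cong)
      fix \<pi>
      have h: "\<bar>1 / 2 * x - 1 / 2 * y\<bar> = 1 / 2 * \<bar>x - y\<bar>" for x y :: real by (simp add: abs_if field_simps)
      show "hessian_error n \<pi> = (\<Sum>p\<in>UNIV. \<Sum>r\<in>UNIV. 1 / 2 * \<bar>emp2 n \<pi> (hessian_kernel p r) - (\<integral>u. hessian_kernel p r u \<partial>(\<mu> \<Otimes>\<^sub>M \<mu>))\<bar>)"
        unfolding hessian_error_def vector_minus_component A_entry h[symmetric] by (simp add: hessian_def)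
    qed
    then show ?thesis by (simp only: E_sum E_cmult)
  qed
  moreover have "(\<lambda>n. \<Sum>p\<in>UNIV. \<Sum>r\<in>UNIV. 1 / 2 * E n (\<lambda>\<pi>. \<bar>emp2 n \<pi> (hessian_kernel p r) - (\<integral>u. hessian_kernel p r u \<partial>(\<mu> \<Otimes>\<^sub>M \<mu>))\<bar>))
     \<longlonglongrightarrow> (\<Sum>p\<in>(UNIV::'l set). \<Sum>r\<in>(UNIV::'l set). 1 / 2 * 0)"
    by (intro tendsto_sum tendsto_mult_left LLN2(1)[unfolded L1_lim_def] continuous_hessian_kernel)
  ultimately show ?thesis by simp
qed

lemma swap_diff_bound: obtains Y where "Y > 0" "\<And>u. u \<in> unit_square \<times> unit_square \<Longrightarrow> norm (swap_diff u) \<le> Y"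
proof -
  have "compact (swap_diff ` (unit_square \<times> unit_square))"
    by (intro compact_continuous_image continuous_swap_diff compact_Times compact_unit_square)
  then obtain Y where Y: "\<And>u. u \<in> unit_square \<times> unit_square \<Longrightarrow> norm (swap_diff u) \<le> Y"
    using compact_imp_bounded bounded_iff by (metis image_eqI)
  show ?thesis by (rule that[of "max 1 Y"]) (use Y in fastforce)+
qed

lemma mean_score_taylor:
  obtains C where "C > 0" "\<And>n \<pi> v. n > 0 \<Longrightarrow> \<pi> \<in> perms n \<Longrightarrow> norm (mean_score n \<pi> v - mean_score n \<pi> 0 + hessian n \<pi> *v v) \<le> C * (norm v)\<^sup>2"
proof -
  obtain Y where Y: "Y > 0" "\<And>u. u \<in> unit_square \<times> unit_square \<Longrightarrow> norm (swap_diff u) \<le> Y" using swap_diff_bound by blast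
  show ?thesis
  proof (rule that[of "Y ^ 3"])
    fix n :: nat and \<pi> and v :: "real ^ 'l" assume n: "n > 0" and p: "\<pi> \<in> perms n"
    define e where "e = mean_score n \<pi> v - mean_score n \<pi> 0 + hessian n \<pi> *v v"
    let ?s = "\<lambda>u. \<theta> \<bullet> swap_diff u" and ?d = "\<lambda>u. v \<bullet> swap_diff u"
    have "e \<bullet> e = 1 / 2 * emp2 n \<pi> (\<lambda>u. logistic (?s u + ?d u) * (e \<bullet> swap_diff u) - logistic (?s u + 0 \<bullet> swap_diff u) * (e \<bullet> swap_diff u) + (e \<bullet> swap_diff u) * ?d u * logistic_weight u)"
      unfolding emp2_add emp2_diff distrib_left right_diff_distrib mean_score_emp2[OF n p, symmetric] hessian_emp2[symmetric]
      by (simp add: e_def inner_add_right inner_diff_right)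
    also have "\<bar>\<dots>\<bar> \<le> 1 / 2 * (Y ^ 3 * (norm v)\<^sup>2 * norm e)"
      unfolding abs_mult
    proof (intro mult_mono emp2_bound n p)
      fix u assume u: "u \<in> unit_square \<times> unit_square"
      have "\<bar>logistic (?s u + ?d u) * (e \<bullet> swap_diff u) - logistic (?s u + 0 \<bullet> swap_diff u) * (e \<bullet> swap_diff u) + (e \<bullet> swap_diff u) * ?d u * logistic_weight u\<bar>
        = \<bar>logistic (?s u + ?d u) - logistic (?s u) + logistic (?s u) * (1 - logistic (?s u)) * ?d u\<bar> * \<bar>e \<bullet> swap_diff u\<bar>"
        unfolding abs_mult[symmetric] by (simp add: logistic_weight_def algebra_simps)
      also have "\<dots> \<le> (norm v * Y)\<^sup>2 * (norm e * Y)"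
      proof (rule mult_mono)
        have "\<bar>?d u\<bar> \<le> norm v * norm (swap_diff u)" by (rule Cauchy_Schwarz_ineq2)
        also have "\<dots> \<le> norm v * Y" by (intro mult_left_mono Y u) auto
        finally have "\<bar>?d u\<bar>\<^sup>2 \<le> (norm v * Y)\<^sup>2" by (intro power_mono) auto
        then show "\<bar>logistic (?s u + ?d u) - logistic (?s u) + logistic (?s u) * (1 - logistic (?s u)) * ?d u\<bar> \<le> (norm v * Y)\<^sup>2"
          using logistic_taylor[of "?s u" "?d u"] by simp
        have "\<bar>e \<bullet> swap_diff u\<bar> \<le> norm e * norm (swap_diff u)" by (rule Cauchy_Schwarz_ineq2)
        also have "\<dots> \<le> norm e * Y" by (intro mult_left_mono Y u) auto
        finally show "\<bar>e \<bullet> swap_diff u\<bar> \<le> norm e * Y" .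
      qed auto
      also have "\<dots> = Y ^ 3 * (norm v)\<^sup>2 * norm e" by (simp add: power2_eq_square power3_eq_cube)
      finally show "\<bar>logistic (?s u + ?d u) * (e \<bullet> swap_diff u) - logistic (?s u + 0 \<bullet> swap_diff u) * (e \<bullet> swap_diff u) + (e \<bullet> swap_diff u) * ?d u * logistic_weight u\<bar> \<le> Y ^ 3 * (norm v)\<^sup>2 * norm e" .
    qed auto
    also have "\<dots> \<le> 1 * (Y ^ 3 * (norm v)\<^sup>2 * norm e)" using Y(1) by (intro mult_right_mono mult_nonneg_nonneg) auto
    finally have le: "norm e * norm e \<le> (Y ^ 3 * (norm v)\<^sup>2) * norm e" by (simp add: power2_norm_eq_inner[symmetric] power2_eq_square)
    have "norm e \<le> Y ^ 3 * (norm v)\<^sup>2"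
    proof (cases "e = 0")
      case True then show ?thesis using Y(1) by simp
    next
      case False then show ?thesis using le by simp
    qed
    then show "norm (mean_score n \<pi> v - mean_score n \<pi> 0 + hessian n \<pi> *v v) \<le> Y ^ 3 * (norm v)\<^sup>2" by (simp add: e_def)
  qed (use Y in simp)
qed

text \<open>The logistic function is strictly decreasing, so equal scores at two parameters force their difference
  to be orthogonal to all swap differences, and hence to lie in the kernel of the Hessian.\<close>

lemma mean_score_monotone:
  assumes n: "n > 0" and p: "\<pi> \<in> perms n" and pd: "\<And>x. x \<noteq> 0 \<Longrightarrow> 0 < x \<bullet> (hessian n \<pi> *v x)"
    and eq: "mean_score n \<pi> v = mean_score n \<pi> v'"
  shows "v = v'"
proof (rule ccontr)
  assume ne: "v \<noteq> v'"
  define x where "x = v - v'"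
  define c where "c u = (logistic (\<theta> \<bullet> swap_diff u + v \<bullet> swap_diff u) - logistic (\<theta> \<bullet> swap_diff u + v' \<bullet> swap_diff u)) * (x \<bullet> swap_diff u)" for u
  have cd: "c u = (logistic (\<theta> \<bullet> swap_diff u + v \<bullet> swap_diff u) - logistic (\<theta> \<bullet> swap_diff u + v' \<bullet> swap_diff u)) * ((\<theta> \<bullet> swap_diff u + v \<bullet> swap_diff u) - (\<theta> \<bullet> swap_diff u + v' \<bullet> swap_diff u))" for u
    by (simp add: c_def x_def inner_diff_left)
  have c0: "c u \<le> 0" for u unfolding cd by (rule logistic_monotone(1))
  have cz: "x \<bullet> swap_diff u = 0" if "c u = 0" for u
    using logistic_monotone(2)[OF that[unfolded cd]] by (simp add: x_def inner_diff_left)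
  have "emp2 n \<pi> c = 0"
  proof -
    have "1 / 2 * emp2 n \<pi> c = x \<bullet> mean_score n \<pi> v - x \<bullet> mean_score n \<pi> v'"
      unfolding mean_score_emp2[OF n p] c_def[abs_def] left_diff_distrib emp2_diff right_diff_distrib ..
    then show ?thesis by (simp add: eq)
  qed
  then have sum0: "(\<Sum>i=1..n. \<Sum>j=1..n. - c (pt n \<pi> i, pt n \<pi> j)) = 0"
    using n by (simp add: emp2_def emp_def avg_def sum_divide_distrib[symmetric] sum_negf)
  have nn: "0 \<le> - c u" for u using c0[of u] by simp
  have row0: "(\<Sum>j=1..n. - c (pt n \<pi> i, pt n \<pi> j)) = 0" if "i \<in> {1..n}" for i
    by (rule sum_nonneg_0[OF finite_atLeastAtMost _ sum0 that]) (intro sum_nonneg nn)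
  have "- c (pt n \<pi> i, pt n \<pi> j) = 0" if "i \<in> {1..n}" "j \<in> {1..n}" for i j
    by (rule sum_nonneg_0[OF finite_atLeastAtMost nn row0[OF that(1)] that(2)])
  then have "c (pt n \<pi> i, pt n \<pi> j) = 0" if "i \<in> {1..n}" "j \<in> {1..n}" for i j
    using that by simp
  then have "emp2 n \<pi> (\<lambda>u. (x \<bullet> swap_diff u) * (x \<bullet> swap_diff u) * logistic_weight u) = 0"
    unfolding emp2_def emp_def avg_def using cz by simp
  then have "x \<bullet> (hessian n \<pi> *v x) = 0" unfolding hessian_emp2 by simp
  moreover have "x \<noteq> 0" using ne by (simp add: x_def)
  ultimately show False using pd[of x] by simp
qed

end

section \<open>The pseudo-likelihood estimator\<close>

lemma cos_lipschitz: "\<bar>cos a - cos b\<bar> \<le> \<bar>a - b\<bar>" for a b :: real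
proof -
  have "\<bar>cos a - cos b\<bar> = 2 * (\<bar>sin ((a + b) / 2)\<bar> * \<bar>sin ((b - a) / 2)\<bar>)"
    by (simp add: cos_diff_cos abs_mult)
  also have "\<dots> \<le> 2 * (1 * \<bar>(b - a) / 2\<bar>)"
    by (intro mult_left_mono mult_mono abs_sin_x_le_abs_x abs_sin_le_one) auto
  finally show ?thesis by (simp add: abs_minus_commute)
qed

context tilted_model
begin

lemma continuous_mean_score: "n > 0 \<Longrightarrow> continuous_on UNIV (mean_score n \<pi>)"
  unfolding mean_score_def[abs_def] pl_score_def case_prod_beta
  by (intro continuous_on_scaleR continuous_on_const continuous_on_sum continuous_on_divide continuous_on_add continuous_on_exp
      continuous_on_inner continuous_on_id ballI) (metis add_pos_pos exp_gt_zero less_irrefl zero_less_one)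

text \<open>On a small sphere the linear term \<open>- hessian v\<close> dominates the constant and the quadratic term of the
  Taylor expansion, so the score points inwards; the same inequality at the root bounds its norm.\<close>

lemma root_analysis:
  assumes n: "n > 0" and p: "\<pi> \<in> perms n"
    and l: "l > 0" "\<And>x. l * (norm x)\<^sup>2 \<le> x \<bullet> (A_mat f \<theta> *v x)"
    and C: "C > 0" "\<And>v. norm (mean_score n \<pi> v - mean_score n \<pi> 0 + hessian n \<pi> *v v) \<le> C * (norm v)\<^sup>2"
    and D: "hessian_error n \<pi> \<le> l / 4" and small: "norm (mean_score n \<pi> 0) < l\<^sup>2 / (8 * C)"
  shows "\<exists>!v. mean_score n \<pi> v = 0"
    and "mean_score n \<pi> v = 0 \<Longrightarrow> norm v \<le> 2 / l * norm (mean_score n \<pi> 0)"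
    and "mean_score n \<pi> v = 0 \<Longrightarrow> norm (A_mat f \<theta> *v v - mean_score n \<pi> 0) \<le> hessian_error n \<pi> * norm v + C * (norm v)\<^sup>2"
proof -
  let ?A = "A_mat f \<theta>" and ?H = "hessian n \<pi>"
  (* On this radius the quadratic Taylor term is at most a quarter of the coercivity bound. *)
  define r where "r = l / (4 * C)"
  have r: "r > 0" using l C by (simp add: r_def)
  have dH: "norm (?H *v x - ?A *v x) \<le> hessian_error n \<pi> * norm x" for x
    using norm_matrix_vector_entries[of "?H - ?A" x] by (simp add: hessian_error_def matrix_vector_mult_diff_rdistrib)
  have H: "(3 / 4 * l) * (norm x)\<^sup>2 \<le> x \<bullet> (?H *v x)" for x
  proof -
    have "\<bar>x \<bullet> (?H *v x - ?A *v x)\<bar> \<le> norm x * norm (?H *v x - ?A *v x)" by (rule Cauchy_Schwarz_ineq2)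
    also have "\<dots> \<le> norm x * (l / 4 * norm x)"
      by (intro mult_left_mono order_trans[OF dH mult_right_mono[OF D]]) auto
    finally have "\<bar>x \<bullet> (?H *v x) - x \<bullet> (?A *v x)\<bar> \<le> l / 4 * (norm x)\<^sup>2"
      by (simp add: inner_diff_right power2_eq_square mult_ac)
    then show ?thesis using l(2)[of x] by linarith
  qed
  have Hpd: "0 < x \<bullet> (?H *v x)" if "x \<noteq> 0" for x
  proof -
    have "0 < (3 / 4 * l) * (norm x)\<^sup>2" using l that by simp
    with H[of x] show ?thesis by linarith
  qed
  have key: "v \<bullet> mean_score n \<pi> v \<le> norm v * norm (mean_score n \<pi> 0) - (l / 2) * (norm v)\<^sup>2" if v: "norm v \<le> r" for v
  proof -
    define e where "e = mean_score n \<pi> v - mean_score n \<pi> 0 + ?H *v v"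
    have "v \<bullet> e \<le> norm v * norm e" by (rule norm_cauchy_schwarz)
    also have "\<dots> \<le> norm v * (C * (norm v)\<^sup>2)" unfolding e_def by (intro mult_left_mono C) auto
    also have "\<dots> = (C * norm v) * (norm v)\<^sup>2" by simp
    also have "\<dots> \<le> (C * r) * (norm v)\<^sup>2" using v C by (intro mult_right_mono mult_left_mono) auto
    also have "C * r = l / 4" using C by (simp add: r_def)
    finally have "v \<bullet> e \<le> l / 4 * (norm v)\<^sup>2" .
    moreover have "v \<bullet> mean_score n \<pi> v = v \<bullet> e + v \<bullet> mean_score n \<pi> 0 - v \<bullet> (?H *v v)"
      by (simp add: e_def inner_add_right inner_diff_right)
    moreover have "v \<bullet> mean_score n \<pi> 0 \<le> norm v * norm (mean_score n \<pi> 0)" by (rule norm_cauchy_schwarz)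
    ultimately show ?thesis using H[of v] by (simp add: algebra_simps)
  qed
  obtain v0 where v0: "norm v0 \<le> r" "mean_score n \<pi> v0 = 0"
  proof (rule inward_field_root[OF continuous_mean_score[OF n] r])
    fix v :: "real ^ 'l" assume v: "norm v = r"
    have "v \<bullet> mean_score n \<pi> v \<le> r * norm (mean_score n \<pi> 0) - (l / 2) * r\<^sup>2" using key[of v] v by simp
    also have "\<dots> = r * (norm (mean_score n \<pi> 0) - l\<^sup>2 / (8 * C))" using C by (simp add: r_def power2_eq_square field_simps)
    also have "\<dots> < 0" using r small by (intro mult_pos_neg) auto
    finally show "v \<bullet> mean_score n \<pi> v < 0" .
  qed
  have unique: "v = v0" if "mean_score n \<pi> v = 0" for v
    by (rule mean_score_monotone[OF n p Hpd]) (use that v0 in auto)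
  then show "\<exists>!v. mean_score n \<pi> v = 0" using v0 by blast
  assume v: "mean_score n \<pi> v = 0"
  have "norm v \<le> r" using unique[OF v] v0 by simp
  from key[OF this] have le: "norm v * (l / 2 * norm v) \<le> norm v * norm (mean_score n \<pi> 0)" by (simp add: v power2_eq_square mult_ac)
  show "norm v \<le> 2 / l * norm (mean_score n \<pi> 0)"
  proof (cases "v = 0")
    case True then show ?thesis using l by simp
  next
    case False
    with le have "l / 2 * norm v \<le> norm (mean_score n \<pi> 0)" by simp
    then show ?thesis using l by (simp add: field_simps)
  qed
  have "?A *v v - mean_score n \<pi> 0 = (mean_score n \<pi> v - mean_score n \<pi> 0 + ?H *v v) - (?H *v v - ?A *v v)" by (simp add: v)
  also have "norm \<dots> \<le> C * (norm v)\<^sup>2 + hessian_error n \<pi> * norm v"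
    using C(2)[of v] dH[of v] norm_triangle_ineq4[of "mean_score n \<pi> v - mean_score n \<pi> 0 + ?H *v v" "?H *v v - ?A *v v"] by linarith
  finally show "norm (?A *v v - mean_score n \<pi> 0) \<le> hessian_error n \<pi> * norm v + C * (norm v)\<^sup>2" by simp
qed

lemma scaled_score_mean_score: "n > 0 \<Longrightarrow> scaled_score n \<pi> = sqrt n *\<^sub>R mean_score n \<pi> 0"
proof -
  assume n: "n > 0"
  have "(real n)\<^sup>2 = real n powr 2" using n by simp
  then have "real n powr (- 3 / 2) * (real n)\<^sup>2 = real n powr (- 3 / 2) * real n powr 2" by (simp only:)
  also have "\<dots> = real n powr (- 3 / 2 + 2)" by (rule powr_add[symmetric])
  also have "\<dots> = sqrt n" by (simp add: powr_half_sqrt)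
  finally have "real n powr (- 3 / 2) = sqrt n * (1 / (real n)\<^sup>2)" using n by (simp add: field_simps)
  then show ?thesis unfolding scaled_score_def mean_score_def by (simp only: scaleR_scaleR add_0_right)
qed

text \<open>On the event \<open>good\<close>, whose probability tends to 1, \<open>root_analysis\<close> applies. It bounds the distance between
  the rescaled root and the inverse of \<open>A_mat\<close> times the scaled score by terms that vanish in the limit,
  so the two have the same characteristic functions asymptotically.\<close>

theorem root_exists_and_clt:
  shows "(\<lambda>n. E n (\<lambda>\<pi>. of_bool (\<exists>!\<eta>. pl_score f n \<pi> \<eta> = 0))) \<longlonglongrightarrow> 1"
    and "(\<And>n \<pi>. \<pi> \<in> perms n \<Longrightarrow> \<exists>!\<eta>. pl_score f n \<pi> \<eta> = 0 \<Longrightarrow> pl_score f n \<pi> (\<eta>\<^sub>P n \<pi>) = 0) \<Longrightarrow>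
       conv_in_distr_normal (\<lambda>n. perm_law f n \<theta>) (\<lambda>n \<pi>. sqrt n *\<^sub>R (\<eta>\<^sub>P n \<pi> - \<theta>)) 0
         (matrix_inv (A_mat f \<theta>) ** Sigma_mat f \<theta> ** matrix_inv (A_mat f \<theta>))"
proof -
  let ?A = "A_mat f \<theta>" and ?\<Sigma> = "Sigma_mat f \<theta>"
  define B where "B = matrix_inv ?A"
  note inv = pos_def_inverse[OF A_pos_def, folded B_def]
  obtain l where l: "l > 0" "\<And>x. l * (norm x)\<^sup>2 \<le> x \<bullet> (?A *v x)" using pos_def_coercive[OF A_pos_def] by blast
  obtain C where C: "C > 0" "\<And>n \<pi> v. n > 0 \<Longrightarrow> \<pi> \<in> perms n \<Longrightarrow> norm (mean_score n \<pi> v - mean_score n \<pi> 0 + hessian n \<pi> *v v) \<le> C * (norm v)\<^sup>2"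
    using mean_score_taylor by blast
  obtain K where K: "0 \<le> K" "\<And>n. n > 0 \<Longrightarrow> E n (\<lambda>\<pi>. (norm (scaled_score n \<pi>))\<^sup>2) \<le> K" using scaled_score_second_moment by blast
  define c where "c = l\<^sup>2 / (8 * C)"
  have c: "c > 0" using l C by (simp add: c_def)
  (* The two thresholds are those of the root analysis; Markov's inequality bounds the probability of failure. *)
  define good where "good n \<pi> \<longleftrightarrow> hessian_error n \<pi> \<le> l / 4 \<and> norm (scaled_score n \<pi>) < sqrt n * c" for n \<pi>
  define bad where "bad n = E n (\<lambda>\<pi>. of_bool (\<not> good n \<pi>))" for n
  have sqrtlim: "(\<lambda>n. 1 / sqrt (real n)) \<longlonglongrightarrow> 0"
    using tendsto_real_sqrt[OF lim_1_over_n[where 'a=real]] by (simp add: real_sqrt_divide)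
  have bad0: "0 \<le> bad n" for n unfolding bad_def by (intro E_nonneg) simp
  have bad: "bad \<longlonglongrightarrow> 0"
  proof (rule tendsto_sandwich[OF _ _ tendsto_const])
    show "\<forall>\<^sub>F n in sequentially. 0 \<le> bad n" using bad0 by simp
    show "\<forall>\<^sub>F n in sequentially. bad n \<le> 4 / l * E n (hessian_error n) + K / c\<^sup>2 * (1 / n)"
      using eventually_gt_at_top[of 0]
    proof eventually_elim
      case (elim n)
      have "bad n \<le> E n (\<lambda>\<pi>. 4 / l * hessian_error n \<pi> + (1 / (n * c\<^sup>2)) * (norm (scaled_score n \<pi>))\<^sup>2)"
        unfolding bad_def
      proof (rule E_mono)
        fix \<pi>
        have a: "0 \<le> 4 / l * hessian_error n \<pi>" "0 \<le> (1 / (n * c\<^sup>2)) * (norm (scaled_score n \<pi>))\<^sup>2" using l hessian_error_nonneg by auto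
        show "of_bool (\<not> good n \<pi>) \<le> 4 / l * hessian_error n \<pi> + (1 / (n * c\<^sup>2)) * (norm (scaled_score n \<pi>))\<^sup>2"
        proof (cases "hessian_error n \<pi> \<le> l / 4")
          case False
          then have "1 \<le> 4 / l * hessian_error n \<pi>" using l by (simp add: field_simps)
          moreover have "of_bool (\<not> good n \<pi>) \<le> (1::real)" by simp
          ultimately show ?thesis using a by linarith
        next
          case True
          show ?thesis
          proof (cases "norm (scaled_score n \<pi>) < sqrt n * c")
            case True
            then show ?thesis using \<open>hessian_error n \<pi> \<le> l / 4\<close> a by (simp add: good_def)
          next
            case False
            then have "(sqrt n * c)\<^sup>2 \<le> (norm (scaled_score n \<pi>))\<^sup>2" using c by (intro power_mono) auto
            then have "n * c\<^sup>2 \<le> (norm (scaled_score n \<pi>))\<^sup>2" by (simp add: power_mult_distrib)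
            then have "1 \<le> (1 / (n * c\<^sup>2)) * (norm (scaled_score n \<pi>))\<^sup>2" using c elim by simp
            moreover have "of_bool (\<not> good n \<pi>) \<le> (1::real)" by simp
            ultimately show ?thesis using a by linarith
          qed
        qed
      qed
      also have "\<dots> = 4 / l * E n (hessian_error n) + (1 / (n * c\<^sup>2)) * E n (\<lambda>\<pi>. (norm (scaled_score n \<pi>))\<^sup>2)" by (simp only: E_add E_cmult)
      also have "\<dots> \<le> 4 / l * E n (hessian_error n) + (1 / (n * c\<^sup>2)) * K" by (intro add_left_mono mult_left_mono K elim) auto
      finally show ?case by (simp add: mult_ac)
    qed
    have "(\<lambda>n. 4 / l * E n (hessian_error n) + K / c\<^sup>2 * (1 / n)) \<longlonglongrightarrow> 4 / l * 0 + K / c\<^sup>2 * 0"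
      by (intro tendsto_add tendsto_mult_left hessian_error_conv lim_1_over_n)
    then show "(\<lambda>n. 4 / l * E n (hessian_error n) + K / c\<^sup>2 * (1 / n)) \<longlonglongrightarrow> 0" by simp
  qed
  have root: "\<exists>!v. mean_score n \<pi> v = 0" "\<And>v. mean_score n \<pi> v = 0 \<Longrightarrow> norm v \<le> 2 / l * norm (mean_score n \<pi> 0)"
     "\<And>v. mean_score n \<pi> v = 0 \<Longrightarrow> norm (?A *v v - mean_score n \<pi> 0) \<le> hessian_error n \<pi> * norm v + C * (norm v)\<^sup>2"
    if n: "n > 0" and p: "\<pi> \<in> perms n" and g: "good n \<pi>" for n \<pi>
  proof -
    have "norm (scaled_score n \<pi>) = sqrt n * norm (mean_score n \<pi> 0)" by (simp add: scaled_score_mean_score[OF n])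
    then have "sqrt n * norm (mean_score n \<pi> 0) < sqrt n * c" using g by (simp add: good_def)
    then have "norm (mean_score n \<pi> 0) < l\<^sup>2 / (8 * C)" unfolding c_def by (rule mult_left_less_imp_less) simp
    note r = root_analysis[OF n p l C(1) C(2)[OF n p] _ this]
    show "\<exists>!v. mean_score n \<pi> v = 0" by (rule r(1)) (use g in \<open>simp add: good_def\<close>)
    show "\<And>v. mean_score n \<pi> v = 0 \<Longrightarrow> norm v \<le> 2 / l * norm (mean_score n \<pi> 0)" by (rule r(2)) (use g in \<open>simp_all add: good_def\<close>)
    show "\<And>v. mean_score n \<pi> v = 0 \<Longrightarrow> norm (?A *v v - mean_score n \<pi> 0) \<le> hessian_error n \<pi> * norm v + C * (norm v)\<^sup>2"
      by (rule r(3)) (use g in \<open>simp_all add: good_def\<close>)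
  qed
  have root_iff: "mean_score n \<pi> v = 0 \<longleftrightarrow> pl_score f n \<pi> (\<theta> + v) = 0" if "n > 0" for n \<pi> v
    using that by (simp add: mean_score_def)
  have ex1: "\<exists>!\<eta>. pl_score f n \<pi> \<eta> = 0" if n: "n > 0" and p: "\<pi> \<in> perms n" and g: "good n \<pi>" for n \<pi>
  proof -
    obtain v where v: "mean_score n \<pi> v = 0" "\<And>v'. mean_score n \<pi> v' = 0 \<Longrightarrow> v' = v" using root(1)[OF n p g] by blast
    show ?thesis
    proof (rule ex1I[of _ "\<theta> + v"])
      show "pl_score f n \<pi> (\<theta> + v) = 0" using v(1) root_iff[OF n] by simp
      fix \<eta> assume "pl_score f n \<pi> \<eta> = 0"
      then have "mean_score n \<pi> (\<eta> - \<theta>) = 0" using root_iff[OF n] by simp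
      from v(2)[OF this] show "\<eta> = \<theta> + v" by (simp add: algebra_simps)
    qed
  qed
  show "(\<lambda>n. E n (\<lambda>\<pi>. of_bool (\<exists>!\<eta>. pl_score f n \<pi> \<eta> = 0))) \<longlonglongrightarrow> 1"
  proof (rule tendsto_sandwich[OF _ _ _ tendsto_const])
    show "\<forall>\<^sub>F n in sequentially. 1 - bad n \<le> E n (\<lambda>\<pi>. of_bool (\<exists>!\<eta>. pl_score f n \<pi> \<eta> = 0))"
      using eventually_gt_at_top[of 0]
    proof eventually_elim
      case (elim n)
      have "1 - bad n = E n (\<lambda>\<pi>. 1 - of_bool (\<not> good n \<pi>))" by (simp only: E_diff E_const bad_def)
      also have "\<dots> \<le> E n (\<lambda>\<pi>. of_bool (\<exists>!\<eta>. pl_score f n \<pi> \<eta> = 0))"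
      proof (rule E_mono)
        fix \<pi> assume p: "\<pi> \<in> perms n"
        show "1 - of_bool (\<not> good n \<pi>) \<le> (of_bool (\<exists>!\<eta>. pl_score f n \<pi> \<eta> = 0) :: real)"
          using ex1[OF elim p] by (cases "good n \<pi>") auto
      qed
      finally show ?case .
    qed
    show "\<forall>\<^sub>F n in sequentially. E n (\<lambda>\<pi>. of_bool (\<exists>!\<eta>. pl_score f n \<pi> \<eta> = 0)) \<le> 1"
      by (intro always_eventually allI E_le) simp
    show "(\<lambda>n. 1 - bad n) \<longlonglongrightarrow> 1" using tendsto_diff[OF tendsto_const bad, of 1] by simp
  qed
  assume \<eta>P: "\<And>n \<pi>. \<pi> \<in> perms n \<Longrightarrow> \<exists>!\<eta>. pl_score f n \<pi> \<eta> = 0 \<Longrightarrow> pl_score f n \<pi> (\<eta>\<^sub>P n \<pi>) = 0"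
  define Y where "Y n \<pi> = sqrt n *\<^sub>R (\<eta>\<^sub>P n \<pi> - \<theta>)" for n \<pi>
  define k where "k = (\<Sum>p\<in>UNIV. \<Sum>q\<in>UNIV. \<bar>B $ p $ q\<bar>)"
  have k: "0 \<le> k" unfolding k_def by (intro sum_nonneg) auto
  have Yb: "norm (Y n \<pi>) \<le> 2 / l * norm (scaled_score n \<pi>)"
    and YS: "norm (Y n \<pi> - B *v scaled_score n \<pi>) \<le> k * (2 / l * (hessian_error n \<pi> * norm (scaled_score n \<pi>)) + 4 * C / l\<^sup>2 * ((norm (scaled_score n \<pi>))\<^sup>2 * (1 / sqrt n)))"
    if n: "n > 0" and p: "\<pi> \<in> perms n" and g: "good n \<pi>" for n \<pi>
  proof -
    let ?v = "\<eta>\<^sub>P n \<pi> - \<theta>" and ?e = "mean_score n \<pi> 0"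
    have sn: "sqrt n > 0" using n by simp
    have v0: "mean_score n \<pi> ?v = 0" using \<eta>P[OF p ex1[OF n p g]] root_iff[OF n] by simp
    note r = root(2)[OF n p g v0] root(3)[OF n p g v0]
    have nS: "norm (scaled_score n \<pi>) = sqrt n * norm ?e" by (simp add: scaled_score_mean_score[OF n])
    have nY: "norm (Y n \<pi>) = sqrt n * norm ?v" by (simp add: Y_def)
    show Yb: "norm (Y n \<pi>) \<le> 2 / l * norm (scaled_score n \<pi>)"
      using mult_left_mono[OF r(1), of "sqrt n"] by (simp add: nS nY mult_ac)
    have BA: "B *v (?A *v x) = x" for x by (simp add: matrix_vector_mul_assoc inv(2))
    have "Y n \<pi> - B *v scaled_score n \<pi> = sqrt n *\<^sub>R (B *v (?A *v ?v - ?e))"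
      by (simp add: Y_def scaled_score_mean_score[OF n] matrix_vector_mult_diff_distrib BA matrix_vector_mult_scaleR scaleR_diff_right)
    then have "norm (Y n \<pi> - B *v scaled_score n \<pi>) = sqrt n * norm (B *v (?A *v ?v - ?e))" by simp
    also have "\<dots> \<le> sqrt n * (k * (hessian_error n \<pi> * norm ?v + C * (norm ?v)\<^sup>2))"
    proof (intro mult_left_mono)
      have "norm (B *v (?A *v ?v - ?e)) \<le> k * norm (?A *v ?v - ?e)" unfolding k_def by (rule norm_matrix_vector_entries)
      also have "\<dots> \<le> k * (hessian_error n \<pi> * norm ?v + C * (norm ?v)\<^sup>2)" by (intro mult_left_mono r k)
      finally show "norm (B *v (?A *v ?v - ?e)) \<le> k * (hessian_error n \<pi> * norm ?v + C * (norm ?v)\<^sup>2)" .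
    qed simp
    also have "\<dots> = k * (hessian_error n \<pi> * norm (Y n \<pi>) + C * ((norm (Y n \<pi>))\<^sup>2 * (1 / sqrt n)))"
      using sn by (simp add: nY power2_eq_square field_simps)
    also have "\<dots> \<le> k * (hessian_error n \<pi> * (2 / l * norm (scaled_score n \<pi>)) + C * ((2 / l * norm (scaled_score n \<pi>))\<^sup>2 * (1 / sqrt n)))"
      using C k hessian_error_nonneg Yb by (intro mult_left_mono add_mono mult_right_mono power_mono) auto
    also have "\<dots> = k * (2 / l * (hessian_error n \<pi> * norm (scaled_score n \<pi>)) + 4 * C / l\<^sup>2 * ((norm (scaled_score n \<pi>))\<^sup>2 * (1 / sqrt n)))"
      by (simp add: power_mult_distrib power_divide mult_ac)
    finally show "norm (Y n \<pi> - B *v scaled_score n \<pi>) \<le> k * (2 / l * (hessian_error n \<pi> * norm (scaled_score n \<pi>)) + 4 * C / l\<^sup>2 * ((norm (scaled_score n \<pi>))\<^sup>2 * (1 / sqrt n)))" .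
  qed
  define x where "x n = E n (\<lambda>\<pi>. of_bool (good n \<pi>) * (hessian_error n \<pi> * norm (scaled_score n \<pi>)))" for n
  have xlim: "x \<longlonglongrightarrow> 0"
  (* The error times the score is at most e * score^2 if the error is below e * score; otherwise the score is
     below error / e, and the error is bounded by l / 4 on the good event. *)
  proof (rule tendsto_zero_of_tradeoff[where y = "\<lambda>n. l / 4 * E n (hessian_error n)" and K = K])
    show "0 \<le> x n" for n unfolding x_def by (intro E_nonneg) (simp add: hessian_error_nonneg)
    show "(\<lambda>n. l / 4 * E n (hessian_error n)) \<longlonglongrightarrow> 0" using tendsto_mult_left[OF hessian_error_conv, of "l / 4"] by simp
    fix n :: nat and e :: real assume n: "n > 0" and e: "e > 0"
    have "x n \<le> E n (\<lambda>\<pi>. e * (norm (scaled_score n \<pi>))\<^sup>2 + (l / 4 / e) * hessian_error n \<pi>)"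
      unfolding x_def
    proof (rule E_mono)
      fix \<pi>
      let ?d = "hessian_error n \<pi>" and ?s = "norm (scaled_score n \<pi>)"
      have nn: "0 \<le> e * ?s\<^sup>2" "0 \<le> (l / 4 / e) * ?d" using e l hessian_error_nonneg by auto
      show "of_bool (good n \<pi>) * (?d * ?s) \<le> e * ?s\<^sup>2 + (l / 4 / e) * ?d"
      proof (cases "good n \<pi>")
        case True
        then have d: "?d \<le> l / 4" by (simp add: good_def)
        show ?thesis
        proof (cases "?d \<le> e * ?s")
          case t: True
          then have "?d * ?s \<le> e * ?s\<^sup>2" using mult_right_mono[OF t, of ?s] by (simp add: power2_eq_square mult_ac)
          then show ?thesis using True nn by simp
        next
          case False
          then have "?s \<le> ?d / e" using e by (simp add: field_simps)
          then have "?d * ?s \<le> ?d * (?d / e)" by (intro mult_left_mono hessian_error_nonneg)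
          also have "\<dots> \<le> ?d * ((l / 4) / e)" using d e by (intro mult_left_mono divide_right_mono hessian_error_nonneg) auto
          finally show ?thesis using True nn by (simp add: mult_ac)
        qed
      qed (use nn in simp)
    qed
    also have "\<dots> = e * E n (\<lambda>\<pi>. (norm (scaled_score n \<pi>))\<^sup>2) + (l / 4 / e) * E n (hessian_error n)" by (simp only: E_add E_cmult)
    also have "\<dots> \<le> e * K + (l / 4 / e) * E n (hessian_error n)" using e by (intro add_right_mono mult_left_mono K n) auto
    finally show "x n \<le> e * K + l / 4 * E n (hessian_error n) / e" by simp
  qed (rule K)
  let ?S2 = "B ** ?\<Sigma> ** B"
  have Bt: "t \<bullet> (B *v y) = (B *v t) \<bullet> y" for t y
    using dot_lmul_matrix[of t B y] transpose_matrix_vector[of B t] inv(3) by simp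
  have quad: "t \<bullet> (?S2 *v t) = (B *v t) \<bullet> (?\<Sigma> *v (B *v t))" for t
    by (simp add: matrix_vector_mul_assoc[symmetric] Bt)
  have "conv_in_distr_normal (\<lambda>n. perm_law f n \<theta>) Y 0 ?S2"
  proof (rule normal_limit_criterion)
    show "transpose ?S2 = ?S2" by (simp add: matrix_transpose_mul inv(3) Sigma_sym matrix_mul_assoc)
    show "0 \<le> t \<bullet> (?S2 *v t)" for t unfolding quad by (rule Sigma_psd)
  next
    fix t :: "real ^ 'l" and \<phi> :: real
    define y where "y n = 2 * bad n + norm t * (k * (2 / l * x n + 4 * C / l\<^sup>2 * (K * (1 / sqrt n))))" for n
    have ylim: "y \<longlonglongrightarrow> 0"
    proof -
      have "y \<longlonglongrightarrow> 2 * 0 + norm t * (k * (2 / l * 0 + 4 * C / l\<^sup>2 * (K * 0)))"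
        unfolding y_def by (intro tendsto_add tendsto_mult_left bad xlim sqrtlim)
      then show ?thesis by simp
    qed
    have "\<bar>E n (\<lambda>\<pi>. cos (t \<bullet> Y n \<pi> + \<phi>)) - E n (\<lambda>\<pi>. cos ((B *v t) \<bullet> scaled_score n \<pi> + \<phi>))\<bar> \<le> y n" if n: "n > 0" for n
    proof -
      have "\<bar>E n (\<lambda>\<pi>. cos (t \<bullet> Y n \<pi> + \<phi>)) - E n (\<lambda>\<pi>. cos ((B *v t) \<bullet> scaled_score n \<pi> + \<phi>))\<bar>
         \<le> E n (\<lambda>\<pi>. \<bar>cos (t \<bullet> Y n \<pi> + \<phi>) - cos ((B *v t) \<bullet> scaled_score n \<pi> + \<phi>)\<bar>)"
        unfolding E_diff[symmetric] by (rule E_abs)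
      also have "\<dots> \<le> E n (\<lambda>\<pi>. 2 * of_bool (\<not> good n \<pi>) + norm t * (k * (2 / l * (of_bool (good n \<pi>) * (hessian_error n \<pi> * norm (scaled_score n \<pi>))) + 4 * C / l\<^sup>2 * ((1 / sqrt n) * (norm (scaled_score n \<pi>))\<^sup>2))))"
      proof (rule E_mono)
        fix \<pi> assume p: "\<pi> \<in> perms n"
        let ?L = "\<bar>cos (t \<bullet> Y n \<pi> + \<phi>) - cos ((B *v t) \<bullet> scaled_score n \<pi> + \<phi>)\<bar>"
        have nn: "0 \<le> norm t * (k * (4 * C / l\<^sup>2 * ((1 / sqrt n) * (norm (scaled_score n \<pi>))\<^sup>2)))"
          using k C by (intro mult_nonneg_nonneg) auto
        show "?L \<le> 2 * of_bool (\<not> good n \<pi>) + norm t * (k * (2 / l * (of_bool (good n \<pi>) * (hessian_error n \<pi> * norm (scaled_score n \<pi>))) + 4 * C / l\<^sup>2 * ((1 / sqrt n) * (norm (scaled_score n \<pi>))\<^sup>2)))"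
        proof (cases "good n \<pi>")
          case False
          have "?L \<le> 2" using cos_le_one[of "t \<bullet> Y n \<pi> + \<phi>"] cos_ge_minus_one[of "t \<bullet> Y n \<pi> + \<phi>"]
             cos_le_one[of "(B *v t) \<bullet> scaled_score n \<pi> + \<phi>"] cos_ge_minus_one[of "(B *v t) \<bullet> scaled_score n \<pi> + \<phi>"] by linarith
          then show ?thesis using False nn by simp
        next
          case True
          have "?L \<le> \<bar>(t \<bullet> Y n \<pi> + \<phi>) - ((B *v t) \<bullet> scaled_score n \<pi> + \<phi>)\<bar>" by (rule cos_lipschitz)
          also have "\<dots> = \<bar>t \<bullet> (Y n \<pi> - B *v scaled_score n \<pi>)\<bar>" by (simp add: inner_diff_right Bt)
          also have "\<dots> \<le> norm t * norm (Y n \<pi> - B *v scaled_score n \<pi>)" by (rule Cauchy_Schwarz_ineq2)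
          also have "\<dots> \<le> norm t * (k * (2 / l * (hessian_error n \<pi> * norm (scaled_score n \<pi>)) + 4 * C / l\<^sup>2 * ((norm (scaled_score n \<pi>))\<^sup>2 * (1 / sqrt n))))"
            by (intro mult_left_mono YS n p True) simp
          finally show ?thesis using True by (simp add: mult_ac)
        qed
      qed
      also have "\<dots> = 2 * bad n + norm t * (k * (2 / l * x n + 4 * C / l\<^sup>2 * ((1 / sqrt n) * E n (\<lambda>\<pi>. (norm (scaled_score n \<pi>))\<^sup>2))))"
        by (simp only: E_add E_cmult bad_def x_def)
      also have "\<dots> \<le> 2 * bad n + norm t * (k * (2 / l * x n + 4 * C / l\<^sup>2 * ((1 / sqrt n) * K)))"
        using k C by (intro add_left_mono mult_left_mono K n) auto
      finally show ?thesis by (simp only: y_def mult.commute[of K])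
    qed
    then have ev: "\<forall>\<^sub>F n in sequentially. norm (E n (\<lambda>\<pi>. cos (t \<bullet> Y n \<pi> + \<phi>)) - E n (\<lambda>\<pi>. cos ((B *v t) \<bullet> scaled_score n \<pi> + \<phi>))) \<le> y n"
      by (intro eventually_mono[OF eventually_gt_at_top[of 0]]) simp
    have "(\<lambda>n. (E n (\<lambda>\<pi>. cos (t \<bullet> Y n \<pi> + \<phi>)) - E n (\<lambda>\<pi>. cos ((B *v t) \<bullet> scaled_score n \<pi> + \<phi>))) + E n (\<lambda>\<pi>. cos ((B *v t) \<bullet> scaled_score n \<pi> + \<phi>)))
      \<longlonglongrightarrow> 0 + cos \<phi> * exp (- ((B *v t) \<bullet> (?\<Sigma> *v (B *v t))) / 2)"
      by (intro tendsto_add scaled_score_char Lim_null_comparison[OF ev ylim])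
    then show "(\<lambda>n. E n (\<lambda>\<pi>. cos (t \<bullet> Y n \<pi> + \<phi>))) \<longlonglongrightarrow> cos \<phi> * exp (- (t \<bullet> (?S2 *v t)) / 2)"
      unfolding quad by simp
  next
    fix e :: real assume e: "e > 0"
    obtain R where R: "R > 0" "\<And>n. n > 0 \<Longrightarrow> E n (\<lambda>\<pi>. of_bool (R < norm (scaled_score n \<pi>))) \<le> e / 2" using scaled_score_tight[of "e / 2"] e by auto
    have "\<forall>\<^sub>F n in sequentially. bad n < e / 2" using order_tendstoD(2)[OF bad, of "e / 2"] e by simp
    then have "\<forall>\<^sub>F n in sequentially. E n (\<lambda>\<pi>. of_bool (2 / l * R < norm (Y n \<pi>))) \<le> e"
      using eventually_gt_at_top[of 0]
    proof eventually_elim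
      case (elim n)
      have "E n (\<lambda>\<pi>. of_bool (2 / l * R < norm (Y n \<pi>))) \<le> E n (\<lambda>\<pi>. of_bool (\<not> good n \<pi>) + of_bool (R < norm (scaled_score n \<pi>)))"
      proof (rule E_mono)
        fix \<pi> assume p: "\<pi> \<in> perms n"
        have "R < norm (scaled_score n \<pi>)" if "good n \<pi>" "2 / l * R < norm (Y n \<pi>)"
        proof -
          have "2 / l * R < 2 / l * norm (scaled_score n \<pi>)" using Yb[OF elim(2) p that(1)] that(2) by linarith
          then show ?thesis by (rule mult_left_less_imp_less) (use l in simp)
        qed
        then show "of_bool (2 / l * R < norm (Y n \<pi>)) \<le> (of_bool (\<not> good n \<pi>) + of_bool (R < norm (scaled_score n \<pi>)) :: real)"
          by (cases "good n \<pi>"; cases "2 / l * R < norm (Y n \<pi>)") auto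
      qed
      also have "\<dots> = bad n + E n (\<lambda>\<pi>. of_bool (R < norm (scaled_score n \<pi>)))" by (simp only: E_add bad_def)
      also have "\<dots> \<le> e" using elim(1) R(2)[OF elim(2)] by linarith
      finally show ?case .
    qed
    then show "\<exists>R. \<forall>\<^sub>F n in sequentially. E n (\<lambda>\<pi>. of_bool (R < norm (Y n \<pi>))) \<le> e" by blast
  qed
  then show "conv_in_distr_normal (\<lambda>n. perm_law f n \<theta>) (\<lambda>n \<pi>. sqrt n *\<^sub>R (\<eta>\<^sub>P n \<pi> - \<theta>)) 0
         (matrix_inv ?A ** ?\<Sigma> ** matrix_inv ?A)"
    unfolding Y_def[abs_def] B_def .
qed

end

section \<open>Construction of the model data\<close>

definition clamp_square :: "real \<times> real \<Rightarrow> real \<times> real" where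
  "clamp_square z = (max 0 (min 1 (fst z)), max 0 (min 1 (snd z)))"

lemma clamp_square: "clamp_square z \<in> unit_square" "z \<in> unit_square \<Longrightarrow> clamp_square z = z"
  by (auto simp: clamp_square_def unit_square_def)

text \<open>Clamping the argument to the square extends \<open>f\<close> continuously and boundedly to the plane, which makes
  \<open>exp (\<theta> \<bullet> F)\<close> a positive kernel.\<close>

lemma tilted_model_exists:
  fixes f :: "real \<times> real \<Rightarrow> real ^ 'l" and \<theta> :: "real ^ 'l"
  assumes indep: "lin_indep f" and cls: "\<And>r. (\<lambda>z. f z $ r) \<in> class_C"
  obtains M F a b where "tilted_model M f F \<theta> a b"
proof -
  define F where "F z = f (clamp_square z)" for z
  have F_eq: "F z = f z" if "z \<in> unit_square" for z using clamp_square(2)[OF that] by (simp add: F_def)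
  have fc: "continuous_on unit_square (\<lambda>z. f z $ r)" for r using cls[of r] by (simp add: class_C_def)
  have cc: "continuous_on UNIV clamp_square" unfolding clamp_square_def
    by (intro continuous_on_Pair continuous_on_max continuous_on_min continuous_on_const continuous_on_fst continuous_on_snd continuous_on_id)
  have Fr: "continuous_on UNIV (\<lambda>z. F z $ r)" for r
    unfolding F_def by (rule continuous_on_compose2[OF fc cc]) (use clamp_square in auto)
  have F_cont: "continuous_on UNIV F"
    using continuous_on_vec_lambda[of UNIV "\<lambda>r z. F z $ r"] Fr by simp
  have comp1: "continuous_on S (\<lambda>y. F (x, y) $ r)" "continuous_on S (\<lambda>y. F (y, x) $ r)" for x r and S :: "real set"
    by (rule continuous_on_compose2[OF Fr]; auto intro!: continuous_on_Pair continuous_on_const continuous_on_id)+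
  have int1: "integral {0..1} (\<lambda>y. F (x, y) $ r) = 0" if x: "x \<in> {0..1}" for x r
  proof -
    have "set_integrable lborel {0..1} (\<lambda>y. F (x, y) $ r)"
      unfolding set_integrable_def by (intro borel_integrable_compact comp1) auto
    then have "integral {0..1} (\<lambda>y. F (x, y) $ r) = (LBINT y:{0..1}. F (x, y) $ r)"
      by (rule set_borel_integral_eq_integral(2)[symmetric])
    also have "\<dots> = (LBINT y:{0..1}. f (x, y) $ r)"
      using x by (intro set_lebesgue_integral_cong) (auto simp: F_eq unit_square_def)
    also have "\<dots> = 0" using cls[of r] x by (auto simp: class_C_def)
    finally show ?thesis .
  qed
  have int2: "integral {0..1} (\<lambda>y. F (y, x) $ r) = 0" if x: "x \<in> {0..1}" for x r
  proof -
    have "set_integrable lborel {0..1} (\<lambda>y. F (y, x) $ r)"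
      unfolding set_integrable_def by (intro borel_integrable_compact comp1) auto
    then have "integral {0..1} (\<lambda>y. F (y, x) $ r) = (LBINT y:{0..1}. F (y, x) $ r)"
      by (rule set_borel_integral_eq_integral(2)[symmetric])
    also have "\<dots> = (LBINT y:{0..1}. f (y, x) $ r)"
      using x by (intro set_lebesgue_integral_cong) (auto simp: F_eq unit_square_def)
    also have "\<dots> = 0" using cls[of r] x by (auto simp: class_C_def)
    finally show ?thesis .
  qed
  have tint: "integral {0..1} (\<lambda>y. t \<bullet> F (x, y)) = 0" "integral {0..1} (\<lambda>y. t \<bullet> F (y, x)) = 0" if x: "x \<in> {0..1}" for t x
  proof -
    have "integral {0..1} (\<lambda>y. t \<bullet> F (x, y)) = (\<Sum>r\<in>UNIV. t $ r * integral {0..1} (\<lambda>y. F (x, y) $ r))"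
      unfolding inner_vec_def inner_real_def
      by (subst integral_sum) (auto intro!: integrable_continuous_interval continuous_on_mult continuous_on_const comp1)
    then show "integral {0..1} (\<lambda>y. t \<bullet> F (x, y)) = 0" by (simp add: int1[OF x])
    have "integral {0..1} (\<lambda>y. t \<bullet> F (y, x)) = (\<Sum>r\<in>UNIV. t $ r * integral {0..1} (\<lambda>y. F (y, x) $ r))"
      unfolding inner_vec_def inner_real_def
      by (subst integral_sum) (auto intro!: integrable_continuous_interval continuous_on_mult continuous_on_const comp1)
    then show "integral {0..1} (\<lambda>y. t \<bullet> F (y, x)) = 0" by (simp add: int2[OF x])
  qed
  have "compact (F ` unit_square)" by (intro compact_continuous_image continuous_on_subset[OF F_cont] compact_unit_square) auto
  then obtain c where c: "\<And>z. z \<in> unit_square \<Longrightarrow> norm (F z) \<le> c"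
    using compact_imp_bounded bounded_iff by (metis image_eqI)
  have hb: "\<bar>\<theta> \<bullet> F z\<bar> \<le> norm \<theta> * c" for z
  proof -
    have "F z = F (clamp_square z)" using clamp_square(2)[OF clamp_square(1)[of z]] by (simp add: F_def)
    then have "norm (F z) \<le> c" using c[OF clamp_square(1)[of z]] by simp
    have "\<bar>\<theta> \<bullet> F z\<bar> \<le> norm \<theta> * norm (F z)" by (rule Cauchy_Schwarz_ineq2)
    also have "\<dots> \<le> norm \<theta> * c" using \<open>norm (F z) \<le> c\<close> by (intro mult_left_mono) auto
    finally show ?thesis .
  qed
  have hc: "continuous_on UNIV (\<lambda>z. \<theta> \<bullet> F z)" by (intro continuous_on_inner continuous_on_const F_cont)
  define K where "K x y = exp (\<theta> \<bullet> F (x, y))" for x y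
  interpret positive_kernel K "exp (- (norm \<theta> * c))" "exp (norm \<theta> * c)"
  proof
    show "continuous_on UNIV (\<lambda>z. K (fst z) (snd z))" unfolding K_def using continuous_on_exp[OF hc] by simp
    show "exp (- (norm \<theta> * c)) \<le> K x y" "K x y \<le> exp (norm \<theta> * c)" for x y
      using hb[of "(x, y)"] by (auto simp: K_def abs_le_iff)
  qed simp
  obtain A B where AB: "continuous_on UNIV A" "continuous_on UNIV B" "\<And>y. 0 < A y" "\<And>x. 0 < B x"
    "\<And>x. integral {0..1} (\<lambda>y. K x y / (B x * A y)) = 1"
    "\<And>y. integral {0..1} (\<lambda>x. K x y / (B x * A y)) = 1"
    by (rule schroedinger_system) blast
  define M where "M z = K (fst z) (snd z) / (B (fst z) * A (snd z))" for z
  have AB0: "A y \<noteq> 0" "B y \<noteq> 0" for y using AB(3)[of y] AB(4)[of y] by auto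
  have "tilted_model M f F \<theta> (\<lambda>x. ln (B x)) (\<lambda>y. ln (A y))"
  proof
    show "continuous_on UNIV M" unfolding M_def
      by (intro continuous_on_divide continuous_on_mult K_cont continuous_on_compose2[OF AB(1)] continuous_on_compose2[OF AB(2)]
        continuous_on_fst continuous_on_snd continuous_on_id) (auto simp: AB0)
    show "0 < M z" for z unfolding M_def using AB K_pos by simp
    show "integral {0..1} (\<lambda>y. M (x, y)) = 1" "integral {0..1} (\<lambda>x. M (x, y)) = 1" for x y
      by (simp_all add: M_def AB)
    show "\<theta> \<bullet> F z = ln (M z) + (ln (B (fst z)) + ln (A (snd z)))" for z
      by (simp add: M_def K_def ln_div ln_mult AB AB0)
    show "continuous_on UNIV (\<lambda>x. ln (B x))" "continuous_on UNIV (\<lambda>x. ln (A x))"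
      by (intro continuous_on_ln AB ballI AB0)+
  qed (auto simp: F_cont F_eq indep tint simp del: atLeastAtMost_iff)
  then show ?thesis by (rule that)
qed

theorem theorem1p5:
  fixes f :: "real \<times> real \<Rightarrow> real ^ 'l"
    and \<theta>\<^sub>0 :: "real ^ 'l"
  assumes indep: "lin_indep f"
    and cls: "\<And>r. (\<lambda>z. f z $ r) \<in> class_C"
  shows
    "conv_in_distr_normal (\<lambda>n. perm_law f n \<theta>\<^sub>0)
        (\<lambda>n \<pi>. (real n powr (- 3 / 2)) *\<^sub>R pl_score f n \<pi> \<theta>\<^sub>0)
        0 (Sigma_mat f \<theta>\<^sub>0)
     \<and> (\<forall>\<theta>. pos_def (A_mat f \<theta>))
     \<and> (\<lambda>n. measure (perm_law f n \<theta>\<^sub>0) {\<pi> \<in> perms n. \<exists>!\<theta>. pl_score f n \<pi> \<theta> = 0})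
          \<longlonglongrightarrow> 1
     \<and> (\<forall>\<theta>_PL :: nat \<Rightarrow> (nat \<Rightarrow> nat) \<Rightarrow> real ^ 'l.
          (\<forall>n. \<forall>\<pi>\<in>perms n. (\<exists>!\<theta>. pl_score f n \<pi> \<theta> = 0) \<longrightarrow> pl_score f n \<pi> (\<theta>_PL n \<pi>) = 0)
          \<longrightarrow> conv_in_distr_normal (\<lambda>n. perm_law f n \<theta>\<^sub>0)
                (\<lambda>n \<pi>. sqrt (real n) *\<^sub>R (\<theta>_PL n \<pi> - \<theta>\<^sub>0))
                0 (matrix_inv (A_mat f \<theta>\<^sub>0) ** Sigma_mat f \<theta>\<^sub>0 ** matrix_inv (A_mat f \<theta>\<^sub>0)))"
proof -
  obtain M F a b where "tilted_model M f F \<theta>\<^sub>0 a b" using tilted_model_exists[OF assms] by blast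
  then interpret tilted_model M f F \<theta>\<^sub>0 a b .
  have "pos_def (A_mat f \<theta>)" for \<theta>
  proof -
    obtain M F a b where "tilted_model M f F \<theta> a b" using tilted_model_exists[OF assms] by blast
    then interpret T: tilted_model M f F \<theta> a b .
    show ?thesis by (rule T.A_pos_def)
  qed
  then show ?thesis
    using score_clt root_exists_and_clt unfolding measure_perm_law scaled_score_def[abs_def] by auto
qed

end
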